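(* Let $u_0 \in H^3(\mathbb{R}) \cap L^1(\mathbb{R})$ be real-valued and not identically zero. Assume that there exists $\ell_0 \in (0,1)$ such that either $u_0 - \ell^2 u_0'' \geq 0$ on $\mathbb{R}$ for every $\ell \in (0,\ell_0)$, or $u_0 - \ell^2 u_0'' \leq 0$ on $\mathbb{R}$ for every $\ell \in (0,\ell_0)$. For $\ell \in (0,\ell_0)$, let $u^\ell$ be the unique global solution on $[0,\infty)\times\mathbb{R}$ of the Camassa--Holm equation $$u^\ell_t + u^\ell u^\ell_x + \ell^2 P^\ell_x + Q^\ell_x = 0, \qquad u^\ell(0,\cdot) = u_0,$$ where $P^\ell = G_\ell * \tfrac12 (u^\ell_x)^2$, $Q^\ell = G_\ell * (u^\ell)^2$, $G_\ell(x) = \frac{1}{2\ell} e^{-|x|/\ell}$, and $*$ denotes convolution in $x$. Let $u$ be the unique entropy solution of the Burgers equation $$u_t + \left(\tfrac32 u^2\right)_x = 0 \quad \text{on } (0,\infty)\times\mathbb{R}, \qquad u(0,\cdot) = u_0.$$ Set $$T_{\mathrm B}^* := -\frac{1}{3 \inf_{x\in\mathbb{R}} u_0'(x)},$$ which belongs to $(0,\infty)$. Then, for all real numbers $t_2 > t_1 \geq T_{\mathrm B}^*$, there is no sequence $(\ell_n)_{n}$ in $(0,\ell_0)$ with $\ell_n \downarrow 0$ such that $$u^{\ell_n} \to u \quad \text{strongly in } L^1_{\mathrm{loc}}\bigl([t_1,t_2]\times\mathbb{R}\bigr).$$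
   Context: The solution $u^\ell$ of the Camassa--Holm equation is the unique solution with initial datum $u_0$ in the class $C([0,\infty);H^3(\mathbb{R})) \cap C^1([0,\infty);H^2(\mathbb{R}))$; its global existence and uniqueness under the stated one-sign condition on $u_0 - \ell^2 u_0''$ is a known result. The nonlocal equation in the claim is the form, obtained by applying $(1-\ell^2\partial_x^2)^{-1} = G_\ell *$, of $$u^\ell_t + 3u^\ell u^\ell_x = \ell^2\left(u^\ell_{xxt} + 2u^\ell_x u^\ell_{xx} + u^\ell u^\ell_{xxx}\right).$$ The entropy solution of the Burgers equation $u_t + f(u)_x = 0$, $f(u) = \tfrac32 u^2$, with bounded initial datum $u_0$, is the unique (Kruzhkov) function $u \in L^\infty((0,\infty)\times\mathbb{R})$ such that for every $k\in\mathbb{R}$ and every nonnegative $\varphi \in C_c^\infty([0,\infty)\times\mathbb{R})$, $$\int_0^\infty\!\!\int_{\mathbb{R}} \Bigl(|u-k|\,\varphi_t + \mathrm{sign}(u-k)\,(f(u)-f(k))\,\varphi_x\Bigr)\,dx\,dt + \int_{\mathbb{R}} |u_0(x)-k|\,\varphi(0,x)\,dx \geq 0.$$ Strong convergence in $L^1_{\mathrm{loc}}([t_1,t_2]\times\mathbb{R})$ means that $\int_{t_1}^{t_2}\int_{-R}^{R} |u^{\ell_n}-u|\,dx\,dt \to 0$ for every $R>0$. *)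

theory Defs
  imports "HOL-Analysis.Analysis"
begin

primrec Ck :: "nat \<Rightarrow> ('a::euclidean_space \<Rightarrow> real) \<Rightarrow> bool" where
  "Ck 0 f \<longleftrightarrow> continuous_on UNIV f"
| "Ck (Suc n) f \<longleftrightarrow>
     (\<forall>x. f differentiable (at x)) \<and>
     (\<forall>b\<in>Basis. Ck n (\<lambda>x. frechet_derivative f (at x) b))"

definition Cc_infinity :: "('a::euclidean_space \<Rightarrow> real) set" where
  "Cc_infinity = {f. (\<forall>n. Ck n f) \<and> compact (closure {x. f x \<noteq> 0})}"

definition loc_integrable :: "(real \<Rightarrow> real) \<Rightarrow> bool" where
  "loc_integrable f \<longleftrightarrow> (\<forall>K. compact K \<longrightarrow> f absolutely_integrable_on K)"

definition has_weak_deriv :: "nat \<Rightarrow> (real \<Rightarrow> real) \<Rightarrow> (real \<Rightarrow> real) \<Rightarrow> bool" where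
  "has_weak_deriv k f g \<longleftrightarrow>
     loc_integrable f \<and> loc_integrable g \<and>
     (\<forall>\<phi>\<in>Cc_infinity.
        (LINT x|lebesgue. f x * (deriv ^^ k) \<phi> x) = (-1) ^ k * (LINT x|lebesgue. g x * \<phi> x))"

definition L2 :: "(real \<Rightarrow> real) set" where
  "L2 = {f. f \<in> borel_measurable lebesgue \<and> integrable lebesgue (\<lambda>x. (f x)\<^sup>2)}"

text \<open>Elements are functions rather than classes modulo null sets. The case \<open>j = 0\<close> says
  that \<open>f\<close> itself is square integrable.\<close>

definition sobolev_H :: "nat \<Rightarrow> (real \<Rightarrow> real) set" where
  "sobolev_H k = {f. \<forall>j\<le>k. \<exists>g\<in>L2. has_weak_deriv j f g}"

text \<open>Weak derivatives are unique up to null sets, so the choice does not affect the norm.\<close>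

definition weak_deriv :: "nat \<Rightarrow> (real \<Rightarrow> real) \<Rightarrow> real \<Rightarrow> real" where
  "weak_deriv k f = (SOME g. has_weak_deriv k f g)"

definition sobolev_norm :: "nat \<Rightarrow> (real \<Rightarrow> real) \<Rightarrow> real" where
  "sobolev_norm k f = sqrt (\<Sum>j\<le>k. LINT x|lebesgue. (weak_deriv j f x)\<^sup>2)"

text \<open>A function of time and space is curried, \<open>u t x\<close>; only its values for \<open>t \<ge> 0\<close> matter
  in what follows. The next two predicates express \<open>u \<in> C([0,\<infinity>); H\<^sup>k)\<close> and that \<open>v\<close> is the
  strong \<open>H\<^sup>k\<close>-valued time derivative of \<open>u\<close> on \<open>[0,\<infinity>)\<close> (one-sided at 0).\<close>

definition time_continuous_H :: "nat \<Rightarrow> (real \<Rightarrow> real \<Rightarrow> real) \<Rightarrow> bool" where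
  "time_continuous_H k u \<longleftrightarrow>
     (\<forall>t\<ge>0. u t \<in> sobolev_H k \<and>
        ((\<lambda>s. sobolev_norm k (\<lambda>x. u s x - u t x)) \<longlongrightarrow> 0) (at t within {0..}))"

definition has_time_deriv_H ::
  "nat \<Rightarrow> (real \<Rightarrow> real \<Rightarrow> real) \<Rightarrow> (real \<Rightarrow> real \<Rightarrow> real) \<Rightarrow> bool" where
  "has_time_deriv_H k u v \<longleftrightarrow>
     (\<forall>t\<ge>0. ((\<lambda>s. sobolev_norm k (\<lambda>x. (u s x - u t x) / (s - t) - v t x)) \<longlongrightarrow> 0)
        (at t within {0..}))"

definition convolution :: "(real \<Rightarrow> real) \<Rightarrow> (real \<Rightarrow> real) \<Rightarrow> real \<Rightarrow> real" where
  "convolution f g x = (LINT y|lebesgue. f (x - y) * g y)"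

definition G_kernel :: "real \<Rightarrow> real \<Rightarrow> real" where
  "G_kernel l x = 1 / (2 * l) * exp (- \<bar>x\<bar> / l)"

definition P_term :: "real \<Rightarrow> (real \<Rightarrow> real) \<Rightarrow> real \<Rightarrow> real" where
  "P_term l w = convolution (G_kernel l) (\<lambda>x. 1 / 2 * (deriv w x)\<^sup>2)"

definition Q_term :: "real \<Rightarrow> (real \<Rightarrow> real) \<Rightarrow> real \<Rightarrow> real" where
  "Q_term l w = convolution (G_kernel l) (\<lambda>x. (w x)\<^sup>2)"

text \<open>Global solutions in \<open>C([0,\<infinity>); H\<^sup>3) \<inter> C\<^sup>1([0,\<infinity>); H\<^sup>2)\<close>. Each time slice of \<open>u\<close> and of its
  time derivative \<open>v\<close> is taken to be the continuous representative of its class. Then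
  \<open>u t\<close> is \<open>C\<^sup>2\<close> and both convolutions are differentiable, so the spatial derivatives are
  classical and the equation, which is an identity in \<open>H\<^sup>2\<close>, holds at every point.\<close>

definition CH_solution ::
  "real \<Rightarrow> (real \<Rightarrow> real) \<Rightarrow> (real \<Rightarrow> real \<Rightarrow> real) \<Rightarrow> bool" where
  "CH_solution l u0 u \<longleftrightarrow>
     (\<forall>t\<ge>0. continuous_on UNIV (u t)) \<and>
     time_continuous_H 3 u \<and>
     u 0 = u0 \<and>
     (\<exists>v. (\<forall>t\<ge>0. continuous_on UNIV (v t)) \<and>
          time_continuous_H 2 v \<and>
          has_time_deriv_H 2 u v \<and>
          (\<forall>t\<ge>0. \<forall>x. v t x + u t x * deriv (u t) x
             + l\<^sup>2 * deriv (P_term l (u t)) x + deriv (Q_term l (u t)) x = 0))"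

text \<open>Test functions in \<open>C\<^sub>c\<^sup>\<infinity>([0,\<infinity>) \<times> \<real>)\<close> are the restrictions of those in
  \<open>C\<^sub>c\<^sup>\<infinity>(\<real> \<times> \<real>)\<close>; nonnegativity is required on the half plane only.
  The first coordinate is time.\<close>

definition entropy_solution ::
  "(real \<Rightarrow> real) \<Rightarrow> (real \<Rightarrow> real) \<Rightarrow> (real \<Rightarrow> real \<Rightarrow> real) \<Rightarrow> bool" where
  "entropy_solution f u0 u \<longleftrightarrow>
     (\<lambda>(t, x). u t x) \<in> borel_measurable (lebesgue_on ({0<..} \<times> UNIV)) \<and>
     (\<exists>M. AE (t, x) in lebesgue_on ({0<..} \<times> UNIV). \<bar>u t x\<bar> \<le> M) \<and>
     (\<forall>k. \<forall>\<phi>\<in>Cc_infinity. (\<forall>t\<ge>0. \<forall>x. \<phi> (t, x) \<ge> 0) \<longrightarrow>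
        (LINT (t, x)|lebesgue_on ({0<..} \<times> UNIV).
            \<bar>u t x - k\<bar> * frechet_derivative \<phi> (at (t, x)) (1, 0)
            + sgn (u t x - k) * (f (u t x) - f k) * frechet_derivative \<phi> (at (t, x)) (0, 1))
        + (LINT x|lebesgue. \<bar>u0 x - k\<bar> * \<phi> (0, x)) \<ge> 0)"

definition burgers_flux :: "real \<Rightarrow> real" where
  "burgers_flux v = 3 / 2 * v\<^sup>2"

definition burgers_time :: "(real \<Rightarrow> real) \<Rightarrow> real" where
  "burgers_time u0 = - 1 / (3 * (INF x. deriv u0 x))"

definition converges_L1_loc ::
  "real \<Rightarrow> real \<Rightarrow> (nat \<Rightarrow> real \<Rightarrow> real \<Rightarrow> real) \<Rightarrow> (real \<Rightarrow> real \<Rightarrow> real) \<Rightarrow> bool" where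
  "converges_L1_loc t1 t2 w u \<longleftrightarrow>
     (\<forall>R>0. (\<lambda>n. \<integral>\<^sup>+ (t, x). ennreal \<bar>w n t x - u t x\<bar> \<partial>lebesgue_on ({t1..t2} \<times> {-R..R}))
        \<longlonglongrightarrow> 0)"

end

theory Submission
  imports Defs
begin

text \<open>Suppose that \<open>u\<^sup>l\<close> converges to the entropy solution \<open>w\<close> on a time window after wave breaking.
  The flow conserves \<open>\<integral> u\<^sup>2 + l\<^sup>2 u\<^sub>x\<^sup>2\<close>. Since the momentum keeps its sign, \<open>l \<bar>u\<^sub>x\<bar> \<le> \<bar>u\<bar>\<close>, so
  the energy flux is controlled by the conserved cubic Hamiltonian and the energy is tight, uniformly
  in \<open>l\<close>. The momentum flux is \<open>3/2 u\<^sup>2 + l\<^sup>2/2 u\<^sub>x\<^sup>2\<close> up to terms of order \<open>l\<close>, while that of \<open>w\<close> is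
  \<open>3/2 w\<^sup>2\<close>; testing both weak forms with a truncation of \<open>x\<close> shows that the non-negative
  defect \<open>l\<^sup>2 u\<^sub>x\<^sup>2\<close> vanishes in the limit. Hence \<open>w\<close> still has the full initial energy
  in the window.

  The quadratic entropy is the average over \<open>k\<close> of the Kruzhkov entropies, whose productions all have
  the same sign. As no quadratic entropy is lost, each Kruzhkov entropy is conserved up to the window.
  Subtracting the conservation laws for \<open>k\<close> and \<open>k + h\<close> and letting \<open>h\<close> tend to 0, the sets \<open>{w > k}\<close>
  and \<open>{w < k}\<close> are transported with speed \<open>3 k\<close>. After the breaking time two such sets with
  incompatible values of \<open>w\<close> meet, a contradiction.\<close>

section \<open>Smooth test functions\<close>

text \<open>Convergence in \<open>L\<^sup>1\<close> on compact sets passes to the limit only in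
  expressions linear in \<open>u\<close>; no sup bound uniform in \<open>l\<close> is used, so
  nothing prevents \<open>u\<^sup>2\<close> from concentrating. The moment
  \<open>\<integral> x u\<close> is the way out: it is linear, yet its time derivative is the total
  momentum flux. With \<open>A = 3/2 u\<^sup>2 + l\<^sup>2/2 u\<^sub>x\<^sup>2\<close> the energy
  density is exactly \<open>2 A - 2 u\<^sup>2\<close>. The moment yields the limit
  \<open>3/2 w\<^sup>2\<close> for \<open>A\<close>, and for \<open>- 2 u\<^sup>2\<close> lower
  semicontinuity has the right sign, so the initial energy is at most that of
  \<open>(3 - 2) w\<^sup>2\<close>. All this is averaged in time with minus the derivative of a
  smooth step that falls across the window; no trace of \<open>w\<close> at a fixed time occurs, and
  the same step tests the entropy conditions. The entropy solution is merely bounded and measurable,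
  so characteristics cannot be followed. Test functions moving with speed \<open>3 k\<close> replace
  them: in that frame the flux difference between the levels \<open>k\<close> and
  \<open>k + h\<close> is quadratic in \<open>h\<close>, while the entropy difference is linear in
  \<open>h\<close>.\<close>

lemma Ck_imp_continuous: "Ck n f \<Longrightarrow> continuous_on UNIV f"
  by (cases n) (auto intro!: differentiable_imp_continuous_on differentiable_at_imp_differentiable_on)

lemma Ck_SucD: "Ck (Suc n) f \<Longrightarrow> Ck n f"
proof (induction n arbitrary: f)
  case 0
  then show ?case using Ck_imp_continuous[OF 0] by simp
next
  case (Suc n)
  then show ?case by (metis Ck.simps(2))
qed

lemma Ck_const [simp]: "Ck n (\<lambda>x. c)"
  by (induction n arbitrary: c) auto

lemma Ck_bounded_linear:
  assumes "bounded_linear L" shows "Ck n L"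
proof (cases n)
  case 0
  then show ?thesis using assms linear_continuous_on by auto
next
  case (Suc m)
  have d: "(L has_derivative L) (at x)" for x
    using assms by (rule bounded_linear.has_derivative) (rule has_derivative_ident)
  then have "frechet_derivative L (at x) = L" for x
    by (metis frechet_derivative_at)
  with d show ?thesis
    by (auto simp: Suc differentiable_def)
qed

lemma Ck_add:
  assumes "Ck n f" "Ck n g" shows "Ck n (\<lambda>x. f x + g x)"
  using assms
proof (induction n arbitrary: f g)
  case 0 then show ?case by (auto intro: continuous_on_add)
next
  case (Suc n)
  have d: "((\<lambda>x. f x + g x) has_derivative
      (\<lambda>h. frechet_derivative f (at x) h + frechet_derivative g (at x) h)) (at x)" for x
    using Suc.prems by (auto intro!: has_derivative_add simp: frechet_derivative_works)
  show ?case
    using Suc d by (auto simp: differentiable_def frechet_derivative_at[OF d, symmetric])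
qed

lemma Ck_mult:
  assumes "Ck n f" "Ck n g" shows "Ck n (\<lambda>x. f x * g x)"
  using assms
proof (induction n arbitrary: f g)
  case 0 then show ?case by (auto intro: continuous_on_mult)
next
  case (Suc n)
  have d: "((\<lambda>x. f x * g x) has_derivative
      (\<lambda>h. f x * frechet_derivative g (at x) h + frechet_derivative f (at x) h * g x)) (at x)" for x
    using Suc.prems by (auto intro!: has_derivative_mult simp: frechet_derivative_works)
  have "Ck n (\<lambda>x. frechet_derivative (\<lambda>x. f x * g x) (at x) b)" if "b \<in> Basis" for b
    unfolding frechet_derivative_at[OF d, symmetric]
    using Suc.prems that by (intro Ck_add Suc.IH Ck_SucD[of n f] Ck_SucD[of n g]) auto
  then show ?case
    using d by (auto simp: differentiable_def)
qed

lemma Ck_cmult: "Ck n f \<Longrightarrow> Ck n (\<lambda>x. c * f x)"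
  by (intro Ck_mult Ck_const)

lemma Ck_uminus: "Ck n f \<Longrightarrow> Ck n (\<lambda>x. - f x)"
  using Ck_cmult[of n f "-1"] by simp

lemma Ck_diff: "Ck n f \<Longrightarrow> Ck n g \<Longrightarrow> Ck n (\<lambda>x. f x - g x)"
  using Ck_add[of n f "\<lambda>x. - g x"] Ck_uminus[of n g] by simp

text \<open>The chain rule replaces \<open>F\<close> by its derivative composed with
  \<open>g\<close>, so the induction keeps the outer function arbitrary.\<close>

lemma Ck_compose:
  fixes F :: "real \<Rightarrow> real" and g :: "'a::euclidean_space \<Rightarrow> real"
  assumes "Ck n F" "Ck n g" shows "Ck n (\<lambda>x. F (g x))"
  using assms
proof (induction n arbitrary: F)
  case 0 then show ?case by (auto intro: continuous_on_compose2)
next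
  case (Suc n)
  have dF: "(F has_derivative frechet_derivative F (at y)) (at y)" for y
    using Suc.prems by (auto simp: frechet_derivative_works)
  have dF1: "frechet_derivative F (at y) h = h * frechet_derivative F (at y) 1" for y h
    using linear_scale[OF has_derivative_linear[OF dF], of y h 1]
    by (metis real_scaleR_def mult.right_neutral)
  have d: "((\<lambda>x. F (g x)) has_derivative
      (\<lambda>h. frechet_derivative g (at x) h * frechet_derivative F (at (g x)) 1)) (at x)" for x
  proof -
    have "((\<lambda>x. F (g x)) has_derivative
      (\<lambda>h. frechet_derivative F (at (g x)) (frechet_derivative g (at x) h))) (at x)"
      using Suc.prems(2) by (intro has_derivative_compose[OF _ dF]) (auto simp: frechet_derivative_works)
    moreover have "(\<lambda>h. frechet_derivative F (at (g x)) (frechet_derivative g (at x) h)) =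
        (\<lambda>h. frechet_derivative g (at x) h * frechet_derivative F (at (g x)) 1)"
      by (rule ext, rule dF1)
    ultimately show ?thesis by (simp only:)
  qed
  have "Ck n (\<lambda>x. frechet_derivative (\<lambda>x. F (g x)) (at x) b)" if "b \<in> Basis" for b
    unfolding frechet_derivative_at[OF d, symmetric]
    using Suc.prems that
    by (intro Ck_mult Suc.IH[of "\<lambda>y. frechet_derivative F (at y) 1"] Ck_SucD[of n g]) auto
  moreover have "(\<lambda>x. F (g x)) differentiable (at x)" for x
    using d by (metis differentiable_def)
  ultimately show ?case by simp
qed

lemma frechet_derivative_real:
  fixes f :: "real \<Rightarrow> real"
  assumes "(f has_real_derivative D) (at x)"
  shows "frechet_derivative f (at x) h = D * h"
  by (simp flip: frechet_derivative_at[OF assms[unfolded has_field_derivative_def]])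

lemma Ck_SucI_real:
  assumes "\<And>x. (f has_real_derivative f' x) (at x)" "Ck n f'"
  shows "Ck (Suc n) f"
proof -
  have "f differentiable (at x)" for x
    using assms(1) real_differentiable_def by blast
  then show ?thesis
    using assms(2) by (auto simp: frechet_derivative_real[OF assms(1)])
qed

lemma Ck_Suc_real:
  fixes f :: "real \<Rightarrow> real"
  assumes "Ck (Suc n) f"
  shows "(f has_real_derivative deriv f x) (at x)" "Ck n (deriv f)"
proof -
  show *: "(f has_real_derivative deriv f x) (at x)" for x
    using assms by (simp add: DERIV_deriv_iff_real_differentiable)
  have "(\<lambda>x. frechet_derivative f (at x) 1) = deriv f"
    by (auto simp: frechet_derivative_real[OF *])
  then show "Ck n (deriv f)" using assms by auto
qed

lemma Cc_infinityI:
  assumes "\<And>n. Ck n f" "compact K" "\<And>x. f x \<noteq> 0 \<Longrightarrow> x \<in> K"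
  shows "f \<in> Cc_infinity"
proof -
  have "closure {x. f x \<noteq> 0} \<subseteq> K"
    using assms by (intro closure_minimal compact_imp_closed) auto
  then have "compact (closure {x. f x \<noteq> 0})"
    using assms(2) by (metis closed_closure compact_Int_closed inf.absorb_iff2)
  then show ?thesis using assms(1) by (auto simp: Cc_infinity_def)
qed

lemma Cc_infinityE:
  assumes "f \<in> Cc_infinity"
  obtains R where "\<And>x. f x \<noteq> 0 \<Longrightarrow> norm x \<le> R" "R > 0"
proof -
  have "bounded (closure {x. f x \<noteq> 0})"
    using assms compact_imp_bounded by (auto simp: Cc_infinity_def)
  then obtain R where R: "R > 0" "\<forall>x\<in>closure {x. f x \<noteq> 0}. norm x \<le> R"
    by (auto simp: bounded_pos)
  have "norm x \<le> R" if "f x \<noteq> 0" for x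
    using R(2) that closure_subset[of "{x. f x \<noteq> 0}"] by blast
  with R(1) show thesis by (intro that[of R])
qed

lemma Cc_infinity_deriv:
  fixes f :: "real \<Rightarrow> real"
  assumes "f \<in> Cc_infinity" shows "deriv f \<in> Cc_infinity"
proof -
  obtain R where R: "\<And>x. f x \<noteq> 0 \<Longrightarrow> norm x \<le> R" by (rule Cc_infinityE[OF assms]) blast
  have C: "Ck n f" for n using assms by (auto simp: Cc_infinity_def)
  have "deriv f x = 0" if "R < norm x" for x
  proof -
    have "\<forall>\<^sub>F y in nhds x. f y = 0"
    proof (rule eventually_nhds_in_open[of "{y. R < norm y}", THEN eventually_mono])
      show "open {y::real. R < norm y}" by (intro open_Collect_less) (auto intro: continuous_intros)
    qed (use that R in \<open>auto simp: not_le[symmetric]\<close>)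
    then have "deriv f x = deriv (\<lambda>_. 0) x" by (intro deriv_cong_ev) auto
    then show ?thesis by simp
  qed
  then have "deriv f x \<noteq> 0 \<Longrightarrow> x \<in> cball 0 R" for x by (fastforce simp: not_le[symmetric])
  then show ?thesis
    using Ck_Suc_real(2)[OF C] by (intro Cc_infinityI[of _ "cball 0 R"]) auto
qed

section \<open>A smooth step function\<close>

definition flat :: "nat \<Rightarrow> real \<Rightarrow> real" where
  "flat n x = (if x \<le> 0 then 0 else inverse x ^ n * exp (- inverse x))"

lemma flat_tendsto: "(flat n \<longlongrightarrow> 0) (at_right 0)"
proof -
  have "((\<lambda>y. y ^ n / exp y) \<longlongrightarrow> (0::real)) at_top"
    by (rule tendsto_power_div_exp_0)
  then have "((\<lambda>x. inverse x ^ n / exp (inverse x)) \<longlongrightarrow> (0::real)) (at_right 0)"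
    using filterlim_compose filterlim_inverse_at_top_right by blast
  moreover have "\<forall>\<^sub>F x in at_right 0. inverse x ^ n / exp (inverse x) = flat n x"
    by (auto simp: eventually_at_right_field flat_def exp_minus divide_simps intro: exI[of _ 1])
  ultimately show ?thesis
    by (rule Lim_transform_eventually)
qed

text \<open>The family \<open>flat n\<close> is closed under differentiation up to linear
  combinations, so one formula for the first derivative gives smoothness of all orders by
  induction.\<close>

lemma flat_deriv:
  "(flat n has_real_derivative (flat (n + 2) x - n * flat (n + 1) x)) (at x)"
proof (cases x "0::real" rule: linorder_cases)
  case less
  have "((\<lambda>_. 0) has_real_derivative 0) (at x)" by simp
  then have "(flat n has_real_derivative 0) (at x)"
    by (rule has_field_derivative_transform_within_open[of _ _ _ "{..<0}"])
       (use less in \<open>auto simp: flat_def\<close>)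
  then show ?thesis using less by (simp add: flat_def)
next
  case greater
  have "((\<lambda>x. inverse x ^ n * exp (- inverse x)) has_real_derivative
      (flat (n + 2) x - n * flat (n + 1) x)) (at x)"
    using greater
    by (auto intro!: derivative_eq_intros simp: flat_def power2_eq_square field_simps)
       (cases n; simp add: field_simps)
  then show ?thesis
    by (rule has_field_derivative_transform_within_open[of _ _ _ "{0<..}"])
       (use greater in \<open>auto simp: flat_def\<close>)
next
  case equal
  \<comment> \<open>To the right of 0 the difference quotient of \<open>flat n\<close> is
    \<open>flat (Suc n)\<close>, whose limit is already known.\<close>
  have "((\<lambda>h. flat n h / h) \<longlongrightarrow> 0) (at_right 0)"
  proof (rule Lim_transform_eventually[OF flat_tendsto[of "Suc n"]])
    show "\<forall>\<^sub>F x in at_right 0. flat (Suc n) x = flat n x / x"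
      by (auto simp: eventually_at_right_field flat_def divide_simps intro: exI[of _ 1])
  qed
  moreover have "((\<lambda>h. flat n h / h) \<longlongrightarrow> 0) (at_left 0)"
    by (rule Lim_transform_eventually[OF tendsto_const[of 0]])
       (auto simp: eventually_at_left_field flat_def intro: exI[of _ "-1"])
  ultimately have "((\<lambda>h. flat n h / h) \<longlongrightarrow> 0) (at 0)"
    by (simp add: filterlim_split_at)
  then show ?thesis by (simp add: equal DERIV_def flat_def)
qed

lemma Ck_flat: "Ck m (flat n)"
proof (induction m arbitrary: n)
  case 0
  show ?case using DERIV_continuous_on[OF flat_deriv] by (simp add: continuous_at_imp_continuous_on DERIV_isCont[OF flat_deriv])
next
  case (Suc m)
  show ?case
    by (rule Ck_SucI_real[OF flat_deriv]) (intro Ck_diff Ck_cmult Suc.IH)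
qed

lemma Ck_affine: "Ck n (\<lambda>x::real. a * x + b)"
  by (intro Ck_add Ck_const Ck_bounded_linear bounded_linear_mult_right)

lemma Ck_compose_affine: "Ck n F \<Longrightarrow> Ck n (\<lambda>x::real. F (a * x + b))"
  by (rule Ck_compose[OF _ Ck_affine])

definition bump :: "real \<Rightarrow> real" where
  "bump x = flat 0 x * flat 0 (1 - x)"

lemma Ck_bump: "Ck n bump"
proof -
  have "Ck n (\<lambda>x. flat 0 x * flat 0 ((-1) * x + 1))"
    by (intro Ck_mult Ck_flat Ck_compose_affine)
  moreover have "(\<lambda>x. flat 0 x * flat 0 ((-1) * x + 1)) = bump"
    by (auto simp: bump_def)
  ultimately show ?thesis by simp
qed

lemma bump_pos: "0 < x \<Longrightarrow> x < 1 \<Longrightarrow> bump x > 0"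
  and bump_nonneg: "bump x \<ge> 0"
  and bump_eq_0: "x \<le> 0 \<or> 1 \<le> x \<Longrightarrow> bump x = 0"
  by (simp_all add: bump_def flat_def) arith

text \<open>The oriented integral from 0 to \<open>x\<close>: integrals over reversed intervals
  vanish, so exactly one of the two terms is active for each sign of \<open>x\<close>.\<close>

definition prim :: "(real \<Rightarrow> real) \<Rightarrow> real \<Rightarrow> real" where
  "prim g x = integral {0..x} g - integral {x..0} g"

lemma prim_diff:
  assumes "\<And>a b. g integrable_on {a..b}" "a \<le> b"
  shows "prim g b - prim g a = integral {a..b} g"
proof -
  have c: "integral {p..r} g = integral {p..q} g + integral {q..r} g" if "p \<le> q" "q \<le> r" for p q r
    using Henstock_Kurzweil_Integration.integral_combine[OF that assms(1)] by simp
  have z: "integral {p..q} g = 0" if "q \<le> p" for p q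
    using that by (cases "p = q") auto
  consider "0 \<le> a" | "b \<le> 0" | "a \<le> 0" "0 \<le> b" by linarith
  then show ?thesis
  proof cases
    case 1
    then show ?thesis using c[of 0 a b] assms(2) z[of 0 a] z[of 0 b] by (auto simp: prim_def)
  next
    case 2
    then show ?thesis using c[of a b 0] assms(2) z[of a 0] z[of b 0] by (auto simp: prim_def)
  next
    case 3
    then show ?thesis using c[of a 0 b] z[of a 0] z[of 0 b] by (auto simp: prim_def)
  qed
qed

lemma prim_deriv:
  assumes "continuous_on UNIV g"
  shows "(prim g has_real_derivative g x) (at x)"
proof -
  have i: "g integrable_on {a..b}" for a b
    using assms by (meson continuous_on_subset integrable_continuous_real subset_UNIV)
  have "((\<lambda>y. integral {x - 1..y} g) has_real_derivative g x) (at x within {x - 1..x + 1})"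
    using assms by (intro integral_has_real_derivative) (auto intro: continuous_on_subset)
  then have "((\<lambda>y. integral {x - 1..y} g) has_real_derivative g x) (at x)"
    by (subst (asm) at_within_interior) auto
  then have "((\<lambda>y. integral {x - 1..y} g + prim g (x - 1)) has_real_derivative g x) (at x)"
    by (auto intro!: derivative_eq_intros)
  then show ?thesis
  proof (rule has_field_derivative_transform_within_open[of _ _ _ "{x - 1<..}"])
    fix y assume "y \<in> {x - 1<..}"
    then show "integral {x - 1..y} g + prim g (x - 1) = prim g y"
      using prim_diff[OF i, of "x - 1" y] by auto
  qed auto
qed

lemma Ck_prim: "(\<And>n. Ck n g) \<Longrightarrow> Ck n (prim g)"
  by (rule Ck_SucD[OF Ck_SucI_real[OF prim_deriv[OF Ck_imp_continuous[of 0]]]])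

definition smoothstep :: "real \<Rightarrow> real" where
  "smoothstep x = prim bump x / prim bump 1"

lemma prim_bump: "x \<le> 0 \<Longrightarrow> prim bump x = 0" "prim bump 1 > 0" "1 \<le> x \<Longrightarrow> prim bump x = prim bump 1"
proof -
  have c: "continuous_on A bump" for A
    using Ck_imp_continuous[OF Ck_bump] continuous_on_subset by blast
  have i: "bump integrable_on {a..b}" for a b
    using c by (rule integrable_continuous_real)
  show "x \<le> 0 \<Longrightarrow> prim bump x = 0"
  proof -
    assume "x \<le> 0"
    then have "integral {x..0} bump = integral {x..0} (\<lambda>_. 0)"
      by (intro integral_cong bump_eq_0) auto
    moreover have "integral {0..x} bump = 0"
      using \<open>x \<le> 0\<close> by (cases "x = 0") auto
    ultimately show ?thesis by (simp add: prim_def)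
  qed
  show "1 \<le> x \<Longrightarrow> prim bump x = prim bump 1"
  proof -
    assume x: "1 \<le> x"
    then have "integral {1..x} bump = integral {1..x} (\<lambda>_. 0)"
      by (intro integral_cong bump_eq_0) auto
    then show ?thesis using prim_diff[OF i x] by simp
  qed
  \<comment> \<open>A continuous non-negative function with zero integral vanishes in the interior,
    contradicting positivity at \<open>1/2\<close>.\<close>
  have "integral {0..1} bump \<noteq> 0"
  proof
    assume "integral {0..1} bump = 0"
    then have "(bump has_integral 0) (cbox 0 1)"
      using i[of 0 1] by (metis cbox_interval has_integral_integral)
    then have "bump (1/2) = 0"
      by (rule has_integral_0_cbox_imp_0[rotated 2]) (auto simp: c bump_nonneg box_real)
    then show False using bump_pos[of "1/2"] by simp
  qed
  moreover have "integral {0..1} bump \<ge> 0"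
    by (rule integral_nonneg) (auto simp: i bump_nonneg)
  ultimately show "prim bump 1 > 0"
    by (simp add: prim_def)
qed

lemma smoothstep_deriv: "(smoothstep has_real_derivative bump x / prim bump 1) (at x)"
  unfolding smoothstep_def
  by (intro DERIV_cdivide prim_deriv Ck_imp_continuous[OF Ck_bump])

lemma Ck_smoothstep: "Ck n smoothstep"
  unfolding smoothstep_def using Ck_cmult[OF Ck_prim[OF Ck_bump], of n "1 / prim bump 1"] by simp

lemma smoothstep_mono: "x \<le> y \<Longrightarrow> smoothstep x \<le> smoothstep y"
  by (rule DERIV_nonneg_imp_nondecreasing, assumption)
     (metis smoothstep_deriv prim_bump(2) bump_nonneg divide_nonneg_pos)

lemma smoothstep_eq_0 [simp]: "x \<le> 0 \<Longrightarrow> smoothstep x = 0"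
  and smoothstep_eq_1 [simp]: "1 \<le> x \<Longrightarrow> smoothstep x = 1"
  using prim_bump(1)[of x] prim_bump(3)[of x] prim_bump(2) by (simp_all add: smoothstep_def)

lemma smoothstep_nonneg: "0 \<le> smoothstep x" and smoothstep_le_1: "smoothstep x \<le> 1"
  using smoothstep_mono[of "min x 0" x] smoothstep_mono[of x "max x 1"]
  by simp_all

lemma smoothstep_pos: assumes "0 < x" shows "0 < smoothstep x"
proof (cases "x < 1")
  case True
  have "smoothstep 0 < smoothstep x"
  proof (rule DERIV_pos_imp_increasing_open[OF assms])
    show "continuous_on {0..x} smoothstep"
      by (rule continuous_on_subset[OF Ck_imp_continuous[OF Ck_smoothstep] subset_UNIV])
    fix y assume "0 < y" "y < x"
    then show "\<exists>z. (smoothstep has_real_derivative z) (at y) \<and> 0 < z"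
      using True bump_pos[of y] prim_bump(2)
      by (intro exI[of _ "bump y / prim bump 1"] conjI smoothstep_deriv) simp
  qed
  then show ?thesis by simp
qed auto

section \<open>Absolutely continuous functions and cutoffs\<close>

lemma absolutely_integrable_continuous_mult:
  fixes h g :: "real \<Rightarrow> real"
  assumes "continuous_on {a..b} h" "g absolutely_integrable_on {a..b}"
  shows "(\<lambda>x. h x * g x) absolutely_integrable_on {a..b}"
proof (rule absolutely_integrable_bounded_measurable_product_real)
  show "h \<in> borel_measurable (lebesgue_on {a..b})"
    using assms(1) by (intro continuous_imp_measurable_on_sets_lebesgue) auto
  show "bounded (h ` {a..b})"
    using assms(1) by (intro compact_imp_bounded compact_continuous_image) auto
qed (use assms in auto)

text \<open>Local absolute continuity with a named density. The density is determined only almost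
  everywhere, which is all that is available for the top derivative of a Sobolev function.\<close>

definition AC_deriv :: "(real \<Rightarrow> real) \<Rightarrow> (real \<Rightarrow> real) \<Rightarrow> bool" where
  "AC_deriv f g \<longleftrightarrow> (\<forall>a b. g absolutely_integrable_on {a..b}) \<and>
     (\<forall>a b. a \<le> b \<longrightarrow> f b - f a = integral {a..b} g)"

lemma AC_derivD:
  assumes "AC_deriv f g"
  shows "g absolutely_integrable_on {a..b}" "g integrable_on {a..b}"
    "a \<le> b \<Longrightarrow> f b - f a = integral {a..b} g"
  using assms set_lebesgue_integral_eq_integral(1) by (auto simp: AC_deriv_def)

lemma AC_deriv_continuous:
  assumes "AC_deriv f g" shows "continuous_on A f"
proof -
  have "isCont f x" for x
  proof -
    have "continuous_on {x - 1..x + 1} (\<lambda>y. integral {x - 1..y} g + f (x - 1))"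
      by (intro continuous_intros indefinite_integral_continuous_1 AC_derivD[OF assms])
    then have "continuous_on {x - 1..x + 1} f"
      by (rule continuous_on_eq) (use AC_derivD(3)[OF assms, of "x - 1"] in force)
    then show ?thesis
      by (rule continuous_on_interior) auto
  qed
  then show ?thesis by (intro continuous_at_imp_continuous_on) auto
qed

lemma AC_derivI_C1:
  assumes "\<And>x. (f has_real_derivative g x) (at x)" "continuous_on UNIV g"
  shows "AC_deriv f g"
  unfolding AC_deriv_def
proof (intro conjI allI impI)
  fix a b
  have c: "continuous_on {a..b} g" using assms(2) continuous_on_subset by blast
  then show "g absolutely_integrable_on {a..b}" by (rule absolutely_integrable_continuous_real)
  assume "a \<le> b"
  then have "(g has_integral (f b - f a)) {a..b}"
    using assms(1)
    by (intro fundamental_theorem_of_calculus)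
       (auto simp flip: has_real_derivative_iff_has_vector_derivative intro: has_field_derivative_at_within)
  then show "f b - f a = integral {a..b} g" by (simp add: integral_unique)
qed

text \<open>The intermediate point of the classical mean value theorem for \<open>j\<close> lies
  between \<open>f a\<close> and \<open>f b\<close>, so continuity of \<open>f\<close> makes it a
  value \<open>f c\<close>.\<close>

lemma mvt_along_continuous:
  fixes f j j' :: "real \<Rightarrow> real"
  assumes "\<And>y. (j has_real_derivative j' y) (at y)" "continuous_on {a..b} f" "a \<le> b"
  shows "\<exists>c\<in>{a..b}. j (f b) - j (f a) = j' (f c) * (f b - f a)"
proof (cases "f a" "f b" rule: linorder_cases)
  case less
  obtain z where z: "f a < z" "z < f b" "j (f b) - j (f a) = (f b - f a) * j' z"
    using MVT2[OF less, of j j'] assms(1) by blast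
  then obtain c where "a \<le> c" "c \<le> b" "f c = z"
    using IVT'[of f a z b] assms by force
  then show ?thesis using z by (intro bexI[of _ c]) auto
next
  case greater
  obtain z where z: "f b < z" "z < f a" "j (f a) - j (f b) = (f a - f b) * j' z"
    using MVT2[OF greater, of j j'] assms(1) by blast
  then obtain c where "a \<le> c" "c \<le> b" "f c = z"
    using IVT2'[of f b z a] assms by force
  then show ?thesis using z by (intro bexI[of _ c]) (auto simp: algebra_simps)
qed (use assms in auto)

text \<open>On a short interval the mean value theorem compares \<open>j (f b) - j (f a)\<close> with
  \<open>j' (f c)\<close> times the integral of \<open>g\<close>; these comparisons add up.\<close>

lemma AC_deriv_chain:
  assumes fg: "AC_deriv f g" and j: "\<And>y. (j has_real_derivative j' y) (at y)"
    and cj: "continuous_on UNIV j'"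
  shows "AC_deriv (\<lambda>x. j (f x)) (\<lambda>x. j' (f x) * g x)"
proof -
  have cf: "continuous_on A f" for A by (rule AC_deriv_continuous[OF fg])
  have cjf: "continuous_on A (\<lambda>x. j' (f x))" for A
    by (rule continuous_on_compose2[OF cj cf]) auto
  define G where "G = (\<lambda>x. j' (f x) * g x)"
  have Gabs: "G absolutely_integrable_on {a..b}" for a b
    unfolding G_def by (rule absolutely_integrable_continuous_mult[OF cjf AC_derivD(1)[OF fg]])
  have Gi: "G integrable_on {a..b}" for a b
    using Gabs set_lebesgue_integral_eq_integral(1) by blast
  have gabs: "(\<lambda>x. \<bar>g x\<bar>) integrable_on {a..b}" for a b
    using AC_derivD(1)[OF fg, of a b] unfolding absolutely_integrable_on_def by simp
  have key: "\<bar>j (f b) - j (f a) - integral {a..b} G\<bar> \<le> e * integral {a..b} (\<lambda>x. \<bar>g x\<bar>)"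
    if ab: "a \<le> b" and e: "e > 0" for a b e
  proof -
    define P where "P = (\<lambda>a b. a \<le> b \<longrightarrow>
      \<bar>j (f b) - j (f a) - integral {a..b} G\<bar> \<le> e * integral {a..b} (\<lambda>x. \<bar>g x\<bar>))"
    have "P a b" using ab
    proof (induction rule: Bolzano)
      case (trans a b c)
      have "integral {a..c} G = integral {a..b} G + integral {b..c} G"
        "integral {a..c} (\<lambda>x. \<bar>g x\<bar>) = integral {a..b} (\<lambda>x. \<bar>g x\<bar>) + integral {b..c} (\<lambda>x. \<bar>g x\<bar>)"
        using trans Gi gabs by (simp_all add: Henstock_Kurzweil_Integration.integral_combine)
      then show ?case using trans by (auto simp: P_def algebra_simps)
    next
      case (local x)
      have "isCont (\<lambda>x. j' (f x)) x" using cjf[of UNIV] by (simp add: continuous_on_eq_continuous_at)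
      then obtain d where d: "d > 0" "\<And>y. \<bar>y - x\<bar> < d \<Longrightarrow> \<bar>j' (f y) - j' (f x)\<bar> < e / 2"
        using e unfolding continuous_at_eps_delta dist_real_def by (meson half_gt_zero)
      have "P a b" if x: "a \<le> x" "x \<le> b" "b - a < d" for a b
      proof -
        have "a \<le> b" using x by simp
        obtain c where c: "c \<in> {a..b}" "j (f b) - j (f a) = j' (f c) * (f b - f a)"
          using mvt_along_continuous[OF j cf \<open>a \<le> b\<close>] by blast
        have cg: "(\<lambda>y. j' (f c) * g y) integrable_on {a..b}"
          using AC_derivD(2)[OF fg] by (rule integrable_on_mult_right)
        have "j (f b) - j (f a) - integral {a..b} G = integral {a..b} (\<lambda>y. j' (f c) * g y) - integral {a..b} G"
          using AC_derivD(3)[OF fg \<open>a \<le> b\<close>] c(2) by simp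
        also have "\<dots> = integral {a..b} (\<lambda>y. j' (f c) * g y - G y)"
          using Henstock_Kurzweil_Integration.integral_diff[OF cg Gi] by simp
        finally have eq: "j (f b) - j (f a) - integral {a..b} G = integral {a..b} (\<lambda>y. j' (f c) * g y - G y)" .
        have "norm (integral {a..b} (\<lambda>y. j' (f c) * g y - G y)) \<le> integral {a..b} (\<lambda>y. e * \<bar>g y\<bar>)"
        proof (rule integral_norm_bound_integral)
          fix y assume y: "y \<in> {a..b}"
          have "\<bar>j' (f c) - j' (f y)\<bar> \<le> e"
            using d(2)[of c] d(2)[of y] c(1) y x by (force simp: abs_if split: if_splits)
          then show "norm (j' (f c) * g y - G y) \<le> e * \<bar>g y\<bar>"
            by (simp add: G_def abs_mult mult_right_mono flip: left_diff_distrib)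
        qed (auto intro: integrable_diff cg Gi integrable_on_mult_right gabs)
        then show ?thesis using eq by (simp add: P_def)
      qed
      then show ?case using d(1) by blast
    qed
    then show ?thesis using ab by (simp add: P_def)
  qed
  have "j (f b) - j (f a) = integral {a..b} G" if "a \<le> b" for a b
  proof (rule ccontr)
    define D I where "D = \<bar>j (f b) - j (f a) - integral {a..b} G\<bar>"
      and "I = integral {a..b} (\<lambda>x. \<bar>g x\<bar>)"
    assume "j (f b) - j (f a) \<noteq> integral {a..b} G"
    then have D: "D > 0" by (simp add: D_def)
    have I: "I \<ge> 0" unfolding I_def by (intro integral_nonneg gabs) auto
    \<comment> \<open>This choice of \<open>e\<close> pushes the error bound below \<open>D\<close>;
      the summand 1 keeps the divisor positive when \<open>I\<close> vanishes.\<close>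
    have "D \<le> D / (2 * (I + 1)) * I"
      using key[OF that, of "D / (2 * (I + 1))"] D I by (simp add: D_def I_def)
    moreover have "D * I < D * (2 * (I + 1))" using D I by (intro mult_strict_left_mono) auto
    ultimately show False using I by (simp add: divide_simps split: if_splits)
  qed
  then show ?thesis using Gabs by (simp add: AC_deriv_def G_def)
qed

lemma AC_deriv_cong:
  assumes "AC_deriv f g" "\<And>x. f x = f' x" "\<And>x. g x = g' x"
  shows "AC_deriv f' g'"
proof -
  have "f = f'" "g = g'" using assms by auto
  then show ?thesis using assms(1) by simp
qed

lemma AC_deriv_add:
  assumes "AC_deriv f g" "AC_deriv f' g'"
  shows "AC_deriv (\<lambda>x. f x + f' x) (\<lambda>x. g x + g' x)"
  unfolding AC_deriv_def
proof (intro conjI allI impI)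
  fix a b :: real
  show "(\<lambda>x. g x + g' x) absolutely_integrable_on {a..b}"
    using AC_derivD(1)[OF assms(1)] AC_derivD(1)[OF assms(2)] by (rule set_integral_add)
  assume "a \<le> b"
  then show "f b + f' b - (f a + f' a) = integral {a..b} (\<lambda>x. g x + g' x)"
    using AC_derivD[OF assms(1), of a b] AC_derivD[OF assms(2), of a b]
    by (simp add: Henstock_Kurzweil_Integration.integral_add)
qed

lemma AC_deriv_cmult:
  assumes "AC_deriv f g"
  shows "AC_deriv (\<lambda>x. c * f x) (\<lambda>x. c * g x)"
  unfolding AC_deriv_def
proof (intro conjI allI impI)
  fix a b :: real
  show "(\<lambda>x. c * g x) absolutely_integrable_on {a..b}"
    using AC_derivD(1)[OF assms(1)] by (simp)
  assume "a \<le> b"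
  then show "c * f b - c * f a = integral {a..b} (\<lambda>x. c * g x)"
    using AC_derivD(3)[OF assms(1), of a b] by (simp flip: right_diff_distrib)
qed

lemma AC_deriv_diff:
  assumes "AC_deriv f g" "AC_deriv f' g'"
  shows "AC_deriv (\<lambda>x. f x - f' x) (\<lambda>x. g x - g' x)"
  using AC_deriv_add[OF assms(1) AC_deriv_cmult[OF assms(2), of "-1"]] by simp

text \<open>Polarisation: the product is a quarter of the difference of two squares, and squares are
  covered by the chain rule.\<close>

lemma AC_deriv_mult:
  assumes "AC_deriv f g" "AC_deriv f' g'"
  shows "AC_deriv (\<lambda>x. f x * f' x) (\<lambda>x. g x * f' x + f x * g' x)"
proof -
  have sq: "AC_deriv (\<lambda>x. (h x)\<^sup>2) (\<lambda>x. 2 * h x * k x)" if "AC_deriv h k" for h k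
    by (rule AC_deriv_chain[OF that]) (auto intro!: derivative_eq_intros continuous_intros)
  have "AC_deriv (\<lambda>x. 1/4 * ((f x + f' x)\<^sup>2 - (f x - f' x)\<^sup>2))
      (\<lambda>x. 1/4 * (2 * (f x + f' x) * (g x + g' x) - 2 * (f x - f' x) * (g x - g' x)))"
    by (intro AC_deriv_cmult AC_deriv_diff[OF sq[OF AC_deriv_add[OF assms]] sq[OF AC_deriv_diff[OF assms]]])
  then show ?thesis
    by (rule AC_deriv_cong) (auto simp: power2_eq_square algebra_simps)
qed

lemma prim_AC:
  assumes "\<And>a b. g absolutely_integrable_on {a..b}"
  shows "AC_deriv (prim g) g"
proof -
  have "g integrable_on {a..b}" for a b
    using assms set_lebesgue_integral_eq_integral(1) by blast
  then show ?thesis using assms prim_diff by (simp add: AC_deriv_def)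
qed

section \<open>Cutoffs at scale \<open>R\<close>\<close>

definition cutoff :: "real \<Rightarrow> real \<Rightarrow> real" where
  "cutoff R x = smoothstep (2 - x / R) * smoothstep (2 + x / R)"

lemma Ck_cutoff: "Ck n (cutoff R)"
proof -
  have "Ck n (\<lambda>x. smoothstep ((- 1 / R) * x + 2) * smoothstep ((1 / R) * x + 2))"
    by (intro Ck_mult Ck_compose_affine Ck_smoothstep)
  moreover have "(\<lambda>x. smoothstep ((- 1 / R) * x + 2) * smoothstep ((1 / R) * x + 2)) = cutoff R"
    by (auto simp: cutoff_def add.commute)
  ultimately show ?thesis by simp
qed

lemma cutoff_deriv: "(cutoff R has_real_derivative deriv (cutoff R) x) (at x)"
  by (rule Ck_Suc_real(1)[OF Ck_cutoff])

lemma continuous_cutoff: "continuous_on A (cutoff R)"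
  and continuous_deriv_cutoff: "continuous_on A (deriv (cutoff R))"
  using Ck_imp_continuous[OF Ck_cutoff] Ck_imp_continuous[OF Ck_Suc_real(2)[OF Ck_cutoff[of "Suc 0"]]]
    continuous_on_subset by blast+

lemma cutoff_bounds: "0 \<le> cutoff R x" "cutoff R x \<le> 1"
  unfolding cutoff_def
  by (auto intro!: mult_nonneg_nonneg mult_le_one smoothstep_nonneg smoothstep_le_1)

lemma cutoff_eq_1: "R > 0 \<Longrightarrow> \<bar>x\<bar> \<le> R \<Longrightarrow> cutoff R x = 1"
proof -
  assume "R > 0" "\<bar>x\<bar> \<le> R"
  then have "1 \<le> 2 - x / R" "1 \<le> 2 + x / R" by (auto simp: field_simps abs_le_iff)
  then show ?thesis by (simp add: cutoff_def)
qed

lemma cutoff_eq_0: "R > 0 \<Longrightarrow> \<bar>x\<bar> \<ge> 2 * R \<Longrightarrow> cutoff R x = 0"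
proof -
  assume "R > 0" "\<bar>x\<bar> \<ge> 2 * R"
  then have "2 - x / R \<le> 0 \<or> 2 + x / R \<le> 0" by (auto simp: field_simps abs_if split: if_splits)
  then show ?thesis by (auto simp: cutoff_def)
qed

lemma cutoff_Cc: "R > 0 \<Longrightarrow> cutoff R \<in> Cc_infinity"
proof (rule Cc_infinityI[of _ "{-2*R..2*R}"])
  fix x assume "R > 0" "cutoff R x \<noteq> 0"
  then have "\<not> \<bar>x\<bar> \<ge> 2 * R" using cutoff_eq_0[of R x] by blast
  then show "x \<in> {-2*R..2*R}" by auto
qed (auto intro: Ck_cutoff)

lemma deriv_cutoff_eq_0:
  assumes "R > 0" "\<bar>x\<bar> < R \<or> 2 * R < \<bar>x\<bar>"
  shows "deriv (cutoff R) x = 0"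
proof -
  have "\<exists>c. \<forall>\<^sub>F y in nhds x. cutoff R y = c"
  proof (cases "\<bar>x\<bar> < R")
    case True
    have "\<forall>\<^sub>F y in nhds x. y \<in> {y. \<bar>y\<bar> < R}"
      using True by (intro eventually_nhds_in_open open_Collect_less continuous_intros) auto
    then show ?thesis
      using assms by (intro exI[of _ 1]) (auto elim!: eventually_mono intro: cutoff_eq_1)
  next
    case False
    have "\<forall>\<^sub>F y in nhds x. y \<in> {y. 2 * R < \<bar>y\<bar>}"
      using False assms by (intro eventually_nhds_in_open open_Collect_less continuous_intros) auto
    then show ?thesis
      using assms by (intro exI[of _ 0]) (auto elim!: eventually_mono intro: cutoff_eq_0)
  qed
  then obtain c where "\<forall>\<^sub>F y in nhds x. cutoff R y = c" ..
  then have "deriv (cutoff R) x = deriv (\<lambda>_. c) x" by (rule deriv_cong_ev) simp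
  then show ?thesis by simp
qed

text \<open>Every \<open>cutoff R\<close> is a dilation of \<open>cutoff 1\<close>, so one constant
  serves all scales. This decay \<open>1/R\<close> is the source of every estimate at spatial
  infinity.\<close>

lemma deriv_cutoff_bound: "\<exists>C>0. \<forall>R>0. \<forall>x. \<bar>deriv (cutoff R) x\<bar> \<le> C / R"
proof -
  have c: "compact (deriv (cutoff 1) ` {-2..2})"
    by (intro compact_continuous_image continuous_deriv_cutoff) auto
  then obtain C where C: "C > 0" "\<And>x. x \<in> {-2..2} \<Longrightarrow> \<bar>deriv (cutoff 1) x\<bar> \<le> C"
    using compact_imp_bounded[OF c] by (auto simp: bounded_pos)
  have C': "\<bar>deriv (cutoff 1) x\<bar> \<le> C" for x
    using C deriv_cutoff_eq_0[of 1 x] by (cases "x \<in> {-2..2}") (auto simp: abs_if split: if_splits)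
  have "\<bar>deriv (cutoff R) x\<bar> \<le> C / R" if "R > 0" for R x
  proof -
    have eq: "cutoff R = (\<lambda>x. cutoff 1 (x / R))" by (auto simp: cutoff_def)
    have "(cutoff R has_real_derivative deriv (cutoff 1) (x / R) * (1 / R)) (at x)"
      unfolding eq using that
      by (intro DERIV_chain2[OF cutoff_deriv]) (auto intro!: derivative_eq_intros)
    then have "deriv (cutoff R) x = deriv (cutoff 1) (x / R) / R"
      by (simp add: DERIV_imp_deriv)
    then show ?thesis using C'[of "x / R"] that by (simp add: divide_right_mono)
  qed
  then show ?thesis using C(1) by blast
qed

lemma cutoff_tendsto_1: "(\<lambda>n. cutoff (real (Suc n)) x) \<longlonglongrightarrow> 1"
proof (rule tendsto_eventually)
  obtain N where "\<bar>x\<bar> \<le> real N" using real_arch_simple by blast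
  then show "\<forall>\<^sub>F n in sequentially. cutoff (real (Suc n)) x = 1"
    by (auto simp: eventually_sequentially intro!: exI[of _ N] cutoff_eq_1)
qed

lemma borel_cutoff [measurable]: "cutoff R \<in> borel_measurable borel" "deriv (cutoff R) \<in> borel_measurable borel"
  by (auto intro!: borel_measurable_continuous_onI continuous_cutoff continuous_deriv_cutoff)

lemma integrable_lebesgue_mult_bounded:
  fixes f g :: "real \<Rightarrow> real"
  assumes "integrable lebesgue f" "g \<in> borel_measurable lebesgue" "\<And>x. \<bar>g x\<bar> \<le> C"
  shows "integrable lebesgue (\<lambda>x. g x * f x)"
proof (rule Bochner_Integration.integrable_bound[of _ "\<lambda>x. C * f x"])
  show "AE x in lebesgue. norm (g x * f x) \<le> norm (C * f x)"
    using assms(3) by (auto simp: abs_mult intro!: mult_right_mono order_trans[OF assms(3) abs_ge_self])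
qed (use assms in auto)

text \<open>Cutting off at scale \<open>R\<close> costs at most \<open>O(1/R)\<close>.\<close>

lemma AC_deriv_integral_zero:
  assumes fg: "AC_deriv f g" and f: "integrable lebesgue f" and g: "integrable lebesgue g"
  shows "(LINT x|lebesgue. g x) = 0"
proof -
  obtain C where C: "C > 0" "\<And>R x. R > 0 \<Longrightarrow> \<bar>deriv (cutoff R) x\<bar> \<le> C / R"
    using deriv_cutoff_bound by blast
  have m: "cutoff R \<in> borel_measurable lebesgue" "deriv (cutoff R) \<in> borel_measurable lebesgue" for R
    by (auto intro!: measurable_completion)
  have int0: "(LINT x|lebesgue. cutoff R x * g x) = - (LINT x|lebesgue. deriv (cutoff R) x * f x)"
    if R: "R > 0" for R
  proof -
    have i: "integrable lebesgue (\<lambda>x. cutoff R x * g x)" "integrable lebesgue (\<lambda>x. deriv (cutoff R) x * f x)"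
      using integrable_lebesgue_mult_bounded[OF g m(1), of R 1] cutoff_bounds
        integrable_lebesgue_mult_bounded[OF f m(2), of R "C/R"] C(2)[OF R] by auto
    \<comment> \<open>The interval extends past \<open>2 * R\<close> so that outside it the
      derivative of the cutoff vanishes as well; its vanishing is known only strictly beyond
      \<open>2 * R\<close>.\<close>
    have z: "cutoff R x * g x + deriv (cutoff R) x * f x = 0" if "x \<notin> {-3*R..3*R}" for x
      using that R cutoff_eq_0[of R x] deriv_cutoff_eq_0[of R x] by (cases "x \<ge> 0") auto
    have "AC_deriv (\<lambda>x. cutoff R x * f x) (\<lambda>x. deriv (cutoff R) x * f x + cutoff R x * g x)"
      by (intro AC_deriv_mult fg AC_derivI_C1 cutoff_deriv continuous_deriv_cutoff)
    note AC = AC_derivD[OF this]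
    have "(LINT x|lebesgue. cutoff R x * g x) + (LINT x|lebesgue. deriv (cutoff R) x * f x)
        = (LINT x|lebesgue. cutoff R x * g x + deriv (cutoff R) x * f x)"
      using i by simp
    also have "\<dots> = (LINT x:{-3*R..3*R}|lebesgue. deriv (cutoff R) x * f x + cutoff R x * g x)"
      unfolding set_lebesgue_integral_def using z
      by (intro Bochner_Integration.integral_cong) (auto simp: indicator_def)
    also have "\<dots> = integral {-3*R..3*R} (\<lambda>x. deriv (cutoff R) x * f x + cutoff R x * g x)"
      by (rule set_lebesgue_integral_eq_integral(2)[OF AC(1)])
    also have "\<dots> = 0"
      using AC(3)[of "-3*R" "3*R"] R by (simp add: cutoff_eq_0)
    finally show ?thesis by simp
  qed
  have 1: "(\<lambda>n. LINT x|lebesgue. cutoff (real (Suc n)) x * g x) \<longlonglongrightarrow> (LINT x|lebesgue. g x)"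
  proof (rule integral_dominated_convergence[where w = "\<lambda>x. \<bar>g x\<bar>"])
    show "AE x in lebesgue. (\<lambda>n. cutoff (real (Suc n)) x * g x) \<longlonglongrightarrow> g x"
      using tendsto_mult[OF cutoff_tendsto_1 tendsto_const] by auto
    show "AE x in lebesgue. norm (cutoff (real (Suc n)) x * g x) \<le> \<bar>g x\<bar>" for n
      using cutoff_bounds by (auto simp: abs_mult intro!: mult_left_le_one_le)
  qed (use g m in auto)
  have "(\<lambda>n. - (LINT x|lebesgue. deriv (cutoff (real (Suc n))) x * f x)) \<longlonglongrightarrow> 0"
  proof (rule Lim_null_comparison)
    show "(\<lambda>n. C * (LINT x|lebesgue. \<bar>f x\<bar>) * inverse (real (Suc n))) \<longlonglongrightarrow> 0"
      by (intro tendsto_mult_right_zero LIMSEQ_inverse_real_of_nat)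
    have "norm (LINT x|lebesgue. deriv (cutoff (real (Suc n))) x * f x)
        \<le> (LINT x|lebesgue. C / real (Suc n) * \<bar>f x\<bar>)" for n
      using C(2)[of "real (Suc n)"] f
      by (intro Bochner_Integration.integral_norm_bound_integral integrable_lebesgue_mult_bounded[OF f m(2), of _ "C / real (Suc n)"])
         (simp_all add: abs_mult mult_right_mono del: of_nat_Suc times_divide_eq_left)
    then show "\<forall>\<^sub>F n in sequentially. norm (- (LINT x|lebesgue. deriv (cutoff (real (Suc n))) x * f x))
        \<le> C * (LINT x|lebesgue. \<bar>f x\<bar>) * inverse (real (Suc n))"
      by (auto simp: divide_inverse mult_ac)
  qed
  then have "(\<lambda>n. LINT x|lebesgue. cutoff (real (Suc n)) x * g x) \<longlonglongrightarrow> 0"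
    by (simp add: int0)
  with 1 show ?thesis using LIMSEQ_unique by blast
qed

text \<open>Closed intervals form an intersection-stable generator of the Borel sets. After
  truncation to \<open>{-n..n}\<close> the total integral is zero too, which handles complements, so
  the integral over every Borel set vanishes and the density is null.\<close>

lemma interval_integrals_zero_imp_AE_zero:
  fixes h :: "real \<Rightarrow> real"
  assumes hi: "\<And>a b. h absolutely_integrable_on {a..b}"
    and h0: "\<And>a b. a \<le> b \<Longrightarrow> integral {a..b} h = 0"
  shows "AE x in lebesgue. h x = 0"
proof -
  have "AE x in lebesgue. indicator {-real n..real n} x * h x = 0" for n :: nat
  proof -
    define f where "f = (\<lambda>x. indicator {-real n..real n} x * h x)"
    have fi: "integrable lebesgue f"
      using hi[of "-real n" "real n"] by (simp add: f_def set_integrable_def)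
    \<comment> \<open>A Borel representative allows the generator argument to run over Borel sets
      instead of Lebesgue sets.\<close>
    obtain f' where f': "f' \<in> borel_measurable lborel" "AE x in lborel. f x = f' x"
      using completion_ex_borel_measurable_real[of f lborel] borel_measurable_integrable[OF fi] by blast
    have ae: "AE x in lebesgue. f x = f' x" using f'(2) by (rule AE_completion)
    have f'i: "integrable lebesgue f'"
      by (rule integrable_cong_AE_imp[OF fi measurable_completion[OF f'(1)]]) (use ae in auto)
    have f'il: "integrable lborel f'"
      using f'i f'(1) by (simp add: integrable_completion)
    have int: "(LINT x|lborel. indicator {a..b} x * f' x) = 0" for a b
    proof -
      have "(LINT x|lborel. indicator {a..b} x * f' x) = (LINT x|lebesgue. indicator {a..b} x * f' x)"
        using f'(1) by (intro integral_completion[symmetric]) auto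
      also have "\<dots> = (LINT x|lebesgue. indicator {a..b} x * f x)"
        using ae f' borel_measurable_integrable[OF fi]
        by (intro integral_cong_AE borel_measurable_times borel_measurable_indicator)
           (auto intro: measurable_completion)
      also have "\<dots> = (LINT x:{max a (-real n)..min b (real n)}|lebesgue. h x)"
        unfolding set_lebesgue_integral_def f_def
        by (intro Bochner_Integration.integral_cong) (auto simp: indicator_def)
      also have "\<dots> = integral {max a (-real n)..min b (real n)} h"
        by (rule set_lebesgue_integral_eq_integral(2)[OF hi])
      also have "\<dots> = 0"
        using h0[of "max a (-real n)" "min b (real n)"]
        by (cases "max a (-real n) \<le> min b (real n)") auto
      finally show ?thesis .
    qed
    have tot: "(LINT x|lborel. f' x) = 0"
    proof -
      have "(LINT x|lborel. f' x) = (LINT x|lborel. indicator {-real n..real n} x * f' x)"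
      proof (rule integral_cong_AE)
        show "AE x in lborel. f' x = indicator {-real n..real n} x * f' x"
          using f'(2)
        proof eventually_elim
          case (elim x)
          then show ?case by (cases "x \<in> {-real n..real n}") (auto simp: f_def)
        qed
      qed (use f' in auto)
      then show ?thesis using int by simp
    qed
    have "(LINT x|lborel. indicator A x * f' x) = 0" if "A \<in> sets borel" for A
    proof -
      let ?G = "range (\<lambda>(a::real, b). {a..b})"
      have "Int_stable ?G" by (auto simp: Int_stable_def)
      moreover have "?G \<subseteq> Pow UNIV" by simp
      moreover have "A \<in> sigma_sets UNIV ?G"
        using that by (simp add: borel_eq_atLeastAtMost)
      ultimately show ?thesis
      proof (induction A rule: sigma_sets_induct_disjoint)
        case (basic A) then show ?case using int by auto
      next
        case empty show ?case by simp
      next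
        case (compl A)
        then have A: "A \<in> sets borel" by (simp add: borel_eq_atLeastAtMost)
        have i: "integrable lborel (\<lambda>x. indicator A x * f' x)"
          using integrable_mult_indicator[OF _ f'il, of A] A by simp
        have "(LINT x|lborel. indicator (UNIV - A) x * f' x) = (LINT x|lborel. f' x - indicator A x * f' x)"
          by (intro Bochner_Integration.integral_cong) (auto simp: indicator_def)
        then show ?case using compl tot i f'il by simp
      next
        case (union A)
        then have A: "A i \<in> sets borel" for i by (auto simp: borel_eq_atLeastAtMost)
        have si: "set_integrable lborel (\<Union>i. A i) f'"
          using integrable_mult_indicator[OF _ f'il, of "\<Union>i. A i"] A by (simp add: set_integrable_def)
        have "set_lebesgue_integral lborel (\<Union>i. A i) f' = (\<Sum>i. set_lebesgue_integral lborel (A i) f')"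
          using A si union(1) by (intro lebesgue_integral_countable_add) (auto simp: disjoint_family_on_def)
        then show ?case using union by (simp add: set_lebesgue_integral_def)
      qed
    qed
    then have "AE x in lborel. f' x = 0"
      using f'il by (intro density_unique_real) (auto simp: set_lebesgue_integral_def)
    with f'(2) have "AE x in lborel. f x = 0" by eventually_elim simp
    then show ?thesis unfolding f_def by (rule AE_completion)
  qed
  then have "AE x in lebesgue. \<forall>n::nat. indicator {-real n..real n} x * h x = 0"
    unfolding AE_all_countable by blast
  then show ?thesis
  proof eventually_elim
    case (elim x)
    obtain N where "\<bar>x\<bar> \<le> real N" using real_arch_simple by blast
    then show ?case using elim[rule_format, of N] by (auto simp: indicator_def abs_le_iff split: if_splits)
  qed
qed

lemma AC_deriv_unique:
  assumes "AC_deriv f g" "AC_deriv f g'"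
  shows "AE x in lebesgue. g x = g' x"
proof -
  have d: "AC_deriv (\<lambda>x. 0) (\<lambda>x. g x - g' x)" using AC_deriv_diff[OF assms] by simp
  have "AE x in lebesgue. g x - g' x = 0"
    by (rule interval_integrals_zero_imp_AE_zero) (use AC_derivD[OF d] in auto)
  then show ?thesis by simp
qed

section \<open>Weak derivatives\<close>

lemma loc_integrableI:
  assumes "\<And>a b. f absolutely_integrable_on {a..b}"
  shows "loc_integrable f"
  unfolding loc_integrable_def
proof (intro allI impI)
  fix K :: "real set" assume K: "compact K"
  then obtain a b where ab: "K \<subseteq> {a..b}"
    by (metis bounded_subset_cbox_symmetric cbox_interval compact_imp_bounded)
  have "K \<in> sets lebesgue"
    using compact_imp_closed[OF K] by auto
  then show "f absolutely_integrable_on K"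
    using set_integrable_subset[OF assms _ ab] by blast
qed

lemma loc_integrable_interval: "loc_integrable f \<Longrightarrow> f absolutely_integrable_on {a..b}"
  by (simp add: loc_integrable_def)

lemma loc_integrable_continuous: "continuous_on UNIV f \<Longrightarrow> loc_integrable f"
  by (intro loc_integrableI absolutely_integrable_continuous_real) (auto intro: continuous_on_subset)

lemma loc_integrable_AC: "AC_deriv f g \<Longrightarrow> loc_integrable f" "AC_deriv f g \<Longrightarrow> loc_integrable g"
  by (auto intro: loc_integrableI AC_derivD loc_integrable_continuous AC_deriv_continuous)

lemma loc_integrable_diff: "loc_integrable f \<Longrightarrow> loc_integrable g \<Longrightarrow> loc_integrable (\<lambda>x. f x - g x)"
  by (auto simp: loc_integrable_def intro: set_integral_diff)

lemma loc_integrable_measurable: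
  assumes "loc_integrable h" shows "h \<in> borel_measurable lebesgue"
proof (rule borel_measurable_LIMSEQ_real)
  show "(\<lambda>n. indicator {-real n..real n} x * h x) \<longlonglongrightarrow> h x" for x
  proof (rule tendsto_eventually)
    obtain N where "\<bar>x\<bar> \<le> real N" using real_arch_simple by blast
    then show "\<forall>\<^sub>F n in sequentially. indicator {-real n..real n} x * h x = h x"
      by (force simp: eventually_sequentially indicator_def abs_le_iff intro!: exI[of _ N])
  qed
  show "(\<lambda>x. indicator {-real n..real n} x * h x) \<in> borel_measurable lebesgue" for n
    using loc_integrable_interval[OF assms, of "-real n" "real n"]
    by (simp add: set_integrable_def borel_measurable_integrable)
qed

lemma loc_integrable_mult_integrable:
  assumes "loc_integrable f" "continuous_on UNIV \<phi>" "\<And>x. \<phi> x \<noteq> 0 \<Longrightarrow> \<bar>x\<bar> \<le> R"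
  shows "integrable lebesgue (\<lambda>x. f x * \<phi> x)"
proof -
  have "(\<lambda>x. \<phi> x * f x) absolutely_integrable_on {-R..R}"
    using assms(2) loc_integrable_interval[OF assms(1)]
    by (intro absolutely_integrable_continuous_mult) (auto intro: continuous_on_subset)
  moreover have "indicator {-R..R} x *\<^sub>R (\<phi> x * f x) = f x * \<phi> x" for x
    using assms(3)[of x] by (cases "\<phi> x = 0") (auto simp: indicator_def abs_le_iff)
  ultimately show ?thesis unfolding set_integrable_def by (simp only:)
qed

lemma Cc_infinity_D:
  fixes \<phi> :: "real \<Rightarrow> real"
  assumes "\<phi> \<in> Cc_infinity"
  shows "continuous_on A \<phi>" "(\<phi> has_real_derivative deriv \<phi> x) (at x)"
proof -
  have C: "Ck n \<phi>" for n using assms by (auto simp: Cc_infinity_def)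
  show "continuous_on A \<phi>" using Ck_imp_continuous[OF C] continuous_on_subset by blast
  show "(\<phi> has_real_derivative deriv \<phi> x) (at x)" by (rule Ck_Suc_real(1)[OF C])
qed

lemma loc_integrable_mult_test:
  assumes "loc_integrable f" "\<phi> \<in> Cc_infinity"
  shows "integrable lebesgue (\<lambda>x. f x * \<phi> x)"
proof -
  obtain R where "\<And>x. \<phi> x \<noteq> 0 \<Longrightarrow> norm x \<le> R" by (rule Cc_infinityE[OF assms(2)]) blast
  then show ?thesis
    by (intro loc_integrable_mult_integrable[of f \<phi> R] assms Cc_infinity_D) auto
qed

lemma AC_deriv_test:
  assumes "AC_deriv f g" "\<phi> \<in> Cc_infinity"
  shows "(LINT x|lebesgue. f x * deriv \<phi> x) = - (LINT x|lebesgue. g x * \<phi> x)"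
proof -
  have d: "deriv \<phi> \<in> Cc_infinity" by (rule Cc_infinity_deriv[OF assms(2)])
  have "AC_deriv \<phi> (deriv \<phi>)"
    by (intro AC_derivI_C1 Cc_infinity_D[OF assms(2)] Cc_infinity_D[OF d])
  from AC_deriv_mult[OF assms(1) this]
  have "(LINT x|lebesgue. g x * \<phi> x + f x * deriv \<phi> x) = 0"
    using assms d
    by (intro AC_deriv_integral_zero[of "\<lambda>x. f x * \<phi> x"] Bochner_Integration.integrable_add
        loc_integrable_mult_test loc_integrable_AC[OF assms(1)]) auto
  moreover have "(LINT x|lebesgue. g x * \<phi> x + f x * deriv \<phi> x)
      = (LINT x|lebesgue. g x * \<phi> x) + (LINT x|lebesgue. f x * deriv \<phi> x)"
    using assms d
    by (intro Bochner_Integration.integral_add loc_integrable_mult_test loc_integrable_AC[OF assms(1)])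
  ultimately show ?thesis by simp
qed

text \<open>Differences of ever steeper smooth steps are test functions converging boundedly to the
  indicator of a half-open interval, so all interval integrals of \<open>h\<close> vanish.\<close>

lemma test_functions_separate:
  assumes h: "loc_integrable h"
    and z: "\<And>\<phi>. \<phi> \<in> Cc_infinity \<Longrightarrow> (LINT x|lebesgue. h x * \<phi> x) = 0"
  shows "AE x in lebesgue. h x = 0"
proof (rule interval_integrals_zero_imp_AE_zero)
  show ha: "h absolutely_integrable_on {a..b}" for a b by (rule loc_integrable_interval[OF h])
  fix a b :: real assume ab: "a \<le> b"
  define \<phi> where "\<phi> = (\<lambda>n x. smoothstep (real (Suc n) * x + (- real (Suc n) * a)) - smoothstep (real (Suc n) * x + (- real (Suc n) * b)))"
  \<comment> \<open>Each step has width \<open>1 / Suc n\<close>, at most 1, so all supports lie in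
    one compact interval; this provides the integrable majorant.\<close>
  have \<phi>0: "\<phi> n x = 0" if "x \<notin> {a..b+1}" for n x
  proof (cases "x < a")
    case True
    then have "real (Suc n) * x + (- real (Suc n) * a) \<le> 0" "real (Suc n) * x + (- real (Suc n) * b) \<le> 0"
      using ab by (auto simp: mult_left_mono simp del: of_nat_Suc)
    then show ?thesis by (simp add: \<phi>_def del: of_nat_Suc)
  next
    case False
    have "1 * 1 \<le> real (Suc n) * (x - b)" "1 * 1 \<le> real (Suc n) * (x - a)"
      using False that ab by (intro mult_mono; simp)+
    then show ?thesis by (simp add: \<phi>_def algebra_simps del: of_nat_Suc)
  qed
  have \<phi>Cc: "\<phi> n \<in> Cc_infinity" for n
    using \<phi>0 unfolding \<phi>_def
    by (intro Cc_infinityI[of _ "{a..b+1}"] Ck_diff Ck_compose_affine Ck_smoothstep) (auto simp: \<phi>_def)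
  have \<phi>1: "\<bar>\<phi> n x\<bar> \<le> 1" for n x
    using smoothstep_nonneg smoothstep_le_1 by (smt (verit) \<phi>_def)
  have lim: "(\<lambda>n. h x * \<phi> n x) \<longlonglongrightarrow> h x * indicator {a<..b} x" for x
  proof -
    have s: "(\<lambda>n. smoothstep (real (Suc n) * x + (- real (Suc n) * c))) \<longlonglongrightarrow> (if x \<le> c then 0 else 1)" for c
    proof (rule tendsto_eventually)
      show "\<forall>\<^sub>F n in sequentially. smoothstep (real (Suc n) * x + (- real (Suc n) * c)) = (if x \<le> c then 0 else 1)"
      proof (cases "x \<le> c")
        case True
        then have "real (Suc n) * x + (- real (Suc n) * c) \<le> 0" for n
          by (auto simp: mult_left_mono simp del: of_nat_Suc)
        then show ?thesis using True by simp
      next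
        case False
        obtain N where N: "1 / (x - c) \<le> real N" using real_arch_simple by blast
        have "1 \<le> real (Suc n) * x + (- real (Suc n) * c)" if "n \<ge> N" for n
        proof -
          have "1 / (x - c) \<le> real (Suc n)" using N that by simp
          then show ?thesis using False by (simp add: field_simps)
        qed
        then have "smoothstep (real (Suc n) * x + (- real (Suc n) * c)) = 1" if "n \<ge> N" for n
          using that smoothstep_eq_1 by blast
        then show ?thesis using False by (auto simp: eventually_sequentially simp del: of_nat_Suc)
      qed
    qed
    have "(\<lambda>n. h x * \<phi> n x) \<longlonglongrightarrow> h x * ((if x \<le> a then 0 else 1) - (if x \<le> b then 0 else 1))"
      unfolding \<phi>_def by (intro tendsto_intros s)
    then show ?thesis using ab by (auto simp: indicator_def split: if_splits)
  qed
  have hm: "h \<in> borel_measurable lebesgue" by (rule loc_integrable_measurable[OF h])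
  have "(\<lambda>n. LINT x|lebesgue. h x * \<phi> n x) \<longlonglongrightarrow> (LINT x|lebesgue. h x * indicator {a<..b} x)"
  proof (rule integral_dominated_convergence[where w = "\<lambda>x. \<bar>indicator {a..b+1} x * h x\<bar>"])
    show "(\<lambda>x. h x * \<phi> n x) \<in> borel_measurable lebesgue" for n
      using loc_integrable_mult_test[OF h \<phi>Cc] by (rule borel_measurable_integrable)
    show "integrable lebesgue (\<lambda>x. \<bar>indicator {a..b+1} x * h x\<bar>)"
      using ha[of a "b+1"] by (intro integrable_abs) (simp add: set_integrable_def)
    show "AE x in lebesgue. norm (h x * \<phi> n x) \<le> \<bar>indicator {a..b+1} x * h x\<bar>" for n
    proof (rule AE_I2)
      fix x show "norm (h x * \<phi> n x) \<le> \<bar>indicator {a..b+1} x * h x\<bar>"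
      using \<phi>0[of x n] \<phi>1[of n x]
      by (cases "x \<in> {a..b+1}") (auto simp: abs_mult mult_left_le)
    qed
    show "(\<lambda>x. h x * indicator {a<..b} x) \<in> borel_measurable lebesgue"
      using hm by (intro borel_measurable_times borel_measurable_indicator) auto
  qed (use lim in auto)
  then have "(LINT x|lebesgue. h x * indicator {a<..b} x) = 0"
    unfolding z[OF \<phi>Cc] by (simp add: LIMSEQ_const_iff)
  moreover have "(LINT x|lebesgue. h x * indicator {a<..b} x) = (LINT x:{a..b}|lebesgue. h x)"
    unfolding set_lebesgue_integral_def
  proof (rule integral_cong_AE)
    have "AE x in lborel. x \<noteq> a" by (rule AE_lborel_singleton)
    then have "AE x in lebesgue. x \<noteq> a" by (rule AE_completion)
    then show "AE x in lebesgue. h x * indicator {a<..b} x = indicator {a..b} x *\<^sub>R h x"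
      by eventually_elim (auto simp: indicator_def)
  qed (use hm in \<open>auto intro!: borel_measurable_times borel_measurable_indicator borel_measurable_scaleR\<close>)
  ultimately show "integral {a..b} h = 0"
    using set_lebesgue_integral_eq_integral(2)[OF ha[of a b]] by simp
qed

lemma has_weak_deriv_unique:
  assumes "has_weak_deriv k f g" "has_weak_deriv k f g'"
  shows "AE x in lebesgue. g x = g' x"
proof -
  have l: "loc_integrable g" "loc_integrable g'" using assms by (auto simp: has_weak_deriv_def)
  have "AE x in lebesgue. g x - g' x = 0"
  proof (rule test_functions_separate[OF loc_integrable_diff[OF l]])
    fix \<phi> :: "real \<Rightarrow> real" assume \<phi>: "\<phi> \<in> Cc_infinity"
    have "(-1) ^ k * (LINT x|lebesgue. g x * \<phi> x) = (-1) ^ k * (LINT x|lebesgue. g' x * \<phi> x)"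
      using assms \<phi> by (simp add: has_weak_deriv_def)
    then have "(LINT x|lebesgue. g x * \<phi> x) = (LINT x|lebesgue. g' x * \<phi> x)" by simp
    moreover have "(LINT x|lebesgue. (g x - g' x) * \<phi> x) = (LINT x|lebesgue. g x * \<phi> x) - (LINT x|lebesgue. g' x * \<phi> x)"
      using loc_integrable_mult_test[OF l(1) \<phi>] loc_integrable_mult_test[OF l(2) \<phi>]
      by (simp add: left_diff_distrib)
    ultimately show "(LINT x|lebesgue. (g x - g' x) * \<phi> x) = 0" by simp
  qed
  then show ?thesis by simp
qed

section \<open>Regularity from a locally integrable second weak derivative\<close>

definition ramp :: "real \<Rightarrow> real" where "ramp = prim smoothstep"

lemma ramp_deriv: "(ramp has_real_derivative smoothstep x) (at x)"
  unfolding ramp_def by (rule prim_deriv[OF Ck_imp_continuous[OF Ck_smoothstep]])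

lemma Ck_ramp: "Ck n ramp"
  unfolding ramp_def by (rule Ck_prim[OF Ck_smoothstep])

text \<open>Right of 1 the ramp differs from the identity by a constant only. Hence combinations of
  shifted ramps with zero total weight and zero first moment have compact support.\<close>

lemma ramp_eq: "x \<le> 0 \<Longrightarrow> ramp x = 0" "1 \<le> x \<Longrightarrow> ramp x = ramp 1 + (x - 1)"
proof -
  have i: "smoothstep integrable_on {a..b}" for a b
    by (intro integrable_continuous_real continuous_on_subset[OF Ck_imp_continuous[OF Ck_smoothstep]]) auto
  show "x \<le> 0 \<Longrightarrow> ramp x = 0"
  proof -
    assume x: "x \<le> 0"
    have "integral {x..0} smoothstep = integral {x..0} (\<lambda>_. 0)"
      by (intro integral_cong) auto
    then show ?thesis using prim_diff[OF i x] by (simp add: ramp_def prim_def)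
  qed
  show "1 \<le> x \<Longrightarrow> ramp x = ramp 1 + (x - 1)"
  proof -
    assume x: "1 \<le> x"
    have "integral {1..x} smoothstep = integral {1..x} (\<lambda>_. 1)"
      by (intro integral_cong) auto
    then show ?thesis using prim_diff[OF i x] x by (simp add: ramp_def)
  qed
qed

text \<open>An approximate identity concentrating at \<open>a\<close> from the right.\<close>

definition spike :: "real \<Rightarrow> real \<Rightarrow> real \<Rightarrow> real" where
  "spike n a x = n * (bump (n * (x - a)) / prim bump 1)"

lemma spike_deriv: "((\<lambda>x. smoothstep (n * (x - a))) has_real_derivative spike n a x) (at x)"
proof -
  have "((\<lambda>x. smoothstep (n * (x - a))) has_real_derivative bump (n * (x - a)) / prim bump 1 * n) (at x)"
    by (rule DERIV_chain2[OF smoothstep_deriv]) (auto intro!: derivative_eq_intros)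
  then show ?thesis by (simp add: spike_def mult.commute)
qed

lemma continuous_spike: "continuous_on A (spike n a)"
proof -
  have "continuous_on A (\<lambda>x. bump (n * (x - a)))"
    by (rule continuous_on_compose2[OF Ck_imp_continuous[OF Ck_bump]]) (auto intro!: continuous_intros)
  then show ?thesis unfolding spike_def using prim_bump(2) by (intro continuous_intros) auto
qed

lemma spike_nonneg: "n \<ge> 0 \<Longrightarrow> spike n a x \<ge> 0"
  using bump_nonneg prim_bump(2) by (simp add: spike_def less_imp_le)

lemma spike_eq_0: "n > 0 \<Longrightarrow> x \<notin> {a..a + 1 / n} \<Longrightarrow> spike n a x = 0"
proof -
  assume n: "n > 0" and x: "x \<notin> {a..a + 1 / n}"
  have "n * (x - a) \<le> 0 \<or> 1 \<le> n * (x - a)"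
    using n x by (auto simp: field_simps not_le mult_le_0_iff)
  then show ?thesis by (simp add: spike_def bump_eq_0)
qed

text \<open>A spike is the derivative of a step from 0 to 1, hence has mass one, and its support
  shrinks to \<open>a\<close>.\<close>

lemma spike_tendsto:
  assumes "continuous_on UNIV d"
  shows "(\<lambda>n. LINT x|lebesgue. d x * spike (real (Suc n)) a x) \<longlonglongrightarrow> d a"
proof (rule LIMSEQ_I)
  fix r :: real assume r: "r > 0"
  have "isCont d a" using assms by (simp add: continuous_on_eq_continuous_at)
  then obtain \<delta> where \<delta>: "\<delta> > 0" "\<And>y. \<bar>y - a\<bar> < \<delta> \<Longrightarrow> \<bar>d y - d a\<bar> < r / 2"
    using r unfolding continuous_at_eps_delta dist_real_def by (meson half_gt_zero)
  obtain N where N: "1 / \<delta> < real N" using reals_Archimedean2 by blast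
  have "norm ((LINT x|lebesgue. d x * spike (real (Suc n)) a x) - d a) < r" if "n \<ge> N" for n
  proof -
    define s where "s = spike (real (Suc n)) a"
    have s0: "s x = 0" if "x \<notin> {a..a+1}" for x
      unfolding s_def using that
    proof (intro spike_eq_0)
      have "1 / real (Suc n) \<le> 1" by simp
      then have "a + 1 / real (Suc n) \<le> a + 1" by linarith
      then show "x \<notin> {a..a + 1 / real (Suc n)}" using that unfolding atLeastAtMost_iff by linarith
    qed simp
    have nd: "1 / real (Suc n) < \<delta>"
    proof -
      have "1 / \<delta> < real (Suc n)" using N that by linarith
      then show ?thesis using \<delta>(1) by (simp add: field_simps)
    qed
    have si: "s integrable_on {a..a+1}" "(\<lambda>x. d x * s x) integrable_on {a..a+1}"
      "(\<lambda>x. d a * s x) integrable_on {a..a+1}"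
      unfolding s_def
      by (auto intro!: integrable_continuous_real continuous_intros continuous_spike continuous_on_subset[OF assms])
    have "(s has_integral (smoothstep (real (Suc n) * (a + 1 - a)) - smoothstep (real (Suc n) * (a - a)))) {a..a+1}"
      unfolding s_def
      by (intro fundamental_theorem_of_calculus)
         (auto simp flip: has_real_derivative_iff_has_vector_derivative intro: has_field_derivative_at_within spike_deriv)
    then have s1: "integral {a..a+1} s = 1" by (simp add: integral_unique)
    have "(LINT x|lebesgue. d x * s x) = (LINT x:{a..a+1}|lebesgue. d x * s x)"
      unfolding set_lebesgue_integral_def using s0
      by (intro Bochner_Integration.integral_cong) (auto simp: indicator_def)
    also have "\<dots> = integral {a..a+1} (\<lambda>x. d x * s x)"
      unfolding s_def
      by (intro set_lebesgue_integral_eq_integral(2) absolutely_integrable_continuous_real continuous_intros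
          continuous_spike continuous_on_subset[OF assms]) auto
    finally have "(LINT x|lebesgue. d x * s x) - d a = integral {a..a+1} (\<lambda>x. d x * s x) - integral {a..a+1} (\<lambda>x. d a * s x)"
      using s1 by simp
    also have "\<dots> = integral {a..a+1} (\<lambda>x. d x * s x - d a * s x)"
      using si by (simp add: Henstock_Kurzweil_Integration.integral_diff)
    finally have eq: "(LINT x|lebesgue. d x * s x) - d a = integral {a..a+1} (\<lambda>x. d x * s x - d a * s x)" .
    have "norm (integral {a..a+1} (\<lambda>x. d x * s x - d a * s x)) \<le> integral {a..a+1} (\<lambda>x. r / 2 * s x)"
    proof (rule integral_norm_bound_integral)
      fix x assume x: "x \<in> {a..a+1}"
      show "norm (d x * s x - d a * s x) \<le> r / 2 * s x"
      proof (cases "x \<le> a + 1 / real (Suc n)")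
        case True
        then have "\<bar>d x - d a\<bar> \<le> r / 2" using \<delta>(2)[of x] x nd by auto
        then show ?thesis
          using spike_nonneg[of "real (Suc n)" a x] mult_right_mono[of "\<bar>d x - d a\<bar>" "r / 2" "s x"]
          by (simp add: s_def abs_mult flip: left_diff_distrib del: of_nat_Suc)
      next
        case False
        then have "s x = 0" unfolding s_def by (intro spike_eq_0) (auto)
        then show ?thesis by simp
      qed
    qed (use si in \<open>auto intro!: integrable_diff integrable_on_mult_right\<close>)
    also have "\<dots> = r / 2" using s1 by simp
    finally show ?thesis using eq r by (simp add: s_def)
  qed
  then show "\<exists>no. \<forall>n\<ge>no. norm ((LINT x|lebesgue. d x * spike (real (Suc n)) a x) - d a) < r" by blast
qed

text \<open>Testing against second differences of mollified ramps shows that \<open>d\<close> is affine.\<close>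

lemma weak_second_deriv_zero_affine:
  assumes d: "continuous_on UNIV d"
    and z: "\<And>\<phi>. \<phi> \<in> Cc_infinity \<Longrightarrow> (LINT x|lebesgue. d x * deriv (deriv \<phi>) x) = 0"
  shows "\<exists>\<alpha> \<beta>. \<forall>x. d x = \<alpha> + \<beta> * x"
proof -
  \<comment> \<open>The weights of the second divided difference at \<open>a\<close>,
    \<open>m\<close>, \<open>b\<close>: their sum and their first moment are zero, so the same
    combination of ramps is a test function, while its second derivative converges to point
    evaluations with these weights.\<close>
  have three: "(b - m) * d a - (b - a) * d m + (m - a) * d b = 0" if ab: "a \<le> m" "m \<le> b" for a m b
  proof -
    define K where "K = (\<lambda>n c x. ramp (real (Suc n) * x + (- real (Suc n) * c)) / real (Suc n))"
    define \<phi> where "\<phi> = (\<lambda>n x. (b - m) * K n a x - (b - a) * K n m x + (m - a) * K n b x)"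
    define \<psi> where "\<psi> = (\<lambda>n x. (b - m) * smoothstep (real (Suc n) * (x - a)) - (b - a) * smoothstep (real (Suc n) * (x - m)) + (m - a) * smoothstep (real (Suc n) * (x - b)))"
    define \<omega> where "\<omega> = (\<lambda>n x. (b - m) * spike (real (Suc n)) a x - (b - a) * spike (real (Suc n)) m x + (m - a) * spike (real (Suc n)) b x)"
    have Kd: "(K n c has_real_derivative smoothstep (real (Suc n) * (x - c))) (at x)" for n c x
    proof -
      have "(K n c has_real_derivative smoothstep (real (Suc n) * x + (- real (Suc n) * c)) * real (Suc n) / real (Suc n)) (at x)"
        unfolding K_def
        by (intro DERIV_cdivide DERIV_chain2[OF ramp_deriv]) (auto intro!: derivative_eq_intros)
      moreover have "real (Suc n) * x + (- real (Suc n) * c) = real (Suc n) * (x - c)"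
        by (simp add: right_diff_distrib del: of_nat_Suc)
      ultimately show ?thesis by (simp del: of_nat_Suc)
    qed
    have \<phi>d: "(\<phi> n has_real_derivative \<psi> n x) (at x)" for n x
      unfolding \<phi>_def \<psi>_def by (auto intro!: derivative_eq_intros Kd)
    have \<psi>d: "(\<psi> n has_real_derivative \<omega> n x) (at x)" for n x
      unfolding \<psi>_def \<omega>_def by (auto intro!: derivative_eq_intros spike_deriv)
    have dd: "deriv (deriv (\<phi> n)) = \<omega> n" for n
    proof -
      have "deriv (\<phi> n) = \<psi> n" using DERIV_imp_deriv[OF \<phi>d] by auto
      then show ?thesis using DERIV_imp_deriv[OF \<psi>d] by auto
    qed
    have K0: "K n c x = 0" if "x \<le> c" for n c x
    proof -
      have "real (Suc n) * x + (- real (Suc n) * c) \<le> 0"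
        using that by (auto simp: mult_left_mono simp del: of_nat_Suc)
      then show ?thesis unfolding K_def by (simp add: ramp_eq(1) del: of_nat_Suc)
    qed
    have K1: "K n c x = (x - c) + (ramp 1 - 1) / real (Suc n)" if "c + 1 \<le> x" for n c x
    proof -
      have "1 * 1 \<le> real (Suc n) * (x - c)" using that by (intro mult_mono) auto
      then have 1: "1 \<le> real (Suc n) * x + (- real (Suc n) * c)"
        by (simp add: right_diff_distrib del: of_nat_Suc)
      have "(r + (N * x + (- N * c) - 1)) / N = (x - c) + (r - 1) / N" if "N > 0" for r N :: real
        using that by (simp add: field_simps)
      then show ?thesis unfolding K_def ramp_eq(2)[OF 1] by (simp del: of_nat_Suc)
    qed
    have \<phi>0: "\<phi> n x = 0" if "x \<notin> {a..b+1}" for n x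
    proof (cases "x < a")
      case True
      then show ?thesis using ab by (simp add: \<phi>_def K0)
    next
      case False
      then have "x > b + 1" using that by auto
      then show ?thesis using ab by (simp add: \<phi>_def K1 algebra_simps)
    qed
    have "Ck k (\<lambda>x. 1 / real (Suc n) * ramp (real (Suc n) * x + (- real (Suc n) * c)))" for k n c
      by (intro Ck_cmult Ck_compose_affine Ck_ramp)
    then have CK: "Ck k (K n c)" for k n c by (simp add: K_def)
    have Cc: "\<phi> n \<in> Cc_infinity" for n
      using \<phi>0 unfolding \<phi>_def
      by (intro Cc_infinityI[of _ "{a..b+1}"] Ck_diff Ck_add Ck_cmult CK) (auto simp: \<phi>_def)
    have i: "integrable lebesgue (\<lambda>x. d x * spike (real (Suc n)) c x)" for n c
    proof (rule loc_integrable_mult_integrable[OF loc_integrable_continuous[OF d] continuous_spike])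
      fix x assume "spike (real (Suc n)) c x \<noteq> 0"
      then have "x \<in> {c..c + 1 / real (Suc n)}"
        using spike_eq_0[of "real (Suc n)" x c] by (metis of_nat_0_less_iff zero_less_Suc)
      moreover have "1 / real (Suc n) \<le> 1" by simp
      ultimately show "\<bar>x\<bar> \<le> \<bar>c\<bar> + 1" unfolding atLeastAtMost_iff by linarith
    qed
    have "(LINT x|lebesgue. d x * \<omega> n x) = (b - m) * (LINT x|lebesgue. d x * spike (real (Suc n)) a x)
        - (b - a) * (LINT x|lebesgue. d x * spike (real (Suc n)) m x)
        + (m - a) * (LINT x|lebesgue. d x * spike (real (Suc n)) b x)" for n
    proof -
      have "(LINT x|lebesgue. d x * \<omega> n x) = (LINT x|lebesgue. (b - m) * (d x * spike (real (Suc n)) a x)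
        - (b - a) * (d x * spike (real (Suc n)) m x) + (m - a) * (d x * spike (real (Suc n)) b x))"
        unfolding \<omega>_def by (intro Bochner_Integration.integral_cong) (auto simp: algebra_simps)
      then show ?thesis using i by simp
    qed
    moreover have "(\<lambda>n. (b - m) * (LINT x|lebesgue. d x * spike (real (Suc n)) a x)
        - (b - a) * (LINT x|lebesgue. d x * spike (real (Suc n)) m x)
        + (m - a) * (LINT x|lebesgue. d x * spike (real (Suc n)) b x)) \<longlonglongrightarrow>
        (b - m) * d a - (b - a) * d m + (m - a) * d b"
      by (intro tendsto_intros spike_tendsto d)
    ultimately have "(\<lambda>n. LINT x|lebesgue. d x * \<omega> n x) \<longlonglongrightarrow> (b - m) * d a - (b - a) * d m + (m - a) * d b"
      by simp
    then show ?thesis using z[OF Cc] by (simp add: dd LIMSEQ_const_iff)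
  qed
  have "d x = d 0 + (d 1 - d 0) * x" for x
  proof -
    consider "x < 0" | "0 \<le> x" "x \<le> 1" | "1 < x" by linarith
    then show ?thesis
    proof cases
      case 1 then show ?thesis using three[of x 0 1] by (simp add: algebra_simps)
    next
      case 2 then show ?thesis using three[of 0 x 1] by (simp add: algebra_simps)
    next
      case 3 then show ?thesis using three[of 0 1 x] by (simp add: algebra_simps)
    qed
  qed
  then show ?thesis by blast
qed

text \<open>Subtracting a second primitive of \<open>g\<close> leaves a continuous function with
  zero second weak derivative, which is affine. Thus \<open>f\<close> inherits the regularity of
  that primitive.\<close>

lemma weak_second_deriv_regularity:
  assumes f: "continuous_on UNIV f" and g: "loc_integrable g"
    and w: "\<And>\<phi>. \<phi> \<in> Cc_infinity \<Longrightarrow> (LINT x|lebesgue. f x * deriv (deriv \<phi>) x) = (LINT x|lebesgue. g x * \<phi> x)"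
  shows "\<exists>f1. (\<forall>x. (f has_real_derivative f1 x) (at x)) \<and> AC_deriv f1 g"
proof -
  define k where "k = prim g"
  have k: "AC_deriv k g" unfolding k_def by (rule prim_AC[OF loc_integrable_interval[OF g]])
  have ck: "continuous_on UNIV k" by (rule AC_deriv_continuous[OF k])
  define K where "K = prim k"
  have K: "(K has_real_derivative k x) (at x)" for x
    unfolding K_def by (rule prim_deriv[OF ck])
  have K': "AC_deriv K k" by (rule AC_derivI_C1[OF K ck])
  have cK: "continuous_on UNIV K" by (rule AC_deriv_continuous[OF K'])
  have "\<exists>\<alpha> \<beta>. \<forall>x. f x - K x = \<alpha> + \<beta> * x"
  proof (rule weak_second_deriv_zero_affine)
    show "continuous_on UNIV (\<lambda>x. f x - K x)" by (intro continuous_intros f cK)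
    fix \<phi> :: "real \<Rightarrow> real" assume \<phi>: "\<phi> \<in> Cc_infinity"
    have d: "deriv \<phi> \<in> Cc_infinity" "deriv (deriv \<phi>) \<in> Cc_infinity"
      by (intro Cc_infinity_deriv \<phi>)+
    have "(LINT x|lebesgue. K x * deriv (deriv \<phi>) x) = (LINT x|lebesgue. g x * \<phi> x)"
      using AC_deriv_test[OF K' d(1)] AC_deriv_test[OF k \<phi>] by simp
    then show "(LINT x|lebesgue. (f x - K x) * deriv (deriv \<phi>) x) = 0"
      using w[OF \<phi>] loc_integrable_mult_test[OF loc_integrable_continuous[OF f] d(2)]
        loc_integrable_mult_test[OF loc_integrable_continuous[OF cK] d(2)]
      by (simp add: left_diff_distrib)
  qed
  then obtain \<alpha> \<beta> where ab: "\<And>x. f x = K x + (\<alpha> + \<beta> * x)"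
    by (metis add.commute diff_add_cancel)
  have "((\<lambda>x. K x + (\<alpha> + \<beta> * x)) has_real_derivative k x + \<beta>) (at x)" for x
    by (auto intro!: derivative_eq_intros K)
  moreover have "(\<lambda>x. K x + (\<alpha> + \<beta> * x)) = f" using ab by auto
  moreover have "AC_deriv (\<lambda>x. k x + \<beta>) g" using k by (simp add: AC_deriv_def)
  ultimately show ?thesis by (intro exI[of _ "\<lambda>x. k x + \<beta>"]) auto
qed

section \<open>Square integrable functions and Sobolev spaces\<close>

lemma L2_D: "f \<in> L2 \<Longrightarrow> f \<in> borel_measurable lebesgue" "f \<in> L2 \<Longrightarrow> integrable lebesgue (\<lambda>x. (f x)\<^sup>2)"
  by (auto simp: L2_def)

lemma L2_prod_integrable:
  assumes "f \<in> L2" "g \<in> L2" shows "integrable lebesgue (\<lambda>x. f x * g x)"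
proof (rule Bochner_Integration.integrable_bound[of _ "\<lambda>x. (f x)\<^sup>2 + (g x)\<^sup>2"])
  show "AE x in lebesgue. norm (f x * g x) \<le> norm ((f x)\<^sup>2 + (g x)\<^sup>2)"
  proof (rule AE_I2)
    fix x
    have "2 * \<bar>f x * g x\<bar> \<le> (f x)\<^sup>2 + (g x)\<^sup>2"
      using sum_squares_bound[of "\<bar>f x\<bar>" "\<bar>g x\<bar>"] by (simp add: abs_mult)
    then show "norm (f x * g x) \<le> norm ((f x)\<^sup>2 + (g x)\<^sup>2)" by simp
  qed
qed (use assms L2_D in auto)

lemma L2_add: assumes "f \<in> L2" "g \<in> L2" shows "(\<lambda>x. f x + g x) \<in> L2"
proof -
  have "integrable lebesgue (\<lambda>x. (f x)\<^sup>2 + (g x)\<^sup>2 + 2 * (f x * g x))"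
    using assms L2_D L2_prod_integrable by (intro Bochner_Integration.integrable_add integrable_mult_right) auto
  moreover have "(\<lambda>x. f x + g x) \<in> borel_measurable lebesgue"
    using assms L2_D by (intro borel_measurable_add)
  ultimately show ?thesis by (simp add: L2_def power2_sum mult.assoc)
qed

lemma L2_cmult: "f \<in> L2 \<Longrightarrow> (\<lambda>x. c * f x) \<in> L2"
  by (auto simp: L2_def power_mult_distrib)

lemma L2_diff: "f \<in> L2 \<Longrightarrow> g \<in> L2 \<Longrightarrow> (\<lambda>x. f x - g x) \<in> L2"
  using L2_add[OF _ L2_cmult[of g "-1"], of f] by simp

lemma L2_mult_bounded:
  assumes "f \<in> L2" "h \<in> borel_measurable lebesgue" "\<And>x. \<bar>h x\<bar> \<le> C"
  shows "(\<lambda>x. h x * f x) \<in> L2"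
proof -
  have "integrable lebesgue (\<lambda>x. (h x)\<^sup>2 * (f x)\<^sup>2)"
    using assms L2_D abs_le_square_iff[of "h _" C] order_trans[OF abs_ge_zero assms(3)]
    by (intro integrable_lebesgue_mult_bounded[of _ _ "C\<^sup>2"]) (auto simp: abs_le_square_iff)
  moreover have "(\<lambda>x. h x * f x) \<in> borel_measurable lebesgue"
    using assms L2_D by (intro borel_measurable_times)
  ultimately show ?thesis by (simp add: L2_def power_mult_distrib)
qed

lemma L2_cong_AE:
  assumes "f \<in> L2" "AE x in lebesgue. f x = g x" "g \<in> borel_measurable lebesgue"
  shows "g \<in> L2"
proof -
  have "integrable lebesgue (\<lambda>x. (g x)\<^sup>2)"
    by (rule integrable_cong_AE_imp[OF L2_D(2)[OF assms(1)]]) (use assms in auto)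
  then show ?thesis using assms by (simp add: L2_def)
qed

lemma L2_Cauchy_Schwarz:
  assumes "f \<in> L2" "g \<in> L2"
  shows "(LINT x|lebesgue. f x * g x)\<^sup>2 \<le> (LINT x|lebesgue. (f x)\<^sup>2) * (LINT x|lebesgue. (g x)\<^sup>2)"
proof -
  define A B C where "A = (LINT x|lebesgue. (f x)\<^sup>2)" and "B = (LINT x|lebesgue. f x * g x)"
    and "C = (LINT x|lebesgue. (g x)\<^sup>2)"
  have q: "0 \<le> A + 2 * c * B + c\<^sup>2 * C" for c
  proof -
    have "0 \<le> (LINT x|lebesgue. (f x + c * g x)\<^sup>2)" by simp
    also have "\<dots> = (LINT x|lebesgue. (f x)\<^sup>2 + 2 * c * (f x * g x) + c\<^sup>2 * (g x)\<^sup>2)"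
      by (intro Bochner_Integration.integral_cong) (auto simp: power2_eq_square algebra_simps)
    also have "\<dots> = A + 2 * c * B + c\<^sup>2 * C"
      using assms by (simp add: A_def B_def C_def L2_D L2_prod_integrable)
    finally show ?thesis .
  qed
  have C0: "C \<ge> 0" by (simp add: C_def)
  show ?thesis
  proof (cases "C = 0")
    case True
    have "B = 0"
    proof (rule ccontr)
      assume "B \<noteq> 0"
      \<comment> \<open>At this value of \<open>c\<close> the quadratic form degenerates to
        \<open>A + 2 * c * B = - 1\<close>.\<close>
      then show False using q[of "- (A + 1) / (2 * B)"] True by (simp add: field_simps)
    qed
    then show ?thesis using True by (simp add: A_def B_def C_def)
  next
    case False
    have "0 \<le> A - B\<^sup>2 / C" using q[of "- B / C"] False by (simp add: power2_eq_square field_simps)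
    then have "B\<^sup>2 \<le> A * C" using False C0 by (simp add: field_simps)
    then show ?thesis by (simp add: A_def B_def C_def)
  qed
qed

text \<open>Membership in \<open>L2\<close> is part of the notion because the integral of a
  non-integrable function is 0 by convention; without it the convergence of the integrals could hold
  vacuously.\<close>

definition L2_tendsto :: "('b \<Rightarrow> real \<Rightarrow> real) \<Rightarrow> (real \<Rightarrow> real) \<Rightarrow> 'b filter \<Rightarrow> bool" where
  "L2_tendsto fs f F \<longleftrightarrow> f \<in> L2 \<and> (\<forall>\<^sub>F s in F. fs s \<in> L2) \<and>
     ((\<lambda>s. LINT x|lebesgue. (fs s x - f x)\<^sup>2) \<longlongrightarrow> 0) F"

lemma L2_tendsto_const: "f \<in> L2 \<Longrightarrow> L2_tendsto (\<lambda>s. f) f F"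
  by (simp add: L2_tendsto_def)

text \<open>Uniformly convergent bounded factors preserve strong convergence, by the splitting
  \<open>hs fs - h f = hs (fs - f) + (hs - h) f\<close>.\<close>

lemma L2_tendsto_mult:
  assumes f: "L2_tendsto fs f F"
    and h: "\<And>x. \<bar>h x\<bar> \<le> C" "h \<in> borel_measurable lebesgue"
    and e: "(e \<longlongrightarrow> 0) F"
    and hs: "\<forall>\<^sub>F s in F. (\<forall>x. \<bar>hs s x - h x\<bar> \<le> e s) \<and> hs s \<in> borel_measurable lebesgue"
  shows "L2_tendsto (\<lambda>s x. hs s x * fs s x) (\<lambda>x. h x * f x) F"
  unfolding L2_tendsto_def
proof (intro conjI)
  have fL: "f \<in> L2" and fsL: "\<forall>\<^sub>F s in F. fs s \<in> L2"
    and lim: "((\<lambda>s. LINT x|lebesgue. (fs s x - f x)\<^sup>2) \<longlongrightarrow> 0) F"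
    using f by (auto simp: L2_tendsto_def)
  show "(\<lambda>x. h x * f x) \<in> L2" by (rule L2_mult_bounded[OF fL h(2,1)])
  have e1: "\<forall>\<^sub>F s in F. e s < 1" using e by (rule order_tendstoD) simp
  have bd: "\<bar>hs s x\<bar> \<le> C + 1" if "\<forall>x. \<bar>hs s x - h x\<bar> \<le> e s" "e s < 1" for s x
    using that(1)[rule_format, of x] that(2) h(1)[of x] by linarith
  show "\<forall>\<^sub>F s in F. (\<lambda>x. hs s x * fs s x) \<in> L2"
    using fsL hs e1 by eventually_elim (use bd in \<open>auto intro!: L2_mult_bounded[of _ _ "C + 1"]\<close>)
  show "((\<lambda>s. LINT x|lebesgue. (hs s x * fs s x - h x * f x)\<^sup>2) \<longlongrightarrow> 0) F"
  proof (rule Lim_null_comparison)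
    show "((\<lambda>s. 2 * (C + 1)\<^sup>2 * (LINT x|lebesgue. (fs s x - f x)\<^sup>2) + 2 * (e s)\<^sup>2 * (LINT x|lebesgue. (f x)\<^sup>2)) \<longlongrightarrow> 0) F"
      using lim e by (auto intro!: tendsto_eq_intros)
    show "\<forall>\<^sub>F s in F. norm (LINT x|lebesgue. (hs s x * fs s x - h x * f x)\<^sup>2)
        \<le> 2 * (C + 1)\<^sup>2 * (LINT x|lebesgue. (fs s x - f x)\<^sup>2) + 2 * (e s)\<^sup>2 * (LINT x|lebesgue. (f x)\<^sup>2)"
      using fsL hs e1
    proof eventually_elim
      case (elim s)
      then have L: "(\<lambda>x. fs s x - f x) \<in> L2" using fL L2_diff by blast
      have L': "(\<lambda>x. hs s x * fs s x - h x * f x) \<in> L2"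
        using elim bd by (intro L2_diff L2_mult_bounded[OF fL h(2,1)] L2_mult_bounded[of _ _ "C + 1"]) auto
      have "(LINT x|lebesgue. (hs s x * fs s x - h x * f x)\<^sup>2)
          \<le> (LINT x|lebesgue. 2 * (C + 1)\<^sup>2 * (fs s x - f x)\<^sup>2 + 2 * (e s)\<^sup>2 * (f x)\<^sup>2)"
      proof (rule integral_mono)
        show "integrable lebesgue (\<lambda>x. 2 * (C + 1)\<^sup>2 * (fs s x - f x)\<^sup>2 + 2 * (e s)\<^sup>2 * (f x)\<^sup>2)"
          using L2_D(2)[OF L] L2_D(2)[OF fL] by auto
        fix x
        define a b where "a = hs s x * (fs s x - f x)" and "b = (hs s x - h x) * f x"
        have "a\<^sup>2 \<le> (C + 1)\<^sup>2 * (fs s x - f x)\<^sup>2"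
          unfolding a_def power_mult_distrib using bd[of s x] elim
          by (intro mult_right_mono) (auto simp flip: abs_le_square_iff)
        moreover have "b\<^sup>2 \<le> (e s)\<^sup>2 * (f x)\<^sup>2"
          unfolding b_def power_mult_distrib using elim order_trans[OF _ abs_ge_self]
          by (intro mult_right_mono) (auto simp flip: abs_le_square_iff)
        moreover have "(a + b)\<^sup>2 \<le> 2 * a\<^sup>2 + 2 * b\<^sup>2"
          using sum_squares_bound[of a b] by (simp add: power2_sum)
        moreover have "hs s x * fs s x - h x * f x = a + b" by (simp add: a_def b_def algebra_simps)
        ultimately show "(hs s x * fs s x - h x * f x)\<^sup>2 \<le> 2 * (C + 1)\<^sup>2 * (fs s x - f x)\<^sup>2 + 2 * (e s)\<^sup>2 * (f x)\<^sup>2"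
          by (simp only:)
      qed (use L2_D(2)[OF L'] in auto)
      then show ?case using L2_D(2)[OF L] L2_D(2)[OF fL] by simp
    qed
  qed
qed

lemma L2_tendsto_mult_const:
  assumes "L2_tendsto fs f F" "\<And>x. \<bar>h x\<bar> \<le> C" "h \<in> borel_measurable lebesgue"
  shows "L2_tendsto (\<lambda>s x. h x * fs s x) (\<lambda>x. h x * f x) F"
  by (rule L2_tendsto_mult[OF assms, of "\<lambda>_. 0"]) (use assms in auto)

lemma L2_tendsto_add:
  assumes "L2_tendsto fs f F" "L2_tendsto gs g F"
  shows "L2_tendsto (\<lambda>s x. fs s x + gs s x) (\<lambda>x. f x + g x) F"
  unfolding L2_tendsto_def
proof (intro conjI)
  have L: "f \<in> L2" "g \<in> L2" "\<forall>\<^sub>F s in F. fs s \<in> L2" "\<forall>\<^sub>F s in F. gs s \<in> L2"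
    and lim: "((\<lambda>s. LINT x|lebesgue. (fs s x - f x)\<^sup>2) \<longlongrightarrow> 0) F"
      "((\<lambda>s. LINT x|lebesgue. (gs s x - g x)\<^sup>2) \<longlongrightarrow> 0) F"
    using assms by (auto simp: L2_tendsto_def)
  show "(\<lambda>x. f x + g x) \<in> L2" using L by (intro L2_add)
  show "\<forall>\<^sub>F s in F. (\<lambda>x. fs s x + gs s x) \<in> L2"
    using L(3,4) by eventually_elim (rule L2_add)
  show "((\<lambda>s. LINT x|lebesgue. (fs s x + gs s x - (f x + g x))\<^sup>2) \<longlongrightarrow> 0) F"
  proof (rule Lim_null_comparison)
    show "((\<lambda>s. 2 * (LINT x|lebesgue. (fs s x - f x)\<^sup>2) + 2 * (LINT x|lebesgue. (gs s x - g x)\<^sup>2)) \<longlongrightarrow> 0) F"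
      using lim by (auto intro!: tendsto_eq_intros)
    show "\<forall>\<^sub>F s in F. norm (LINT x|lebesgue. (fs s x + gs s x - (f x + g x))\<^sup>2)
      \<le> 2 * (LINT x|lebesgue. (fs s x - f x)\<^sup>2) + 2 * (LINT x|lebesgue. (gs s x - g x)\<^sup>2)"
      using L(3,4)
    proof eventually_elim
      case (elim s)
      then have i: "integrable lebesgue (\<lambda>x. (fs s x - f x)\<^sup>2)" "integrable lebesgue (\<lambda>x. (gs s x - g x)\<^sup>2)"
        "integrable lebesgue (\<lambda>x. (fs s x + gs s x - (f x + g x))\<^sup>2)"
        using L by (auto intro!: L2_D(2) L2_diff L2_add)
      have "(LINT x|lebesgue. (fs s x + gs s x - (f x + g x))\<^sup>2)
         \<le> (LINT x|lebesgue. 2 * (fs s x - f x)\<^sup>2 + 2 * (gs s x - g x)\<^sup>2)"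
      proof (rule integral_mono[OF i(3)])
        fix x
        have "((fs s x - f x) + (gs s x - g x))\<^sup>2 \<le> 2 * (fs s x - f x)\<^sup>2 + 2 * (gs s x - g x)\<^sup>2"
          using sum_squares_bound[of "fs s x - f x" "gs s x - g x"] by (simp add: power2_sum)
        then show "(fs s x + gs s x - (f x + g x))\<^sup>2 \<le> 2 * (fs s x - f x)\<^sup>2 + 2 * (gs s x - g x)\<^sup>2"
          by (simp add: algebra_simps)
      qed (use i in auto)
      then show ?case using i by simp
    qed
  qed
qed

lemma L2_tendsto_cmult:
  assumes "L2_tendsto fs f F" shows "L2_tendsto (\<lambda>s x. c * fs s x) (\<lambda>x. c * f x) F"
  by (rule L2_tendsto_mult_const[OF assms, of "\<lambda>_. c" "\<bar>c\<bar>"]) auto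

lemma L2_tendsto_integral:
  assumes "L2_tendsto fs f F" "L2_tendsto gs g F"
  shows "((\<lambda>s. LINT x|lebesgue. fs s x * gs s x) \<longlongrightarrow> (LINT x|lebesgue. f x * g x)) F"
proof -
  have L: "f \<in> L2" "g \<in> L2" "\<forall>\<^sub>F s in F. fs s \<in> L2" "\<forall>\<^sub>F s in F. gs s \<in> L2"
    and lim: "((\<lambda>s. LINT x|lebesgue. (fs s x - f x)\<^sup>2) \<longlongrightarrow> 0) F"
      "((\<lambda>s. LINT x|lebesgue. (gs s x - g x)\<^sup>2) \<longlongrightarrow> 0) F"
    using assms by (auto simp: L2_tendsto_def)
  have "((\<lambda>s. (LINT x|lebesgue. fs s x * gs s x) - (LINT x|lebesgue. f x * g x)) \<longlongrightarrow> 0) F"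
  proof (rule Lim_null_comparison)
    let ?N = "\<lambda>f. LINT x|lebesgue. (f x)\<^sup>2"
    show "((\<lambda>s. sqrt (?N (\<lambda>x. fs s x - f x) * ?N (\<lambda>x. gs s x - g x)) + sqrt (?N (\<lambda>x. fs s x - f x) * ?N g)
       + sqrt (?N f * ?N (\<lambda>x. gs s x - g x))) \<longlongrightarrow> 0) F"
      using lim by (auto intro!: tendsto_eq_intros)
    show "\<forall>\<^sub>F s in F. norm ((LINT x|lebesgue. fs s x * gs s x) - (LINT x|lebesgue. f x * g x)) \<le>
       sqrt (?N (\<lambda>x. fs s x - f x) * ?N (\<lambda>x. gs s x - g x)) + sqrt (?N (\<lambda>x. fs s x - f x) * ?N g)
       + sqrt (?N f * ?N (\<lambda>x. gs s x - g x))"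
      using L(3,4)
    proof eventually_elim
      case (elim s)
      have CS: "\<bar>LINT x|lebesgue. a x * b x\<bar> \<le> sqrt (?N a * ?N b)" if "a \<in> L2" "b \<in> L2" for a b
        using L2_Cauchy_Schwarz[OF that] by (intro real_le_rsqrt) simp
      have d: "(\<lambda>x. fs s x - f x) \<in> L2" "(\<lambda>x. gs s x - g x) \<in> L2"
        using L elim by (auto intro: L2_diff)
      have "(LINT x|lebesgue. fs s x * gs s x) - (LINT x|lebesgue. f x * g x) =
        (LINT x|lebesgue. fs s x * gs s x - f x * g x)"
        using L elim by (simp add: L2_prod_integrable)
      also have "\<dots> = (LINT x|lebesgue. (fs s x - f x) * (gs s x - g x) + (fs s x - f x) * g x + f x * (gs s x - g x))"
        by (intro Bochner_Integration.integral_cong) (auto simp: algebra_simps)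
      also have "\<dots> = (LINT x|lebesgue. (fs s x - f x) * (gs s x - g x)) + (LINT x|lebesgue. (fs s x - f x) * g x)
          + (LINT x|lebesgue. f x * (gs s x - g x))"
        using L2_prod_integrable[OF d] L2_prod_integrable[OF d(1) L(2)] L2_prod_integrable[OF L(1) d(2)]
        by (simp only: Bochner_Integration.integral_add Bochner_Integration.integrable_add)
      finally show ?case
        using CS[OF d] CS[OF d(1) L(2)] CS[OF L(1) d(2)] unfolding real_norm_def by linarith
    qed
  qed
  then show ?thesis by (rule LIM_zero_cancel)
qed

lemma integral_interval_le_LINT:
  fixes f :: "real \<Rightarrow> real"
  assumes "integrable lebesgue f" "\<And>x. f x \<ge> 0"
  shows "integral {a..b} f \<le> (LINT x|lebesgue. f x)" "f integrable_on {a..b}"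
proof -
  have s: "set_integrable lebesgue {a..b} f"
    unfolding set_integrable_def by (intro integrable_mult_indicator[OF _ assms(1)]) auto
  show "f integrable_on {a..b}" using s by (rule set_lebesgue_integral_eq_integral(1))
  have "integral {a..b} f = (LINT x:{a..b}|lebesgue. f x)"
    using set_lebesgue_integral_eq_integral(2)[OF s] by simp
  also have "\<dots> \<le> (LINT x|lebesgue. f x)"
    unfolding set_lebesgue_integral_def
    using s assms by (intro integral_mono) (auto simp: set_integrable_def indicator_def)
  finally show "integral {a..b} f \<le> (LINT x|lebesgue. f x)" .
qed

text \<open>The one-dimensional Sobolev embedding. Integrating \<open>2 f f'\<close> from
  \<open>a\<close> to \<open>x\<close> bounds \<open>(f x)\<^sup>2\<close> by the total plus
  \<open>(f a)\<^sup>2\<close>; averaging over \<open>a\<close> in an interval of growing length to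
  the left of \<open>x\<close> removes the last term.\<close>

lemma L2_AC_sup_bound:
  assumes AC: "AC_deriv f f1" and L: "f \<in> L2" "f1 \<in> L2"
  shows "(f x)\<^sup>2 \<le> (LINT x|lebesgue. (f x)\<^sup>2) + (LINT x|lebesgue. (f1 x)\<^sup>2)"
proof -
  define T where "T = (LINT x|lebesgue. (f x)\<^sup>2) + (LINT x|lebesgue. (f1 x)\<^sup>2)"
  have i: "integrable lebesgue (\<lambda>x. (f x)\<^sup>2 + (f1 x)\<^sup>2)" using L L2_D by simp
  have sq: "AC_deriv (\<lambda>x. (f x)\<^sup>2) (\<lambda>x. 2 * f x * f1 x)"
    by (rule AC_deriv_chain[OF AC]) (auto intro!: derivative_eq_intros continuous_intros)
  have step: "(f x)\<^sup>2 \<le> T + (f a)\<^sup>2" if "a \<le> x" for a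
  proof -
    have "(f x)\<^sup>2 - (f a)\<^sup>2 = integral {a..x} (\<lambda>x. 2 * f x * f1 x)" using AC_derivD(3)[OF sq that] .
    also have "\<dots> \<le> integral {a..x} (\<lambda>x. (f x)\<^sup>2 + (f1 x)\<^sup>2)"
      using integral_interval_le_LINT(2)[OF i]
      by (intro integral_le AC_derivD[OF sq] sum_squares_bound) auto
    also have "\<dots> \<le> (LINT x|lebesgue. (f x)\<^sup>2 + (f1 x)\<^sup>2)"
      by (intro integral_interval_le_LINT i) auto
    also have "\<dots> = T" using L L2_D by (simp add: T_def)
    finally show ?thesis by simp
  qed
  have f2: "integral {x - real n..x} (\<lambda>a. (f a)\<^sup>2) \<le> (LINT x|lebesgue. (f x)\<^sup>2)"
    "(\<lambda>a. (f a)\<^sup>2) integrable_on {x - real n..x}" for n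
    using integral_interval_le_LINT[OF L2_D(2)[OF L(1)]] by auto
  have "(f x)\<^sup>2 \<le> T + (LINT x|lebesgue. (f x)\<^sup>2) * inverse (real (Suc n))" for n
  proof -
    have "integral {x - real (Suc n)..x} (\<lambda>a. (f x)\<^sup>2 - T) \<le> integral {x - real (Suc n)..x} (\<lambda>a. (f a)\<^sup>2)"
      by (intro integral_le f2) (use step in \<open>auto simp: algebra_simps\<close>)
    then have "real (Suc n) * ((f x)\<^sup>2 - T) \<le> (LINT x|lebesgue. (f x)\<^sup>2)"
      using f2(1)[of "Suc n"] by (simp del: of_nat_Suc)
    then have "(f x)\<^sup>2 - T \<le> (LINT x|lebesgue. (f x)\<^sup>2) / real (Suc n)"
      by (subst pos_le_divide_eq) (simp_all add: mult.commute)
    then show ?thesis by (simp add: divide_inverse algebra_simps del: of_nat_Suc)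
  qed
  moreover have "(\<lambda>n. T + (LINT x|lebesgue. (f x)\<^sup>2) * inverse (real (Suc n))) \<longlonglongrightarrow> T + 0"
    by (intro tendsto_intros tendsto_mult_right_zero LIMSEQ_inverse_real_of_nat)
  ultimately have "(f x)\<^sup>2 \<le> T + 0"
    by (intro LIMSEQ_le_const) auto
  then show ?thesis by (simp add: T_def)
qed

text \<open>The continuously differentiable representative of an \<open>H\<^sup>2\<close> class
  together with its derivatives, the second one being only an \<open>L\<^sup>2\<close> density. A
  function in \<open>H\<^sup>3\<close> is described by two overlapping triples.\<close>

definition H2_fun :: "(real \<Rightarrow> real) \<Rightarrow> (real \<Rightarrow> real) \<Rightarrow> (real \<Rightarrow> real) \<Rightarrow> bool" where
  "H2_fun f f1 f2 \<longleftrightarrow> (\<forall>x. (f has_real_derivative f1 x) (at x)) \<and> AC_deriv f1 f2 \<and> f \<in> L2 \<and> f1 \<in> L2 \<and> f2 \<in> L2"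

lemma H2_funD:
  assumes "H2_fun f f1 f2"
  shows "(f has_real_derivative f1 x) (at x)" "AC_deriv f1 f2" "f \<in> L2" "f1 \<in> L2" "f2 \<in> L2"
    "AC_deriv f f1" "continuous_on A f" "continuous_on A f1"
proof -
  show d: "(f has_real_derivative f1 x) (at x)" for x using assms by (simp add: H2_fun_def)
  show "AC_deriv f1 f2" "f \<in> L2" "f1 \<in> L2" "f2 \<in> L2" using assms by (auto simp: H2_fun_def)
  then show "continuous_on A f1" for A by (intro AC_deriv_continuous)
  then show "AC_deriv f f1" by (intro AC_derivI_C1 d)
  then show "continuous_on A f" by (rule AC_deriv_continuous)
qed

lemma H2_fun_deriv: "H2_fun f f1 f2 \<Longrightarrow> deriv f = f1"
  using DERIV_imp_deriv[OF H2_funD(1)] by auto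

lemma H2_fun_cmult:
  assumes "H2_fun f f1 f2"
  shows "H2_fun (\<lambda>x. c * f x) (\<lambda>x. c * f1 x) (\<lambda>x. c * f2 x)"
  using assms by (auto simp: H2_fun_def intro!: DERIV_cmult AC_deriv_cmult L2_cmult)

lemma H2_fun_diff:
  assumes "H2_fun f f1 f2" "H2_fun g g1 g2"
  shows "H2_fun (\<lambda>x. f x - g x) (\<lambda>x. f1 x - g1 x) (\<lambda>x. f2 x - g2 x)"
  using assms by (auto simp: H2_fun_def intro!: DERIV_diff AC_deriv_diff L2_diff)

lemma H2_fun_weak_deriv:
  assumes "H2_fun f f1 f2"
  shows "has_weak_deriv 0 f f" "has_weak_deriv 1 f f1" "has_weak_deriv 2 f f2"
proof -
  note D = H2_funD[OF assms]
  have l: "loc_integrable f" "loc_integrable f1" "loc_integrable f2"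
    using loc_integrable_AC D by auto
  show "has_weak_deriv 0 f f" "has_weak_deriv 1 f f1"
    using l AC_deriv_test[OF D(6)] by (auto simp: has_weak_deriv_def)
  show "has_weak_deriv 2 f f2"
    using l AC_deriv_test[OF D(6) Cc_infinity_deriv] AC_deriv_test[OF D(2)]
    by (auto simp: has_weak_deriv_def numeral_2_eq_2)
qed

lemma H2_fun_weak_deriv_3:
  assumes "H2_fun f f1 f2" "H2_fun f1 f2 f3"
  shows "has_weak_deriv 3 f f3"
proof -
  have "has_weak_deriv 2 f1 f3" by (rule H2_fun_weak_deriv(3)[OF assms(2)])
  then show ?thesis
    using AC_deriv_test[OF H2_funD(6)[OF assms(1)] Cc_infinity_deriv[OF Cc_infinity_deriv]] H2_fun_weak_deriv(1)[OF assms(1)]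
    by (auto simp: has_weak_deriv_def numeral_2_eq_2 numeral_3_eq_3)
qed

text \<open>The second weak derivative alone makes the continuous function classically
  differentiable; uniqueness of weak derivatives then transfers square integrability from the
  abstract representatives to \<open>f\<close> and \<open>f1\<close>.\<close>

lemma sobolev_H_H2_fun:
  assumes "f \<in> sobolev_H k" "2 \<le> k" "continuous_on UNIV f"
  shows "\<exists>f1 f2. H2_fun f f1 f2"
proof -
  obtain g0 g1 g2 where g: "g0 \<in> L2" "has_weak_deriv 0 f g0" "g1 \<in> L2" "has_weak_deriv 1 f g1" "g2 \<in> L2" "has_weak_deriv 2 f g2"
  proof -
    have S: "\<exists>g\<in>L2. has_weak_deriv j f g" if "j \<le> k" for j
      using assms(1) that by (simp add: sobolev_H_def)
    show thesis using S[of 0] S[of 1] S[of 2] assms(2) that by auto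
  qed
  have w: "\<And>\<phi>. \<phi> \<in> Cc_infinity \<Longrightarrow> (LINT x|lebesgue. f x * deriv (deriv \<phi>) x) = (LINT x|lebesgue. g2 x * \<phi> x)"
    using g(6) by (simp add: has_weak_deriv_def numeral_2_eq_2)
  obtain f1 where f1: "\<And>x. (f has_real_derivative f1 x) (at x)" "AC_deriv f1 g2"
    using weak_second_deriv_regularity[OF assms(3) _ w] g(6) by (auto simp: has_weak_deriv_def)
  have c1: "continuous_on UNIV f1" by (rule AC_deriv_continuous[OF f1(2)])
  have AC: "AC_deriv f f1" by (rule AC_derivI_C1[OF f1(1) c1])
  have l: "loc_integrable f" "loc_integrable f1" by (rule loc_integrable_AC[OF AC])+
  have "has_weak_deriv 0 f f" "has_weak_deriv 1 f f1"
    using l AC_deriv_test[OF AC] by (auto simp: has_weak_deriv_def)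
  from has_weak_deriv_unique[OF g(2) this(1)] has_weak_deriv_unique[OF g(4) this(2)]
  have "f \<in> L2" "f1 \<in> L2"
    using L2_cong_AE[OF g(1)] L2_cong_AE[OF g(3)] loc_integrable_measurable l by auto
  then show ?thesis using f1 g(5) by (auto simp: H2_fun_def)
qed

lemma sobolev_H3_H2_fun:
  assumes "f \<in> sobolev_H 3" "continuous_on UNIV f"
  shows "\<exists>f1 f2 f3. H2_fun f f1 f2 \<and> H2_fun f1 f2 f3"
proof -
  obtain f1 g2 where f1: "H2_fun f f1 g2" using sobolev_H_H2_fun[OF assms(1) _ assms(2)] by auto
  note D = H2_funD[OF f1]
  obtain g3 where g3: "g3 \<in> L2" "has_weak_deriv 3 f g3" using assms(1) unfolding sobolev_H_def by blast
  \<comment> \<open>Moving one derivative onto the test function shows that the third weak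
    derivative of \<open>f\<close> is the second weak derivative of \<open>f1\<close>, so the
    regularity result applies once more.\<close>
  have w: "(LINT x|lebesgue. f1 x * deriv (deriv \<phi>) x) = (LINT x|lebesgue. g3 x * \<phi> x)" if "\<phi> \<in> Cc_infinity" for \<phi>
    using AC_deriv_test[OF D(6) Cc_infinity_deriv[OF Cc_infinity_deriv[OF that]]] g3(2) that
    by (auto simp: has_weak_deriv_def numeral_3_eq_3)
  obtain f2 where f2: "\<And>x. (f1 has_real_derivative f2 x) (at x)" "AC_deriv f2 g3"
    using weak_second_deriv_regularity[OF D(8) _ w] g3 by (auto simp: has_weak_deriv_def)
  have AC: "AC_deriv f1 f2" by (rule AC_derivI_C1[OF f2(1) AC_deriv_continuous[OF f2(2)]])
  have "f2 \<in> L2"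
    using L2_cong_AE[OF D(5) AC_deriv_unique[OF D(2) AC]] loc_integrable_measurable loc_integrable_AC(2)[OF AC] by auto
  then have "H2_fun f f1 f2" "H2_fun f1 f2 g3" using D AC f2 g3 by (auto simp: H2_fun_def)
  then show ?thesis by blast
qed

lemma weak_deriv_norm:
  assumes "has_weak_deriv k f g"
  shows "(LINT x|lebesgue. (weak_deriv k f x)\<^sup>2) = (LINT x|lebesgue. (g x)\<^sup>2)"
proof -
  have w: "has_weak_deriv k f (weak_deriv k f)"
    unfolding weak_deriv_def by (rule someI[of "has_weak_deriv k f", OF assms])
  have "AE x in lebesgue. weak_deriv k f x = g x" by (rule has_weak_deriv_unique[OF w assms])
  then show ?thesis
    using w assms
    by (intro integral_cong_AE borel_measurable_power loc_integrable_measurable)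
       (auto simp: has_weak_deriv_def)
qed

lemma sobolev_norm_2:
  assumes "H2_fun f f1 f2"
  shows "(sobolev_norm 2 f)\<^sup>2 = (LINT x|lebesgue. (f x)\<^sup>2) + (LINT x|lebesgue. (f1 x)\<^sup>2) + (LINT x|lebesgue. (f2 x)\<^sup>2)"
  using H2_fun_weak_deriv[OF assms, THEN weak_deriv_norm]
  by (simp add: sobolev_norm_def numeral_2_eq_2)

lemma sobolev_norm_3:
  assumes "H2_fun f f1 f2" "H2_fun f1 f2 f3"
  shows "(sobolev_norm 3 f)\<^sup>2 = (LINT x|lebesgue. (f x)\<^sup>2) + (LINT x|lebesgue. (f1 x)\<^sup>2)
     + (LINT x|lebesgue. (f2 x)\<^sup>2) + (LINT x|lebesgue. (f3 x)\<^sup>2)"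
  using H2_fun_weak_deriv[OF assms(1), THEN weak_deriv_norm] weak_deriv_norm[OF H2_fun_weak_deriv_3[OF assms]]
  by (simp add: sobolev_norm_def numeral_3_eq_3 numeral_2_eq_2)

section \<open>Convolution with the kernel of the inverse Helmholtz operator\<close>

lemma AC_deriv_has_derivative:
  assumes "AC_deriv f g" "continuous_on UNIV g"
  shows "(f has_real_derivative g x) (at x)"
proof -
  have i: "g integrable_on {a..b}" for a b by (rule AC_derivD(2)[OF assms(1)])
  define c where "c = f 0 - prim g 0"
  have "f y = prim g y + c" for y
    unfolding c_def using prim_diff[OF i, of 0 y] prim_diff[OF i, of y 0] AC_derivD(3)[OF assms(1), of 0 y] AC_derivD(3)[OF assms(1), of y 0]
    by (cases "0 \<le> y") auto
  then have eq: "f = (\<lambda>y. prim g y + c)" by (rule ext)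
  show ?thesis
    unfolding eq by (auto intro!: derivative_eq_intros prim_deriv[OF assms(2)])
qed

lemma integrable_if_intervals_bounded:
  fixes f :: "real \<Rightarrow> real"
  assumes c: "continuous_on UNIV f" and nn: "\<And>x. f x \<ge> 0"
    and b: "\<And>n::nat. integral {-real n..real n} f \<le> C"
  shows "integrable lebesgue f" "(LINT x|lebesgue. f x) \<le> C"
proof -
  define F where "F = (\<lambda>(n::nat) x. if x \<in> {-real n..real n} then f x else 0)"
  have i: "f integrable_on {a..b}" for a b
    using c by (intro integrable_continuous_real) (auto intro: continuous_on_subset)
  have eq: "integral UNIV (F k) = integral {-real k..real k} f" for k
    unfolding F_def by (rule integral_restrict_UNIV)
  have lim: "f integrable_on UNIV \<and> (\<lambda>k. integral UNIV (F k)) \<longlonglongrightarrow> integral UNIV f"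
  proof (rule monotone_convergence_increasing)
    show "F k integrable_on UNIV" for k
      unfolding F_def integrable_restrict_UNIV by (rule i)
    show "F k x \<le> F (Suc k) x" for k x using nn by (auto simp: F_def)
    show "(\<lambda>k. F k x) \<longlonglongrightarrow> f x" for x
    proof (rule tendsto_eventually)
      obtain N where "\<bar>x\<bar> \<le> real N" using real_arch_simple by blast
      then show "\<forall>\<^sub>F n in sequentially. F n x = f x"
        by (force simp: eventually_sequentially F_def abs_le_iff intro!: exI[of _ N])
    qed
    have "\<bar>integral UNIV (F k)\<bar> \<le> C" for k
    proof -
      have "integral {-real k..real k} f \<ge> 0" by (intro integral_nonneg i nn)
      then show ?thesis using b[of k] by (simp add: eq)
    qed
    then show "bounded (range (\<lambda>k. integral UNIV (F k)))" by (auto simp: bounded_iff)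
  qed
  then have a: "f absolutely_integrable_on UNIV" using nn by (intro nonnegative_absolutely_integrable_1) auto
  then show "integrable lebesgue f" by (simp add: set_integrable_def)
  have "integral UNIV f \<le> C"
    by (rule LIMSEQ_le_const2[OF conjunct2[OF lim]]) (use b eq in auto)
  then show "(LINT x|lebesgue. f x) \<le> C"
    using set_lebesgue_integral_eq_integral(2)[OF a] by (simp add: set_lebesgue_integral_def)
qed

lemma continuous_G_kernel: "l > 0 \<Longrightarrow> continuous_on A (\<lambda>y. G_kernel l (x - y))"
  unfolding G_kernel_def by (intro continuous_intros) auto

lemma G_kernel_nonneg: "l > 0 \<Longrightarrow> G_kernel l x \<ge> 0"
  by (simp add: G_kernel_def)

lemma G_kernel_integral:
  assumes l: "l > 0"
  shows "integrable lebesgue (\<lambda>y. G_kernel l (x - y))" "(LINT y|lebesgue. G_kernel l (x - y)) \<le> 1"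
proof -
  have ii: "(\<lambda>y. G_kernel l (x - y)) integrable_on {a..b}" for a b
    by (intro integrable_continuous_real continuous_G_kernel l)
  have b: "integral {-real n..real n} (\<lambda>y. G_kernel l (x - y)) \<le> 1" for n :: nat
  proof -
    \<comment> \<open>Since \<open>N\<close> is at least \<open>\<bar>x\<bar>\<close>, the kink of
      the kernel lies in the interval and splits it into two pieces with elementary
      antiderivatives.\<close>
    define N where "N = max (real n) \<bar>x\<bar>"
    have N: "-N \<le> x" "x \<le> N" "real n \<le> N" by (auto simp: N_def)
    have "((\<lambda>y. G_kernel l (x - y)) has_integral (1/2 * exp (-(x - x)/l) - 1/2 * exp (-(x - (-N))/l))) {-N..x}"
    proof (rule fundamental_theorem_of_calculus[OF N(1)])
      fix y assume y: "y \<in> {-N..x}"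
      have "((\<lambda>y. 1/2 * exp (-(x - y)/l)) has_real_derivative G_kernel l (x - y)) (at y)"
        using l y by (auto intro!: derivative_eq_intros simp: G_kernel_def)
      then show "((\<lambda>y. 1/2 * exp (-(x - y)/l)) has_vector_derivative G_kernel l (x - y)) (at y within {-N..x})"
        by (simp flip: has_real_derivative_iff_has_vector_derivative add: has_field_derivative_at_within)
    qed
    moreover have "((\<lambda>y. G_kernel l (x - y)) has_integral (- 1/2 * exp ((x - N)/l) - (- 1/2 * exp ((x - x)/l)))) {x..N}"
    proof (rule fundamental_theorem_of_calculus[OF N(2)])
      fix y assume y: "y \<in> {x..N}"
      have "((\<lambda>y. - 1/2 * exp ((x - y)/l)) has_real_derivative G_kernel l (x - y)) (at y)"
        using l y by (auto intro!: derivative_eq_intros simp: G_kernel_def)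
      then show "((\<lambda>y. - 1/2 * exp ((x - y)/l)) has_vector_derivative G_kernel l (x - y)) (at y within {x..N})"
        by (simp flip: has_real_derivative_iff_has_vector_derivative add: has_field_derivative_at_within)
    qed
    ultimately have eq: "integral {-N..N} (\<lambda>y. G_kernel l (x - y)) = 1 + (- (exp ((- x - N) / l) / 2) - exp ((x - N) / l) / 2)"
      using Henstock_Kurzweil_Integration.integral_combine[OF N(1,2) ii] by (simp add: integral_unique)
    have "0 \<le> exp ((- x - N) / l) / 2" "0 \<le> exp ((x - N) / l) / 2" by simp_all
    with eq have "integral {-N..N} (\<lambda>y. G_kernel l (x - y)) \<le> 1" by linarith
    moreover have "integral {-real n..real n} (\<lambda>y. G_kernel l (x - y)) \<le> integral {-N..N} (\<lambda>y. G_kernel l (x - y))"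
      by (intro integral_subset_le ii) (use N G_kernel_nonneg[OF l] in auto)
    ultimately show ?thesis by linarith
  qed
  show "integrable lebesgue (\<lambda>y. G_kernel l (x - y))" "(LINT y|lebesgue. G_kernel l (x - y)) \<le> 1"
    using integrable_if_intervals_bounded[OF continuous_G_kernel[OF l] G_kernel_nonneg[OF l] b] by auto
qed

lemma convolution_integrand_integrable:
  assumes l: "l > 0" and iq: "integrable lebesgue q"
  shows "integrable lebesgue (\<lambda>y. G_kernel l (x - y) * q y)"
proof (rule integrable_lebesgue_mult_bounded[OF iq])
  show "(\<lambda>y. G_kernel l (x - y)) \<in> borel_measurable lebesgue"
    using continuous_G_kernel[OF l] by (auto intro!: measurable_completion borel_measurable_continuous_onI)
  show "\<bar>G_kernel l (x - y)\<bar> \<le> 1 / (2 * l)" for y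
    using l by (simp add: G_kernel_def abs_mult field_simps)
qed

lemma convolution_linear:
  assumes "l > 0" "integrable lebesgue q" "integrable lebesgue r"
  shows "convolution (G_kernel l) (\<lambda>x. a * q x + b * r x) x = a * convolution (G_kernel l) q x + b * convolution (G_kernel l) r x"
proof -
  have "convolution (G_kernel l) (\<lambda>x. a * q x + b * r x) x
     = (LINT y|lebesgue. a * (G_kernel l (x - y) * q y) + b * (G_kernel l (x - y) * r y))"
    unfolding convolution_def by (intro Bochner_Integration.integral_cong) (auto simp: algebra_simps)
  then show ?thesis
    using convolution_integrand_integrable[OF assms(1,2)] convolution_integrand_integrable[OF assms(1,3)]
    by (simp add: convolution_def)
qed

lemma convolution_mono:
  assumes "l > 0" "integrable lebesgue q" "integrable lebesgue r" "\<And>x. q x \<le> r x"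
  shows "convolution (G_kernel l) q x \<le> convolution (G_kernel l) r x"
  unfolding convolution_def
  by (intro integral_mono convolution_integrand_integrable assms mult_left_mono G_kernel_nonneg)

context
  fixes l :: real and q :: "real \<Rightarrow> real"
  assumes l: "l > 0" and cq: "continuous_on UNIV q" and iq: "integrable lebesgue q"
    and qnn: "\<And>x. q x \<ge> 0"
begin

text \<open>On either side of the kink the kernel factors into a function of \<open>x\<close> and a
  function of \<open>y\<close>. The convolution becomes a combination of two primitives,
  differentiable by the fundamental theorem.\<close>

definition kernel_left :: "real \<Rightarrow> real" where
  "kernel_left x = integral {..x} (\<lambda>y. exp (y / l) * q y)"

definition kernel_right :: "real \<Rightarrow> real" where
  "kernel_right x = integral {x..} (\<lambda>y. exp (- y / l) * q y)"

definition conv_deriv :: "real \<Rightarrow> real" where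
  "conv_deriv x = (exp (x / l) * kernel_right x - exp (- x / l) * kernel_left x) / (2 * l\<^sup>2)"

lemma kernel_integrable:
  "(\<lambda>y. exp (y / l) * q y) absolutely_integrable_on {..x}"
  "(\<lambda>y. exp (- y / l) * q y) absolutely_integrable_on {x..}"
proof -
  have m: "q \<in> borel_measurable lebesgue" using iq by auto
  have e: "continuous_on UNIV (\<lambda>y. exp (y / l))" "continuous_on UNIV (\<lambda>y. exp (- y / l))"
    by (intro continuous_intros; use l in simp)+
  have em: "(\<lambda>y. exp (y / l)) \<in> borel_measurable lebesgue" "(\<lambda>y. exp (- y / l)) \<in> borel_measurable lebesgue"
    using e by (auto intro!: measurable_completion borel_measurable_continuous_onI)
  have "integrable lebesgue (\<lambda>y. (indicator {..x} y * exp (y / l)) * q y)"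
  proof (rule integrable_lebesgue_mult_bounded[OF iq])
    show "(\<lambda>y. indicator {..x} y * exp (y / l)) \<in> borel_measurable lebesgue"
      by (intro borel_measurable_times borel_measurable_indicator em) auto
    show "\<bar>indicator {..x} y * exp (y / l)\<bar> \<le> exp (x / l)" for y
      using l by (auto simp: indicator_def divide_right_mono)
  qed
  then show "(\<lambda>y. exp (y / l) * q y) absolutely_integrable_on {..x}"
    by (simp add: set_integrable_def mult.assoc)
  have "integrable lebesgue (\<lambda>y. (indicator {x..} y * exp (- y / l)) * q y)"
  proof (rule integrable_lebesgue_mult_bounded[OF iq])
    show "(\<lambda>y. indicator {x..} y * exp (- y / l)) \<in> borel_measurable lebesgue"
      by (intro borel_measurable_times borel_measurable_indicator em) auto
    show "\<bar>indicator {x..} y * exp (- y / l)\<bar> \<le> exp (- x / l)" for y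
      using l by (auto simp: indicator_def divide_right_mono)
  qed
  then show "(\<lambda>y. exp (- y / l) * q y) absolutely_integrable_on {x..}"
    by (simp add: set_integrable_def mult.assoc)
qed

lemma kernel_integrable_on:
  "(\<lambda>y. exp (y / l) * q y) integrable_on {..x}"
  "(\<lambda>y. exp (- y / l) * q y) integrable_on {x..}"
  using kernel_integrable set_lebesgue_integral_eq_integral(1) by blast+

lemma kernel_nonneg: "kernel_left x \<ge> 0" "kernel_right x \<ge> 0"
  unfolding kernel_left_def kernel_right_def
  by (intro integral_nonneg kernel_integrable_on mult_nonneg_nonneg qnn; simp)+

lemma kernel_deriv:
  "(kernel_left has_real_derivative exp (x / l) * q x) (at x)"
  "(kernel_right has_real_derivative - (exp (- x / l) * q x)) (at x)"
proof -
  have c: "continuous_on A (\<lambda>y. exp (y / l) * q y)" "continuous_on A (\<lambda>y. exp (- y / l) * q y)" for A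
    using l by (auto intro!: continuous_intros continuous_on_subset[OF cq])
  have i: "(\<lambda>y. exp (y / l) * q y) integrable_on {a..b}" "(\<lambda>y. exp (- y / l) * q y) integrable_on {a..b}" for a b
    by (intro integrable_continuous_real c)+
  have "AC_deriv kernel_left (\<lambda>y. exp (y / l) * q y)"
    unfolding AC_deriv_def
  proof (intro conjI allI impI)
    show "(\<lambda>y. exp (y / l) * q y) absolutely_integrable_on {a..b}" for a b
      by (intro absolutely_integrable_continuous_real c)
    fix a b :: real assume ab: "a \<le> b"
    have "integral ({..a} \<union> {a..b}) (\<lambda>y. exp (y / l) * q y) = kernel_left a + integral {a..b} (\<lambda>y. exp (y / l) * q y)"
      unfolding kernel_left_def
      by (rule Henstock_Kurzweil_Integration.integral_Un[OF kernel_integrable_on(1) i(1)],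
          rule negligible_subset[of "{a}"]) auto
    moreover have "{..a} \<union> {a..b} = {..b}" using ab by auto
    ultimately show "kernel_left b - kernel_left a = integral {a..b} (\<lambda>y. exp (y / l) * q y)"
      by (simp add: kernel_left_def)
  qed
  then show "(kernel_left has_real_derivative exp (x / l) * q x) (at x)"
    by (rule AC_deriv_has_derivative) (rule c)
  have "AC_deriv (\<lambda>x. - kernel_right x) (\<lambda>y. exp (- y / l) * q y)"
    unfolding AC_deriv_def
  proof (intro conjI allI impI)
    show "(\<lambda>y. exp (- y / l) * q y) absolutely_integrable_on {a..b}" for a b
      by (intro absolutely_integrable_continuous_real c)
    fix a b :: real assume ab: "a \<le> b"
    have "integral ({a..b} \<union> {b..}) (\<lambda>y. exp (- y / l) * q y) = integral {a..b} (\<lambda>y. exp (- y / l) * q y) + kernel_right b"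
      unfolding kernel_right_def
      by (rule Henstock_Kurzweil_Integration.integral_Un[OF i(2) kernel_integrable_on(2)],
          rule negligible_subset[of "{b}"]) auto
    moreover have "{a..b} \<union> {b..} = {a..}" using ab by auto
    ultimately show "- kernel_right b - - kernel_right a = integral {a..b} (\<lambda>y. exp (- y / l) * q y)"
      by (simp add: kernel_right_def)
  qed
  then have "((\<lambda>x. - kernel_right x) has_real_derivative exp (- x / l) * q x) (at x)"
    by (rule AC_deriv_has_derivative) (rule c)
  from DERIV_minus[OF this] show "(kernel_right has_real_derivative - (exp (- x / l) * q x)) (at x)"
    by simp
qed

lemma convolution_eq:
  "convolution (G_kernel l) q x = (exp (- x / l) * kernel_left x + exp (x / l) * kernel_right x) / (2 * l)"
proof -
  let ?k = "\<lambda>y. G_kernel l (x - y) * q y"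
  have "integrable lebesgue ?k" by (rule convolution_integrand_integrable[OF l iq])
  then have ku: "?k absolutely_integrable_on UNIV" by (simp add: set_integrable_def)
  have ks: "?k integrable_on S" if "S \<in> sets lebesgue" for S
    using set_lebesgue_integral_eq_integral(1)[OF set_integrable_subset[OF ku that]] by simp
  have "convolution (G_kernel l) q x = integral UNIV ?k"
    using set_lebesgue_integral_eq_integral(2)[OF ku] by (simp add: convolution_def set_lebesgue_integral_def)
  also have "\<dots> = integral ({..x} \<union> {x..}) ?k" by (rule arg_cong2[where f = integral]) auto
  also have "\<dots> = integral {..x} ?k + integral {x..} ?k"
    by (rule Henstock_Kurzweil_Integration.integral_Un[OF ks ks], simp, simp,
        rule negligible_subset[of "{x}"]) auto
  also have "integral {..x} ?k = integral {..x} (\<lambda>y. (exp (- x / l) / (2 * l)) * (exp (y / l) * q y))"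
  proof (rule integral_cong)
    fix y assume "y \<in> {..x}"
    then have "- \<bar>x - y\<bar> / l = - x / l + y / l" by (simp add: diff_divide_distrib)
    then show "?k y = exp (- x / l) / (2 * l) * (exp (y / l) * q y)"
      by (simp only: G_kernel_def exp_add) simp
  qed
  also have "\<dots> = (exp (- x / l) / (2 * l)) * kernel_left x"
    unfolding kernel_left_def by (rule Henstock_Kurzweil_Integration.integral_mult_right)
  also have "integral {x..} ?k = integral {x..} (\<lambda>y. (exp (x / l) / (2 * l)) * (exp (- y / l) * q y))"
  proof (rule integral_cong)
    fix y assume "y \<in> {x..}"
    then have "- \<bar>x - y\<bar> / l = x / l + - y / l" by (simp add: diff_divide_distrib)
    then show "?k y = exp (x / l) / (2 * l) * (exp (- y / l) * q y)"
      by (simp only: G_kernel_def exp_add) simp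
  qed
  also have "\<dots> = (exp (x / l) / (2 * l)) * kernel_right x"
    unfolding kernel_right_def by (rule Henstock_Kurzweil_Integration.integral_mult_right)
  finally show ?thesis by (simp add: add_divide_distrib)
qed

text \<open>The contributions of the moving endpoint \<open>y = x\<close> from the two halves
  cancel, so only the exponential prefactors are differentiated.\<close>

lemma convolution_deriv:
  "(convolution (G_kernel l) q has_real_derivative conv_deriv x) (at x)"
proof -
  have "((\<lambda>x. (exp (- x / l) * kernel_left x + exp (x / l) * kernel_right x) / (2 * l)) has_real_derivative conv_deriv x) (at x)"
    using l by (auto intro!: derivative_eq_intros kernel_deriv simp: conv_deriv_def power2_eq_square field_simps exp_minus)
  then show ?thesis by (simp add: convolution_eq[abs_def])
qed

text \<open>Here the endpoint contributions add up instead and produce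
  \<open>- q / l\<^sup>2\<close>: the kernel inverts the operator
  \<open>1 - l\<^sup>2 \<partial>\<^sub>x\<^sub>x\<close>.\<close>

lemma conv_deriv_deriv:
  "(conv_deriv has_real_derivative (convolution (G_kernel l) q x - q x) / l\<^sup>2) (at x)"
  unfolding conv_deriv_def[abs_def]
  using l by (auto intro!: derivative_eq_intros kernel_deriv simp: convolution_eq power2_eq_square field_simps exp_minus)

lemma convolution_nonneg: "convolution (G_kernel l) q x \<ge> 0"
  using kernel_nonneg[of x] l by (simp add: convolution_eq)

text \<open>For non-negative \<open>q\<close> both one-sided parts are non-negative; the derivative
  is their difference and the convolution their sum, up to the factor \<open>1 / l\<close>.\<close>

lemma conv_deriv_bound: "\<bar>conv_deriv x\<bar> \<le> convolution (G_kernel l) q x / l"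
proof -
  have "\<bar>exp (x / l) * kernel_right x - exp (- x / l) * kernel_left x\<bar> \<le> exp (x / l) * kernel_right x + exp (- x / l) * kernel_left x"
    using kernel_nonneg[of x] by (simp add: abs_le_iff)
  then have "\<bar>exp (x / l) * kernel_right x - exp (- x / l) * kernel_left x\<bar> / (2 * l\<^sup>2) \<le> (exp (x / l) * kernel_right x + exp (- x / l) * kernel_left x) / (2 * l\<^sup>2)"
    by (rule divide_right_mono) simp
  then show ?thesis using l by (simp add: conv_deriv_def convolution_eq abs_divide power2_eq_square add.commute)
qed

lemma convolution_le: "convolution (G_kernel l) q x \<le> (LINT x|lebesgue. q x) / (2 * l)"
proof -
  have m: "(\<lambda>y. G_kernel l (x - y)) \<in> borel_measurable lebesgue"
    unfolding G_kernel_def using l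
    by (auto intro!: measurable_completion borel_measurable_continuous_onI continuous_intros)
  have b: "\<bar>G_kernel l (x - y)\<bar> \<le> 1 / (2 * l)" for y
    using l by (simp add: G_kernel_def abs_mult field_simps)
  have "convolution (G_kernel l) q x \<le> (LINT y|lebesgue. 1 / (2 * l) * q y)"
    unfolding convolution_def
    by (intro integral_mono integrable_lebesgue_mult_bounded[OF iq m b] integrable_mult_right iq mult_right_mono qnn
        order_trans[OF abs_ge_self b])
  then show ?thesis by simp
qed

lemma continuous_convolution: "continuous_on A (convolution (G_kernel l) q)" "continuous_on A conv_deriv"
  using DERIV_continuous_on[OF has_field_derivative_at_within[OF convolution_deriv]]
    DERIV_continuous_on[OF has_field_derivative_at_within[OF conv_deriv_deriv]] by blast+

text \<open>Both integrability and conservation of mass come from the Helmholtz identity. Over a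
  bounded interval the masses of the convolution and of \<open>q\<close> differ by
  \<open>l\<^sup>2\<close> times a difference of values of the bounded function
  \<open>conv_deriv\<close>; over the whole line the integral of its derivative is zero.\<close>

lemma convolution_integrable: "integrable lebesgue (convolution (G_kernel l) q)"
  and conv_deriv_integrable: "integrable lebesgue conv_deriv"
  and convolution_integral: "(LINT x|lebesgue. convolution (G_kernel l) q x) = (LINT x|lebesgue. q x)"
proof -
  let ?p = "convolution (G_kernel l) q"
  define Q where "Q = (LINT x|lebesgue. q x)"
  have c2: "continuous_on UNIV (\<lambda>x. (?p x - q x) / l\<^sup>2)"
    using l by (intro continuous_intros continuous_convolution cq) auto
  have AC: "AC_deriv conv_deriv (\<lambda>x. (?p x - q x) / l\<^sup>2)"
    by (rule AC_derivI_C1[OF conv_deriv_deriv c2])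
  have qi: "q integrable_on {a..b}" "?p integrable_on {a..b}" for a b
    by (intro integrable_continuous_real continuous_on_subset[OF cq] continuous_convolution; simp)+
  have d: "\<bar>conv_deriv x\<bar> \<le> Q / (2 * l) / l" for x
    using conv_deriv_bound[of x] convolution_le[of x] l divide_right_mono[of "?p x" "Q / (2 * l)" l] by (simp add: Q_def)
  show pi: "integrable lebesgue ?p"
  proof (rule integrable_if_intervals_bounded[OF continuous_convolution(1) convolution_nonneg])
    fix n :: nat
    have "integral {-real n..real n} (\<lambda>x. (?p x - q x) / l\<^sup>2) = conv_deriv (real n) - conv_deriv (- real n)"
      using AC_derivD(3)[OF AC, of "-real n" "real n"] by simp
    moreover have "integral {-real n..real n} (\<lambda>x. (?p x - q x) / l\<^sup>2) = (integral {-real n..real n} ?p - integral {-real n..real n} q) / l\<^sup>2"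
      using qi by (simp add: Henstock_Kurzweil_Integration.integral_diff)
    ultimately have "integral {-real n..real n} ?p = integral {-real n..real n} q + l\<^sup>2 * (conv_deriv (real n) - conv_deriv (- real n))"
      using l by (simp add: field_simps)
    also have "\<dots> \<le> Q + l\<^sup>2 * (Q / (2 * l) / l + Q / (2 * l) / l)"
      using d[of "real n"] d[of "- real n"] integral_interval_le_LINT(1)[OF iq qnn]
      by (intro add_mono mult_left_mono) (auto simp: Q_def abs_le_iff)
    finally show "integral {-real n..real n} ?p \<le> Q + l\<^sup>2 * (Q / (2 * l) / l + Q / (2 * l) / l)" .
  qed
  show di: "integrable lebesgue conv_deriv"
  proof (rule Bochner_Integration.integrable_bound[of _ "\<lambda>x. ?p x / l"])
    show "conv_deriv \<in> borel_measurable lebesgue"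
      by (intro measurable_completion) (auto intro!: borel_measurable_continuous_onI continuous_convolution)
    show "AE x in lebesgue. norm (conv_deriv x) \<le> norm (?p x / l)"
      unfolding real_norm_def by (intro AE_I2 order_trans[OF conv_deriv_bound abs_ge_self])
  qed (use pi in auto)
  have "(LINT x|lebesgue. (?p x - q x) / l\<^sup>2) = 0"
    using pi iq by (intro AC_deriv_integral_zero[OF AC di]) auto
  then show "(LINT x|lebesgue. ?p x) = (LINT x|lebesgue. q x)" using pi iq l by simp
qed

end

section \<open>Conservation laws of the Camassa-Holm flow\<close>

lemma H2_fun_bounded:
  assumes "H2_fun f f1 f2"
  obtains C where "C > 0" "\<And>x. \<bar>f x\<bar> \<le> C" "\<And>x. \<bar>f1 x\<bar> \<le> C"
proof -
  note D = H2_funD[OF assms]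
  define A B where "A = sqrt ((LINT x|lebesgue. (f x)\<^sup>2) + (LINT x|lebesgue. (f1 x)\<^sup>2))"
    and "B = sqrt ((LINT x|lebesgue. (f1 x)\<^sup>2) + (LINT x|lebesgue. (f2 x)\<^sup>2))"
  have "\<bar>f x\<bar> \<le> A" "\<bar>f1 x\<bar> \<le> B" for x
    unfolding A_def B_def
    by (intro real_le_rsqrt; simp add: L2_AC_sup_bound[OF D(6,3,4)] L2_AC_sup_bound[OF D(2,4,5)])+
  then have b: "\<bar>f x\<bar> \<le> A" "\<bar>f1 x\<bar> \<le> B" for x by auto
  have nn: "A \<ge> 0" "B \<ge> 0" using b[of 0] by linarith+
  have "\<bar>f x\<bar> \<le> A + B + 1" "\<bar>f1 x\<bar> \<le> A + B + 1" for x using b[of x] nn by linarith+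
  then show thesis using nn by (intro that[of "A + B + 1"]) auto
qed

lemma continuous_lebesgue_measurable: "continuous_on UNIV f \<Longrightarrow> (f::real\<Rightarrow>real) \<in> borel_measurable lebesgue"
  by (auto intro!: measurable_completion borel_measurable_continuous_onI)

lemma integrable_bounded_continuous_mult:
  fixes f g :: "real \<Rightarrow> real"
  assumes "integrable lebesgue f" "continuous_on UNIV g" "\<And>x. \<bar>g x\<bar> \<le> C"
  shows "integrable lebesgue (\<lambda>x. g x * f x)"
  by (rule integrable_lebesgue_mult_bounded[OF assms(1) continuous_lebesgue_measurable[OF assms(2)] assms(3)])

abbreviation at0 :: "real \<Rightarrow> real filter" where "at0 t \<equiv> at t within {0..}"

lemma eventually_at0: "t \<ge> 0 \<Longrightarrow> \<forall>\<^sub>F s in at0 t. s \<ge> 0 \<and> s \<noteq> t"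
  by (auto simp: eventually_at_filter)

lemma tendsto_at0_diff: "((\<lambda>s. s - t) \<longlongrightarrow> 0) (at0 t)"
  by (auto intro!: tendsto_eq_intros)

text \<open>Here \<open>v\<close> is the time derivative of \<open>u\<close>, and the two nonlocal terms are merged into a single
  convolution with \<open>u\<^sup>2 + l\<^sup>2/2 u\<^sub>x\<^sup>2\<close>.\<close>

locale CH_flow =
  fixes l :: real and u u1 u2 u3 v v1 v2 :: "real \<Rightarrow> real \<Rightarrow> real"
  assumes l: "l > 0"
    and H: "\<And>t. t \<ge> 0 \<Longrightarrow> H2_fun (u t) (u1 t) (u2 t)" "\<And>t. t \<ge> 0 \<Longrightarrow> H2_fun (u1 t) (u2 t) (u3 t)"
    and V: "\<And>t. t \<ge> 0 \<Longrightarrow> H2_fun (v t) (v1 t) (v2 t)"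
    and cont: "\<And>t. t \<ge> 0 \<Longrightarrow> L2_tendsto u (u t) (at0 t)" "\<And>t. t \<ge> 0 \<Longrightarrow> L2_tendsto u1 (u1 t) (at0 t)"
      "\<And>t. t \<ge> 0 \<Longrightarrow> L2_tendsto u2 (u2 t) (at0 t)"
    and diff: "\<And>t. t \<ge> 0 \<Longrightarrow> L2_tendsto (\<lambda>s x. (u s x - u t x) / (s - t)) (v t) (at0 t)"
      "\<And>t. t \<ge> 0 \<Longrightarrow> L2_tendsto (\<lambda>s x. (u1 s x - u1 t x) / (s - t)) (v1 t) (at0 t)"
      "\<And>t. t \<ge> 0 \<Longrightarrow> L2_tendsto (\<lambda>s x. (u2 s x - u2 t x) / (s - t)) (v2 t) (at0 t)"
    and eq: "\<And>t x. t \<ge> 0 \<Longrightarrow> v t x + u t x * u1 t x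
       + conv_deriv l (\<lambda>x. (u t x)\<^sup>2 + l\<^sup>2 / 2 * (u1 t x)\<^sup>2) x = 0"
begin

definition q where "q t x = (u t x)\<^sup>2 + l\<^sup>2 / 2 * (u1 t x)\<^sup>2"
definition p where "p t = convolution (G_kernel l) (q t)"
definition p1 where "p1 t = conv_deriv l (q t)"

lemma v_eq: "t \<ge> 0 \<Longrightarrow> v t x = - (u t x * u1 t x) - p1 t x"
  using eq[of t x] by (simp add: p1_def q_def[abs_def])

lemmas uD = H2_funD[OF H(1)] and u1D = H2_funD[OF H(2)] and vD = H2_funD[OF V]

lemma q_facts:
  assumes "t \<ge> 0"
  shows "continuous_on UNIV (q t)" "integrable lebesgue (q t)" "q t x \<ge> 0"
  unfolding q_def[abs_def] using assms
  by (auto intro!: continuous_intros uD u1D integrable_mult_right L2_D)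

lemma p_deriv: "t \<ge> 0 \<Longrightarrow> (p t has_real_derivative p1 t x) (at x)"
  unfolding p_def p1_def by (rule convolution_deriv[OF l q_facts])

lemma p1_deriv: "t \<ge> 0 \<Longrightarrow> (p1 t has_real_derivative (p t x - q t x) / l\<^sup>2) (at x)"
  unfolding p_def p1_def by (rule conv_deriv_deriv[OF l q_facts])

lemma p_facts:
  assumes "t \<ge> 0"
  shows "p t x \<ge> 0" "continuous_on A (p t)" "continuous_on A (p1 t)" "integrable lebesgue (p t)"
    "integrable lebesgue (p1 t)" "p t x \<le> (LINT x|lebesgue. q t x) / (2 * l)"
  unfolding p_def p1_def
  by (intro convolution_nonneg[OF l q_facts] continuous_convolution[OF l q_facts] convolution_integrable[OF l q_facts]
      conv_deriv_integrable[OF l q_facts] convolution_le[OF l q_facts] assms)+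

lemma v1_eq:
  assumes t: "t \<ge> 0"
  shows "v1 t x = - (u1 t x)\<^sup>2 - u t x * u2 t x - (p t x - q t x) / l\<^sup>2"
proof -
  have "((\<lambda>x. - (u t x * u1 t x) - p1 t x) has_real_derivative - (u1 t x)\<^sup>2 - u t x * u2 t x - (p t x - q t x) / l\<^sup>2) (at x)"
    using t by (auto intro!: derivative_eq_intros p1_deriv uD u1D simp: power2_eq_square algebra_simps)
  moreover have "v t = (\<lambda>x. - (u t x * u1 t x) - p1 t x)" using v_eq[OF t] by auto
  ultimately show ?thesis using vD(1)[OF t] DERIV_unique by metis
qed

text \<open>As \<open>u3\<close> is only a density of \<open>u2\<close>, differentiating the formula
  for \<open>v1\<close> once more compares two densities of the same function, which agree almost
  everywhere.\<close>

lemma v2_eq_AE: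
  assumes t: "t \<ge> 0"
  shows "AE x in lebesgue. v2 t x = - 3 * u1 t x * u2 t x - u t x * u3 t x
    - (p1 t x - 2 * u t x * u1 t x - l\<^sup>2 * u1 t x * u2 t x) / l\<^sup>2"
proof (rule AC_deriv_unique[OF vD(2)[OF t]])
  have c: "continuous_on UNIV (u t)" "continuous_on UNIV (u1 t)" "continuous_on UNIV (u2 t)" "continuous_on UNIV (p t)" "continuous_on UNIV (p1 t)"
    using uD(7,8)[OF t] u1D(8)[OF t] p_facts[OF t] by auto
  have A: "AC_deriv (u t) (u1 t)" "AC_deriv (u1 t) (u2 t)" "AC_deriv (u2 t) (u3 t)" "AC_deriv (p t) (p1 t)"
    using uD(6)[OF t] uD(2)[OF t] u1D(2)[OF t] AC_derivI_C1[OF p_deriv[OF t] c(5)] by auto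
  have "AC_deriv (\<lambda>x. (- 1 / 2) * (u1 t x * u1 t x) + (- 1) * (u t x * u2 t x) + (- 1 / l\<^sup>2) * p t x + (1 / l\<^sup>2) * (u t x * u t x))
    (\<lambda>x. (- 1 / 2) * (u2 t x * u1 t x + u1 t x * u2 t x) + (- 1) * (u1 t x * u2 t x + u t x * u3 t x) + (- 1 / l\<^sup>2) * p1 t x
      + (1 / l\<^sup>2) * (u1 t x * u t x + u t x * u1 t x))"
    by (intro AC_deriv_add AC_deriv_cmult AC_deriv_mult A)
  then show "AC_deriv (v1 t) (\<lambda>x. - 3 * u1 t x * u2 t x - u t x * u3 t x
    - (p1 t x - 2 * u t x * u1 t x - l\<^sup>2 * u1 t x * u2 t x) / l\<^sup>2)"
    by (rule AC_deriv_cong) (use l in \<open>auto simp: v1_eq[OF t] q_def power2_eq_square field_simps\<close>)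
qed

text \<open>The Sobolev bound applied to differences: \<open>L\<^sup>2\<close> control of
  \<open>u\<close>, \<open>u1\<close> and \<open>u2\<close> dominates the sup norms of the first
  two.\<close>

lemma uniform_cont:
  assumes t: "t \<ge> 0"
  obtains e where "(e \<longlongrightarrow> 0) (at0 t)" "\<And>s x. s \<ge> 0 \<Longrightarrow> \<bar>u s x - u t x\<bar> \<le> e s"
    "\<And>s x. s \<ge> 0 \<Longrightarrow> \<bar>u1 s x - u1 t x\<bar> \<le> e s"
proof -
  let ?N = "\<lambda>w s. LINT x|lebesgue. (w s x - w t x)\<^sup>2"
  define e where "e s = sqrt (?N u s + ?N u1 s + ?N u2 s)" for s
  have "((\<lambda>s. ?N u s) \<longlongrightarrow> 0) (at0 t)" "((\<lambda>s. ?N u1 s) \<longlongrightarrow> 0) (at0 t)" "((\<lambda>s. ?N u2 s) \<longlongrightarrow> 0) (at0 t)"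
    using cont[OF t] by (auto simp: L2_tendsto_def)
  then have "(e \<longlongrightarrow> 0) (at0 t)" unfolding e_def by (auto intro!: tendsto_eq_intros)
  moreover have "\<bar>u s x - u t x\<bar> \<le> e s" "\<bar>u1 s x - u1 t x\<bar> \<le> e s" if s: "s \<ge> 0" for s x
  proof -
    note D = H2_funD[OF H2_fun_diff[OF H(1)[OF s] H(1)[OF t]]]
    have nn: "?N u s \<ge> 0" "?N u1 s \<ge> 0" "?N u2 s \<ge> 0" by auto
    have 1: "(u s x - u t x)\<^sup>2 \<le> ?N u s + ?N u1 s" "(u1 s x - u1 t x)\<^sup>2 \<le> ?N u1 s + ?N u2 s"
      by (rule L2_AC_sup_bound[OF D(6,3,4)], rule L2_AC_sup_bound[OF D(2,4,5)])
    show "\<bar>u s x - u t x\<bar> \<le> e s" "\<bar>u1 s x - u1 t x\<bar> \<le> e s"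
      unfolding e_def using 1 nn by (intro real_le_rsqrt; unfold power2_abs; linarith)+
  qed
  ultimately show thesis by (rule that)
qed

lemma L2_tendsto_mult_u:
  assumes t: "t \<ge> 0" and f: "L2_tendsto fs f (at0 t)"
  shows "L2_tendsto (\<lambda>s x. u s x * fs s x) (\<lambda>x. u t x * f x) (at0 t)"
    "L2_tendsto (\<lambda>s x. u1 s x * fs s x) (\<lambda>x. u1 t x * f x) (at0 t)"
    "L2_tendsto (\<lambda>s x. u t x * fs s x) (\<lambda>x. u t x * f x) (at0 t)"
    "L2_tendsto (\<lambda>s x. u1 t x * fs s x) (\<lambda>x. u1 t x * f x) (at0 t)"
proof -
  obtain e where e: "(e \<longlongrightarrow> 0) (at0 t)" "\<And>s x. s \<ge> 0 \<Longrightarrow> \<bar>u s x - u t x\<bar> \<le> e s"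
    "\<And>s x. s \<ge> 0 \<Longrightarrow> \<bar>u1 s x - u1 t x\<bar> \<le> e s" by (rule uniform_cont[OF t]) blast
  obtain C where C: "\<And>x. \<bar>u t x\<bar> \<le> C" "\<And>x. \<bar>u1 t x\<bar> \<le> C" by (rule H2_fun_bounded[OF H(1)[OF t]]) blast
  have m: "u s \<in> borel_measurable lebesgue" "u1 s \<in> borel_measurable lebesgue" if "s \<ge> 0" for s
    using uD(7,8)[OF that] by (intro continuous_lebesgue_measurable; simp)+
  have ev: "\<forall>\<^sub>F s in at0 t. s \<ge> 0" using eventually_at0[OF t] by (rule eventually_mono) simp
  show "L2_tendsto (\<lambda>s x. u s x * fs s x) (\<lambda>x. u t x * f x) (at0 t)"
    by (rule L2_tendsto_mult[OF f C(1) m(1)[OF t] e(1)]) (use ev in eventually_elim, use e m in auto)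
  show "L2_tendsto (\<lambda>s x. u1 s x * fs s x) (\<lambda>x. u1 t x * f x) (at0 t)"
    by (rule L2_tendsto_mult[OF f C(2) m(2)[OF t] e(1)]) (use ev in eventually_elim, use e m in auto)
  show "L2_tendsto (\<lambda>s x. u t x * fs s x) (\<lambda>x. u t x * f x) (at0 t)"
    by (rule L2_tendsto_mult_const[OF f C(1) m(1)[OF t]])
  show "L2_tendsto (\<lambda>s x. u1 t x * fs s x) (\<lambda>x. u1 t x * f x) (at0 t)"
    by (rule L2_tendsto_mult_const[OF f C(2) m(2)[OF t]])
qed

lemma has_derivative_at0I:
  assumes t: "t \<ge> 0" and lim: "(g \<longlongrightarrow> D) (at0 t)"
    and eq: "\<And>s. s \<ge> 0 \<Longrightarrow> s \<noteq> t \<Longrightarrow> (f s - f t) / (s - t) = g s"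
  shows "(f has_real_derivative D) (at0 t)"
  unfolding has_field_derivative_iff
proof (rule Lim_transform_eventually[OF lim])
  show "\<forall>\<^sub>F s in at0 t. g s = (f s - f t) / (s - t)"
    using eventually_at0[OF t] by eventually_elim (use eq in auto)
qed

section \<open>Local balance and conservation of energy\<close>

definition energy :: "(real \<Rightarrow> real) \<Rightarrow> real \<Rightarrow> real" where
  "energy \<psi> t = (LINT x|lebesgue. \<psi> x * ((u t x)\<^sup>2 + l\<^sup>2 * (u1 t x)\<^sup>2))"

lemma energy_density_integrable:
  assumes "t \<ge> 0" shows "integrable lebesgue (\<lambda>x. (u t x)\<^sup>2 + l\<^sup>2 * (u1 t x)\<^sup>2)"
  using L2_D(2)[OF uD(3)[OF assms]] L2_D(2)[OF uD(4)[OF assms]] by auto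

text \<open>Factoring the differences of squares writes the difference quotient as pairings of
  strongly convergent \<open>L\<^sup>2\<close> factors, so the limit is taken without pointwise
  differentiation in time.\<close>

lemma energy_time_deriv:
  assumes t: "t \<ge> 0" and \<psi>: "continuous_on UNIV \<psi>" "\<And>x. \<bar>\<psi> x\<bar> \<le> C"
  shows "(energy \<psi> has_real_derivative
     (LINT x|lebesgue. v t x * (\<psi> x * (2 * u t x))) + (LINT x|lebesgue. v1 t x * (\<psi> x * (l\<^sup>2 * (2 * u1 t x))))) (at0 t)"
proof (rule has_derivative_at0I[OF t])
  have \<psi>m: "\<psi> \<in> borel_measurable lebesgue" by (rule continuous_lebesgue_measurable[OF \<psi>(1)])
  have 1: "L2_tendsto (\<lambda>s x. \<psi> x * (u s x + u t x)) (\<lambda>x. \<psi> x * (u t x + u t x)) (at0 t)"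
    by (intro L2_tendsto_mult_const[OF _ \<psi>(2) \<psi>m] L2_tendsto_add cont t L2_tendsto_const uD(3))
  have 2: "L2_tendsto (\<lambda>s x. \<psi> x * (l\<^sup>2 * (u1 s x + u1 t x))) (\<lambda>x. \<psi> x * (l\<^sup>2 * (u1 t x + u1 t x))) (at0 t)"
    by (intro L2_tendsto_mult_const[OF _ \<psi>(2) \<psi>m] L2_tendsto_cmult L2_tendsto_add cont t L2_tendsto_const uD(4))
  let ?g = "\<lambda>s. (LINT x|lebesgue. (u s x - u t x) / (s - t) * (\<psi> x * (u s x + u t x)))
       + (LINT x|lebesgue. (u1 s x - u1 t x) / (s - t) * (\<psi> x * (l\<^sup>2 * (u1 s x + u1 t x))))"
  have "(?g \<longlongrightarrow> (LINT x|lebesgue. v t x * (\<psi> x * (u t x + u t x))) + (LINT x|lebesgue. v1 t x * (\<psi> x * (l\<^sup>2 * (u1 t x + u1 t x))))) (at0 t)"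
    by (intro tendsto_add L2_tendsto_integral[OF diff(1)[OF t] 1] L2_tendsto_integral[OF diff(2)[OF t] 2])
  then show "(?g \<longlongrightarrow> (LINT x|lebesgue. v t x * (\<psi> x * (2 * u t x))) + (LINT x|lebesgue. v1 t x * (\<psi> x * (l\<^sup>2 * (2 * u1 t x))))) (at0 t)"
    by (simp only: mult_2)
  fix s assume s: "s \<ge> 0" "s \<noteq> t"
  have i: "integrable lebesgue (\<lambda>x. \<psi> x * ((u r x)\<^sup>2 + l\<^sup>2 * (u1 r x)\<^sup>2))" if "r \<ge> 0" for r
    by (rule integrable_lebesgue_mult_bounded[OF energy_density_integrable[OF that] \<psi>m \<psi>(2)])
  have L: "(\<lambda>x. (u s x - u t x) / (s - t)) \<in> L2" "(\<lambda>x. (u1 s x - u1 t x) / (s - t)) \<in> L2"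
    using L2_cmult[OF L2_diff[OF uD(3)[OF s(1)] uD(3)[OF t]], of "1 / (s - t)"]
      L2_cmult[OF L2_diff[OF uD(4)[OF s(1)] uD(4)[OF t]], of "1 / (s - t)"] by simp_all
  have j: "integrable lebesgue (\<lambda>x. (u s x - u t x) / (s - t) * (\<psi> x * (u s x + u t x)))"
    "integrable lebesgue (\<lambda>x. (u1 s x - u1 t x) / (s - t) * (\<psi> x * (l\<^sup>2 * (u1 s x + u1 t x))))"
    by (intro L2_prod_integrable L L2_mult_bounded[OF _ \<psi>m \<psi>(2)] L2_cmult L2_add uD(3,4) s t)+
  have "(energy \<psi> s - energy \<psi> t) / (s - t) = (LINT x|lebesgue. (\<psi> x * ((u s x)\<^sup>2 + l\<^sup>2 * (u1 s x)\<^sup>2) - \<psi> x * ((u t x)\<^sup>2 + l\<^sup>2 * (u1 t x)\<^sup>2)) / (s - t))"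
    using i[OF s(1)] i[OF t] by (simp add: energy_def)
  also have "\<dots> = (LINT x|lebesgue. (u s x - u t x) / (s - t) * (\<psi> x * (u s x + u t x)) + (u1 s x - u1 t x) / (s - t) * (\<psi> x * (l\<^sup>2 * (u1 s x + u1 t x))))"
  proof (intro Bochner_Integration.integral_cong refl)
    fix x
    have "\<psi> x * ((u s x)\<^sup>2 + l\<^sup>2 * (u1 s x)\<^sup>2) - \<psi> x * ((u t x)\<^sup>2 + l\<^sup>2 * (u1 t x)\<^sup>2)
      = (u s x - u t x) * (\<psi> x * (u s x + u t x)) + (u1 s x - u1 t x) * (\<psi> x * (l\<^sup>2 * (u1 s x + u1 t x)))"
      by (simp add: power2_eq_square algebra_simps)
    then show "(\<psi> x * ((u s x)\<^sup>2 + l\<^sup>2 * (u1 s x)\<^sup>2) - \<psi> x * ((u t x)\<^sup>2 + l\<^sup>2 * (u1 t x)\<^sup>2)) / (s - t)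
      = (u s x - u t x) / (s - t) * (\<psi> x * (u s x + u t x)) + (u1 s x - u1 t x) / (s - t) * (\<psi> x * (l\<^sup>2 * (u1 s x + u1 t x)))"
      by (simp add: add_divide_distrib)
  qed
  also have "\<dots> = ?g s" by (rule Bochner_Integration.integral_add[OF j])
  finally show "(energy \<psi> s - energy \<psi> t) / (s - t) = ?g s" .
qed

definition flux where "flux t x = 2 * (u t x * p t x) + l\<^sup>2 * (u t x * (u1 t x)\<^sup>2)"

lemma flux_integrable:
  assumes t: "t \<ge> 0" shows "integrable lebesgue (flux t)"
proof -
  obtain C where C: "\<And>x. \<bar>u t x\<bar> \<le> C" by (rule H2_fun_bounded[OF H(1)[OF t]]) blast
  show ?thesis
    unfolding flux_def[abs_def]
    by (intro Bochner_Integration.integrable_add integrable_mult_right integrable_bounded_continuous_mult[OF _ uD(7)[OF t] C]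
        p_facts[OF t] L2_D(2)[OF uD(4)[OF t]])
qed

text \<open>This is an exact pointwise balance law for the energy density. The Helmholtz identity
  trades \<open>l\<^sup>2 p\<^sub>x\<^sub>x\<close> for \<open>p - q\<close>, and the resulting term
  \<open>2 u\<^sup>2 u\<^sub>x\<close> cancels the one from the transport term.\<close>

lemma flux_deriv:
  assumes t: "t \<ge> 0"
  shows "(flux t has_real_derivative - (2 * u t x * v t x + 2 * l\<^sup>2 * u1 t x * v1 t x)) (at x)"
proof -
  have "(flux t has_real_derivative
      2 * (u1 t x * p t x + u t x * p1 t x) + l\<^sup>2 * (u1 t x * (u1 t x)\<^sup>2 + u t x * (2 * u1 t x * u2 t x))) (at x)"
    unfolding flux_def[abs_def] by (auto intro!: derivative_eq_intros p_deriv uD(1) u1D(1) t)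
  moreover have "2 * (u1 t x * p t x + u t x * p1 t x) + l\<^sup>2 * (u1 t x * (u1 t x)\<^sup>2 + u t x * (2 * u1 t x * u2 t x))
     = - (2 * u t x * v t x + 2 * l\<^sup>2 * u1 t x * v1 t x)"
    using l by (simp add: v_eq[OF t] v1_eq[OF t] q_def power2_eq_square field_simps)
  ultimately show ?thesis by metis
qed

lemma energy_deriv:
  assumes t: "t \<ge> 0" and \<psi>: "\<And>x. (\<psi> has_real_derivative \<psi>' x) (at x)" "continuous_on UNIV \<psi>'"
     "\<And>x. \<bar>\<psi> x\<bar> \<le> C" "\<And>x. \<bar>\<psi>' x\<bar> \<le> C'"
  shows "(energy \<psi> has_real_derivative (LINT x|lebesgue. \<psi>' x * flux t x)) (at0 t)"
proof -
  have AC\<psi>: "AC_deriv \<psi> \<psi>'" by (rule AC_derivI_C1[OF \<psi>(1,2)])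
  have c\<psi>: "continuous_on UNIV \<psi>" by (rule AC_deriv_continuous[OF AC\<psi>])
  let ?g = "\<lambda>x. - (2 * u t x * v t x + 2 * l\<^sup>2 * u1 t x * v1 t x)"
  have "AC_deriv (flux t) ?g"
    by (rule AC_derivI_C1[OF flux_deriv[OF t]]) (intro continuous_intros uD(7,8) vD(7,8) t)
  then have AC: "AC_deriv (\<lambda>x. \<psi> x * flux t x) (\<lambda>x. \<psi>' x * flux t x + \<psi> x * ?g x)"
    by (rule AC_deriv_mult[OF AC\<psi>])
  have i1: "integrable lebesgue (\<lambda>x. \<psi> x * flux t x)" "integrable lebesgue (\<lambda>x. \<psi>' x * flux t x)"
    by (rule integrable_bounded_continuous_mult[OF flux_integrable[OF t]], fact, fact)+
  note \<psi>m = continuous_lebesgue_measurable[OF c\<psi>]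
  have i2: "integrable lebesgue (\<lambda>x. v t x * (\<psi> x * (2 * u t x)))" "integrable lebesgue (\<lambda>x. v1 t x * (\<psi> x * (l\<^sup>2 * (2 * u1 t x))))"
    by (intro L2_prod_integrable vD(3,4) t L2_mult_bounded[OF _ \<psi>m \<psi>(3)] L2_cmult uD(3,4))+
  have geq: "\<psi> x * ?g x = - (v t x * (\<psi> x * (2 * u t x)) + v1 t x * (\<psi> x * (l\<^sup>2 * (2 * u1 t x))))" for x
    by (simp add: algebra_simps)
  have i3: "integrable lebesgue (\<lambda>x. \<psi> x * ?g x)"
    unfolding geq by (intro integrable_minus Bochner_Integration.integrable_add i2)
  have "(LINT x|lebesgue. \<psi>' x * flux t x + \<psi> x * ?g x) = 0"
    by (rule AC_deriv_integral_zero[OF AC i1(1)]) (intro Bochner_Integration.integrable_add i1 i3)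
  then have "(LINT x|lebesgue. \<psi>' x * flux t x) + (LINT x|lebesgue. \<psi> x * ?g x) = 0"
    using i1 i3 by (simp only: Bochner_Integration.integral_add)
  moreover have "(LINT x|lebesgue. \<psi> x * ?g x) = - ((LINT x|lebesgue. v t x * (\<psi> x * (2 * u t x))) + (LINT x|lebesgue. v1 t x * (\<psi> x * (l\<^sup>2 * (2 * u1 t x)))))"
    unfolding geq using i2 by (simp only: Bochner_Integration.integral_add integral_minus)
  ultimately have "(LINT x|lebesgue. v t x * (\<psi> x * (2 * u t x))) + (LINT x|lebesgue. v1 t x * (\<psi> x * (l\<^sup>2 * (2 * u1 t x))))
      = (LINT x|lebesgue. \<psi>' x * flux t x)" by linarith
  then show ?thesis
    using energy_time_deriv[OF t c\<psi> \<psi>(3)] by (simp only:)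
qed

lemma energy_const:
  assumes t: "t \<ge> 0" shows "energy (\<lambda>_. 1) t = energy (\<lambda>_. 1) 0"
proof -
  have "(energy (\<lambda>_. 1) has_real_derivative 0) (at0 s)" if "s \<ge> 0" for s
    using energy_deriv[OF that, of "\<lambda>_. 1" "\<lambda>_. 0" 1 0] by simp
  then have "\<exists>c. \<forall>s\<in>{0..}. energy (\<lambda>_. 1) s = c"
    by (intro has_field_derivative_zero_constant) auto
  then show ?thesis using t by auto
qed

section \<open>Conservation of the cubic Hamiltonian\<close>

definition cubic :: "real \<Rightarrow> real" where
  "cubic t = (LINT x|lebesgue. u t x * ((u t x)\<^sup>2 + l\<^sup>2 * (u1 t x)\<^sup>2))"

lemma cubic_integrable:
  assumes t: "t \<ge> 0" shows "integrable lebesgue (\<lambda>x. u t x * ((u t x)\<^sup>2 + l\<^sup>2 * (u1 t x)\<^sup>2))"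
proof -
  obtain C where C: "\<And>x. \<bar>u t x\<bar> \<le> C" by (rule H2_fun_bounded[OF H(1)[OF t]]) blast
  show ?thesis by (rule integrable_bounded_continuous_mult[OF energy_density_integrable[OF t] uD(7)[OF t] C])
qed

lemma cubic_time_deriv:
  assumes t: "t \<ge> 0"
  shows "(cubic has_real_derivative
     (LINT x|lebesgue. v t x * (3 * (u t x * u t x) + l\<^sup>2 * (u1 t x * u1 t x))) + (LINT x|lebesgue. v1 t x * (l\<^sup>2 * (u t x * (2 * u1 t x))))) (at0 t)"
proof (rule has_derivative_at0I[OF t])
  have uu: "L2_tendsto (\<lambda>s. u t) (u t) (at0 t)" "L2_tendsto (\<lambda>s. u1 t) (u1 t) (at0 t)"
    using uD(3,4)[OF t] by (auto intro: L2_tendsto_const)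
  \<comment> \<open>The difference of the cubic densities is split asymmetrically: the coefficient
    of \<open>u s - u t\<close> contains \<open>u1\<close> at time \<open>s\<close>, and the
    coefficient of \<open>u1 s - u1 t\<close> contains \<open>u\<close> at time \<open>t\<close>.
    Both coefficients converge strongly in \<open>L\<^sup>2\<close>.\<close>
  have "L2_tendsto (\<lambda>s x. u s x * u s x + u s x * u t x + u t x * u t x + l\<^sup>2 * (u1 s x * u1 s x))
      (\<lambda>x. u t x * u t x + u t x * u t x + u t x * u t x + l\<^sup>2 * (u1 t x * u1 t x)) (at0 t)" (is "L2_tendsto ?A _ _")
    by (intro L2_tendsto_add L2_tendsto_cmult L2_tendsto_mult_u t cont uu)
  then have 1: "L2_tendsto ?A (\<lambda>x. 3 * (u t x * u t x) + l\<^sup>2 * (u1 t x * u1 t x)) (at0 t)"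
    by (simp add: algebra_simps)
  have "L2_tendsto (\<lambda>s x. l\<^sup>2 * (u t x * (u1 s x + u1 t x))) (\<lambda>x. l\<^sup>2 * (u t x * (u1 t x + u1 t x))) (at0 t)" (is "L2_tendsto ?B _ _")
    by (intro L2_tendsto_cmult L2_tendsto_mult_u L2_tendsto_add t cont uu)
  then have 2: "L2_tendsto ?B (\<lambda>x. l\<^sup>2 * (u t x * (2 * u1 t x))) (at0 t)"
    by (simp only: mult_2)
  let ?g = "\<lambda>s. (LINT x|lebesgue. (u s x - u t x) / (s - t) * ?A s x) + (LINT x|lebesgue. (u1 s x - u1 t x) / (s - t) * ?B s x)"
  show "(?g \<longlongrightarrow> (LINT x|lebesgue. v t x * (3 * (u t x * u t x) + l\<^sup>2 * (u1 t x * u1 t x)))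
     + (LINT x|lebesgue. v1 t x * (l\<^sup>2 * (u t x * (2 * u1 t x))))) (at0 t)"
    by (intro tendsto_add L2_tendsto_integral[OF diff(1)[OF t] 1] L2_tendsto_integral[OF diff(2)[OF t] 2])
  fix s assume s: "s \<ge> 0" "s \<noteq> t"
  obtain C where C: "\<And>x. \<bar>u t x\<bar> \<le> C" by (rule H2_fun_bounded[OF H(1)[OF t]]) blast
  obtain D where D: "\<And>x. \<bar>u s x\<bar> \<le> D" "\<And>x. \<bar>u1 s x\<bar> \<le> D" by (rule H2_fun_bounded[OF H(1)[OF s(1)]]) blast
  note m = continuous_lebesgue_measurable[OF uD(7)[OF t]] continuous_lebesgue_measurable[OF uD(7)[OF s(1)]]
    continuous_lebesgue_measurable[OF uD(8)[OF s(1)]]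
  have L: "(\<lambda>x. (u s x - u t x) / (s - t)) \<in> L2" "(\<lambda>x. (u1 s x - u1 t x) / (s - t)) \<in> L2"
    using L2_cmult[OF L2_diff[OF uD(3)[OF s(1)] uD(3)[OF t]], of "1 / (s - t)"]
      L2_cmult[OF L2_diff[OF uD(4)[OF s(1)] uD(4)[OF t]], of "1 / (s - t)"] by simp_all
  have AB: "?A s \<in> L2" "?B s \<in> L2"
    by (intro L2_add L2_cmult L2_mult_bounded[OF _ m(1) C] L2_mult_bounded[OF _ m(2) D(1)] L2_mult_bounded[OF _ m(3) D(2)] uD(3,4) s t)+
  have "(cubic s - cubic t) / (s - t) = (LINT x|lebesgue. (u s x * ((u s x)\<^sup>2 + l\<^sup>2 * (u1 s x)\<^sup>2) - u t x * ((u t x)\<^sup>2 + l\<^sup>2 * (u1 t x)\<^sup>2)) / (s - t))"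
    using cubic_integrable[OF s(1)] cubic_integrable[OF t] by (simp add: cubic_def)
  also have "\<dots> = (LINT x|lebesgue. (u s x - u t x) / (s - t) * ?A s x + (u1 s x - u1 t x) / (s - t) * ?B s x)"
  proof (intro Bochner_Integration.integral_cong refl)
    fix x
    have "u s x * ((u s x)\<^sup>2 + l\<^sup>2 * (u1 s x)\<^sup>2) - u t x * ((u t x)\<^sup>2 + l\<^sup>2 * (u1 t x)\<^sup>2)
      = (u s x - u t x) * ?A s x + (u1 s x - u1 t x) * ?B s x"
      by (simp add: power2_eq_square algebra_simps)
    then show "(u s x * ((u s x)\<^sup>2 + l\<^sup>2 * (u1 s x)\<^sup>2) - u t x * ((u t x)\<^sup>2 + l\<^sup>2 * (u1 t x)\<^sup>2)) / (s - t)
      = (u s x - u t x) / (s - t) * ?A s x + (u1 s x - u1 t x) / (s - t) * ?B s x"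
      by (simp only: add_divide_distrib times_divide_eq_left)
  qed
  also have "\<dots> = ?g s"
    by (rule Bochner_Integration.integral_add[OF L2_prod_integrable[OF L(1) AB(1)] L2_prod_integrable[OF L(2) AB(2)]])
  finally show "(cubic s - cubic t) / (s - t) = ?g s" .
qed

text \<open>With \<open>s = u\<^sup>2 / 2 + p\<close> the equation reads \<open>v = - s\<^sub>x\<close>, and the variational derivative of
  \<open>cubic\<close> is \<open>2 (s - l\<^sup>2 s\<^sub>x\<^sub>x)\<close>; hence the antisymmetry of \<open>\<partial>\<^sub>x\<close> makes \<open>cubic\<close> a constant
  of motion.\<close>

lemma cubic_const:
  assumes t: "t \<ge> 0" shows "cubic t = cubic 0"
proof -
  have "(cubic has_real_derivative 0) (at0 t)" if t: "t \<ge> 0" for t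
  proof -
    obtain C where C: "\<And>x. \<bar>u t x\<bar> \<le> C" "\<And>x. \<bar>u1 t x\<bar> \<le> C" by (rule H2_fun_bounded[OF H(1)[OF t]]) blast
    define s where "s x = (u t x)\<^sup>2 / 2 + p t x" for x
    \<comment> \<open>A primitive of the integrand \<open>b\<close>. Its first term arises from
      integrating by parts in \<open>v1\<close>; the others integrate
      \<open>2 v (s - l\<^sup>2 s\<^sub>x\<^sub>x)\<close> by means of
      \<open>v = - s\<^sub>x\<close>.\<close>
    define B where "B x = 2 * l\<^sup>2 * (u1 t x * (u t x * v t x)) - (s x)\<^sup>2 + l\<^sup>2 * (v t x)\<^sup>2" for x
    define b where "b x = v t x * (3 * (u t x * u t x) + l\<^sup>2 * (u1 t x * u1 t x)) + v1 t x * (l\<^sup>2 * (u t x * (2 * u1 t x)))" for x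
    have sd: "(s has_real_derivative - v t x) (at x)" for x
      unfolding s_def[abs_def] by (auto intro!: derivative_eq_intros p_deriv uD(1) t simp: v_eq[OF t] power2_eq_square)
    have Bd: "(B has_real_derivative b x) (at x)" for x
    proof -
      have "(B has_real_derivative 2 * l\<^sup>2 * (u2 t x * (u t x * v t x) + u1 t x * (u1 t x * v t x + u t x * v1 t x))
          - 2 * s x * (- v t x) + l\<^sup>2 * (2 * v t x * v1 t x)) (at x)"
        unfolding B_def[abs_def] by (auto intro!: derivative_eq_intros sd uD(1) u1D(1) vD(1) t simp: algebra_simps)
      moreover have "2 * l\<^sup>2 * (u2 t x * (u t x * v t x) + u1 t x * (u1 t x * v t x + u t x * v1 t x))
          - 2 * s x * (- v t x) + l\<^sup>2 * (2 * v t x * v1 t x) = b x"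
      proof -
        have "l\<^sup>2 * v1 t x = - l\<^sup>2 * (u1 t x)\<^sup>2 - l\<^sup>2 * (u t x * u2 t x) - p t x + q t x"
          using l by (simp add: v1_eq[OF t] field_simps)
        then have "l\<^sup>2 * (2 * v t x * v1 t x) = 2 * v t x * (- l\<^sup>2 * (u1 t x)\<^sup>2 - l\<^sup>2 * (u t x * u2 t x) - p t x + q t x)"
          by (metis mult.assoc mult.left_commute)
        then show ?thesis by (simp add: b_def s_def q_def power2_eq_square algebra_simps)
      qed
      ultimately show ?thesis by metis
    qed
    have cs: "continuous_on UNIV s" using sd by (intro continuous_at_imp_continuous_on) (auto intro: DERIV_isCont)
    have cb: "continuous_on UNIV b" unfolding b_def[abs_def] by (intro continuous_intros uD(7,8) vD(7,8) t)
    have u2i: "integrable lebesgue (\<lambda>x. (u t x)\<^sup>2)" by (rule L2_D(2)[OF uD(3)[OF t]])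
    have si: "integrable lebesgue s"
      unfolding s_def[abs_def] using u2i p_facts(4)[OF t] by auto
    have sb: "\<bar>s x\<bar> \<le> C\<^sup>2 / 2 + (LINT x|lebesgue. q t x) / (2 * l)" for x
    proof -
      have "(u t x)\<^sup>2 \<le> C\<^sup>2" using C(1)[of x] by (metis abs_ge_zero power2_abs power_mono)
      then show ?thesis using p_facts(1,6)[OF t, of x] by (simp add: s_def)
    qed
    have Bi: "integrable lebesgue B"
    proof -
      have "integrable lebesgue (\<lambda>x. s x * s x)" by (rule integrable_bounded_continuous_mult[OF si cs sb])
      moreover have "integrable lebesgue (\<lambda>x. u1 t x * (u t x * v t x))"
        by (intro integrable_bounded_continuous_mult[OF _ uD(8)[OF t] C(2)] L2_prod_integrable uD(3) vD(3) t)
      ultimately show ?thesis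
        unfolding B_def[abs_def] using L2_D(2)[OF vD(3)[OF t]] by (simp add: power2_eq_square)
    qed
    note m = continuous_lebesgue_measurable[OF uD(7)[OF t]] continuous_lebesgue_measurable[OF uD(8)[OF t]]
    have bi: "integrable lebesgue (\<lambda>x. v t x * (3 * (u t x * u t x) + l\<^sup>2 * (u1 t x * u1 t x)))"
      "integrable lebesgue (\<lambda>x. v1 t x * (l\<^sup>2 * (u t x * (2 * u1 t x))))"
      by (intro L2_prod_integrable vD(3,4) t L2_add L2_cmult L2_mult_bounded[OF _ m(1) C(1)] L2_mult_bounded[OF _ m(2) C(2)] uD(3,4))+
    have "(LINT x|lebesgue. b x) = 0"
      by (rule AC_deriv_integral_zero[OF AC_derivI_C1[OF Bd cb] Bi]) (use bi in \<open>auto simp: b_def[abs_def]\<close>)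
    then show ?thesis using cubic_time_deriv[OF t] bi by (simp add: b_def)
  qed
  then have "\<exists>c. \<forall>s\<in>{0..}. cubic s = c"
    by (intro has_field_derivative_zero_constant) auto
  then show ?thesis using t by auto
qed

end

section \<open>Sign of the momentum\<close>

text \<open>The squared negative part has a Lipschitz derivative, so a Taylor bound with quadratic
  remainder holds although there is no second derivative at 0. The bound is uniform in
  \<open>a\<close> and can therefore be integrated in space.\<close>

lemma neg_part_square_expansion:
  fixes a b :: real
  shows "\<bar>(min b 0)\<^sup>2 - (min a 0)\<^sup>2 - 2 * min a 0 * (b - a)\<bar> \<le> (b - a)\<^sup>2"
proof -
  consider "a \<le> 0" "b \<le> 0" | "a \<le> 0" "b > 0" | "a > 0" "b \<le> 0" | "a > 0" "b > 0" by linarith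
  then show ?thesis
  proof cases
    case 1
    then have "(min b 0)\<^sup>2 - (min a 0)\<^sup>2 - 2 * min a 0 * (b - a) = (b - a)\<^sup>2"
      by (simp add: power2_eq_square algebra_simps)
    then show ?thesis by simp
  next
    case 2
    have "a * b \<le> 0" using 2 by (simp add: mult_nonpos_nonneg)
    moreover have "(min b 0)\<^sup>2 - (min a 0)\<^sup>2 - 2 * min a 0 * (b - a) = a * a - 2 * (a * b)"
      using 2 by (simp add: power2_eq_square algebra_simps)
    moreover have "(b - a)\<^sup>2 = b * b - 2 * (a * b) + a * a" by (simp add: power2_eq_square algebra_simps)
    moreover have "a * a \<ge> 0" "b * b \<ge> 0" by auto
    ultimately show ?thesis unfolding abs_le_iff by linarith
  next
    case 3
    have "a * b \<le> 0" using 3 by (simp add: mult_nonneg_nonpos)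
    moreover have "(min b 0)\<^sup>2 - (min a 0)\<^sup>2 - 2 * min a 0 * (b - a) = b * b"
      using 3 by (simp add: power2_eq_square algebra_simps)
    moreover have "(b - a)\<^sup>2 = b * b - 2 * (a * b) + a * a" by (simp add: power2_eq_square algebra_simps)
    moreover have "a * a \<ge> 0" "b * b \<ge> 0" by auto
    ultimately show ?thesis unfolding abs_le_iff by linarith
  qed simp
qed

lemma neg_part_square_deriv: "((\<lambda>a::real. (min a 0)\<^sup>2) has_real_derivative 2 * min a 0) (at a)"
  unfolding has_field_derivative_iff
proof (rule LIM_zero_cancel, rule Lim_null_comparison)
  show "((\<lambda>b. \<bar>b - a\<bar>) \<longlongrightarrow> 0) (at a)" by (auto intro!: tendsto_eq_intros)
  show "\<forall>\<^sub>F b in at a. norm (((min b 0)\<^sup>2 - (min a 0)\<^sup>2) / (b - a) - 2 * min a 0) \<le> \<bar>b - a\<bar>"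
    unfolding eventually_at_filter
  proof (rule always_eventually, intro allI impI)
    fix b assume b: "b \<noteq> a"
    have "((min b 0)\<^sup>2 - (min a 0)\<^sup>2) / (b - a) - 2 * min a 0 = ((min b 0)\<^sup>2 - (min a 0)\<^sup>2 - 2 * min a 0 * (b - a)) / (b - a)"
      using b by (simp add: diff_divide_distrib)
    then have "norm (((min b 0)\<^sup>2 - (min a 0)\<^sup>2) / (b - a) - 2 * min a 0) = \<bar>(min b 0)\<^sup>2 - (min a 0)\<^sup>2 - 2 * min a 0 * (b - a)\<bar> / \<bar>b - a\<bar>"
      by (simp add: abs_divide)
    also have "\<dots> \<le> (b - a)\<^sup>2 / \<bar>b - a\<bar>" by (intro divide_right_mono neg_part_square_expansion) simp
    also have "\<dots> = (\<bar>b - a\<bar> * \<bar>b - a\<bar>) / \<bar>b - a\<bar>" by (simp add: power2_eq_square)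
    also have "\<dots> = \<bar>b - a\<bar>" using b by (simp del: abs_mult_self_eq)
    finally show "norm (((min b 0)\<^sup>2 - (min a 0)\<^sup>2) / (b - a) - 2 * min a 0) \<le> \<bar>b - a\<bar>" .
  qed
qed

lemma deriv_le_at0:
  assumes t: "t \<ge> 0"
    and d: "\<And>s. 0 \<le> s \<Longrightarrow> s \<le> t \<Longrightarrow> (f has_real_derivative D s) (at0 s)"
    and b: "\<And>s. 0 \<le> s \<Longrightarrow> s \<le> t \<Longrightarrow> D s \<le> K"
  shows "f t \<le> f 0 + K * t"
proof (cases "t = 0")
  case False
  with t have "0 < t" by simp
  have "\<exists>x\<in>{0<..<t}. f t - f 0 = D x * (t - 0)"
  proof (rule mvt_simple[OF \<open>0 < t\<close>, of f "\<lambda>x h. D x * h"])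
    fix x assume "0 \<le> x" "x \<le> t"
    then have "(f has_real_derivative D x) (at x within {0..t})"
      by (intro has_field_derivative_subset[OF d]) auto
    then show "(f has_derivative (\<lambda>h. D x * h)) (at x within {0..t})"
      by (simp add: has_field_derivative_def)
  qed
  then obtain x where x: "0 < x" "x < t" "f t - f 0 = D x * t" by auto
  have "D x * t \<le> K * t" using b[of x] x t by (intro mult_right_mono) auto
  then show ?thesis using x(3) by linarith
qed simp

text \<open>The claim is \<open>(a - b)\<^sup>2 (a + 2 b) \<ge> 0\<close> expanded.\<close>

lemma young_cubic: "0 \<le> a \<Longrightarrow> 0 \<le> b \<Longrightarrow> a * b\<^sup>2 \<le> 1/3 * a ^ 3 + 2/3 * (b::real) ^ 3"
proof -
  assume "0 \<le> a" "0 \<le> b"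
  then have "0 \<le> (a - b)\<^sup>2 * (a + 2 * b)" by simp
  then show ?thesis by (simp add: power2_eq_square power3_eq_cube algebra_simps)
qed

context CH_flow
begin

text \<open>The squared \<open>L\<^sup>2\<close> norms of \<open>u1\<close> and \<open>u2\<close>
  are continuous in time, hence bounded on a compact interval, and control the sup norm of
  \<open>u1\<close>. The constant may depend on \<open>l\<close>; it only enters the Gronwall
  argument for one fixed flow.\<close>

lemma u1_bounded_locally:
  obtains C where "C > 0" "\<And>s x. 0 \<le> s \<Longrightarrow> s \<le> T \<Longrightarrow> \<bar>u1 s x\<bar> \<le> C"
proof -
  define N where "N s = (LINT x|lebesgue. u1 s x * u1 s x) + (LINT x|lebesgue. u2 s x * u2 s x)" for s
  have "continuous_on {0..T} N"
    unfolding continuous_on_def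
  proof
    fix t assume t: "t \<in> {0..T}"
    have "(N \<longlongrightarrow> N t) (at0 t)"
      unfolding N_def using t by (intro tendsto_add L2_tendsto_integral cont) auto
    then show "(N \<longlongrightarrow> N t) (at t within {0..T})" by (rule tendsto_within_subset) auto
  qed
  then have "bounded (N ` {0..T})" by (intro compact_imp_bounded compact_continuous_image) auto
  then obtain K where K: "K > 0" "\<And>s. s \<in> {0..T} \<Longrightarrow> \<bar>N s\<bar> \<le> K" by (auto simp: bounded_pos)
  show thesis
  proof (rule that[of "sqrt K"])
    fix s x assume s: "0 \<le> s" "s \<le> T"
    have "(u1 s x)\<^sup>2 \<le> N s"
      using L2_AC_sup_bound[OF uD(2,4,5)[OF s(1)], of x] by (simp add: N_def power2_eq_square)
    then show "\<bar>u1 s x\<bar> \<le> sqrt K" using K(2)[of s] s by (intro real_le_rsqrt) auto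
  qed (use K in auto)
qed

text \<open>The momentum solves \<open>m\<^sub>t + u m\<^sub>x + 2 u\<^sub>x m = 0\<close>, so the integral of the square of its
  negative part satisfies a Gronwall inequality.\<close>

lemma momentum_sign:
  fixes \<sigma> :: real
  assumes init: "\<And>x. \<sigma> * (u 0 x - l\<^sup>2 * u2 0 x) \<ge> 0" and t: "t \<ge> 0"
  shows "\<sigma> * (u t x - l\<^sup>2 * u2 t x) \<ge> 0"
proof -
  define m where "m t x = \<sigma> * (u t x - l\<^sup>2 * u2 t x)" for t x
  define m' where "m' t x = \<sigma> * (v t x - l\<^sup>2 * v2 t x)" for t x
  define m1 where "m1 t x = \<sigma> * (u1 t x - l\<^sup>2 * u3 t x)" for t x
  define J where "J a = (min a 0)\<^sup>2" for a :: real
  define M where "M t = (LINT x|lebesgue. J (m t x))" for t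
  have cJ: "continuous_on UNIV J" unfolding J_def[abs_def] by (intro continuous_intros)
  have mL: "m t \<in> L2" and cm: "continuous_on A (m t)" if t: "t \<ge> 0" for t A
    unfolding m_def[abs_def] using uD[OF t] u1D(8)[OF t] by (auto intro!: L2_cmult L2_diff continuous_intros)
  have ACm: "AC_deriv (m t) (m1 t)" if t: "t \<ge> 0" for t
    unfolding m_def[abs_def] m1_def[abs_def] using uD(6)[OF t] u1D(2)[OF t] by (intro AC_deriv_cmult AC_deriv_diff)
  have Jle: "J a \<le> a\<^sup>2" "J a \<ge> 0" for a by (auto simp: J_def min_def)
  have cJm: "continuous_on UNIV (\<lambda>x. J (m t x))" if "t \<ge> 0" for t
    by (rule continuous_on_compose2[OF cJ cm[OF that]]) auto
  have Ji: "integrable lebesgue (\<lambda>x. J (m t x))" if t: "t \<ge> 0" for t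
  proof (rule Bochner_Integration.integrable_bound[OF L2_D(2)[OF mL[OF t]]])
    show "(\<lambda>x. J (m t x)) \<in> borel_measurable lebesgue" by (rule continuous_lebesgue_measurable[OF cJm[OF t]])
    show "AE x in lebesgue. norm (J (m t x)) \<le> norm ((m t x)\<^sup>2)" using Jle by simp
  qed
  have mnL: "(\<lambda>x. 2 * min (m t x) 0) \<in> L2" if t: "t \<ge> 0" for t
  proof -
    have "(\<lambda>x. min (m t x) 0) \<in> L2"
      unfolding L2_def
    proof (intro CollectI conjI)
      show "(\<lambda>x. min (m t x) 0) \<in> borel_measurable lebesgue"
        by (intro continuous_lebesgue_measurable continuous_intros cm t)
      show "integrable lebesgue (\<lambda>x. (min (m t x) 0)\<^sup>2)" using Ji[OF t] by (simp add: J_def)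
    qed
    then show ?thesis by (rule L2_cmult)
  qed
  have mdiff: "L2_tendsto (\<lambda>s x. (m s x - m t x) / (s - t)) (m' t) (at0 t)" if t: "t \<ge> 0" for t
  proof -
    have "L2_tendsto (\<lambda>s x. \<sigma> * ((u s x - u t x) / (s - t) + (- l\<^sup>2) * ((u2 s x - u2 t x) / (s - t))))
       (\<lambda>x. \<sigma> * (v t x + (- l\<^sup>2) * v2 t x)) (at0 t)"
      by (intro L2_tendsto_cmult L2_tendsto_add diff t)
    moreover have "(\<lambda>s x. \<sigma> * ((u s x - u t x) / (s - t) + (- l\<^sup>2) * ((u2 s x - u2 t x) / (s - t))))
       = (\<lambda>s x. (m s x - m t x) / (s - t))"
      by (auto simp: fun_eq_iff m_def divide_inverse algebra_simps)
    ultimately show ?thesis by (simp add: m'_def[abs_def])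
  qed
  have Md: "(M has_real_derivative (LINT x|lebesgue. m' t x * (2 * min (m t x) 0))) (at0 t)" if t: "t \<ge> 0" for t
  proof (rule has_derivative_at0I[OF t, where g = "\<lambda>s. (M s - M t) / (s - t)"])
    let ?D = "\<lambda>s x. (m s x - m t x) / (s - t)"
    define g where "g s = (LINT x|lebesgue. ?D s x * (2 * min (m t x) 0))" for s
    have g: "(g \<longlongrightarrow> (LINT x|lebesgue. m' t x * (2 * min (m t x) 0))) (at0 t)"
      unfolding g_def by (intro L2_tendsto_integral mdiff t L2_tendsto_const mnL)
    \<comment> \<open>The quadratic remainder contributes at most \<open>\<bar>s - t\<bar>\<close>
      times the squared norm of the difference quotient of \<open>m\<close>, and that norm
      converges.\<close>
    have "((\<lambda>s. (M s - M t) / (s - t) - g s) \<longlongrightarrow> 0) (at0 t)"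
    proof (rule Lim_null_comparison)
      show "((\<lambda>s. \<bar>s - t\<bar> * (LINT x|lebesgue. ?D s x * ?D s x)) \<longlongrightarrow> 0) (at0 t)"
        using tendsto_mult[OF tendsto_rabs_zero[OF tendsto_at0_diff] L2_tendsto_integral[OF mdiff[OF t] mdiff[OF t]]] by simp
      show "\<forall>\<^sub>F s in at0 t. norm ((M s - M t) / (s - t) - g s) \<le> \<bar>s - t\<bar> * (LINT x|lebesgue. ?D s x * ?D s x)"
        using eventually_at0[OF t]
      proof eventually_elim
        case (elim s)
        then have s: "s \<ge> 0" "s \<noteq> t" by auto
        have DL: "?D s \<in> L2" using L2_cmult[OF L2_diff[OF mL[OF s(1)] mL[OF t]], of "1 / (s - t)"] by simp
        note i1 = Ji[OF s(1)] Ji[OF t] and i2 = L2_prod_integrable[OF DL mnL[OF t]] and i3 = L2_prod_integrable[OF DL DL]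
        have i4: "integrable lebesgue (\<lambda>x. (J (m s x) - J (m t x)) / (s - t))" using i1 by simp
        have "(M s - M t) / (s - t) - g s = (LINT x|lebesgue. (J (m s x) - J (m t x)) / (s - t)) - g s"
          using i1 by (simp add: M_def)
        also have "\<dots> = (LINT x|lebesgue. (J (m s x) - J (m t x)) / (s - t) - ?D s x * (2 * min (m t x) 0))"
          unfolding g_def by (rule Bochner_Integration.integral_diff[OF i4 i2, symmetric])
        finally have eq: "(M s - M t) / (s - t) - g s = (LINT x|lebesgue. (J (m s x) - J (m t x)) / (s - t) - ?D s x * (2 * min (m t x) 0))" .
        have "norm (LINT x|lebesgue. (J (m s x) - J (m t x)) / (s - t) - ?D s x * (2 * min (m t x) 0))
            \<le> (LINT x|lebesgue. \<bar>s - t\<bar> * (?D s x * ?D s x))"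
        proof (rule Bochner_Integration.integral_norm_bound_integral)
          show "integrable lebesgue (\<lambda>x. (J (m s x) - J (m t x)) / (s - t) - ?D s x * (2 * min (m t x) 0))"
            by (rule Bochner_Integration.integrable_diff[OF i4 i2])
          show "integrable lebesgue (\<lambda>x. \<bar>s - t\<bar> * (?D s x * ?D s x))" using i3 by (rule integrable_mult_right)
          fix x
          have "(J (m s x) - J (m t x)) / (s - t) - ?D s x * (2 * min (m t x) 0)
             = (J (m s x) - J (m t x) - 2 * min (m t x) 0 * (m s x - m t x)) / (s - t)"
            by (simp add: divide_inverse algebra_simps)
          then have "norm ((J (m s x) - J (m t x)) / (s - t) - ?D s x * (2 * min (m t x) 0))
             \<le> (m s x - m t x)\<^sup>2 / \<bar>s - t\<bar>"
            using neg_part_square_expansion[of "m s x" "m t x"] by (simp add: J_def abs_divide divide_right_mono)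
          also have "\<dots> = \<bar>s - t\<bar> * (?D s x * ?D s x)"
          proof -
            have "a\<^sup>2 / \<bar>d\<bar> = \<bar>d\<bar> * (a / d * (a / d))" if "d \<noteq> 0" for a d :: real
              using that by (cases "d > 0") (simp_all add: power2_eq_square field_simps)
            then show ?thesis using s by simp
          qed
          finally show "norm ((J (m s x) - J (m t x)) / (s - t) - ?D s x * (2 * min (m t x) 0)) \<le> \<bar>s - t\<bar> * (?D s x * ?D s x)" .
        qed
        then show ?case by (simp only: eq integral_mult_right_zero)
      qed
    qed
    from tendsto_add[OF this g] show "((\<lambda>s. (M s - M t) / (s - t)) \<longlongrightarrow> (LINT x|lebesgue. m' t x * (2 * min (m t x) 0))) (at0 t)"
      by simp
  qed simp
  \<comment> \<open>With \<open>J' m = 2 J\<close>, the transport term gives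
    \<open>- u J\<^sub>x\<close> and the stretching term \<open>- 4 u\<^sub>x J\<close>. Integration
    by parts returns one \<open>u\<^sub>x J\<close>, whence the factor \<open>- 3\<close>.\<close>
  have Md2: "(LINT x|lebesgue. m' t x * (2 * min (m t x) 0)) = - 3 * (LINT x|lebesgue. u1 t x * J (m t x))" if t: "t \<ge> 0" for t
  proof -
    obtain C where C: "\<And>x. \<bar>u t x\<bar> \<le> C" "\<And>x. \<bar>u1 t x\<bar> \<le> C" by (rule H2_fun_bounded[OF H(1)[OF t]]) blast
    have cu: "continuous_on UNIV (u t)" "continuous_on UNIV (u1 t)" using uD(7,8)[OF t] by auto
    note um = continuous_lebesgue_measurable[OF cu(1)]
    have ACJ: "AC_deriv (\<lambda>x. J (m t x)) (\<lambda>x. 2 * min (m t x) 0 * m1 t x)"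
      by (rule AC_deriv_chain[OF ACm[OF t]]) (auto simp: J_def[abs_def] neg_part_square_deriv intro!: continuous_intros)
    have AC: "AC_deriv (\<lambda>x. u t x * J (m t x)) (\<lambda>x. u1 t x * J (m t x) + u t x * (2 * min (m t x) 0 * m1 t x))"
      by (rule AC_deriv_mult[OF uD(6)[OF t] ACJ])
    have m1L: "m1 t \<in> L2" unfolding m1_def[abs_def] using uD(4)[OF t] u1D(5)[OF t] by (intro L2_cmult L2_diff)
    have i1: "integrable lebesgue (\<lambda>x. u1 t x * J (m t x))" "integrable lebesgue (\<lambda>x. u t x * J (m t x))"
      by (rule integrable_bounded_continuous_mult[OF Ji[OF t]], fact, fact)+
    have i2: "integrable lebesgue (\<lambda>x. u t x * (2 * min (m t x) 0 * m1 t x))"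
      by (rule integrable_bounded_continuous_mult[OF L2_prod_integrable[OF mnL[OF t] m1L] cu(1) C(1)])
    have "(LINT x|lebesgue. u1 t x * J (m t x) + u t x * (2 * min (m t x) 0 * m1 t x)) = 0"
      by (rule AC_deriv_integral_zero[OF AC i1(2)]) (use i1 i2 in auto)
    then have z: "(LINT x|lebesgue. u t x * (2 * min (m t x) 0 * m1 t x)) = - (LINT x|lebesgue. u1 t x * J (m t x))"
      using i1 i2 by simp
    have "(LINT x|lebesgue. m' t x * (2 * min (m t x) 0)) = (LINT x|lebesgue. - (u t x * (2 * min (m t x) 0 * m1 t x)) - 4 * (u1 t x * J (m t x)))"
    proof (rule integral_cong_AE)
      have "m' t \<in> L2" unfolding m'_def[abs_def] using vD(3,5)[OF t] by (intro L2_cmult L2_diff)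
      then show "(\<lambda>x. m' t x * (2 * min (m t x) 0)) \<in> borel_measurable lebesgue"
        using L2_prod_integrable[OF _ mnL[OF t]] by (intro borel_measurable_integrable) auto
      show "(\<lambda>x. - (u t x * (2 * min (m t x) 0 * m1 t x)) - 4 * (u1 t x * J (m t x))) \<in> borel_measurable lebesgue"
        using i1 i2 by (intro borel_measurable_integrable) auto
      show "AE x in lebesgue. m' t x * (2 * min (m t x) 0) = - (u t x * (2 * min (m t x) 0 * m1 t x)) - 4 * (u1 t x * J (m t x))"
        using v2_eq_AE[OF t]
      proof eventually_elim
        case (elim x)
        have "l\<^sup>2 * v2 t x = l\<^sup>2 * (- 3 * u1 t x * u2 t x - u t x * u3 t x) - (p1 t x - 2 * u t x * u1 t x - l\<^sup>2 * u1 t x * u2 t x)"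
        proof -
          have "c * (A - N / c) = c * A - N" if "c \<noteq> 0" for A N c :: real
            using that by (simp add: right_diff_distrib)
          then show ?thesis unfolding elim using l by (metis less_irrefl power_eq_0_iff)
        qed
        \<comment> \<open>The nonlocal term \<open>p1\<close> occurs in both \<open>v\<close> and
          \<open>l\<^sup>2 v2\<close> and cancels: the momentum satisfies a local equation.\<close>
        then have 0: "v t x - l\<^sup>2 * v2 t x = - u t x * (u1 t x - l\<^sup>2 * u3 t x) - 2 * u1 t x * (u t x - l\<^sup>2 * u2 t x)"
          unfolding v_eq[OF t] by (simp add: power2_eq_square algebra_simps)
        have 1: "m' t x = - u t x * m1 t x - 2 * u1 t x * m t x"
          unfolding m'_def 0 m1_def m_def by (simp add: algebra_simps)
        have 2: "J (m t x) = min (m t x) 0 * m t x" by (auto simp: J_def min_def power2_eq_square)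
        show ?case unfolding 1 2 by (simp add: algebra_simps)
      qed
    qed
    also have "\<dots> = - (LINT x|lebesgue. u t x * (2 * min (m t x) 0 * m1 t x)) - 4 * (LINT x|lebesgue. u1 t x * J (m t x))"
      using i1 i2 by simp
    finally show ?thesis using z by simp
  qed
  obtain C where C: "C > 0" "\<And>s x. 0 \<le> s \<Longrightarrow> s \<le> t \<Longrightarrow> \<bar>u1 s x\<bar> \<le> C"
    by (rule u1_bounded_locally[of t]) blast
  \<comment> \<open>The factor 3 of \<open>Md2\<close> times the slope bound: with this rate the
    integrating factor \<open>exp (- K * t)\<close> makes \<open>M\<close> non-increasing.\<close>
  define K where "K = 3 * C"
  have "M t * exp (- K * t) \<le> M 0 * exp (- K * 0) + 0 * t"
  proof (rule deriv_le_at0[OF t])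
    fix s assume s: "0 \<le> s" "s \<le> t"
    let ?A = "LINT x|lebesgue. u1 s x * J (m s x)"
    show "((\<lambda>s. M s * exp (- K * s)) has_real_derivative (- 3 * ?A) * exp (- K * s) + exp (- K * s) * (- K) * M s) (at0 s)"
    proof -
      have "((\<lambda>s. exp (- K * s)) has_real_derivative exp (- K * s) * (- K)) (at0 s)"
        by (auto intro!: derivative_eq_intros)
      from DERIV_mult'[OF Md[OF s(1), unfolded Md2[OF s(1)]] this] show ?thesis
        by (rule DERIV_cong) (simp add: mult.commute mult.left_commute)
    qed
    have "- ?A \<le> C * M s"
    proof -
      have "(LINT x|lebesgue. (- u1 s x) * J (m s x)) \<le> (LINT x|lebesgue. C * J (m s x))"
      proof (intro integral_mono mult_right_mono Jle integrable_mult_right Ji s)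
        show "integrable lebesgue (\<lambda>x. - u1 s x * J (m s x))"
          by (rule integrable_bounded_continuous_mult[OF Ji[OF s(1)], of _ C])
             (use uD(8)[OF s(1)] C(2)[OF s] in \<open>auto intro!: continuous_intros\<close>)
        show "- u1 s x \<le> C" for x using C(2)[OF s, of x] by linarith
      qed
      then show ?thesis by (simp add: M_def)
    qed
    then have "(- 3 * ?A - K * M s) * exp (- K * s) \<le> 0"
      by (intro mult_nonpos_nonneg) (auto simp: K_def)
    then show "(- 3 * ?A) * exp (- K * s) + exp (- K * s) * (- K) * M s \<le> 0"
      by (simp add: algebra_simps)
  qed
  moreover have "M 0 = 0" using init by (simp add: M_def J_def m_def)
  ultimately have "M t * exp (- K * t) \<le> 0" by simp
  then have "M t \<le> 0" using exp_gt_zero[of "- K * t"] by (simp add: mult_le_0_iff)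
  moreover have "M t \<ge> 0" using Jle by (simp add: M_def)
  ultimately have "M t = 0" by simp
  then have "AE x in lebesgue. J (m t x) = 0"
    using integral_nonneg_eq_0_iff_AE[OF Ji[OF t]] Jle by (simp add: M_def)
  \<comment> \<open>A closed set of full measure is the whole line, so the sign holds at every
    point.\<close>
  moreover have "closed {x. J (m t x) = 0}" by (intro closed_Collect_eq cJm t) auto
  ultimately have "x \<in> {x. J (m t x) = 0}" by (intro mem_closed_if_AE_lebesgue) auto
  then show ?thesis by (auto simp: J_def m_def min_def split: if_splits)
qed

text \<open>The momentum factors as
  \<open>(1 - l \<partial>\<^sub>x)(1 + l \<partial>\<^sub>x) u\<close>. Its sign makes
  \<open>exp (- x / l) * (\<sigma> * (u + l u\<^sub>x))\<close> decreasing with limit 0 at plus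
  infinity, and \<open>exp (x / l) * (\<sigma> * (u - l u\<^sub>x))\<close> increasing with limit 0
  at minus infinity; both are therefore non-negative.\<close>

lemma slope_bound:
  fixes \<sigma> :: real
  assumes m: "\<And>x. \<sigma> * (u t x - l\<^sup>2 * u2 t x) \<ge> 0" and t: "t \<ge> 0"
  shows "l * \<bar>\<sigma> * u1 t x\<bar> \<le> \<sigma> * u t x"
proof -
  obtain C where C: "C > 0" "\<And>x. \<bar>u t x\<bar> \<le> C" "\<And>x. \<bar>u1 t x\<bar> \<le> C" by (rule H2_fun_bounded[OF H(1)[OF t]]) blast
  define f g where "f x = exp (- x / l) * (\<sigma> * (u t x + l * u1 t x))"
    and "g x = exp (x / l) * (\<sigma> * (u t x - l * u1 t x))" for x
  have fd: "(f has_real_derivative - (exp (- x / l) * (\<sigma> * (u t x - l\<^sup>2 * u2 t x)) / l)) (at x)" for x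
    unfolding f_def[abs_def] using l
    by (auto intro!: derivative_eq_intros uD(1) u1D(1) t simp: power2_eq_square field_simps)
  have gd: "(g has_real_derivative exp (x / l) * (\<sigma> * (u t x - l\<^sup>2 * u2 t x)) / l) (at x)" for x
    unfolding g_def[abs_def] using l
    by (auto intro!: derivative_eq_intros uD(1) u1D(1) t simp: power2_eq_square field_simps)
  have fm: "f y \<le> f x" if "x \<le> y" for x y
    using that m l by (intro DERIV_nonpos_imp_nonincreasing[OF that]) (auto intro!: exI conjI fd)
  have gm: "g x \<le> g y" if "x \<le> y" for x y
    using that m l by (intro DERIV_nonneg_imp_nondecreasing[OF that]) (auto intro!: exI conjI gd)
  define K where "K = \<bar>\<sigma>\<bar> * (C + l * C)"
  have bd: "\<bar>\<sigma> * (u t x + l * u1 t x)\<bar> \<le> K" "\<bar>\<sigma> * (u t x - l * u1 t x)\<bar> \<le> K" for x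
  proof -
    have "\<bar>l * u1 t x\<bar> \<le> l * C" using l C(3)[of x] by (simp add: abs_mult)
    then have "\<bar>u t x + l * u1 t x\<bar> \<le> C + l * C" "\<bar>u t x - l * u1 t x\<bar> \<le> C + l * C"
      using C(2)[of x] by linarith+
    then show "\<bar>\<sigma> * (u t x + l * u1 t x)\<bar> \<le> K" "\<bar>\<sigma> * (u t x - l * u1 t x)\<bar> \<le> K"
      unfolding K_def abs_mult by (intro mult_left_mono; simp)+
  qed
  have 1: "((\<lambda>x. K * exp (- x / l)) \<longlongrightarrow> 0) at_top"
  proof -
    have "filterlim (\<lambda>x. - (x * (1 / l))) at_bot at_top"
      using l filterlim_tendsto_pos_mult_at_top[OF tendsto_const[of "1/l"] _ filterlim_ident]
      by (auto simp: filterlim_uminus_at_top[symmetric] mult.commute filterlim_uminus_at_bot)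
    then have "((\<lambda>x. exp (- (x * (1 / l)))) \<longlongrightarrow> 0) at_top"
      by (rule filterlim_compose[OF exp_at_bot])
    then show ?thesis by (auto intro: tendsto_mult_right_zero)
  qed
  have f0: "(f \<longlongrightarrow> 0) at_top"
  proof (rule Lim_null_comparison[OF always_eventually 1], rule allI)
    fix x show "norm (f x) \<le> K * exp (- x / l)"
      using mult_right_mono[OF bd(1)[of x], of "exp (- x / l)"] by (simp add: f_def abs_mult mult.commute)
  qed
  have g0: "(g \<longlongrightarrow> 0) at_bot"
  proof (rule Lim_null_comparison[OF always_eventually], rule allI)
    show "((\<lambda>x. K * exp (x / l)) \<longlongrightarrow> 0) at_bot" using 1 by (simp add: filterlim_at_bot_mirror)
    fix x show "norm (g x) \<le> K * exp (x / l)"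
      using mult_right_mono[OF bd(2)[of x], of "exp (x / l)"] by (simp add: g_def abs_mult mult.commute)
  qed
  have "0 \<le> f x"
    by (rule tendsto_upperbound[OF f0]) (auto intro!: eventually_at_top_linorderI[of x] fm)
  moreover have "0 \<le> g x"
    by (rule tendsto_upperbound[OF g0]) (auto simp: eventually_at_bot_linorder intro!: exI[of _ x] gm)
  ultimately have "0 \<le> \<sigma> * (u t x + l * u1 t x)" "0 \<le> \<sigma> * (u t x - l * u1 t x)"
    by (auto simp: f_def g_def zero_le_mult_iff)
  then have "\<bar>l * (\<sigma> * u1 t x)\<bar> \<le> \<sigma> * u t x" by (simp add: abs_le_iff algebra_simps)
  then show ?thesis using l by (simp add: abs_mult)
qed

text \<open>With \<open>w = \<bar>u\<bar>\<close>, the slope bound gives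
  \<open>p \<le> 3/2 G * w\<^sup>2\<close>, and Young's inequality under the convolution gives
  \<open>3 w (G * w\<^sup>2) \<le> w\<^sup>3 + 2 G * w\<^sup>3\<close>. The convolution preserves
  mass, so this part integrates to \<open>3 \<integral> w\<^sup>3\<close>; the local part of the
  flux is the second half of the cubic density.\<close>

lemma flux_bound:
  fixes \<sigma> :: real
  assumes \<sigma>: "\<bar>\<sigma>\<bar> = 1" and b: "\<And>x. l * \<bar>\<sigma> * u1 t x\<bar> \<le> \<sigma> * u t x" and t: "t \<ge> 0"
  shows "(LINT x|lebesgue. \<bar>flux t x\<bar>) \<le> 3 * (\<sigma> * cubic t)"
proof -
  define w where "w x = \<sigma> * u t x" for x
  have b': "l * \<bar>u1 t x\<bar> \<le> w x" for x using b[of x] \<sigma> by (simp add: w_def abs_mult)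
  have w0: "w x \<ge> 0" for x
  proof -
    have "0 \<le> l * \<bar>u1 t x\<bar>" using l by simp
    then show ?thesis using b'[of x] by linarith
  qed
  have w2: "(w x)\<^sup>2 = (u t x)\<^sup>2" for x
    using \<sigma> by (simp add: w_def power_mult_distrib flip: power2_abs[of \<sigma>])
  have wabs: "\<bar>u t x\<bar> = w x" for x using \<sigma> w0[of x] by (metis abs_mult abs_of_nonneg mult_1 w_def)
  obtain C where C: "\<And>x. \<bar>w x\<bar> \<le> C" by (rule H2_fun_bounded[OF H2_fun_cmult[OF H(1)[OF t], of \<sigma>]]) (auto simp: w_def)
  have cw: "continuous_on UNIV w" unfolding w_def[abs_def] by (intro continuous_intros uD(7) t)
  have u2i: "integrable lebesgue (\<lambda>x. (u t x)\<^sup>2)" "integrable lebesgue (\<lambda>x. (u1 t x)\<^sup>2)"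
    by (rule L2_D(2)[OF uD(3)[OF t]], rule L2_D(2)[OF uD(4)[OF t]])
  have w3: "w x ^ 3 = w x * (u t x)\<^sup>2" for x
    unfolding w2[symmetric] by (simp add: power2_eq_square power3_eq_cube)
  have w3i: "integrable lebesgue (\<lambda>x. w x ^ 3)"
    unfolding w3 by (rule integrable_bounded_continuous_mult[OF u2i(1) cw C])
  have wu1i: "integrable lebesgue (\<lambda>x. w x * (u1 t x)\<^sup>2)"
    by (rule integrable_bounded_continuous_mult[OF u2i(2) cw C])
  have cw3: "continuous_on UNIV (\<lambda>x. w x ^ 3)" by (intro continuous_intros cw)
  have w3nn: "w x ^ 3 \<ge> 0" for x using w0 by simp
  let ?c = "convolution (G_kernel l)"
  \<comment> \<open>The slope bound in the form
    \<open>l\<^sup>2 u\<^sub>x\<^sup>2 \<le> u\<^sup>2\<close> turns the source \<open>q\<close>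
    into at most \<open>3/2 u\<^sup>2\<close>.\<close>
  have pc: "p t x \<le> 3/2 * ?c (\<lambda>x. (u t x)\<^sup>2) x" for x
  proof -
    have "q t x \<le> 3/2 * (u t x)\<^sup>2 + 0 * (u t x)\<^sup>2" for x
    proof -
      have "(l * \<bar>u1 t x\<bar>)\<^sup>2 \<le> (w x)\<^sup>2" using b'[of x] l by (intro power_mono) auto
      then show ?thesis by (simp add: q_def w2 power_mult_distrib)
    qed
    then have "p t x \<le> ?c (\<lambda>x. 3/2 * (u t x)\<^sup>2 + 0 * (u t x)\<^sup>2) x"
      unfolding p_def using u2i by (intro convolution_mono l q_facts t) auto
    then show ?thesis using convolution_linear[OF l u2i(1) u2i(1), of "3/2" 0 x] by linarith
  qed
  have wc: "w x * ?c (\<lambda>x. (u t x)\<^sup>2) x \<le> 1/3 * w x ^ 3 + 2/3 * ?c (\<lambda>x. w x ^ 3) x" for x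
  proof -
    have "w x * ?c (\<lambda>x. (u t x)\<^sup>2) x = (LINT y|lebesgue. w x * (G_kernel l (x - y) * (u t y)\<^sup>2))"
      by (simp add: convolution_def)
    also have "\<dots> \<le> (LINT y|lebesgue. 1/3 * w x ^ 3 * G_kernel l (x - y) + 2/3 * (G_kernel l (x - y) * w y ^ 3))"
    proof (intro integral_mono Bochner_Integration.integrable_add integrable_mult_right convolution_integrand_integrable u2i w3i l G_kernel_integral)
      fix y
      have "G_kernel l (x - y) * (w x * (w y)\<^sup>2) \<le> G_kernel l (x - y) * (1/3 * w x ^ 3 + 2/3 * w y ^ 3)"
        by (intro mult_left_mono young_cubic w0 G_kernel_nonneg l)
      then show "w x * (G_kernel l (x - y) * (u t y)\<^sup>2) \<le> 1/3 * w x ^ 3 * G_kernel l (x - y) + 2/3 * (G_kernel l (x - y) * w y ^ 3)"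
        by (simp add: w2 algebra_simps)
    qed
    also have "\<dots> = 1/3 * w x ^ 3 * (LINT y|lebesgue. G_kernel l (x - y)) + 2/3 * ?c (\<lambda>x. w x ^ 3) x"
      using G_kernel_integral(1)[OF l] convolution_integrand_integrable[OF l w3i] by (simp add: convolution_def)
    also have "1/3 * w x ^ 3 * (LINT y|lebesgue. G_kernel l (x - y)) \<le> 1/3 * w x ^ 3 * 1"
      using G_kernel_integral(2)[OF l] w3nn by (intro mult_left_mono) auto
    finally show ?thesis by simp
  qed
  note c3 = convolution_integrable[OF l cw3 w3i w3nn] convolution_integral[OF l cw3 w3i w3nn]
  have "(LINT x|lebesgue. \<bar>flux t x\<bar>) \<le> (LINT x|lebesgue. w x ^ 3 + 2 * ?c (\<lambda>x. w x ^ 3) x + l\<^sup>2 * (w x * (u1 t x)\<^sup>2))"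
  proof (rule integral_mono)
    show "integrable lebesgue (\<lambda>x. \<bar>flux t x\<bar>)" using flux_integrable[OF t] by (rule integrable_abs)
    show "integrable lebesgue (\<lambda>x. w x ^ 3 + 2 * ?c (\<lambda>x. w x ^ 3) x + l\<^sup>2 * (w x * (u1 t x)\<^sup>2))"
      using c3 w3i wu1i by auto
    fix x
    have "\<bar>flux t x\<bar> \<le> \<bar>2 * (u t x * p t x)\<bar> + \<bar>l\<^sup>2 * (u t x * (u1 t x)\<^sup>2)\<bar>" unfolding flux_def by (rule abs_triangle_ineq)
    also have "\<dots> = 2 * (w x * p t x) + l\<^sup>2 * (w x * (u1 t x)\<^sup>2)"
      using p_facts(1)[OF t, of x] by (simp add: abs_mult wabs)
    finally have "\<bar>flux t x\<bar> \<le> 2 * (w x * p t x) + l\<^sup>2 * (w x * (u1 t x)\<^sup>2)" .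
    moreover have "w x * p t x \<le> w x * (3/2 * ?c (\<lambda>x. (u t x)\<^sup>2) x)" using pc w0 by (intro mult_left_mono)
    moreover have "w x * (3/2 * ?c (\<lambda>x. (u t x)\<^sup>2) x) = 3/2 * (w x * ?c (\<lambda>x. (u t x)\<^sup>2) x)" by simp
    ultimately show "\<bar>flux t x\<bar> \<le> w x ^ 3 + 2 * ?c (\<lambda>x. w x ^ 3) x + l\<^sup>2 * (w x * (u1 t x)\<^sup>2)" using wc[of x] by linarith
  qed
  also have "\<dots> = 3 * (LINT x|lebesgue. w x ^ 3) + l\<^sup>2 * (LINT x|lebesgue. w x * (u1 t x)\<^sup>2)"
    using c3 w3i wu1i by simp
  also have "\<dots> \<le> 3 * ((LINT x|lebesgue. w x ^ 3) + l\<^sup>2 * (LINT x|lebesgue. w x * (u1 t x)\<^sup>2))"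
    using w0 l by (simp add: integral_nonneg)
  also have "(LINT x|lebesgue. w x ^ 3) + l\<^sup>2 * (LINT x|lebesgue. w x * (u1 t x)\<^sup>2) = (LINT x|lebesgue. w x ^ 3 + l\<^sup>2 * (w x * (u1 t x)\<^sup>2))"
    using w3i wu1i by simp
  also have "\<dots> = (LINT x|lebesgue. \<sigma> * (u t x * ((u t x)\<^sup>2 + l\<^sup>2 * (u1 t x)\<^sup>2)))"
    by (intro Bochner_Integration.integral_cong refl, subst w3) (simp add: w_def algebra_simps)
  also have "\<dots> = \<sigma> * cubic t" by (simp add: cubic_def)
  finally show ?thesis .
qed

text \<open>Continuity in time is uniform in space, which together with continuity of each time
  slice gives joint continuity.\<close>

lemma joint_continuity:
  "continuous_on ({0..} \<times> UNIV) (\<lambda>(t, x). u t x)" "continuous_on ({0..} \<times> UNIV) (\<lambda>(t, x). u1 t x)"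
proof -
  have *: "continuous_on ({0..} \<times> UNIV) (\<lambda>(t, x). w t x)"
    if c: "\<And>t. t \<ge> 0 \<Longrightarrow> continuous_on UNIV (w t)"
      and e: "\<And>t. t \<ge> 0 \<Longrightarrow> \<exists>e. (e \<longlongrightarrow> 0) (at0 t) \<and> (\<forall>s\<ge>0. \<forall>x. \<bar>w s x - w t x\<bar> \<le> e s)"
    for w :: "real \<Rightarrow> real \<Rightarrow> real"
    unfolding continuous_on_iff
  proof (intro ballI allI impI)
    fix z :: "real \<times> real" and \<epsilon> :: real
    assume z: "z \<in> {0..} \<times> UNIV" and \<epsilon>: "0 < \<epsilon>"
    obtain t x where zt: "z = (t, x)" by fastforce
    then have t: "t \<ge> 0" using z by auto
    obtain e where e': "(e \<longlongrightarrow> 0) (at0 t)" "\<And>s x. s \<ge> 0 \<Longrightarrow> \<bar>w s x - w t x\<bar> \<le> e s" using e[OF t] by blast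
    have "\<forall>\<^sub>F s in at0 t. e s < \<epsilon> / 2" using e'(1) by (rule order_tendstoD) (use \<epsilon> in simp)
    then obtain d1 where d1: "d1 > 0" "\<And>s. s \<ge> 0 \<Longrightarrow> s \<noteq> t \<Longrightarrow> \<bar>s - t\<bar> < d1 \<Longrightarrow> e s < \<epsilon> / 2"
      unfolding eventually_at dist_real_def by auto
    have "isCont (w t) x" using c[OF t] by (simp add: continuous_on_eq_continuous_at)
    then obtain d2 where d2: "d2 > 0" "\<And>y. \<bar>y - x\<bar> < d2 \<Longrightarrow> \<bar>w t y - w t x\<bar> < \<epsilon> / 2"
      using \<epsilon> unfolding continuous_at_eps_delta dist_real_def by (meson half_gt_zero)
    show "\<exists>d>0. \<forall>z'\<in>{0..} \<times> UNIV. dist z' z < d \<longrightarrow> dist (case z' of (t, x) \<Rightarrow> w t x) (case z of (t, x) \<Rightarrow> w t x) < \<epsilon>"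
    proof (intro exI[of _ "min d1 d2"] conjI ballI impI)
      fix z' :: "real \<times> real" assume z': "z' \<in> {0..} \<times> UNIV" "dist z' z < min d1 d2"
      obtain s y where sy: "z' = (s, y)" by fastforce
      then have s: "s \<ge> 0" using z' by auto
      have "dist s t \<le> dist z' z" "dist y x \<le> dist z' z" unfolding sy zt
        using dist_fst_le[of "(s, y)" "(t, x)"] dist_snd_le[of "(s, y)" "(t, x)"] by auto
      then have d: "\<bar>s - t\<bar> < d1" "\<bar>y - x\<bar> < d2" using z'(2) by (auto simp: dist_real_def)
      have "\<bar>w s y - w t y\<bar> < \<epsilon> / 2"
        using e'(2)[OF s, of y] d1(2)[OF s _ d(1)] \<epsilon> by (cases "s = t") auto
      then have "\<bar>w s y - w t x\<bar> < \<epsilon>" using d2(2)[OF d(2)] by linarith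
      then show "dist (case z' of (t, x) \<Rightarrow> w t x) (case z of (t, x) \<Rightarrow> w t x) < \<epsilon>"
        by (simp add: sy zt dist_real_def)
    qed (use d1 d2 in auto)
  qed
  have "\<exists>e. (e \<longlongrightarrow> 0) (at0 t) \<and> (\<forall>s\<ge>0. \<forall>x. \<bar>u s x - u t x\<bar> \<le> e s)"
    "\<exists>e. (e \<longlongrightarrow> 0) (at0 t) \<and> (\<forall>s\<ge>0. \<forall>x. \<bar>u1 s x - u1 t x\<bar> \<le> e s)" if "t \<ge> 0" for t
    by (rule uniform_cont[OF that], blast)+
  then show "continuous_on ({0..} \<times> UNIV) (\<lambda>(t, x). u t x)" "continuous_on ({0..} \<times> UNIV) (\<lambda>(t, x). u1 t x)"
    using uD(7,8) by (intro *; blast)+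
qed

end

section \<open>Propagation of energy and the weak form\<close>

lemma Cc_infinity_L2_bounded:
  fixes \<zeta> :: "real \<Rightarrow> real"
  assumes "\<zeta> \<in> Cc_infinity"
  obtains C where "\<zeta> \<in> L2" "integrable lebesgue \<zeta>" "C > 0" "\<And>x. \<bar>\<zeta> x\<bar> \<le> C"
proof -
  obtain R where R: "\<And>x. \<zeta> x \<noteq> 0 \<Longrightarrow> norm x \<le> R" by (rule Cc_infinityE[OF assms]) blast
  note c = Cc_infinity_D(1)[OF assms]
  have "integrable lebesgue (\<lambda>x. \<zeta> x * \<zeta> x)" "integrable lebesgue (\<lambda>x. 1 * \<zeta> x)"
    by (rule loc_integrable_mult_integrable[of _ \<zeta> R]; use R c in \<open>auto intro!: loc_integrable_continuous continuous_intros\<close>)+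
  then have L: "\<zeta> \<in> L2" "integrable lebesgue \<zeta>"
    using continuous_lebesgue_measurable[OF c] by (auto simp: L2_def power2_eq_square)
  have "bounded (\<zeta> ` {-R..R})" by (intro compact_imp_bounded compact_continuous_image c) auto
  then obtain C where C: "C > 0" "\<And>x. x \<in> {-R..R} \<Longrightarrow> \<bar>\<zeta> x\<bar> \<le> C" by (auto simp: bounded_pos)
  have "\<bar>\<zeta> x\<bar> \<le> C" for x
    using C(2)[of x] R[of x] C(1) by (cases "\<zeta> x = 0") (auto simp: abs_le_iff)
  then show thesis using that L C(1) by blast
qed

context CH_flow
begin

text \<open>The right-hand side is free of \<open>l\<close>: it is the majorant that makes the tail
  estimate uniform along the sequence.\<close>

lemma cubic_bound_0:
  fixes \<sigma> :: real
  assumes "\<bar>\<sigma>\<bar> = 1" "l \<le> 1"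
  shows "\<sigma> * cubic 0 \<le> (LINT x|lebesgue. \<bar>u 0 x\<bar> * ((u 0 x)\<^sup>2 + (u1 0 x)\<^sup>2))"
proof -
  obtain C where C: "\<And>x. \<bar>u 0 x\<bar> \<le> C" by (rule H2_fun_bounded[OF H(1)[of 0]]) auto
  have i: "integrable lebesgue (\<lambda>x. \<bar>u 0 x\<bar> * ((u 0 x)\<^sup>2 + (u1 0 x)\<^sup>2))"
    by (rule integrable_bounded_continuous_mult[of _ _ C])
       (use C uD(3,4,7)[of 0] L2_D(2) in \<open>auto intro!: continuous_intros\<close>)
  have "\<sigma> * cubic 0 = (LINT x|lebesgue. \<sigma> * (u 0 x * ((u 0 x)\<^sup>2 + l\<^sup>2 * (u1 0 x)\<^sup>2)))"
    by (simp add: cubic_def)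
  also have "\<dots> \<le> (LINT x|lebesgue. \<bar>u 0 x\<bar> * ((u 0 x)\<^sup>2 + (u1 0 x)\<^sup>2))"
  proof (rule integral_mono[OF integrable_mult_right[OF cubic_integrable] i])
    fix x
    have "\<sigma> * (u 0 x * ((u 0 x)\<^sup>2 + l\<^sup>2 * (u1 0 x)\<^sup>2)) \<le> \<bar>\<sigma> * (u 0 x * ((u 0 x)\<^sup>2 + l\<^sup>2 * (u1 0 x)\<^sup>2))\<bar>" by simp
    also have "\<dots> = \<bar>u 0 x\<bar> * ((u 0 x)\<^sup>2 + l\<^sup>2 * (u1 0 x)\<^sup>2)" using assms by (simp add: abs_mult)
    also have "\<dots> \<le> \<bar>u 0 x\<bar> * ((u 0 x)\<^sup>2 + 1 * (u1 0 x)\<^sup>2)"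
      using l assms by (intro mult_left_mono add_left_mono mult_right_mono) (auto simp: power_le_one)
    finally show "\<sigma> * (u 0 x * ((u 0 x)\<^sup>2 + l\<^sup>2 * (u1 0 x)\<^sup>2)) \<le> \<bar>u 0 x\<bar> * ((u 0 x)\<^sup>2 + (u1 0 x)\<^sup>2)" by simp
  qed simp
  finally show ?thesis .
qed

text \<open>Energy enters the outer region only through the flux weighted by the derivative of the
  cutoff, of size \<open>C / R\<close>, and the \<open>L\<^sup>1\<close> norm of the flux is at most
  three times the conserved quantity.\<close>

lemma energy_tail:
  fixes \<sigma> :: real
  assumes \<sigma>: "\<bar>\<sigma>\<bar> = 1" and init: "\<And>x. \<sigma> * (u 0 x - l\<^sup>2 * u2 0 x) \<ge> 0" and R: "R > 0" and t: "t \<ge> 0"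
    and C: "\<And>x. \<bar>deriv (cutoff R) x\<bar> \<le> C / R" and C0: "C \<ge> 0"
  shows "energy (\<lambda>x. 1 - cutoff R x) t \<le> energy (\<lambda>x. 1 - cutoff R x) 0 + C / R * (3 * (\<sigma> * cubic 0)) * t"
proof (rule deriv_le_at0[OF t])
  fix s assume s: "0 \<le> s" "s \<le> t"
  show "(energy (\<lambda>x. 1 - cutoff R x) has_real_derivative (LINT x|lebesgue. - deriv (cutoff R) x * flux s x)) (at0 s)"
  proof (rule energy_deriv[OF s(1), of _ _ 1 "C / R"])
    show "((\<lambda>x. 1 - cutoff R x) has_real_derivative - deriv (cutoff R) x) (at x)" for x
      by (auto intro!: derivative_eq_intros cutoff_deriv)
  qed (use C cutoff_bounds in \<open>auto intro!: continuous_intros continuous_deriv_cutoff simp: abs_le_iff\<close>)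
  have m: "l * \<bar>\<sigma> * u1 s x\<bar> \<le> \<sigma> * u s x" for x
    by (rule slope_bound[OF momentum_sign[OF init s(1)] s(1)])
  have fa: "integrable lebesgue (\<lambda>x. C / R * \<bar>flux s x\<bar>)"
    using flux_integrable[OF s(1)] by (intro integrable_mult_right integrable_abs)
  have "(LINT x|lebesgue. - deriv (cutoff R) x * flux s x) \<le> (LINT x|lebesgue. C / R * \<bar>flux s x\<bar>)"
  proof (rule integral_mono[OF _ fa])
    show "integrable lebesgue (\<lambda>x. - deriv (cutoff R) x * flux s x)"
      by (rule integrable_bounded_continuous_mult[OF flux_integrable[OF s(1)], of _ "C / R"])
         (use C in \<open>auto intro!: continuous_intros continuous_deriv_cutoff\<close>)
    fix x
    have "- deriv (cutoff R) x * flux s x \<le> \<bar>deriv (cutoff R) x\<bar> * \<bar>flux s x\<bar>"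
      by (metis abs_ge_minus_self abs_mult mult_minus_left)
    also have "\<dots> \<le> C / R * \<bar>flux s x\<bar>" by (intro mult_right_mono C) simp
    finally show "- deriv (cutoff R) x * flux s x \<le> C / R * \<bar>flux s x\<bar>" .
  qed
  also have "\<dots> = C / R * (LINT x|lebesgue. \<bar>flux s x\<bar>)" by simp
  also have "\<dots> \<le> C / R * (3 * (\<sigma> * cubic s))"
    using C0 R by (intro mult_left_mono flux_bound[OF \<sigma> m s(1)]) auto
  also have "\<dots> = C / R * (3 * (\<sigma> * cubic 0))" using cubic_const[OF s(1)] by simp
  finally show "(LINT x|lebesgue. - deriv (cutoff R) x * flux s x) \<le> C / R * (3 * (\<sigma> * cubic 0))" .
qed

text \<open>The exact momentum flux \<open>u\<^sup>2 / 2 + p\<close> exceeds the displayed one by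
  \<open>p - q = l\<^sup>2 p\<^sub>x\<^sub>x\<close>. Both derivatives are moved to the test
  function; the sup bound \<open>E / (2 l)\<close> of \<open>p\<close> loses one power of
  \<open>l\<close>, which leaves an error of order \<open>l\<close>. The weight
  \<open>\<eta>\<close> vanishes at both ends, so no boundary terms in time occur.\<close>

lemma weak_form:
  assumes \<zeta>: "\<zeta> \<in> Cc_infinity" and t: "0 \<le> t1" "t1 \<le> t2"
    and \<eta>: "\<And>t. (\<eta> has_real_derivative \<eta>' t) (at t)" "continuous_on UNIV \<eta>'" "\<eta> t1 = 0" "\<eta> t2 = 0" "\<And>t. \<bar>\<eta> t\<bar> \<le> B"
  shows "\<bar>integral {t1..t2} (\<lambda>t. \<eta>' t * (LINT x|lebesgue. u t x * \<zeta> x)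
      + \<eta> t * (LINT x|lebesgue. (3/2 * (u t x)\<^sup>2 + l\<^sup>2 / 2 * (u1 t x)\<^sup>2) * deriv \<zeta> x))\<bar>
     \<le> l * (B * (energy (\<lambda>_. 1) 0 / 2) * (LINT x|lebesgue. \<bar>deriv (deriv (deriv \<zeta>)) x\<bar>) * (t2 - t1))"
proof -
  define Z where "Z = (LINT x|lebesgue. \<bar>deriv (deriv (deriv \<zeta>)) x\<bar>)"
  define E where "E = energy (\<lambda>_. 1) 0"
  define a where "a t = (LINT x|lebesgue. u t x * \<zeta> x)" for t
  define a' where "a' t = (LINT x|lebesgue. v t x * \<zeta> x)" for t
  define b where "b t = (LINT x|lebesgue. (3/2 * (u t x)\<^sup>2 + l\<^sup>2 / 2 * (u1 t x)\<^sup>2) * deriv \<zeta> x)" for t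
  have \<zeta>1: "deriv \<zeta> \<in> Cc_infinity" and \<zeta>2: "deriv (deriv \<zeta>) \<in> Cc_infinity" and \<zeta>3: "deriv (deriv (deriv \<zeta>)) \<in> Cc_infinity"
    by (intro Cc_infinity_deriv \<zeta>)+
  have \<zeta>L: "\<zeta> \<in> L2" by (rule Cc_infinity_L2_bounded[OF \<zeta>])
  obtain D where D: "\<And>x. \<bar>deriv \<zeta> x\<bar> \<le> D" by (rule Cc_infinity_L2_bounded[OF \<zeta>1]) blast
  note \<zeta>1c = Cc_infinity_D(1)[OF \<zeta>1, of UNIV]
  have ad: "(a has_real_derivative a' t) (at0 t)" if t: "t \<ge> 0" for t
  proof (rule has_derivative_at0I[OF t])
    show "((\<lambda>s. LINT x|lebesgue. (u s x - u t x) / (s - t) * \<zeta> x) \<longlongrightarrow> a' t) (at0 t)"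
      unfolding a'_def by (intro L2_tendsto_integral diff t L2_tendsto_const \<zeta>L)
    fix s assume s: "s \<ge> 0" "s \<noteq> t"
    have i: "integrable lebesgue (\<lambda>x. u s x * \<zeta> x)" "integrable lebesgue (\<lambda>x. u t x * \<zeta> x)"
      using s t by (auto intro!: L2_prod_integrable uD(3) \<zeta>L)
    have "(LINT x|lebesgue. (u s x - u t x) / (s - t) * \<zeta> x) = (LINT x|lebesgue. (u s x * \<zeta> x - u t x * \<zeta> x) / (s - t))"
      by (intro Bochner_Integration.integral_cong) (auto simp: left_diff_distrib)
    also have "\<dots> = (a s - a t) / (s - t)" using i by (simp add: a_def)
    finally show "(a s - a t) / (s - t) = (LINT x|lebesgue. (u s x - u t x) / (s - t) * \<zeta> x)" by (rule sym)
  qed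
  have bc: "(b \<longlongrightarrow> b t) (at0 t)" if t: "t \<ge> 0" for t
  proof -
    let ?h = "\<lambda>s. (LINT x|lebesgue. u s x * (deriv \<zeta> x * (3/2 * u s x))) + (LINT x|lebesgue. u1 s x * (deriv \<zeta> x * (l\<^sup>2 / 2 * u1 s x)))"
    note \<zeta>m = continuous_lebesgue_measurable[OF \<zeta>1c]
    have be: "?h s = b s" if s: "s \<ge> 0" for s
    proof -
      have "integrable lebesgue (\<lambda>x. u s x * (deriv \<zeta> x * (3/2 * u s x)))" "integrable lebesgue (\<lambda>x. u1 s x * (deriv \<zeta> x * (l\<^sup>2 / 2 * u1 s x)))"
        by (intro L2_prod_integrable uD(3,4) s L2_mult_bounded[OF _ \<zeta>m D] L2_cmult)+
      then have "?h s = (LINT x|lebesgue. u s x * (deriv \<zeta> x * (3/2 * u s x)) + u1 s x * (deriv \<zeta> x * (l\<^sup>2 / 2 * u1 s x)))"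
        by (rule Bochner_Integration.integral_add[symmetric])
      then show ?thesis unfolding b_def
        by (simp only:) (intro Bochner_Integration.integral_cong refl, simp add: power2_eq_square algebra_simps add_divide_distrib)
    qed
    have "(?h \<longlongrightarrow> ?h t) (at0 t)"
      by (intro tendsto_add L2_tendsto_integral cont t L2_tendsto_mult_const[OF _ D \<zeta>m] L2_tendsto_cmult)
    then have "(?h \<longlongrightarrow> b t) (at0 t)" unfolding be[OF t] .
    moreover have "\<forall>\<^sub>F s in at0 t. ?h s = b s"
      using eventually_at0[OF t] by (rule eventually_mono) (rule be, simp)
    ultimately show ?thesis by (rule Lim_transform_eventually)
  qed
  have key: "\<bar>b t - a' t\<bar> \<le> l / 2 * E * Z" if t: "t \<ge> 0" for t
  proof -
    let ?pp = "\<lambda>x. (p t x - q t x) / l\<^sup>2"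
    have c2: "continuous_on UNIV ?pp" using l by (intro continuous_intros p_facts q_facts t) auto
    have ACp: "AC_deriv (p t) (p1 t)" by (rule AC_derivI_C1[OF p_deriv[OF t] p_facts(3)[OF t]])
    have ACp1: "AC_deriv (p1 t) ?pp" by (rule AC_derivI_C1[OF p1_deriv[OF t] c2])
    have pp: "(LINT x|lebesgue. ?pp x * deriv \<zeta> x) = (LINT x|lebesgue. p t x * deriv (deriv (deriv \<zeta>)) x)"
      using AC_deriv_test[OF ACp1 \<zeta>1] AC_deriv_test[OF ACp \<zeta>2] by simp
    have ACs: "AC_deriv (\<lambda>x. (u t x)\<^sup>2 / 2 + p t x) (\<lambda>x. - v t x)"
      by (rule AC_derivI_C1)
         (use t in \<open>auto intro!: derivative_eq_intros p_deriv uD(1,7,8) p_facts(3) continuous_intros simp: v_eq power2_eq_square\<close>)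
    have "a' t = (LINT x|lebesgue. ((u t x)\<^sup>2 / 2 + p t x) * deriv \<zeta> x)"
      using AC_deriv_test[OF ACs \<zeta>] by (simp add: a'_def)
    also have "\<dots> = (LINT x|lebesgue. (3/2 * (u t x)\<^sup>2 + l\<^sup>2 / 2 * (u1 t x)\<^sup>2) * deriv \<zeta> x + l\<^sup>2 * (?pp x * deriv \<zeta> x))"
    proof (intro Bochner_Integration.integral_cong refl)
      fix x
      have pq: "l\<^sup>2 * (?pp x * deriv \<zeta> x) = (p t x - q t x) * deriv \<zeta> x" using l by simp
      show "((u t x)\<^sup>2 / 2 + p t x) * deriv \<zeta> x
          = (3/2 * (u t x)\<^sup>2 + l\<^sup>2 / 2 * (u1 t x)\<^sup>2) * deriv \<zeta> x + l\<^sup>2 * (?pp x * deriv \<zeta> x)"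
        unfolding pq by (simp add: q_def algebra_simps)
    qed
    also have "\<dots> = b t + l\<^sup>2 * (LINT x|lebesgue. ?pp x * deriv \<zeta> x)"
    proof -
      have "integrable lebesgue (\<lambda>x. (3/2 * (u t x)\<^sup>2 + l\<^sup>2 / 2 * (u1 t x)\<^sup>2) * deriv \<zeta> x)"
        by (intro loc_integrable_mult_test \<zeta>1 loc_integrable_continuous continuous_intros uD(7,8) t)
      moreover have "integrable lebesgue (\<lambda>x. ?pp x * deriv \<zeta> x)"
        by (intro loc_integrable_mult_test \<zeta>1 loc_integrable_continuous c2)
      ultimately show ?thesis unfolding b_def by (simp only: Bochner_Integration.integral_add integrable_mult_right integral_mult_right_zero)
    qed
    finally have eq: "b t - a' t = - l\<^sup>2 * (LINT x|lebesgue. p t x * deriv (deriv (deriv \<zeta>)) x)"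
      unfolding pp by linarith
    have qE: "(LINT x|lebesgue. q t x) \<le> E"
    proof -
      have "(LINT x|lebesgue. q t x) \<le> energy (\<lambda>_. 1) t"
        unfolding energy_def
      proof (rule integral_mono[OF q_facts(2)[OF t]])
        show "integrable lebesgue (\<lambda>x. 1 * ((u t x)\<^sup>2 + l\<^sup>2 * (u1 t x)\<^sup>2))"
          using energy_density_integrable[OF t] by simp
      qed (simp add: q_def)
      then show ?thesis using energy_const[OF t] by (simp add: E_def)
    qed
    have pb: "\<bar>p t x\<bar> \<le> E / (2 * l)" for x
      using p_facts(1,6)[OF t, of x] divide_right_mono[OF qE, of "2 * l"] l by simp
    have \<zeta>i: "integrable lebesgue (deriv (deriv (deriv \<zeta>)))" by (rule Cc_infinity_L2_bounded[OF \<zeta>3])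
    have "\<bar>LINT x|lebesgue. p t x * deriv (deriv (deriv \<zeta>)) x\<bar> \<le> (LINT x|lebesgue. E / (2 * l) * \<bar>deriv (deriv (deriv \<zeta>)) x\<bar>)"
      unfolding real_norm_def[symmetric]
    proof (rule Bochner_Integration.integral_norm_bound_integral)
      show "integrable lebesgue (\<lambda>x. p t x * deriv (deriv (deriv \<zeta>)) x)"
        by (rule integrable_bounded_continuous_mult[OF \<zeta>i p_facts(2)[OF t] pb])
      show "integrable lebesgue (\<lambda>x. E / (2 * l) * norm (deriv (deriv (deriv \<zeta>)) x))"
        using \<zeta>i by (intro integrable_mult_right integrable_norm)
      show "norm (p t x * deriv (deriv (deriv \<zeta>)) x) \<le> E / (2 * l) * norm (deriv (deriv (deriv \<zeta>)) x)" for x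
        unfolding real_norm_def abs_mult by (intro mult_right_mono pb) auto
    qed
    then have "\<bar>LINT x|lebesgue. p t x * deriv (deriv (deriv \<zeta>)) x\<bar> \<le> E / (2 * l) * Z" by (simp add: Z_def)
    then have "l\<^sup>2 * \<bar>LINT x|lebesgue. p t x * deriv (deriv (deriv \<zeta>)) x\<bar> \<le> l\<^sup>2 * (E / (2 * l) * Z)" by (rule mult_left_mono) simp
    also have "\<dots> = l / 2 * E * Z" using l by (simp add: power2_eq_square)
    finally show ?thesis by (simp add: eq abs_mult)
  qed

  have ca: "continuous_on {t1..t2} a" "continuous_on {t1..t2} b"
  proof -
    have "(a \<longlongrightarrow> a s) (at s within {t1..t2})" "(b \<longlongrightarrow> b s) (at s within {t1..t2})" if "s \<in> {t1..t2}" for s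
    proof -
      have s: "s \<ge> 0" using that t by auto
      have "(a \<longlongrightarrow> a s) (at0 s)" using DERIV_continuous[OF ad[OF s]] by (simp add: continuous_within)
      then show "(a \<longlongrightarrow> a s) (at s within {t1..t2})" by (rule tendsto_within_subset) (use t in auto)
      show "(b \<longlongrightarrow> b s) (at s within {t1..t2})" using bc[OF s] by (rule tendsto_within_subset) (use t in auto)
    qed
    then show "continuous_on {t1..t2} a" "continuous_on {t1..t2} b" by (auto simp: continuous_on_def)
  qed
  have c\<eta>: "continuous_on A \<eta>" for A
    using \<eta>(1) by (intro continuous_at_imp_continuous_on) (auto intro: DERIV_isCont)
  have c\<eta>': "continuous_on A \<eta>'" for A using \<eta>(2) continuous_on_subset by blast
  have 1: "((\<lambda>t. \<eta>' t * a t + \<eta> t * a' t) has_integral (\<eta> t2 * a t2 - \<eta> t1 * a t1)) {t1..t2}"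
  proof (rule fundamental_theorem_of_calculus[OF t(2)])
    fix s assume s: "s \<in> {t1..t2}"
    then have "(a has_real_derivative a' s) (at s within {t1..t2})"
      using t by (intro has_field_derivative_subset[OF ad]) auto
    from DERIV_mult[OF has_field_derivative_at_within[OF \<eta>(1)] this]
    show "((\<lambda>t. \<eta> t * a t) has_vector_derivative \<eta>' s * a s + \<eta> s * a' s) (at s within {t1..t2})"
      by (simp flip: has_real_derivative_iff_has_vector_derivative add: mult.commute)
  qed
  have 2: "(\<lambda>t. \<eta>' t * a t + \<eta> t * b t) integrable_on {t1..t2}"
    by (intro integrable_continuous_real continuous_intros ca c\<eta> c\<eta>')
  have 3: "(\<lambda>t. (\<eta>' t * a t + \<eta> t * b t) - (\<eta>' t * a t + \<eta> t * a' t)) integrable_on {t1..t2}"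
    using 1 2 by (intro integrable_diff) auto
  have "norm (integral {t1..t2} (\<lambda>t. (\<eta>' t * a t + \<eta> t * b t) - (\<eta>' t * a t + \<eta> t * a' t))) \<le> integral {t1..t2} (\<lambda>t. B * (l / 2 * E * Z))"
  proof (rule integral_norm_bound_integral[OF 3])
    fix s assume s: "s \<in> {t1..t2}"
    have "norm ((\<eta>' s * a s + \<eta> s * b s) - (\<eta>' s * a s + \<eta> s * a' s)) = \<bar>\<eta> s\<bar> * \<bar>b s - a' s\<bar>"
      by (simp add: abs_mult flip: right_diff_distrib)
    also have "\<dots> \<le> B * (l / 2 * E * Z)"
    proof (rule mult_mono)
      show "0 \<le> B" using \<eta>(5)[of 0] by linarith
    qed (use \<eta>(5) key[of s] s t in auto)
    finally show "norm ((\<eta>' s * a s + \<eta> s * b s) - (\<eta>' s * a s + \<eta> s * a' s)) \<le> B * (l / 2 * E * Z)" .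
  qed (rule integrable_const_ivl)
  also have "integral {t1..t2} (\<lambda>t. (\<eta>' t * a t + \<eta> t * b t) - (\<eta>' t * a t + \<eta> t * a' t)) = integral {t1..t2} (\<lambda>t. \<eta>' t * a t + \<eta> t * b t)"
    using 1 2 \<eta>(3,4) by (subst Henstock_Kurzweil_Integration.integral_diff) (auto simp: integral_unique)
  also have "integral {t1..t2} (\<lambda>t. B * (l / 2 * E * Z)) = (t2 - t1) * (B * (l / 2 * E * Z))"
    using t by simp
  finally have "\<bar>integral {t1..t2} (\<lambda>t. \<eta>' t * a t + \<eta> t * b t)\<bar> \<le> (t2 - t1) * (B * (l / 2 * E * Z))"
    unfolding real_norm_def .
  also have "\<dots> = l * (B * (E / 2) * Z * (t2 - t1))" by simp
  finally show ?thesis by (simp add: a_def b_def E_def Z_def)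
qed

end

text \<open>The first two space derivatives are given as \<open>deriv\<close>, not merely by
  existence: at time 0 they are then those of the datum and the same for all
  \<open>l\<close>.\<close>

lemma CH_solution_flow:
  assumes CH: "CH_solution l u0 U" and l: "l > 0"
  shows "\<exists>u3 v v1 v2. CH_flow l U (\<lambda>t. deriv (U t)) (\<lambda>t. deriv (deriv (U t))) u3 v v1 v2"
proof -
  from CH obtain v where cU: "\<And>t. t \<ge> 0 \<Longrightarrow> continuous_on UNIV (U t)"
    and tU: "time_continuous_H 3 U"
    and cv: "\<And>t. t \<ge> 0 \<Longrightarrow> continuous_on UNIV (v t)" and tv: "time_continuous_H 2 v"
    and td: "has_time_deriv_H 2 U v"
    and eq: "\<And>t x. t \<ge> 0 \<Longrightarrow> v t x + U t x * deriv (U t) x + l\<^sup>2 * deriv (P_term l (U t)) x + deriv (Q_term l (U t)) x = 0"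
    unfolding CH_solution_def by blast
  define u1 where "u1 t = deriv (U t)" for t
  define u2 where "u2 t = deriv (deriv (U t))" for t
  have "\<exists>f3. H2_fun (U t) (u1 t) (u2 t) \<and> H2_fun (u1 t) (u2 t) f3" if t: "t \<ge> 0" for t
  proof -
    obtain f1 f2 f3 where f: "H2_fun (U t) f1 f2" "H2_fun f1 f2 f3"
      using sobolev_H3_H2_fun[OF _ cU[OF t]] tU t by (auto simp: time_continuous_H_def)
    then show ?thesis using H2_fun_deriv by (auto simp: u1_def u2_def)
  qed
  then obtain u3 where H: "\<And>t. t \<ge> 0 \<Longrightarrow> H2_fun (U t) (u1 t) (u2 t)" "\<And>t. t \<ge> 0 \<Longrightarrow> H2_fun (u1 t) (u2 t) (u3 t)"
    by metis
  have "\<exists>f1 f2. H2_fun (v t) f1 f2" if t: "t \<ge> 0" for t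
    using sobolev_H_H2_fun[OF _ _ cv[OF t]] tv t by (auto simp: time_continuous_H_def)
  then obtain v1 v2 where V: "\<And>t. t \<ge> 0 \<Longrightarrow> H2_fun (v t) (v1 t) (v2 t)" by metis
  \<comment> \<open>The squared Sobolev norm is a sum of squared \<open>L\<^sup>2\<close> norms, so
    its convergence to 0 controls each derivative separately.\<close>
  have L2_tendstoI: "L2_tendsto fs f (at0 t)"
    if "t \<ge> 0" "f \<in> L2" "\<And>s. s \<ge> 0 \<Longrightarrow> s \<noteq> t \<Longrightarrow> fs s \<in> L2" "(N \<longlongrightarrow> 0) (at0 t)"
      "\<And>s. s \<ge> 0 \<Longrightarrow> s \<noteq> t \<Longrightarrow> (LINT x|lebesgue. (fs s x - f x)\<^sup>2) \<le> (N s)\<^sup>2"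
    for fs f N and t :: real
    unfolding L2_tendsto_def
  proof (intro conjI that(2))
    show "\<forall>\<^sub>F s in at0 t. fs s \<in> L2" using eventually_at0[OF that(1)] by (rule eventually_mono) (use that(3) in auto)
    show "((\<lambda>s. LINT x|lebesgue. (fs s x - f x)\<^sup>2) \<longlongrightarrow> 0) (at0 t)"
    proof (rule Lim_null_comparison)
      show "\<forall>\<^sub>F s in at0 t. norm (LINT x|lebesgue. (fs s x - f x)\<^sup>2) \<le> (N s)\<^sup>2"
        using eventually_at0[OF that(1)] by (rule eventually_mono) (use that(5) in auto)
      show "((\<lambda>s. (N s)\<^sup>2) \<longlongrightarrow> 0) (at0 t)" using that(4) by (auto intro!: tendsto_eq_intros)
    qed
  qed
  have cont: "L2_tendsto U (U t) (at0 t)" "L2_tendsto u1 (u1 t) (at0 t)" "L2_tendsto u2 (u2 t) (at0 t)" if t: "t \<ge> 0" for t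
  proof -
    have lim: "((\<lambda>s. sobolev_norm 3 (\<lambda>x. U s x - U t x)) \<longlongrightarrow> 0) (at0 t)"
      using tU t by (auto simp: time_continuous_H_def)
    have n: "(sobolev_norm 3 (\<lambda>x. U s x - U t x))\<^sup>2 = (LINT x|lebesgue. (U s x - U t x)\<^sup>2) + (LINT x|lebesgue. (u1 s x - u1 t x)\<^sup>2)
       + (LINT x|lebesgue. (u2 s x - u2 t x)\<^sup>2) + (LINT x|lebesgue. (u3 s x - u3 t x)\<^sup>2)" if s: "s \<ge> 0" for s
      by (rule sobolev_norm_3[OF H2_fun_diff[OF H(1)[OF s] H(1)[OF t]] H2_fun_diff[OF H(2)[OF s] H(2)[OF t]]])
    show "L2_tendsto U (U t) (at0 t)" "L2_tendsto u1 (u1 t) (at0 t)" "L2_tendsto u2 (u2 t) (at0 t)"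
      by (rule L2_tendstoI[OF t _ _ lim]; use t H2_funD(3,4,5)[OF H(1)] n in simp)+
  qed
  have diff: "L2_tendsto (\<lambda>s x. (U s x - U t x) / (s - t)) (v t) (at0 t)"
    "L2_tendsto (\<lambda>s x. (u1 s x - u1 t x) / (s - t)) (v1 t) (at0 t)"
    "L2_tendsto (\<lambda>s x. (u2 s x - u2 t x) / (s - t)) (v2 t) (at0 t)" if t: "t \<ge> 0" for t
  proof -
    have lim: "((\<lambda>s. sobolev_norm 2 (\<lambda>x. (U s x - U t x) / (s - t) - v t x)) \<longlongrightarrow> 0) (at0 t)"
      using td t by (auto simp: has_time_deriv_H_def)
    have D: "H2_fun (\<lambda>x. (U s x - U t x) / (s - t)) (\<lambda>x. (u1 s x - u1 t x) / (s - t)) (\<lambda>x. (u2 s x - u2 t x) / (s - t))" if s: "s \<ge> 0" for s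
      using H2_fun_cmult[OF H2_fun_diff[OF H(1)[OF s] H(1)[OF t]], of "1 / (s - t)"] by simp
    have n: "(sobolev_norm 2 (\<lambda>x. (U s x - U t x) / (s - t) - v t x))\<^sup>2 = (LINT x|lebesgue. ((U s x - U t x) / (s - t) - v t x)\<^sup>2)
       + (LINT x|lebesgue. ((u1 s x - u1 t x) / (s - t) - v1 t x)\<^sup>2) + (LINT x|lebesgue. ((u2 s x - u2 t x) / (s - t) - v2 t x)\<^sup>2)" if s: "s \<ge> 0" for s
      by (rule sobolev_norm_2[OF H2_fun_diff[OF D[OF s] V[OF t]]])
    show "L2_tendsto (\<lambda>s x. (U s x - U t x) / (s - t)) (v t) (at0 t)"
      "L2_tendsto (\<lambda>s x. (u1 s x - u1 t x) / (s - t)) (v1 t) (at0 t)"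
      "L2_tendsto (\<lambda>s x. (u2 s x - u2 t x) / (s - t)) (v2 t) (at0 t)"
      by (rule L2_tendstoI[OF t _ _ lim]; use t H2_funD(3,4,5)[OF V] H2_funD(3,4,5)[OF D] n in simp)+
  qed
  have "v t x + U t x * u1 t x + conv_deriv l (\<lambda>x. (U t x)\<^sup>2 + l\<^sup>2 / 2 * (u1 t x)\<^sup>2) x = 0" if t: "t \<ge> 0" for t x
  proof -
    note D = H2_funD[OF H(1)[OF t]]
    let ?a = "\<lambda>x. (U t x)\<^sup>2" and ?b = "\<lambda>x. 1 / 2 * (u1 t x)\<^sup>2" and ?q = "\<lambda>x. (U t x)\<^sup>2 + l\<^sup>2 / 2 * (u1 t x)\<^sup>2"
    have c: "continuous_on UNIV ?a" "continuous_on UNIV ?b" "continuous_on UNIV ?q"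
      by (intro continuous_intros D(7,8))+
    have i: "integrable lebesgue ?a" "integrable lebesgue ?b" "integrable lebesgue ?q"
      using L2_D(2)[OF D(3)] L2_D(2)[OF D(4)] by auto
    have nn: "?a x \<ge> 0" "?b x \<ge> 0" "?q x \<ge> 0" for x by auto
    have dP: "(P_term l (U t) has_real_derivative deriv (P_term l (U t)) x) (at x)"
      using convolution_deriv[OF l c(2) i(2) nn(2), of x] DERIV_imp_deriv[OF convolution_deriv[OF l c(2) i(2) nn(2), of x]]
      by (simp add: P_term_def u1_def)
    have dQ: "(Q_term l (U t) has_real_derivative deriv (Q_term l (U t)) x) (at x)"
      using convolution_deriv[OF l c(1) i(1) nn(1), of x] DERIV_imp_deriv[OF convolution_deriv[OF l c(1) i(1) nn(1), of x]]
      by (simp add: Q_term_def)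
    have "convolution (G_kernel l) ?q y = l\<^sup>2 * P_term l (U t) y + Q_term l (U t) y" for y
    proof -
      have "convolution (G_kernel l) (\<lambda>x. l\<^sup>2 * ?b x + 1 * ?a x) y = l\<^sup>2 * convolution (G_kernel l) ?b y + 1 * convolution (G_kernel l) ?a y"
        by (rule convolution_linear[OF l i(2,1)])
      moreover have "(\<lambda>x. l\<^sup>2 * ?b x + 1 * ?a x) = ?q" by auto
      ultimately show ?thesis by (simp add: P_term_def Q_term_def u1_def)
    qed
    then have eqf: "convolution (G_kernel l) ?q = (\<lambda>y. l\<^sup>2 * P_term l (U t) y + Q_term l (U t) y)" by (rule ext)
    have "(convolution (G_kernel l) ?q has_real_derivative l\<^sup>2 * deriv (P_term l (U t)) x + deriv (Q_term l (U t)) x) (at x)"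
      unfolding eqf by (intro DERIV_add DERIV_cmult dP dQ)
    then have "conv_deriv l ?q x = l\<^sup>2 * deriv (P_term l (U t)) x + deriv (Q_term l (U t)) x"
      using convolution_deriv[OF l c(3) i(3) nn(3)] DERIV_unique by blast
    then show ?thesis using eq[OF t, of x] by (simp add: u1_def)
  qed
  then have "CH_flow l U u1 u2 u3 v v1 v2"
    using l H V cont diff by unfold_locales
  moreover have "u1 = (\<lambda>t. deriv (U t))" "u2 = (\<lambda>t. deriv (deriv (U t)))" by (auto simp: u1_def u2_def)
  ultimately show ?thesis by auto
qed

section \<open>Test functions on the half plane\<close>

definition halfplane :: "(real \<times> real) measure" where
  "halfplane = lebesgue_on ({0<..} \<times> UNIV)"

lemma halfplane_set [simp, measurable]: "({0<..} \<times> UNIV :: (real \<times> real) set) \<in> sets borel"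
  by (intro borel_open open_Times) auto

lemma halfplane_set_lebesgue [simp]: "({0<..} \<times> UNIV :: (real \<times> real) set) \<in> sets lebesgue"
  by (simp add: sets_completionI_sets)

lemma space_halfplane: "space halfplane = {0<..} \<times> UNIV"
  by (simp add: halfplane_def)

lemma sigma_finite_lebesgue: "sigma_finite_measure (lebesgue :: 'a::euclidean_space measure)"
proof
    obtain A :: "'a set set" where A: "countable A" "A \<subseteq> sets lborel" "\<Union>A = space lborel" "\<forall>a\<in>A. emeasure lborel a \<noteq> \<infinity>"
      using lborel.sigma_finite_countable by blast
    have "A \<subseteq> sets lebesgue" "\<Union>A = space lebesgue" "\<forall>a\<in>A. emeasure lebesgue a \<noteq> \<infinity>"
      using A by (auto simp: sets_completionI_sets subset_iff)
    with A(1) show "\<exists>A :: 'a set set. countable A \<and> A \<subseteq> sets lebesgue \<and> \<Union>A = space lebesgue \<and> (\<forall>a\<in>A. emeasure lebesgue a \<noteq> \<infinity>)"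
      by blast
qed

lemma sigma_finite_halfplane: "sigma_finite_measure halfplane"
  unfolding halfplane_def
  by (intro sigma_finite_measure_restrict_space sigma_finite_lebesgue) simp

lemma continuous_halfplane_measurable:
  fixes F :: "real \<times> real \<Rightarrow> real"
  assumes "continuous_on UNIV F" shows "F \<in> borel_measurable halfplane"
  unfolding halfplane_def
  using assms by (intro measurable_restrict_space1 measurable_completion) (simp add: borel_measurable_continuous_onI)

definition cont_cs :: "('a::euclidean_space \<Rightarrow> real) \<Rightarrow> bool" where
  "cont_cs F \<longleftrightarrow> continuous_on UNIV F \<and> (\<exists>R. \<forall>z. F z \<noteq> 0 \<longrightarrow> norm z \<le> R)"

lemma cont_cs_integrable:
  assumes "cont_cs F" shows "integrable lborel F"
proof -
  obtain R where F: "continuous_on UNIV F" "\<And>z. F z \<noteq> 0 \<Longrightarrow> norm z \<le> R" using assms by (auto simp: cont_cs_def)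
  have "integrable lborel (\<lambda>z. indicator (cball 0 R) z *\<^sub>R F z)"
    using F(1) by (intro borel_integrable_compact) (auto intro: continuous_on_subset)
  moreover have "(\<lambda>z. indicator (cball 0 R) z *\<^sub>R F z) = F"
    using F(2) by (fastforce simp: indicator_def)
  ultimately show ?thesis by simp
qed

lemma cont_cs_halfplane_integrable:
  assumes "cont_cs F" shows "integrable halfplane F"
proof -
  have "integrable lebesgue F" using cont_cs_integrable[OF assms] by (rule integrable_completion[THEN iffD2, rotated]) (use assms in \<open>simp add: cont_cs_def borel_measurable_continuous_onI\<close>)
  then have "integrable lebesgue (\<lambda>z. indicator ({0<..} \<times> UNIV) z *\<^sub>R F z)"
    by (rule integrable_mult_indicator[rotated]) simp
  then show ?thesis
    unfolding halfplane_def by (subst integrable_restrict_space) auto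
qed

lemma integrable_bounded_mult:
  fixes f W :: "'a \<Rightarrow> real"
  assumes f: "integrable N f" and W: "W \<in> borel_measurable N" "\<And>z. z \<in> space N \<Longrightarrow> \<bar>W z\<bar> \<le> C"
  shows "integrable N (\<lambda>z. W z * f z)"
proof (rule Bochner_Integration.integrable_bound[of _ "\<lambda>z. C * f z"])
  show "AE z in N. norm (W z * f z) \<le> norm (C * f z)"
  proof (rule AE_I2)
    fix z assume "z \<in> space N"
    then have "\<bar>W z\<bar> \<le> \<bar>C\<bar>" using W(2)[of z] by linarith
    then show "norm (W z * f z) \<le> norm (C * f z)" by (simp add: abs_mult mult_right_mono)
  qed
  show "(\<lambda>z. W z * f z) \<in> borel_measurable N"
    using W(1) borel_measurable_integrable[OF f] by (rule borel_measurable_times)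
qed (use f in simp)

lemma halfplane_integrable_mult:
  assumes F: "cont_cs F" and W: "W \<in> borel_measurable halfplane" "\<And>z. \<bar>W z\<bar> \<le> C"
  shows "integrable halfplane (\<lambda>z. W z * F z)"
  by (rule integrable_bounded_mult[OF cont_cs_halfplane_integrable[OF F] W])

text \<open>Lebesgue measure on the plane is the completion of a product measure rather than a
  product, so the integral passes to Borel measure before Fubini's theorem is applied.\<close>

lemma halfplane_integral_iterated:
  assumes "cont_cs F"
  shows "(LINT z|halfplane. F z) = (LINT t|lborel. indicator {0<..} t * (LINT x|lborel. F (t, x)))"
proof -
  have Fm: "F \<in> borel_measurable borel" using assms by (simp add: cont_cs_def borel_measurable_continuous_onI)
  have i: "integrable lborel (\<lambda>z. indicator ({0<..} \<times> UNIV) z * F z)"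
    using integrable_mult_indicator[OF _ cont_cs_integrable[OF assms], of "{0<..} \<times> UNIV"] by simp
  have "(LINT z|halfplane. F z) = (LINT z|lebesgue. indicator ({0<..} \<times> UNIV) z * F z)"
    unfolding halfplane_def by (subst integral_restrict_space) auto
  also have "\<dots> = (LINT z|lborel. indicator ({0<..} \<times> UNIV) z * F z)"
    using Fm by (intro integral_completion) auto
  also have "\<dots> = (LINT z|(lborel \<Otimes>\<^sub>M lborel). indicator ({0<..} \<times> UNIV) z * F z)"
    by (simp only: lborel_prod)
  also have "\<dots> = (LINT t|lborel. LINT x|lborel. indicator ({0<..} \<times> UNIV) (t, x) * F (t, x))"
    by (rule lborel_pair.integral_fst'[symmetric]) (use i in \<open>simp only: lborel_prod\<close>)
  also have "\<dots> = (LINT t|lborel. indicator {0<..} t * (LINT x|lborel. F (t, x)))"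
    by (intro Bochner_Integration.integral_cong refl) (auto simp: indicator_def)
  finally show ?thesis .
qed

section \<open>Travelling test functions\<close>

lemma Cc_infinity_cont_cs: "\<phi> \<in> Cc_infinity \<Longrightarrow> cont_cs (\<phi> :: real \<Rightarrow> real)"
  using Cc_infinityE[of \<phi>] Cc_infinity_D(1)[of \<phi> UNIV] unfolding cont_cs_def by metis

definition wave :: "(real \<Rightarrow> real) \<Rightarrow> (real \<Rightarrow> real) \<Rightarrow> real \<Rightarrow> real \<times> real \<Rightarrow> real" where
  "wave \<theta> \<beta> c z = \<theta> (fst z) * \<beta> (snd z - c * fst z)"

lemma cont_cs_wave:
  assumes "cont_cs \<theta>" "cont_cs \<beta>" shows "cont_cs (wave \<theta> \<beta> c)"
proof -
  obtain A B where AB: "\<And>t. \<theta> t \<noteq> 0 \<Longrightarrow> \<bar>t\<bar> \<le> A" "\<And>x. \<beta> x \<noteq> 0 \<Longrightarrow> \<bar>x\<bar> \<le> B"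
    using assms by (auto simp: cont_cs_def)
  have "continuous_on UNIV (wave \<theta> \<beta> c)"
    unfolding wave_def[abs_def] using assms
    by (auto simp: cont_cs_def intro!: continuous_on_mult continuous_intros
        intro: continuous_on_compose2[of UNIV \<theta>] continuous_on_compose2[of UNIV \<beta>])
  moreover have "norm z \<le> A + (B + \<bar>c\<bar> * A)" if "wave \<theta> \<beta> c z \<noteq> 0" for z
  proof -
    have 1: "\<bar>fst z\<bar> \<le> A" "\<bar>snd z - c * fst z\<bar> \<le> B" using that AB by (auto simp: wave_def)
    then have "\<bar>c * fst z\<bar> \<le> \<bar>c\<bar> * A" by (simp add: abs_mult mult_left_mono)
    then have "\<bar>snd z\<bar> \<le> B + \<bar>c\<bar> * A" using 1 by linarith
    then show ?thesis using 1 norm_Pair_le[of "fst z" "snd z"] by simp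
  qed
  ultimately show ?thesis by (auto simp: cont_cs_def)
qed

lemma Cc_infinity_wave:
  assumes "\<theta> \<in> Cc_infinity" "\<beta> \<in> Cc_infinity" shows "wave \<theta> \<beta> c \<in> Cc_infinity"
proof -
  have C: "Ck n \<theta>" "Ck n \<beta>" for n using assms by (auto simp: Cc_infinity_def)
  have "Ck n (\<lambda>z::real \<times> real. \<theta> (fst z) * \<beta> (snd z - c * fst z))" for n
    by (intro Ck_mult Ck_compose[OF C(1)] Ck_compose[OF C(2)] Ck_bounded_linear bounded_linear_fst
        bounded_linear_sub bounded_linear_snd bounded_linear_const_mult)
  moreover obtain R where "\<And>z. wave \<theta> \<beta> c z \<noteq> 0 \<Longrightarrow> norm z \<le> R"
    using cont_cs_wave[OF assms[THEN Cc_infinity_cont_cs], of c] by (auto simp: cont_cs_def)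
  ultimately show ?thesis
    by (intro Cc_infinityI[of _ "cball 0 R"]) (auto simp: wave_def[abs_def])
qed

text \<open>Motion with speed \<open>c\<close> adds \<open>- c\<close> times the space derivative to
  the time derivative; in a conservation law this amounts to replacing the flux by the flux minus
  \<open>c\<close> times the density.\<close>

lemma wave_derivative:
  assumes "\<theta> \<in> Cc_infinity" "\<beta> \<in> Cc_infinity"
  shows "(wave \<theta> \<beta> c has_derivative (\<lambda>h. fst h * (wave (deriv \<theta>) \<beta> c z - c * wave \<theta> (deriv \<beta>) c z)
     + snd h * wave \<theta> (deriv \<beta>) c z)) (at z)"
proof -
  have d1: "((\<lambda>z. \<theta> (fst z)) has_derivative (\<lambda>h. deriv \<theta> (fst z) * fst h)) (at z)" for z :: "real \<times> real"
    by (rule has_derivative_compose[OF has_derivative_fst[OF has_derivative_ident]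
        Cc_infinity_D(2)[OF assms(1), of "fst z", unfolded has_field_derivative_def]])
  have d2: "((\<lambda>z. \<beta> (snd z - c * fst z)) has_derivative (\<lambda>h. deriv \<beta> (snd z - c * fst z) * (snd h - c * fst h))) (at z)" for z :: "real \<times> real"
  proof -
    have "((\<lambda>z::real \<times> real. snd z - c * fst z) has_derivative (\<lambda>h. snd h - c * fst h)) (at z)"
      by (auto intro!: derivative_eq_intros)
    from has_derivative_compose[OF this Cc_infinity_D(2)[OF assms(2), of "snd z - c * fst z", unfolded has_field_derivative_def]]
    show ?thesis .
  qed
  show ?thesis
    unfolding wave_def[abs_def]
    by (rule has_derivative_eq_rhs[OF has_derivative_mult[OF d1 d2]]) (auto simp: fun_eq_iff algebra_simps)
qed

text \<open>Translation invariance makes the inner integral independent of time, whatever the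
  speed.\<close>

lemma wave_integral:
  assumes "cont_cs f" "cont_cs g"
  shows "(LINT z|halfplane. wave f g c z) = (LINT t|lborel. indicator {0<..} t * f t) * (LINT x|lborel. g x)"
proof -
  have shift: "(LINT x|lborel. g (x - c * t)) = (LINT x|lborel. g x)" for t
    using lborel_integral_real_affine[of 1 g "- (c * t)"] by simp
  have "(LINT z|halfplane. wave f g c z) = (LINT t|lborel. indicator {0<..} t * (f t * (LINT x|lborel. g x)))"
    using halfplane_integral_iterated[OF cont_cs_wave[OF assms]] by (simp add: wave_def shift)
  then show ?thesis by (simp flip: mult.assoc)
qed

text \<open>The productions of constant entropies and constant fluxes: the former is exactly
  balanced by the initial term, the latter vanishes. This allows entropy pairs to be changed by
  constants.\<close>

lemma wave_integrals:
  assumes "\<theta> \<in> Cc_infinity" "\<beta> \<in> Cc_infinity"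
  shows "(LINT z|halfplane. wave (deriv \<theta>) \<beta> c z) = - \<theta> 0 * (LINT x|lborel. \<beta> x)"
    and "(LINT z|halfplane. wave \<theta> (deriv \<beta>) c z) = 0"
proof -
  note cs = Cc_infinity_cont_cs[OF assms(1)] Cc_infinity_cont_cs[OF assms(2)]
    Cc_infinity_cont_cs[OF Cc_infinity_deriv[OF assms(1)]] Cc_infinity_cont_cs[OF Cc_infinity_deriv[OF assms(2)]]

  obtain A where A: "A > 0" "\<And>t. \<theta> t \<noteq> 0 \<Longrightarrow> norm t \<le> A" by (rule Cc_infinityE[OF assms(1)]) blast
  obtain A' where A': "\<And>t. deriv \<theta> t \<noteq> 0 \<Longrightarrow> norm t \<le> A'" by (rule Cc_infinityE[OF Cc_infinity_deriv[OF assms(1)]]) blast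
  define T where "T = max A A' + 1"
  have c': "continuous_on {0..T} (deriv \<theta>)" by (rule Cc_infinity_D(1)[OF Cc_infinity_deriv[OF assms(1)]])
  have "(LINT t|lborel. indicator {0<..} t * deriv \<theta> t) = (LINT t|lborel. deriv \<theta> t * indicator {0..T} t)"
  proof (rule integral_cong_AE)
    have "AE t in lborel. t \<noteq> (0::real)" by (rule AE_lborel_singleton)
    then show "AE t in lborel. indicator {0<..} t * deriv \<theta> t = deriv \<theta> t * indicator {0..T} t"
    proof eventually_elim
      case (elim t)
      then show ?case using A'[of t] by (cases "deriv \<theta> t = 0") (auto simp: indicator_def T_def)
    qed
  next
    have "deriv \<theta> \<in> borel_measurable borel" using cs(3) by (simp add: cont_cs_def borel_measurable_continuous_onI)
    then show "(\<lambda>t. indicator {0<..} t * deriv \<theta> t) \<in> borel_measurable lborel"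
      "(\<lambda>t. deriv \<theta> t * indicator {0..T} t) \<in> borel_measurable lborel" by auto
  qed
  also have "\<dots> = (LINT t:{0..T}|lborel. deriv \<theta> t)"
    by (simp add: set_lebesgue_integral_def mult.commute)
  also have "\<dots> = integral {0..T} (deriv \<theta>)"
    using borel_integrable_atLeastAtMost'[OF c'] by (intro set_borel_integral_eq_integral(2))
  also have "\<dots> = \<theta> T - \<theta> 0"
    using A Cc_infinity_D(2)[OF assms(1)]
    by (intro integral_unique fundamental_theorem_of_calculus)
       (auto simp: T_def simp flip: has_real_derivative_iff_has_vector_derivative intro: has_field_derivative_at_within)
  also have "\<theta> T = 0" using A(2)[of T] A(1) by (cases "\<theta> T = 0") (auto simp: T_def)
  finally show "(LINT z|halfplane. wave (deriv \<theta>) \<beta> c z) = - \<theta> 0 * (LINT x|lborel. \<beta> x)"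
    using wave_integral[OF cs(3,2)] by simp
  have "(LINT x|lebesgue. deriv \<beta> x) = 0"
  proof (rule AC_deriv_integral_zero)
    show "AC_deriv \<beta> (deriv \<beta>)"
      by (intro AC_derivI_C1 Cc_infinity_D[OF assms(2)] Cc_infinity_D[OF Cc_infinity_deriv[OF assms(2)]])
    show "integrable lebesgue \<beta>" "integrable lebesgue (deriv \<beta>)"
      using cont_cs_integrable[OF cs(2)] cont_cs_integrable[OF cs(4)] cs
      by (simp_all add: integrable_completion cont_cs_def borel_measurable_continuous_onI)
  qed
  then have "(LINT x|lborel. deriv \<beta> x) = 0"
    using cs(4) by (subst integral_completion[symmetric]) (auto simp: cont_cs_def borel_measurable_continuous_onI)
  then show "(LINT z|halfplane. wave \<theta> (deriv \<beta>) c z) = 0" using wave_integral[OF cs(1,4)] by simp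
qed

section \<open>Entropy solutions of Burgers' equation\<close>

text \<open>The measure is kept abstract because the result serves both the half plane and the
  initial line. Boundedness of \<open>W\<close> and of the parameter range gives the majorant
  \<open>C * \<bar>F z\<bar>\<close> for dominated convergence and for Fubini's theorem.\<close>

lemma parameter_integral_Fubini:
  fixes \<Phi> :: "real \<Rightarrow> real \<Rightarrow> real" and F W :: "'a \<Rightarrow> real"
  assumes sf: "sigma_finite_measure M1" and W: "W \<in> borel_measurable M1" "\<And>z. \<bar>W z\<bar> \<le> M"
    and F: "integrable M1 F" and \<Phi>: "continuous_on UNIV (\<lambda>(k, s). \<Phi> k s)"
    and C: "\<And>k s. \<bar>k\<bar> \<le> M \<Longrightarrow> \<bar>s\<bar> \<le> M \<Longrightarrow> \<bar>\<Phi> k s\<bar> \<le> C"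
  shows "continuous_on {-M..M} (\<lambda>k. LINT z|M1. \<Phi> k (W z) * F z)"
    and "(LINT k:{-M..M}|lborel. LINT z|M1. \<Phi> k (W z) * F z) = (LINT z|M1. (LINT k:{-M..M}|lborel. \<Phi> k (W z)) * F z)"
    and "\<bar>k\<bar> \<le> M \<Longrightarrow> integrable M1 (\<lambda>z. \<Phi> k (W z) * F z)"
proof -
  interpret pair_sigma_finite M1 lborel
    using sf by (simp add: pair_sigma_finite_def lborel.sigma_finite_measure_axioms)
  have \<Phi>m: "(\<lambda>(k, s). \<Phi> k s) \<in> borel_measurable (borel \<Otimes>\<^sub>M borel)"
    using borel_measurable_continuous_onI[OF \<Phi>] by (simp add: borel_prod)
  have Wm: "(\<lambda>z. \<Phi> k (W z)) \<in> borel_measurable M1" for k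
    using measurable_compose[OF measurable_Pair[OF measurable_const W(1)] \<Phi>m, of k] by simp
  have bd: "\<bar>\<Phi> k (W z) * F z\<bar> \<le> C * \<bar>F z\<bar>" if "\<bar>k\<bar> \<le> M" for k z
    using C[OF that W(2)] by (simp add: abs_mult mult_right_mono)
  show i: "integrable M1 (\<lambda>z. \<Phi> k (W z) * F z)" if k: "\<bar>k\<bar> \<le> M" for k
  proof (rule Bochner_Integration.integrable_bound[of _ "\<lambda>z. C * \<bar>F z\<bar>"])
    show "(\<lambda>z. \<Phi> k (W z) * F z) \<in> borel_measurable M1" using Wm F by auto
    show "AE z in M1. norm (\<Phi> k (W z) * F z) \<le> norm (C * \<bar>F z\<bar>)"
      using bd[OF k] by (intro AE_I2) (metis abs_ge_self order_trans real_norm_def)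
  qed (use F in simp)
  show "continuous_on {-M..M} (\<lambda>k. LINT z|M1. \<Phi> k (W z) * F z)"
    unfolding continuous_on_sequentially
  proof (intro allI ballI impI)
    fix X :: "nat \<Rightarrow> real" and a assume X: "a \<in> {-M..M}" "(\<forall>n. X n \<in> {-M..M}) \<and> X \<longlonglongrightarrow> a"
    have "(\<lambda>n. LINT z|M1. \<Phi> (X n) (W z) * F z) \<longlonglongrightarrow> (LINT z|M1. \<Phi> a (W z) * F z)"
    proof (rule integral_dominated_convergence[where w = "\<lambda>z. C * \<bar>F z\<bar>"])
      show "AE z in M1. (\<lambda>n. \<Phi> (X n) (W z) * F z) \<longlonglongrightarrow> \<Phi> a (W z) * F z"
      proof (rule AE_I2)
        fix z
        have "(\<lambda>n. (X n, W z)) \<longlonglongrightarrow> (a, W z)" using X by (intro tendsto_Pair) auto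
        from continuous_on_tendsto_compose[OF \<Phi> this]
        have "(\<lambda>n. \<Phi> (X n) (W z)) \<longlonglongrightarrow> \<Phi> a (W z)" by simp
        then show "(\<lambda>n. \<Phi> (X n) (W z) * F z) \<longlonglongrightarrow> \<Phi> a (W z) * F z" by (intro tendsto_intros)
      qed
      show "AE z in M1. norm (\<Phi> (X n) (W z) * F z) \<le> C * \<bar>F z\<bar>" for n
      proof (rule AE_I2)
        have "X n \<in> {-M..M}" using X by blast
        then have "\<bar>X n\<bar> \<le> M" by (simp add: abs_le_iff)
        then show "norm (\<Phi> (X n) (W z) * F z) \<le> C * \<bar>F z\<bar>" for z using bd by simp
      qed
    qed (use F Wm in auto)
    then show "((\<lambda>k. LINT z|M1. \<Phi> k (W z) * F z) \<circ> X) \<longlonglongrightarrow> (LINT z|M1. \<Phi> a (W z) * F z)"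
      by (simp add: o_def)
  qed
  define f where "f z k = indicator {-M..M} k * (\<Phi> k (W z) * F z)" for z k
  have gi: "integrable (M1 \<Otimes>\<^sub>M lborel) (\<lambda>(z, k). indicator {-M..M} k * (C * \<bar>F z\<bar>))"
  proof (rule Fubini_integrable)
    show "(\<lambda>(z, k). indicator {-M..M} k * (C * \<bar>F z\<bar>)) \<in> borel_measurable (M1 \<Otimes>\<^sub>M lborel)"
      using F by measurable
    show "AE z in M1. integrable lborel (\<lambda>k. case (z, k) of (z, k) \<Rightarrow> indicator {-M..M} k * (C * \<bar>F z\<bar>))"
      by (intro AE_I2) (auto intro!: integrable_mult_left integrable_real_indicator simp: emeasure_lborel_Icc_eq)
    have "(LINT k|lborel. norm (case (z, k) of (z, k) \<Rightarrow> indicator {-M..M} k * (C * \<bar>F z\<bar>)))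
       = measure lborel {-M..M} * (\<bar>C\<bar> * \<bar>F z\<bar>)" for z
      by (simp add: abs_mult)
    then show "integrable M1 (\<lambda>z. LINT k|lborel. norm (case (z, k) of (z, k) \<Rightarrow> indicator {-M..M} k * (C * \<bar>F z\<bar>)))"
      using F by simp
  qed
  have fi: "integrable (M1 \<Otimes>\<^sub>M lborel) (\<lambda>(z, k). f z k)"
  proof (rule Bochner_Integration.integrable_bound[OF gi])
    have "(\<lambda>x. (case (snd x, W (fst x)) of (k, s) \<Rightarrow> \<Phi> k s)) \<in> borel_measurable (M1 \<Otimes>\<^sub>M lborel)"
      by (rule measurable_compose[OF measurable_Pair \<Phi>m]) (use W(1) in auto)
    then show "(\<lambda>(z, k). f z k) \<in> borel_measurable (M1 \<Otimes>\<^sub>M lborel)"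
      unfolding f_def case_prod_beta using F by auto
    show "AE x in M1 \<Otimes>\<^sub>M lborel. norm (case x of (z, k) \<Rightarrow> f z k) \<le> norm (case x of (z, k) \<Rightarrow> indicator {-M..M} k * (C * \<bar>F z\<bar>))"
    proof (intro AE_I2, clarify)
      fix z k show "norm (f z k) \<le> norm (indicator {-M..M} k * (C * \<bar>F z\<bar>))"
        using bd[of k z] by (auto simp: f_def indicator_def abs_le_iff)
    qed
  qed
  have "(LINT k|lborel. LINT z|M1. f z k) = (LINT z|M1. LINT k|lborel. f z k)"
    by (rule Fubini_integral[OF fi])
  moreover have "(LINT k|lborel. LINT z|M1. f z k) = (LINT k:{-M..M}|lborel. LINT z|M1. \<Phi> k (W z) * F z)"
    by (simp add: f_def set_lebesgue_integral_def)
  moreover have "(LINT z|M1. LINT k|lborel. f z k) = (LINT z|M1. (LINT k:{-M..M}|lborel. \<Phi> k (W z)) * F z)"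
    unfolding f_def set_lebesgue_integral_def by (simp flip: mult.assoc)
  ultimately show "(LINT k:{-M..M}|lborel. LINT z|M1. \<Phi> k (W z) * F z) = (LINT z|M1. (LINT k:{-M..M}|lborel. \<Phi> k (W z)) * F z)"
    by simp
qed

text \<open>The Kruzhkov flux \<open>sgn (s - k) * (3/2 * s\<^sup>2 - 3/2 * k\<^sup>2)\<close>,
  rewritten without the sign function so that joint continuity in \<open>k\<close> and
  \<open>s\<close> is visible.\<close>

definition kruzhkov_flux :: "real \<Rightarrow> real \<Rightarrow> real" where
  "kruzhkov_flux k s = 3/2 * (\<bar>s - k\<bar> * (s + k))"

text \<open>As a function of \<open>s\<close>, \<open>\<bar>s - k\<bar>\<close> has second
  derivative twice a point mass at \<open>k\<close>, so its average over \<open>k\<close> is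
  \<open>s\<^sup>2\<close> up to a constant; the flux averages accordingly to
  \<open>2 * s ^ 3\<close>.\<close>

lemma kruzhkov_integrals:
  assumes "\<bar>s\<bar> \<le> M"
  shows "(LINT k:{-M..M}|lborel. \<bar>s - k\<bar>) = s\<^sup>2 + M\<^sup>2"
    and "(LINT k:{-M..M}|lborel. kruzhkov_flux k s) = 2 * s ^ 3"
proof -
  have s: "-M \<le> s" "s \<le> M" using assms by auto
  have a: "((\<lambda>k. \<bar>s - k\<bar>) has_integral ((s * s - s\<^sup>2 / 2) - (s * (-M) - (-M)\<^sup>2 / 2))) {-M..s}"
    by (rule has_integral_eq[of _ "\<lambda>k. s - k"], simp, rule fundamental_theorem_of_calculus[OF s(1)])
       (auto intro!: derivative_eq_intros simp flip: has_real_derivative_iff_has_vector_derivative)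
  have b: "((\<lambda>k. \<bar>s - k\<bar>) has_integral ((M\<^sup>2 / 2 - s * M) - (s\<^sup>2 / 2 - s * s))) {s..M}"
    by (rule has_integral_eq[of _ "\<lambda>k. k - s"], simp, rule fundamental_theorem_of_calculus[OF s(2)])
       (auto intro!: derivative_eq_intros simp flip: has_real_derivative_iff_has_vector_derivative)
  have ci: "continuous_on {-M..M} (\<lambda>k. \<bar>s - k\<bar>)" "continuous_on {-M..M} (\<lambda>k. kruzhkov_flux k s)"
    unfolding kruzhkov_flux_def by (intro continuous_intros)+
  have "((\<lambda>k. \<bar>s - k\<bar>) has_integral s\<^sup>2 + M\<^sup>2) {-M..M}"
    using has_integral_combine[OF s a b] by (simp add: power2_eq_square algebra_simps)
  then show "(LINT k:{-M..M}|lborel. \<bar>s - k\<bar>) = s\<^sup>2 + M\<^sup>2"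
    using set_borel_integral_eq_integral(2)[OF borel_integrable_atLeastAtMost'[OF ci(1)]] by (simp add: integral_unique)
  have a: "((\<lambda>k. kruzhkov_flux k s) has_integral ((3/2 * (s\<^sup>2 * s - s ^ 3 / 3)) - (3/2 * (s\<^sup>2 * (-M) - (-M) ^ 3 / 3)))) {-M..s}"
    by (rule has_integral_eq[of _ "\<lambda>k. 3/2 * (s\<^sup>2 - k\<^sup>2)"], simp add: kruzhkov_flux_def power2_eq_square algebra_simps,
        rule fundamental_theorem_of_calculus[OF s(1)])
       (auto intro!: derivative_eq_intros simp flip: has_real_derivative_iff_has_vector_derivative)
  have b: "((\<lambda>k. kruzhkov_flux k s) has_integral ((3/2 * (M ^ 3 / 3 - s\<^sup>2 * M)) - (3/2 * (s ^ 3 / 3 - s\<^sup>2 * s)))) {s..M}"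
    by (rule has_integral_eq[of _ "\<lambda>k. 3/2 * (k\<^sup>2 - s\<^sup>2)"], simp add: kruzhkov_flux_def power2_eq_square algebra_simps,
        rule fundamental_theorem_of_calculus[OF s(2)])
       (auto intro!: derivative_eq_intros simp flip: has_real_derivative_iff_has_vector_derivative)
  have "((\<lambda>k. kruzhkov_flux k s) has_integral 2 * s ^ 3) {-M..M}"
    using has_integral_combine[OF s a b] by (simp add: power2_eq_square power3_eq_cube algebra_simps)
  then show "(LINT k:{-M..M}|lborel. kruzhkov_flux k s) = 2 * s ^ 3"
    using set_borel_integral_eq_integral(2)[OF borel_integrable_atLeastAtMost'[OF ci(2)]] by (simp add: integral_unique)
qed

text \<open>The second factor switches the function off at negative times, between
  \<open>- 3\<close> and \<open>- 2\<close>, to give it compact support; for times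
  \<open>t \<ge> - 2\<close> only the descent from \<open>a\<close> to \<open>b\<close>
  remains.\<close>

definition step_down :: "real \<Rightarrow> real \<Rightarrow> real \<Rightarrow> real" where
  "step_down a b t = smoothstep ((b - t) / (b - a)) * smoothstep (t + 3)"

lemma Ck_step_down: "Ck n (step_down a b)"
proof -
  have "Ck n (\<lambda>t. smoothstep ((- 1 / (b - a)) * t + b / (b - a)) * smoothstep (1 * t + 3))"
    by (intro Ck_mult Ck_compose_affine Ck_smoothstep)
  moreover have "(\<lambda>t. smoothstep ((- 1 / (b - a)) * t + b / (b - a)) * smoothstep (1 * t + 3)) = step_down a b"
    by (auto simp: step_down_def diff_divide_distrib)
  ultimately show ?thesis by simp
qed

lemma step_down_bounds: "0 \<le> step_down a b t" "step_down a b t \<le> 1"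
  unfolding step_down_def by (auto intro!: mult_nonneg_nonneg mult_le_one smoothstep_nonneg smoothstep_le_1)

lemma step_down_eq_0: "a < b \<Longrightarrow> b \<le> t \<Longrightarrow> step_down a b t = 0"
  by (simp add: step_down_def divide_nonpos_pos)

lemma step_down_eq_1: "a < b \<Longrightarrow> - 2 \<le> t \<Longrightarrow> t \<le> a \<Longrightarrow> step_down a b t = 1"
  by (simp add: step_down_def)

lemma step_down_Cc: "a < b \<Longrightarrow> step_down a b \<in> Cc_infinity"
proof (rule Cc_infinityI[of _ "{-3..b}"])
  fix t assume "a < b" "step_down a b t \<noteq> 0"
  then have "\<not> b \<le> t" "\<not> t < - 3" using step_down_eq_0[of a b t] by (auto simp: step_down_def)
  then show "t \<in> {-3..b}" by auto
qed (auto intro: Ck_step_down)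

lemma step_down_deriv:
  assumes "a < b" "-2 < t"
  shows "deriv (step_down a b) t = - (bump ((b - t) / (b - a)) / prim bump 1 / (b - a))"
proof (rule DERIV_imp_deriv)
  have "((\<lambda>t. smoothstep ((b - t) / (b - a))) has_real_derivative
      bump ((b - t) / (b - a)) / prim bump 1 * (- 1 / (b - a))) (at t)"
    by (rule DERIV_chain2[OF smoothstep_deriv], rule DERIV_cdivide) (auto intro!: derivative_eq_intros)
  then have "((\<lambda>t. smoothstep ((b - t) / (b - a))) has_real_derivative
      - (bump ((b - t) / (b - a)) / prim bump 1 / (b - a))) (at t)" by simp
  then show "(step_down a b has_real_derivative - (bump ((b - t) / (b - a)) / prim bump 1 / (b - a))) (at t)"
    by (rule has_field_derivative_transform_within_open[of _ _ _ "{-2<..}"]) (use assms in \<open>auto simp: step_down_def\<close>)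
qed

lemma step_down_deriv_sign:
  assumes "a < b" "-2 < t"
  shows "deriv (step_down a b) t \<le> 0" "a < t \<Longrightarrow> t < b \<Longrightarrow> deriv (step_down a b) t < 0"
    "t \<notin> {a<..<b} \<Longrightarrow> deriv (step_down a b) t = 0"
proof -
  show "deriv (step_down a b) t \<le> 0"
    unfolding step_down_deriv[OF assms] using bump_nonneg[of "(b - t) / (b - a)"] prim_bump(2) assms
    by (simp add: divide_nonneg_pos)
  show "deriv (step_down a b) t < 0" if "a < t" "t < b"
  proof -
    have "bump ((b - t) / (b - a)) > 0" using that assms by (intro bump_pos) (auto simp: field_simps)
    then show ?thesis unfolding step_down_deriv[OF assms] using prim_bump(2) assms by simp
  qed
  show "deriv (step_down a b) t = 0" if "t \<notin> {a<..<b}"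
  proof -
    have "bump ((b - t) / (b - a)) = 0" using that assms by (intro bump_eq_0) (auto simp: field_simps)
    then show ?thesis unfolding step_down_deriv[OF assms] by simp
  qed
qed

lemma step_down_mono:
  assumes "a < b" "-2 \<le> s" "s \<le> t" shows "step_down a b t \<le> step_down a b s"
  using assms smoothstep_mono[of "(b - t) / (b - a)" "(b - s) / (b - a)"]
  by (simp add: step_down_def divide_right_mono)

lemma step_down_pos: "a < b \<Longrightarrow> -2 \<le> t \<Longrightarrow> t < b \<Longrightarrow> 0 < step_down a b t"
  by (simp add: step_down_def smoothstep_pos)

lemma Fatou_integrable:
  fixes f :: "nat \<Rightarrow> 'a \<Rightarrow> real"
  assumes f: "\<And>n. integrable M (f n)" "\<And>n z. f n z \<ge> 0" and g: "g \<in> borel_measurable M"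
    and lim: "\<And>z. (\<lambda>n. f n z) \<longlonglongrightarrow> g z" and K: "\<And>n. (LINT z|M. f n z) \<le> K"
  shows "integrable M g"
proof (rule integrableI_nonneg[OF g])
  have g0: "g z \<ge> 0" for z using LIMSEQ_le_const[OF lim] f(2) by blast
  then show "AE z in M. 0 \<le> g z" by simp
  have "(\<integral>\<^sup>+ z. ennreal (g z) \<partial>M) = (\<integral>\<^sup>+ z. liminf (\<lambda>n. ennreal (f n z)) \<partial>M)"
  proof (intro nn_integral_cong)
    fix z
    have "(\<lambda>n. ennreal (f n z)) \<longlonglongrightarrow> ennreal (g z)" using lim by (rule tendsto_ennrealI)
    then show "ennreal (g z) = liminf (\<lambda>n. ennreal (f n z))" by (simp add: lim_imp_Liminf)
  qed
  also have "\<dots> \<le> liminf (\<lambda>n. \<integral>\<^sup>+ z. ennreal (f n z) \<partial>M)"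
    by (rule nn_integral_liminf) (use f in auto)
  also have "\<dots> \<le> liminf (\<lambda>n. ennreal K)"
    using K f by (intro Liminf_mono always_eventually allI) (simp add: nn_integral_eq_integral ennreal_leI)
  also have "\<dots> = ennreal K" by (simp add: Liminf_const)
  finally show "(\<integral>\<^sup>+ z. ennreal (g z) \<partial>M) < \<infinity>" by (simp add: le_less_trans)
qed

lemma zero_Cc: "(\<lambda>_. 0) \<in> (Cc_infinity :: (real \<Rightarrow> real) set)"
  by (rule Cc_infinityI[of _ "{}"]) auto

text \<open>The entropy condition is kept only for differences of travelling waves: the sign of
  \<open>N * wave - wave\<close> gives the domination of one production \<open>D\<close> by another.\<close>

locale entropy_burgers =
  fixes w :: "real \<times> real \<Rightarrow> real" and u0 :: "real \<Rightarrow> real" and M :: real and D :: "real \<Rightarrow> (real \<Rightarrow> real) \<Rightarrow> (real \<Rightarrow> real) \<Rightarrow> real \<Rightarrow> real"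
  assumes wm: "w \<in> borel_measurable halfplane" and wb: "\<And>z. \<bar>w z\<bar> \<le> M"
    and u0: "continuous_on UNIV u0" "u0 \<in> L2" "\<And>x. \<bar>u0 x\<bar> \<le> M"
    and D_def: "\<And>k \<theta> \<beta> c. D k \<theta> \<beta> c = (LINT z|halfplane. \<bar>w z - k\<bar> * wave (deriv \<theta>) \<beta> c z)
       + (LINT z|halfplane. (kruzhkov_flux k (w z) - c * \<bar>w z - k\<bar>) * wave \<theta> (deriv \<beta>) c z)
       + \<theta> 0 * (LINT x|lebesgue. \<bar>u0 x - k\<bar> * \<beta> x)"
    and ent: "\<And>k N \<theta> \<beta> b \<psi> \<rho> c. \<theta> \<in> Cc_infinity \<Longrightarrow> \<beta> \<in> Cc_infinity \<Longrightarrow> \<psi> \<in> Cc_infinity \<Longrightarrow> \<rho> \<in> Cc_infinity \<Longrightarrow>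
       (\<And>t x. t \<ge> 0 \<Longrightarrow> N * wave \<theta> \<beta> b (t, x) - wave \<psi> \<rho> c (t, x) \<ge> 0) \<Longrightarrow> N * D k \<theta> \<beta> b - D k \<psi> \<rho> c \<ge> 0"
begin

lemma M_nonneg: "M \<ge> 0"
  using wb[of undefined] by linarith

lemma D_nonneg:
  assumes "\<theta> \<in> Cc_infinity" "\<beta> \<in> Cc_infinity" "\<And>t. t \<ge> 0 \<Longrightarrow> \<theta> t \<ge> 0" "\<And>x. \<beta> x \<ge> 0"
  shows "D k \<theta> \<beta> c \<ge> 0"
  using ent[OF assms(1,2) zero_Cc zero_Cc, of 1 c 0 k] assms by (simp add: wave_def D_def)

lemma fluxes:
  "continuous_on UNIV (\<lambda>(k, s). \<bar>s - k\<bar> :: real)"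
  "continuous_on UNIV (\<lambda>(k, s). kruzhkov_flux k s - c * \<bar>s - k\<bar>)"
  "\<And>k s. \<bar>k\<bar> \<le> M \<Longrightarrow> \<bar>s\<bar> \<le> M \<Longrightarrow> \<bar>\<bar>s - k\<bar>\<bar> \<le> 2 * M"
  "\<And>k s. \<bar>k\<bar> \<le> M \<Longrightarrow> \<bar>s\<bar> \<le> M \<Longrightarrow> \<bar>kruzhkov_flux k s - c * \<bar>s - k\<bar>\<bar> \<le> 6 * M\<^sup>2 + \<bar>c\<bar> * (2 * M)"
proof -
  show "continuous_on UNIV (\<lambda>(k, s). \<bar>s - k\<bar> :: real)" "continuous_on UNIV (\<lambda>(k, s). kruzhkov_flux k s - c * \<bar>s - k\<bar>)"
    unfolding kruzhkov_flux_def case_prod_beta by (intro continuous_intros)+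
  fix k s :: real assume ks: "\<bar>k\<bar> \<le> M" "\<bar>s\<bar> \<le> M"
  then show 1: "\<bar>\<bar>s - k\<bar>\<bar> \<le> 2 * M" by linarith
  have "\<bar>s - k\<bar> * \<bar>s + k\<bar> \<le> (2 * M) * (2 * M)" using ks by (intro mult_mono) auto
  then have "\<bar>kruzhkov_flux k s\<bar> \<le> 6 * M\<^sup>2" by (simp add: kruzhkov_flux_def abs_mult power2_eq_square)
  moreover have "\<bar>c * \<bar>s - k\<bar>\<bar> \<le> \<bar>c\<bar> * (2 * M)" using 1 by (simp add: abs_mult mult_left_mono)
  ultimately show "\<bar>kruzhkov_flux k s - c * \<bar>s - k\<bar>\<bar> \<le> 6 * M\<^sup>2 + \<bar>c\<bar> * (2 * M)" by linarith
qed

lemma u0_measurable: "u0 \<in> borel_measurable lebesgue"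
  by (rule continuous_lebesgue_measurable[OF u0(1)])

lemma Cc_facts:
  assumes "\<theta> \<in> Cc_infinity" "\<beta> \<in> Cc_infinity"
  shows "cont_cs (wave (deriv \<theta>) \<beta> c)" "cont_cs (wave \<theta> (deriv \<beta>) c)" "cont_cs (wave \<theta> \<beta> c)" "integrable lebesgue \<beta>"
  using assms Cc_infinity_L2_bounded[of \<beta>]
  by (auto intro!: cont_cs_wave Cc_infinity_cont_cs Cc_infinity_deriv)

lemmas F_w = parameter_integral_Fubini[OF sigma_finite_halfplane wm wb cont_cs_halfplane_integrable]
lemmas F_0 = parameter_integral_Fubini[OF sigma_finite_lebesgue u0_measurable u0(3)]

lemma D_continuous:
  assumes "\<theta> \<in> Cc_infinity" "\<beta> \<in> Cc_infinity"
  shows "continuous_on {-M..M} (\<lambda>k. D k \<theta> \<beta> c)"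
  unfolding D_def
  by (intro continuous_on_add continuous_on_mult continuous_on_const
      F_w(1)[OF Cc_facts(1)[OF assms] fluxes(1,3)] F_w(1)[OF Cc_facts(2)[OF assms] fluxes(2,4)]
      F_0(1)[OF Cc_facts(4)[OF assms] fluxes(1,3)])

text \<open>The production of the entropy pair \<open>s\<^sup>2\<close>, \<open>2 s\<^sup>3\<close>,
  initial term included; the flux is a primitive of the characteristic speed \<open>3 s\<close>
  times \<open>2 s\<close>.\<close>

definition Q :: "(real \<Rightarrow> real) \<Rightarrow> (real \<Rightarrow> real) \<Rightarrow> real" where
  "Q \<theta> \<beta> = (LINT z|halfplane. (w z)\<^sup>2 * wave (deriv \<theta>) \<beta> 0 z) + (LINT z|halfplane. 2 * (w z) ^ 3 * wave \<theta> (deriv \<beta>) 0 z)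
     + \<theta> 0 * (LINT x|lebesgue. (u0 x)\<^sup>2 * \<beta> x)"

lemma w_power_integrable:
  assumes "cont_cs F" shows "integrable halfplane (\<lambda>z. (w z) ^ n * F z)"
proof (rule halfplane_integrable_mult[OF assms])
  show "(\<lambda>z. w z ^ n) \<in> borel_measurable halfplane" using wm by simp
  show "\<bar>w z ^ n\<bar> \<le> M ^ n" for z using wb by (simp add: power_abs power_mono)
qed

text \<open>Averaging the Kruzhkov entropies over \<open>k\<close> gives the quadratic entropy.\<close>

lemma D_average:
  assumes Cc: "\<theta> \<in> Cc_infinity" "\<beta> \<in> Cc_infinity"
  shows "(LINT k:{-M..M}|lborel. D k \<theta> \<beta> 0) = Q \<theta> \<beta>"
proof -
  note cs = Cc_facts[OF Cc]
  let ?A = "\<lambda>k. LINT z|halfplane. \<bar>w z - k\<bar> * wave (deriv \<theta>) \<beta> 0 z"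
  let ?B = "\<lambda>k. LINT z|halfplane. (kruzhkov_flux k (w z) - 0 * \<bar>w z - k\<bar>) * wave \<theta> (deriv \<beta>) 0 z"
  let ?C = "\<lambda>k. LINT x|lebesgue. \<bar>u0 x - k\<bar> * \<beta> x"
  have i: "set_integrable lborel {-M..M} ?A" "set_integrable lborel {-M..M} ?B" "set_integrable lborel {-M..M} (\<lambda>k. \<theta> 0 * ?C k)"
    by (rule borel_integrable_atLeastAtMost', rule F_w(1)[OF cs(1) fluxes(1,3)] F_w(1)[OF cs(2) fluxes(2,4)]
        continuous_on_mult[OF continuous_on_const F_0(1)[OF cs(4) fluxes(1,3)]], assumption+)+
  have "(LINT k:{-M..M}|lborel. D k \<theta> \<beta> 0) = (LINT k:{-M..M}|lborel. ?A k) + (LINT k:{-M..M}|lborel. ?B k) + (LINT k:{-M..M}|lborel. \<theta> 0 * ?C k)"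
    unfolding D_def using i by (simp only: set_integral_add)
  also have "(LINT k:{-M..M}|lborel. ?A k) = (LINT z|halfplane. (LINT k:{-M..M}|lborel. \<bar>w z - k\<bar>) * wave (deriv \<theta>) \<beta> 0 z)"
    by (rule F_w(2)[OF cs(1) fluxes(1,3)])
  also have "\<dots> = (LINT z|halfplane. (w z)\<^sup>2 * wave (deriv \<theta>) \<beta> 0 z + M\<^sup>2 * wave (deriv \<theta>) \<beta> 0 z)"
    by (simp add: kruzhkov_integrals(1)[OF wb] distrib_right)
  \<comment> \<open>The constant \<open>M\<^sup>2\<close> left over by the average contributes this
    boundary term, which the initial term below cancels.\<close>
  also have "\<dots> = (LINT z|halfplane. (w z)\<^sup>2 * wave (deriv \<theta>) \<beta> 0 z) - M\<^sup>2 * (\<theta> 0 * (LINT x|lborel. \<beta> x))"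
    using w_power_integrable[OF cs(1), of 2] cont_cs_halfplane_integrable[OF cs(1)] by (simp add: wave_integrals[OF Cc])
  also have "(LINT k:{-M..M}|lborel. ?B k) = (LINT z|halfplane. (LINT k:{-M..M}|lborel. kruzhkov_flux k (w z) - 0 * \<bar>w z - k\<bar>) * wave \<theta> (deriv \<beta>) 0 z)"
    by (rule F_w(2)[OF cs(2) fluxes(2,4)])
  also have "\<dots> = (LINT z|halfplane. 2 * (w z) ^ 3 * wave \<theta> (deriv \<beta>) 0 z)"
    by (simp add: kruzhkov_integrals(2)[OF wb])
  also have "(LINT k:{-M..M}|lborel. \<theta> 0 * ?C k) = \<theta> 0 * (LINT k:{-M..M}|lborel. ?C k)" by simp
  also have "(LINT k:{-M..M}|lborel. ?C k) = (LINT x|lebesgue. (LINT k:{-M..M}|lborel. \<bar>u0 x - k\<bar>) * \<beta> x)"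
    by (rule F_0(2)[OF cs(4) fluxes(1,3)])
  also have "\<dots> = (LINT x|lebesgue. (u0 x)\<^sup>2 * \<beta> x + M\<^sup>2 * \<beta> x)"
    by (simp add: kruzhkov_integrals(1)[OF u0(3)] distrib_right)
  also have "\<dots> = (LINT x|lebesgue. (u0 x)\<^sup>2 * \<beta> x) + M\<^sup>2 * (LINT x|lebesgue. \<beta> x)"
    using cs(4) loc_integrable_mult_test[OF loc_integrable_continuous Cc(2), of "\<lambda>x. (u0 x)\<^sup>2"] u0(1)
    by (simp add: continuous_on_power)
  also have "(LINT x|lebesgue. \<beta> x) = (LINT x|lborel. \<beta> x)"
    using Cc_infinity_D(1)[OF Cc(2)] by (intro integral_completion) (simp add: borel_measurable_continuous_onI)
  finally show ?thesis by (simp add: Q_def algebra_simps)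
qed

lemma Q_nonneg:
  assumes "\<theta> \<in> Cc_infinity" "\<beta> \<in> Cc_infinity" "\<And>t. t \<ge> 0 \<Longrightarrow> \<theta> t \<ge> 0" "\<And>x. \<beta> x \<ge> 0"
  shows "Q \<theta> \<beta> \<ge> 0"
  unfolding D_average[OF assms(1,2), symmetric] set_lebesgue_integral_def
  using D_nonneg[OF assms] by (intro Bochner_Integration.integral_nonneg) (auto simp: indicator_def)

end

section \<open>Conservation of the Kruzhkov entropies\<close>

lemma halfplane_measurable_fst: "h \<in> borel_measurable borel \<Longrightarrow> (\<lambda>z. h (fst z)) \<in> borel_measurable halfplane"
  by (rule measurable_compose[OF continuous_halfplane_measurable[of fst]]) (auto intro!: continuous_intros)

lemma halfplane_measurable_snd: "h \<in> borel_measurable borel \<Longrightarrow> (\<lambda>z. h (snd z)) \<in> borel_measurable halfplane"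
  by (rule measurable_compose[OF continuous_halfplane_measurable[of snd]]) (auto intro!: continuous_intros)

lemma cutoff_integral_le: "R > 0 \<Longrightarrow> (LINT x|lborel. cutoff R x) \<le> 4 * R"
proof -
  assume R: "R > 0"
  have "(LINT x|lborel. cutoff R x) \<le> (LINT x|lborel. indicator {-2*R..2*R} x)"
  proof (rule integral_mono)
    show "integrable lborel (cutoff R)" by (rule cont_cs_integrable[OF Cc_infinity_cont_cs[OF cutoff_Cc[OF R]]])
    show "integrable lborel (indicator {-2*R..2*R} :: real \<Rightarrow> real)"
      by (intro integrable_real_indicator) (auto simp: emeasure_lborel_Icc_eq)
    fix x show "cutoff R x \<le> indicator {-2*R..2*R} x"
      using cutoff_bounds(2)[of R x] cutoff_eq_0[OF R, of x] by (cases "\<bar>x\<bar> \<ge> 2 * R") (auto simp: indicator_def abs_le_iff)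
  qed
  also have "\<dots> = 4 * R" using R by simp
  finally show ?thesis .
qed

lemma Cc_continuous_measurable: "\<phi> \<in> Cc_infinity \<Longrightarrow> (\<phi> :: real \<Rightarrow> real) \<in> borel_measurable borel"
  by (intro borel_measurable_continuous_onI Cc_infinity_D)

lemma step_down_deriv_bounded:
  assumes "a < b" obtains K where "K > 0" "\<And>t. \<bar>deriv (step_down a b) t\<bar> \<le> K"
  by (rule Cc_infinity_L2_bounded[OF Cc_infinity_deriv[OF step_down_Cc[OF assms]]]) blast

context entropy_burgers
begin

lemma w_square_measurable: "(\<lambda>z. indicator {..T} (fst z) * (w z)\<^sup>2) \<in> borel_measurable halfplane"
  by (intro borel_measurable_times borel_measurable_power wm halfplane_measurable_fst) auto

text \<open>The entropy solution is only assumed bounded, so finite energy has to be derived.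
  Non-negativity of the quadratic production bounds the energy under a cutoff by the initial energy
  plus a flux term; the latter stays bounded because a cutoff derivative of size \<open>1/R\<close>
  meets a region of length of order \<open>R\<close>. Fatou's lemma removes the cutoff.\<close>

lemma w_square_integrable:
  assumes T: "T > 0"
  shows "integrable halfplane (\<lambda>z. indicator {..T} (fst z) * (w z)\<^sup>2)"
proof -
  \<comment> \<open>The descent starts before 0 and ends after \<open>T\<close>, so its slope is
    bounded away from 0 on \<open>{0..T}\<close>.\<close>
  define \<theta> where "\<theta> = step_down (-1) (T + 1)"
  have ab: "(-1::real) < T + 1" using T by simp
  have \<theta>: "\<theta> \<in> Cc_infinity" unfolding \<theta>_def by (rule step_down_Cc[OF ab])
  note \<theta>' = Cc_infinity_deriv[OF \<theta>]
  have \<theta>b: "0 \<le> \<theta> t" "\<theta> t \<le> 1" for t unfolding \<theta>_def using step_down_bounds by auto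
  have "\<exists>x\<in>{0..T}. \<forall>y\<in>{0..T}. - deriv \<theta> x \<le> - deriv \<theta> y"
    using T by (intro continuous_attains_inf continuous_intros Cc_infinity_D[OF \<theta>']) auto
  then obtain t0 where t0: "t0 \<in> {0..T}" "\<And>t. t \<in> {0..T} \<Longrightarrow> - deriv \<theta> t0 \<le> - deriv \<theta> t" by blast
  define c where "c = - deriv \<theta> t0"
  have c: "c > 0" unfolding c_def \<theta>_def using step_down_deriv_sign(2)[OF ab, of t0] t0(1) by auto
  have neg: "deriv \<theta> t \<le> 0" if "t > 0" for t
    unfolding \<theta>_def by (rule step_down_deriv_sign(1)[OF ab]) (use that in simp)
  obtain C where C: "C > 0" "\<And>R x. R > 0 \<Longrightarrow> \<bar>deriv (cutoff R) x\<bar> \<le> C / R" using deriv_cutoff_bound by blast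
  define K0 where "K0 = (LINT t|lborel. indicator {0<..} t * \<theta> t)"
  have K0: "K0 \<ge> 0" unfolding K0_def using \<theta>b by (intro Bochner_Integration.integral_nonneg) auto
  define N where "N = (LINT x|lebesgue. (u0 x)\<^sup>2)"
  define K where "K = (2 * M ^ 3 * C * K0 * 8 + N) / c"
  have bound: "(LINT z|halfplane. (w z)\<^sup>2 * (- wave (deriv \<theta>) (cutoff R) 0 z)) \<le> 2 * M ^ 3 * C * K0 * 8 + N" if R: "R > 0" for R
  proof -
    note \<beta> = cutoff_Cc[OF R]
    note cs = Cc_facts[OF \<theta> \<beta>]
    have "0 \<le> Q \<theta> (cutoff R)" by (rule Q_nonneg[OF \<theta> \<beta>]) (use \<theta>b cutoff_bounds in auto)
    then have "(LINT z|halfplane. (w z)\<^sup>2 * (- wave (deriv \<theta>) (cutoff R) 0 z))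
        \<le> (LINT z|halfplane. 2 * w z ^ 3 * wave \<theta> (deriv (cutoff R)) 0 z) + \<theta> 0 * (LINT x|lebesgue. (u0 x)\<^sup>2 * cutoff R x)"
      by (simp add: Q_def)
    also have "(LINT z|halfplane. 2 * w z ^ 3 * wave \<theta> (deriv (cutoff R)) 0 z) \<le> (LINT z|halfplane. 2 * M ^ 3 * (C / R) * wave \<theta> (cutoff (2 * R)) 0 z)"
    proof (rule integral_mono)
      show "integrable halfplane (\<lambda>z. 2 * w z ^ 3 * wave \<theta> (deriv (cutoff R)) 0 z)"
        using integrable_mult_right[OF w_power_integrable[OF cs(2), of 3], of 2] by (simp add: mult.assoc)
      show "integrable halfplane (\<lambda>z. 2 * M ^ 3 * (C / R) * wave \<theta> (cutoff (2 * R)) 0 z)"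
        using R by (intro integrable_mult_right cont_cs_halfplane_integrable Cc_facts(3) \<theta> cutoff_Cc) auto
      fix z :: "real \<times> real"
      \<comment> \<open>The derivative of the cutoff lives where the cutoff at twice the scale
        equals 1, so it is dominated by a multiple of a test function of mass at most
        \<open>8 * R\<close>.\<close>
      have b: "\<bar>deriv (cutoff R) (snd z)\<bar> \<le> C / R * cutoff (2 * R) (snd z)"
      proof (cases "\<bar>snd z\<bar> \<le> 2 * R")
        case True
        then show ?thesis using C(2)[OF R] R by (simp add: cutoff_eq_1)
      next
        case False
        then show ?thesis using deriv_cutoff_eq_0[OF R, of "snd z"] C(1) R cutoff_bounds(1) by simp
      qed
      have "2 * w z ^ 3 * wave \<theta> (deriv (cutoff R)) 0 z \<le> \<bar>2 * w z ^ 3 * wave \<theta> (deriv (cutoff R)) 0 z\<bar>" by simp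
      also have "\<dots> = 2 * \<bar>w z\<bar> ^ 3 * (\<theta> (fst z) * \<bar>deriv (cutoff R) (snd z)\<bar>)"
        using \<theta>b by (simp add: wave_def abs_mult power_abs)
      also have "\<dots> \<le> 2 * M ^ 3 * (\<theta> (fst z) * (C / R * cutoff (2 * R) (snd z)))"
        using wb \<theta>b b M_nonneg by (intro mult_mono power_mono mult_left_mono) auto
      finally show "2 * w z ^ 3 * wave \<theta> (deriv (cutoff R)) 0 z \<le> 2 * M ^ 3 * (C / R) * wave \<theta> (cutoff (2 * R)) 0 z"
        by (simp add: wave_def mult_ac)
    qed
    also have "(LINT z|halfplane. 2 * M ^ 3 * (C / R) * wave \<theta> (cutoff (2 * R)) 0 z) = 2 * M ^ 3 * (C / R) * (K0 * (LINT x|lborel. cutoff (2 * R) x))"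
      using wave_integral[OF Cc_infinity_cont_cs[OF \<theta>] Cc_infinity_cont_cs[OF cutoff_Cc[of "2 * R"]], of 0] R by (simp add: K0_def)
    also have "\<dots> \<le> 2 * M ^ 3 * (C / R) * (K0 * (8 * R))"
      using cutoff_integral_le[of "2 * R"] R C(1) K0 M_nonneg by (intro mult_left_mono) auto
    also have "\<dots> = 2 * M ^ 3 * C * K0 * 8" using R by simp
    also have "\<theta> 0 * (LINT x|lebesgue. (u0 x)\<^sup>2 * cutoff R x) \<le> 1 * N"
    proof (intro mult_mono \<theta>b)
      show "(LINT x|lebesgue. (u0 x)\<^sup>2 * cutoff R x) \<le> N" unfolding N_def
        using cutoff_bounds u0(1) L2_D(2)[OF u0(2)]
        by (intro integral_mono loc_integrable_mult_test loc_integrable_continuous \<beta> continuous_intros mult_left_le) auto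
      show "0 \<le> (LINT x|lebesgue. (u0 x)\<^sup>2 * cutoff R x)" using cutoff_bounds by (intro Bochner_Integration.integral_nonneg) auto
    qed simp
    finally show ?thesis by simp
  qed
  have pw: "indicator {..T} (fst z) * (w z)\<^sup>2 * cutoff R (snd z) \<le> (w z)\<^sup>2 * (- wave (deriv \<theta>) (cutoff R) 0 z) / c"
    if z: "z \<in> space halfplane" for z R
  proof -
    have t: "fst z > 0" using z by (cases z) (auto simp: space_halfplane)
    have "c * indicator {..T} (fst z) \<le> - deriv \<theta> (fst z)"
      using t t0(2)[of "fst z"] neg[OF t] by (auto simp: indicator_def c_def)
    then have "(c * indicator {..T} (fst z)) * ((w z)\<^sup>2 * cutoff R (snd z)) \<le> - deriv \<theta> (fst z) * ((w z)\<^sup>2 * cutoff R (snd z))"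
      using cutoff_bounds by (intro mult_right_mono) auto
    then show ?thesis using c by (simp add: field_simps wave_def)
  qed
  have gi: "integrable halfplane (\<lambda>z. (w z)\<^sup>2 * (- wave (deriv \<theta>) (cutoff R) 0 z) / c)" if "R > 0" for R
    using w_power_integrable[OF Cc_facts(1)[OF \<theta> cutoff_Cc[OF that]], of 2] by simp
  have fi: "integrable halfplane (\<lambda>z. indicator {..T} (fst z) * (w z)\<^sup>2 * cutoff R (snd z))" if R: "R > 0" for R
  proof (rule Bochner_Integration.integrable_bound[OF gi[OF R]])
    show "(\<lambda>z. indicator {..T} (fst z) * (w z)\<^sup>2 * cutoff R (snd z)) \<in> borel_measurable halfplane"
      by (intro borel_measurable_times w_square_measurable halfplane_measurable_snd borel_cutoff)
    show "AE z in halfplane. norm (indicator {..T} (fst z) * (w z)\<^sup>2 * cutoff R (snd z)) \<le> norm ((w z)\<^sup>2 * (- wave (deriv \<theta>) (cutoff R) 0 z) / c)"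
    proof (rule AE_I2)
      fix z assume "z \<in> space halfplane"
      from pw[OF this, of R] show "norm (indicator {..T} (fst z) * (w z)\<^sup>2 * cutoff R (snd z)) \<le> norm ((w z)\<^sup>2 * (- wave (deriv \<theta>) (cutoff R) 0 z) / c)"
      proof -
        have "0 \<le> indicator {..T} (fst z) * (w z)\<^sup>2 * cutoff R (snd z)"
          using cutoff_bounds(1)[of R "snd z"] by simp
        then show ?thesis
          using pw[OF \<open>z \<in> space halfplane\<close>, of R] unfolding real_norm_def by linarith
      qed
    qed
  qed
  show ?thesis
  proof (rule Fatou_integrable[where f = "\<lambda>n z. indicator {..T} (fst z) * (w z)\<^sup>2 * cutoff (real (Suc n)) (snd z)" and K = K])
    show "integrable halfplane (\<lambda>z. indicator {..T} (fst z) * (w z)\<^sup>2 * cutoff (real (Suc n)) (snd z))" for n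
      by (rule fi) simp
    show "0 \<le> indicator {..T} (fst z) * (w z)\<^sup>2 * cutoff (real (Suc n)) (snd z)" for n z
      using cutoff_bounds(1) by simp
    show "(\<lambda>n. indicator {..T} (fst z) * (w z)\<^sup>2 * cutoff (real (Suc n)) (snd z)) \<longlonglongrightarrow> indicator {..T} (fst z) * (w z)\<^sup>2" for z
      using tendsto_mult[OF tendsto_const cutoff_tendsto_1] by fastforce
    show "(LINT z|halfplane. indicator {..T} (fst z) * (w z)\<^sup>2 * cutoff (real (Suc n)) (snd z)) \<le> K" for n
    proof -
      have "(LINT z|halfplane. indicator {..T} (fst z) * (w z)\<^sup>2 * cutoff (real (Suc n)) (snd z))
         \<le> (LINT z|halfplane. (w z)\<^sup>2 * (- wave (deriv \<theta>) (cutoff (real (Suc n))) 0 z) / c)"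
        by (intro integral_mono fi gi pw) auto
      also have "\<dots> = (LINT z|halfplane. (w z)\<^sup>2 * (- wave (deriv \<theta>) (cutoff (real (Suc n))) 0 z)) / c"
        by (rule integral_divide_zero)
      also have "\<dots> \<le> K" unfolding K_def by (rule divide_right_mono[OF bound]) (use c in simp_all)
      finally show ?thesis .
    qed
  qed (rule w_square_measurable)
qed

text \<open>Once the energy is integrable, the cubic flux is at most \<open>M\<close> times an
  integrable function, and the cutoff derivative sends it to zero like \<open>1/R\<close>. What
  remains is the initial energy minus the energy averaged over the descent of the step.\<close>

lemma Q_limit:
  assumes ab: "0 \<le> a" "a < b"
  shows "(\<lambda>n. Q (step_down a b) (cutoff (real (Suc n)))) \<longlonglongrightarrow>
     (LINT z|halfplane. (w z)\<^sup>2 * deriv (step_down a b) (fst z)) + (LINT x|lebesgue. (u0 x)\<^sup>2)"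
    and "integrable halfplane (\<lambda>z. (w z)\<^sup>2 * deriv (step_down a b) (fst z))"
proof -
  let ?\<theta> = "step_down a b"
  have b: "b > 0" using ab by simp
  obtain C where C: "C > 0" "\<And>R x. R > 0 \<Longrightarrow> \<bar>deriv (cutoff R) x\<bar> \<le> C / R" using deriv_cutoff_bound by blast
  obtain K where K: "K > 0" "\<And>t. \<bar>deriv ?\<theta> t\<bar> \<le> K" by (rule step_down_deriv_bounded[OF ab(2)]) blast
  note \<theta> = step_down_Cc[OF ab(2)]
  note wi = w_square_integrable[OF b]
  define W where "W z = indicator {..b} (fst z) * (w z)\<^sup>2" for z
  have W: "integrable halfplane W" "W z \<ge> 0" for z unfolding W_def[abs_def] using wi by auto
  have \<theta>m: "(\<lambda>z. deriv ?\<theta> (fst z)) \<in> borel_measurable halfplane"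
    by (intro halfplane_measurable_fst Cc_continuous_measurable Cc_infinity_deriv \<theta>)
  have dom: "\<bar>(w z)\<^sup>2 * deriv ?\<theta> (fst z)\<bar> \<le> K * W z" if "z \<in> space halfplane" for z
  proof -
    have "fst z > 0" using that by (cases z) (auto simp: space_halfplane)
    then have "\<bar>deriv ?\<theta> (fst z)\<bar> \<le> K * indicator {..b} (fst z)"
      using K step_down_deriv_sign(3)[OF ab(2), of "fst z"] by (auto simp: indicator_def)
    then have "(w z)\<^sup>2 * \<bar>deriv ?\<theta> (fst z)\<bar> \<le> (w z)\<^sup>2 * (K * indicator {..b} (fst z))" by (rule mult_left_mono) simp
    then show ?thesis by (simp add: W_def abs_mult mult_ac)
  qed
  show i: "integrable halfplane (\<lambda>z. (w z)\<^sup>2 * deriv ?\<theta> (fst z))"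
  proof (rule Bochner_Integration.integrable_bound[of _ "\<lambda>z. K * W z"])
    show "AE z in halfplane. norm ((w z)\<^sup>2 * deriv ?\<theta> (fst z)) \<le> norm (K * W z)"
    proof (rule AE_I2)
      fix z assume "z \<in> space halfplane"
      from dom[OF this] show "norm ((w z)\<^sup>2 * deriv ?\<theta> (fst z)) \<le> norm (K * W z)"
        unfolding real_norm_def by linarith
    qed
    show "(\<lambda>z. (w z)\<^sup>2 * deriv ?\<theta> (fst z)) \<in> borel_measurable halfplane"
      by (intro borel_measurable_times borel_measurable_power wm \<theta>m)
  qed (use W in auto)
  have wv: "wave f (cutoff R) 0 z = f (fst z) * cutoff R (snd z)" "wave f (deriv (cutoff R)) 0 z = f (fst z) * deriv (cutoff R) (snd z)" for f R z
    by (auto simp: wave_def)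
  have 1: "(\<lambda>n. LINT z|halfplane. (w z)\<^sup>2 * wave (deriv ?\<theta>) (cutoff (real (Suc n))) 0 z) \<longlonglongrightarrow> (LINT z|halfplane. (w z)\<^sup>2 * deriv ?\<theta> (fst z))"
  proof (rule integral_dominated_convergence[where w = "\<lambda>z. \<bar>(w z)\<^sup>2 * deriv ?\<theta> (fst z)\<bar>"])
    show "(\<lambda>z. (w z)\<^sup>2 * wave (deriv ?\<theta>) (cutoff (real (Suc n))) 0 z) \<in> borel_measurable halfplane" for n
      unfolding wv
      by (intro borel_measurable_times borel_measurable_power wm \<theta>m halfplane_measurable_snd borel_cutoff)
    show "AE z in halfplane. (\<lambda>n. (w z)\<^sup>2 * wave (deriv ?\<theta>) (cutoff (real (Suc n))) 0 z) \<longlonglongrightarrow> (w z)\<^sup>2 * deriv ?\<theta> (fst z)"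
    proof (rule AE_I2)
      fix z
      have "(\<lambda>n. ((w z)\<^sup>2 * deriv ?\<theta> (fst z)) * cutoff (real (Suc n)) (snd z)) \<longlonglongrightarrow> ((w z)\<^sup>2 * deriv ?\<theta> (fst z)) * 1"
        by (intro tendsto_intros cutoff_tendsto_1)
      then show "(\<lambda>n. (w z)\<^sup>2 * wave (deriv ?\<theta>) (cutoff (real (Suc n))) 0 z) \<longlonglongrightarrow> (w z)\<^sup>2 * deriv ?\<theta> (fst z)"
        by (simp add: wv mult.assoc)
    qed
    show "AE z in halfplane. norm ((w z)\<^sup>2 * wave (deriv ?\<theta>) (cutoff (real (Suc n))) 0 z) \<le> \<bar>(w z)\<^sup>2 * deriv ?\<theta> (fst z)\<bar>" for n
      using cutoff_bounds[of "real (Suc n)"]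
      by (intro AE_I2) (auto simp: wv abs_mult simp flip: mult.assoc intro!: mult_left_le)
  qed (use i in auto)
  have 2: "(\<lambda>n. LINT z|halfplane. 2 * w z ^ 3 * wave ?\<theta> (deriv (cutoff (real (Suc n)))) 0 z) \<longlonglongrightarrow> 0"
  proof (rule Lim_null_comparison)
    show "(\<lambda>n. 2 * M * C * (LINT z|halfplane. W z) * inverse (real (Suc n))) \<longlonglongrightarrow> 0"
      by (intro tendsto_mult_right_zero LIMSEQ_inverse_real_of_nat)
    have "norm (LINT z|halfplane. 2 * w z ^ 3 * wave ?\<theta> (deriv (cutoff (real (Suc n)))) 0 z) \<le> 2 * M * C * (LINT z|halfplane. W z) * inverse (real (Suc n))" for n
    proof -
      define R where "R = real (Suc n)"
      have R: "R > 0" by (simp add: R_def)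
      have "norm (LINT z|halfplane. 2 * w z ^ 3 * wave ?\<theta> (deriv (cutoff R)) 0 z) \<le> (LINT z|halfplane. 2 * M * (C / R) * W z)"
      proof (rule Bochner_Integration.integral_norm_bound_integral)
        show "integrable halfplane (\<lambda>z. 2 * w z ^ 3 * wave ?\<theta> (deriv (cutoff R)) 0 z)"
          using integrable_mult_right[OF w_power_integrable[OF Cc_facts(2)[OF \<theta> cutoff_Cc[OF R]], of 3], of 2] by (simp add: mult.assoc)
        show "integrable halfplane (\<lambda>z. 2 * M * (C / R) * W z)" using W by simp
        fix z assume z: "z \<in> space halfplane"
        have "fst z > 0" using z by (cases z) (auto simp: space_halfplane)
        have \<theta>i: "?\<theta> (fst z) \<le> indicator {..b} (fst z)"
          using step_down_bounds(2)[of a b "fst z"] step_down_eq_0[OF ab(2), of "fst z"] by (auto simp: indicator_def)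
        have "norm (2 * w z ^ 3 * wave ?\<theta> (deriv (cutoff R)) 0 z) = 2 * (\<bar>w z\<bar> * (w z)\<^sup>2) * (?\<theta> (fst z) * \<bar>deriv (cutoff R) (snd z)\<bar>)"
          using step_down_bounds(1)[of a b "fst z"] by (simp add: wv abs_mult power3_eq_cube power2_eq_square)
        also have "\<dots> \<le> 2 * (M * (w z)\<^sup>2) * (indicator {..b} (fst z) * (C / R))"
          using wb[of z] \<theta>i C(2)[OF R, of "snd z"] step_down_bounds(1)[of a b "fst z"] M_nonneg
          by (intro mult_mono) auto
        also have "\<dots> = 2 * M * (C / R) * W z" by (simp add: W_def)
        finally show "norm (2 * w z ^ 3 * wave ?\<theta> (deriv (cutoff R)) 0 z) \<le> 2 * M * (C / R) * W z" .
      qed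
      then show ?thesis by (simp add: R_def divide_inverse mult_ac)
    qed
    then show "\<forall>\<^sub>F n in sequentially. norm (LINT z|halfplane. 2 * w z ^ 3 * wave ?\<theta> (deriv (cutoff (real (Suc n)))) 0 z) \<le> 2 * M * C * (LINT z|halfplane. W z) * inverse (real (Suc n))"
      by simp
  qed
  have 3: "(\<lambda>n. LINT x|lebesgue. (u0 x)\<^sup>2 * cutoff (real (Suc n)) x) \<longlonglongrightarrow> (LINT x|lebesgue. (u0 x)\<^sup>2)"
  proof (rule integral_dominated_convergence[where w = "\<lambda>x. (u0 x)\<^sup>2"])
    show "AE x in lebesgue. (\<lambda>n. (u0 x)\<^sup>2 * cutoff (real (Suc n)) x) \<longlonglongrightarrow> (u0 x)\<^sup>2"
      using tendsto_mult[OF tendsto_const cutoff_tendsto_1] by fastforce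
    show "AE x in lebesgue. norm ((u0 x)\<^sup>2 * cutoff (real (Suc n)) x) \<le> (u0 x)\<^sup>2" for n
      using cutoff_bounds by (auto simp: abs_mult intro!: mult_left_le)
    show "(\<lambda>x. (u0 x)\<^sup>2 * cutoff (real (Suc n)) x) \<in> borel_measurable lebesgue" for n
      by (intro continuous_lebesgue_measurable continuous_intros u0 continuous_cutoff)
  qed (use L2_D(2)[OF u0(2)] in auto)
  have t0: "?\<theta> 0 = 1" using ab by (intro step_down_eq_1) auto
  have "(\<lambda>n. Q ?\<theta> (cutoff (real (Suc n)))) \<longlonglongrightarrow> (LINT z|halfplane. (w z)\<^sup>2 * deriv ?\<theta> (fst z)) + 0 + 1 * (LINT x|lebesgue. (u0 x)\<^sup>2)"
    unfolding Q_def t0 by (intro tendsto_add tendsto_mult 1 2 3 tendsto_const)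
  then show "(\<lambda>n. Q ?\<theta> (cutoff (real (Suc n)))) \<longlonglongrightarrow> (LINT z|halfplane. (w z)\<^sup>2 * deriv ?\<theta> (fst z)) + (LINT x|lebesgue. (u0 x)\<^sup>2)"
    by simp
qed

text \<open>Without loss of energy the average of the non-negative productions \<open>D k\<close> vanishes, hence so does
  each of them.\<close>

lemma D_eq_0:
  assumes ab: "0 \<le> a" "a < b'" "b' < b"
    and E: "(LINT x|lebesgue. (u0 x)\<^sup>2) \<le> - (LINT z|halfplane. (w z)\<^sup>2 * deriv (step_down a b) (fst z))"
    and Cc: "\<psi> \<in> Cc_infinity" "\<rho> \<in> Cc_infinity"
    and nn: "\<And>t. t \<ge> 0 \<Longrightarrow> \<psi> t \<ge> 0" "\<And>x. \<rho> x \<ge> 0" and supp: "\<And>t. t \<ge> b' \<Longrightarrow> \<psi> t = 0" and k: "\<bar>k\<bar> < M"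
  shows "D k \<psi> \<rho> c = 0"
proof -
  have ab': "a < b" using ab by simp
  let ?\<theta> = "step_down a b"
  note \<theta> = step_down_Cc[OF ab']
  obtain P where P: "P > 0" "\<And>t. \<bar>\<psi> t\<bar> \<le> P" by (rule Cc_infinity_L2_bounded[OF Cc(1)]) blast
  obtain P' where P': "P' > 0" "\<And>t. \<bar>\<rho> t\<bar> \<le> P'" by (rule Cc_infinity_L2_bounded[OF Cc(2)]) blast
  obtain B where B: "B > 0" "\<And>x. \<rho> x \<noteq> 0 \<Longrightarrow> norm x \<le> B" by (rule Cc_infinityE[OF Cc(2)]) blast
  have \<theta>b: "?\<theta> b' > 0" using ab by (intro step_down_pos) auto
  \<comment> \<open>On the support of \<open>\<psi>\<close> the step is at least its value at
    \<open>b'\<close>, so this factor makes a standing wave dominate the bounded travelling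
    one.\<close>
  define N where "N = P * P' / ?\<theta> b'"
  have N: "N > 0" using P P' \<theta>b by (simp add: N_def)
  \<comment> \<open>Up to time \<open>b'\<close> the travelling support moves by at most
    \<open>\<bar>c\<bar> * b'\<close>; for such \<open>R\<close> it stays where the cutoff equals
    1.\<close>
  have le: "D k \<psi> \<rho> c \<le> N * D k ?\<theta> (cutoff R) 0" if R: "R > 0" "R \<ge> B + \<bar>c\<bar> * b'" for k R
  proof -
    have "0 \<le> N * D k ?\<theta> (cutoff R) 0 - D k \<psi> \<rho> c"
    proof (rule ent[OF \<theta> cutoff_Cc[OF R(1)] Cc])
      fix t x :: real assume t: "t \<ge> 0"
      show "0 \<le> N * wave ?\<theta> (cutoff R) 0 (t, x) - wave \<psi> \<rho> c (t, x)"
      proof (cases "wave \<psi> \<rho> c (t, x) = 0")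
        case True
        have "N * wave ?\<theta> (cutoff R) 0 (t, x) \<ge> 0"
          using N step_down_bounds(1)[of a b t] cutoff_bounds(1)[of R x] by (simp add: wave_def)
        then show ?thesis using True by simp
      next
        case False
        then have *: "t < b'" "\<bar>x - c * t\<bar> \<le> B" using supp[of t] B(2)[of "x - c * t"] by (force simp: wave_def)+
        have "\<bar>c * t\<bar> \<le> \<bar>c\<bar> * b'" using * t by (simp add: abs_mult mult_left_mono)
        then have "\<bar>x\<bar> \<le> R" using * R by linarith
        then have 1: "cutoff R x = 1" using R by (intro cutoff_eq_1)
        have "?\<theta> b' \<le> ?\<theta> t" using * t ab by (intro step_down_mono) auto
        then have "N * ?\<theta> b' \<le> N * ?\<theta> t" using N by (intro mult_left_mono) auto
        moreover have "N * ?\<theta> b' = P * P'" using \<theta>b by (simp add: N_def)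
        moreover have "\<psi> t * \<rho> (x - c * t) \<le> P * P'"
          using P(2)[of t] P'(2)[of "x - c * t"] nn(1)[OF t] nn(2)[of "x - c * t"] P(1) by (intro mult_mono) auto
        ultimately show ?thesis by (simp add: wave_def 1)
      qed
    qed
    then show ?thesis by simp
  qed
  have Dn: "D k \<psi> \<rho> c \<ge> 0" for k by (rule D_nonneg[OF Cc nn])
  note c1 = D_continuous[OF Cc, of c]
  note c2 = D_continuous[OF \<theta> cutoff_Cc, of _ 0]
  let ?I = "LINT k:{-M..M}|lborel. D k \<psi> \<rho> c"
  have "?I \<le> N * Q ?\<theta> (cutoff (real (Suc n)))" if n: "real (Suc n) \<ge> B + \<bar>c\<bar> * b'" for n
  proof -
    have "?I \<le> (LINT k:{-M..M}|lborel. N * D k ?\<theta> (cutoff (real (Suc n))) 0)"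
      using le[OF _ n] c1 c2[of "real (Suc n)"]
      by (intro set_integral_mono borel_integrable_atLeastAtMost' continuous_on_mult continuous_on_const) auto
    also have "\<dots> = N * Q ?\<theta> (cutoff (real (Suc n)))"
      using D_average[OF \<theta> cutoff_Cc, of "real (Suc n)"] by simp
    finally show ?thesis .
  qed
  moreover obtain n0 where "B + \<bar>c\<bar> * b' \<le> real n0" using real_arch_simple by blast
  ultimately have ev: "\<forall>\<^sub>F n in sequentially. ?I \<le> N * Q ?\<theta> (cutoff (real (Suc n)))"
    by (auto simp: eventually_sequentially intro!: exI[of _ n0])
  have "?I \<le> N * ((LINT z|halfplane. (w z)\<^sup>2 * deriv ?\<theta> (fst z)) + (LINT x|lebesgue. (u0 x)\<^sup>2))"
    by (rule tendsto_lowerbound[OF tendsto_mult[OF tendsto_const Q_limit(1)[OF ab(1) ab']] ev]) simp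
  also have "\<dots> \<le> 0" using E N by (intro mult_nonneg_nonpos) auto
  finally have "?I \<le> 0" .
  moreover have "?I \<ge> 0"
    unfolding set_lebesgue_integral_def using Dn by (intro Bochner_Integration.integral_nonneg) (auto simp: indicator_def)
  ultimately have I0: "?I = 0" by simp
  \<comment> \<open>Continuity in \<open>k\<close> upgrades vanishing for almost every level to
    vanishing at every interior level.\<close>
  have "((\<lambda>k. D k \<psi> \<rho> c) has_integral 0) {-M..M}"
    using I0 set_borel_integral_eq_integral[OF borel_integrable_atLeastAtMost'[OF c1]] by (metis has_integral_integral)
  then show ?thesis
    using has_integral_0_cbox_imp_0[of "-M" M "\<lambda>k. D k \<psi> \<rho> c" k] c1 Dn k by (auto simp: box_real abs_less_iff)
qed

end

section \<open>Wave breaking\<close>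

text \<open>Relative to the characteristic speed \<open>3 k\<close> and with
  \<open>r = s - k\<close>, the two fluxes are \<open>3/2 \<bar>r - h\<bar> (r + h)\<close> and
  \<open>3/2 \<bar>r\<bar> r\<close>. Away from the layer \<open>0 < r < h\<close> they differ by
  exactly \<open>3/2 h\<^sup>2\<close> up to sign, and inside it by no more. Any other speed would
  leave a term linear in \<open>h\<close>.\<close>

lemma galilean_flux_difference:
  fixes h k s :: real
  assumes h: "h > 0"
  shows "\<bar>(kruzhkov_flux (k + h) s - 3 * k * \<bar>s - (k + h)\<bar>) - (kruzhkov_flux k s - 3 * k * \<bar>s - k\<bar>)\<bar> \<le> 3/2 * h\<^sup>2"
proof -
  define r where "r = s - k"
  have eq: "(kruzhkov_flux (k + h) s - 3 * k * \<bar>s - (k + h)\<bar>) - (kruzhkov_flux k s - 3 * k * \<bar>s - k\<bar>)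
      = 3/2 * (\<bar>r - h\<bar> * (r + h) - \<bar>r\<bar> * r)"
  proof -
    have "\<bar>s - (k + h)\<bar> = \<bar>r - h\<bar>" "\<bar>s - k\<bar> = \<bar>r\<bar>" "s = r + k" by (simp_all add: r_def algebra_simps)
    then show ?thesis unfolding kruzhkov_flux_def by (simp add: algebra_simps)
  qed
  have "\<bar>\<bar>r - h\<bar> * (r + h) - \<bar>r\<bar> * r\<bar> \<le> h\<^sup>2"
  proof -
    consider "r \<le> 0" | "0 < r" "r < h" | "h \<le> r" by linarith
    then show ?thesis
    proof cases
      case 1
      then have "\<bar>r - h\<bar> * (r + h) - \<bar>r\<bar> * r = h\<^sup>2" using h by (simp add: power2_eq_square algebra_simps)
      then show ?thesis by simp
    next
      case 2
      then have "\<bar>r - h\<bar> * (r + h) - \<bar>r\<bar> * r = h\<^sup>2 - 2 * r\<^sup>2" by (simp add: power2_eq_square algebra_simps)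
      moreover have "r\<^sup>2 \<le> h\<^sup>2" using 2 by (intro power_mono) auto
      ultimately show ?thesis by (simp add: abs_le_iff)
    next
      case 3
      then have "\<bar>r - h\<bar> * (r + h) - \<bar>r\<bar> * r = - h\<^sup>2" using h by (simp add: power2_eq_square algebra_simps)
      then show ?thesis by simp
    qed
  qed
  then show ?thesis unfolding eq by (simp add: abs_mult)
qed

context entropy_burgers
begin

text \<open>Difference quotients in \<open>k\<close> of the Kruzhkov entropies are transported with speed close
  to \<open>3 k\<close>: in the frame moving with that speed their flux is only quadratic in the increment.\<close>

lemma transport_excludes_states:
  assumes ab: "0 \<le> a" "a < b"
    and E: "(LINT x|lebesgue. (u0 x)\<^sup>2) \<le> - (LINT z|halfplane. (w z)\<^sup>2 * deriv (step_down a b) (fst z))"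
    and \<rho>: "\<rho> \<in> Cc_infinity" "\<And>x. \<rho> x \<ge> 0" and t: "0 \<le> a1" "a1 < b1" "a < b1" "b1 < b"
    and k: "\<bar>k\<bar> < M" "h0 > 0" "k + h0 < M"
    and s: "\<bar>s\<bar> = 1" and A: "A \<in> sets borel"
    and S: "\<And>h r. 0 < h \<Longrightarrow> h \<le> h0 \<Longrightarrow> r \<in> A \<Longrightarrow> s * (\<bar>r - (k + h)\<bar> - \<bar>r - k\<bar>) = h"
    and init: "\<And>h x. 0 < h \<Longrightarrow> h \<le> h0 \<Longrightarrow> \<rho> x \<noteq> 0 \<Longrightarrow> s * (\<bar>u0 x - (k + h)\<bar> - \<bar>u0 x - k\<bar>) = - h"
  shows "AE z in halfplane. a1 < fst z \<longrightarrow> fst z < b1 \<longrightarrow> \<rho> (snd z - 3 * k * fst z) > 0 \<longrightarrow> w z \<notin> A"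
proof -
  define \<psi> where "\<psi> = step_down a1 b1"
  have \<psi>: "\<psi> \<in> Cc_infinity" unfolding \<psi>_def by (rule step_down_Cc[OF t(2)])
  have \<psi>b: "0 \<le> \<psi> t" for t unfolding \<psi>_def by (rule step_down_bounds)
  have \<psi>0: "\<psi> 0 = 1" unfolding \<psi>_def using t by (intro step_down_eq_1) auto
  have \<psi>s: "\<psi> t = 0" if "t \<ge> b1" for t unfolding \<psi>_def using that t by (intro step_down_eq_0)
  have neg: "deriv \<psi> t \<le> 0" if "t > 0" for t
    unfolding \<psi>_def by (rule step_down_deriv_sign(1)[OF t(2)]) (use that in simp)
  let ?c = "3 * k"
  define F1 F2 where "F1 = wave (deriv \<psi>) \<rho> ?c" and "F2 = wave \<psi> (deriv \<rho>) ?c"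
  note cs1 = Cc_facts(1)[OF \<psi> \<rho>(1), of ?c, folded F1_def] and cs2 = Cc_facts(2)[OF \<psi> \<rho>(1), of ?c, folded F2_def]
    and \<rho>i = Cc_facts(4)[OF \<psi> \<rho>(1)]
  have F1: "F1 z \<le> 0" if "z \<in> space halfplane" for z
  proof -
    have "fst z > 0" using that by (cases z) (auto simp: space_halfplane)
    then show ?thesis using neg \<rho>(2) by (simp add: F1_def wave_def mult_nonpos_nonneg)
  qed
  define G where "G = (LINT z|halfplane. \<bar>F2 z\<bar>)"
  have G0: "G \<ge> 0" by (simp add: G_def)
  have F2i: "integrable halfplane (\<lambda>z. \<bar>F2 z\<bar>)" using cont_cs_halfplane_integrable[OF cs2] by (rule integrable_abs)
  have F1i: "integrable halfplane F1" by (rule cont_cs_halfplane_integrable[OF cs1])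
  define I where "I = (LINT z|halfplane. indicator A (w z) * - F1 z)"
  have Am: "(\<lambda>z. indicator A (w z) :: real) \<in> borel_measurable halfplane"
    using measurable_compose[OF wm borel_measurable_indicator[OF A]] by simp
  have Ii: "integrable halfplane (\<lambda>z. indicator A (w z) * - F1 z)"
    using halfplane_integrable_mult[OF cs1 Am, of 1] by (auto simp: indicator_def)
  have key: "2 * h * I \<le> 3/2 * h\<^sup>2 * G" if h: "0 < h" "h \<le> h0" for h
  proof -
    have kh: "\<bar>k\<bar> \<le> M" "\<bar>k + h\<bar> \<le> M" "\<bar>k + h\<bar> < M" using k h by auto
    define Y where "Y z = \<bar>w z - (k + h)\<bar> - \<bar>w z - k\<bar>" for z
    define X where "X z = (kruzhkov_flux (k + h) (w z) - ?c * \<bar>w z - (k + h)\<bar>) - (kruzhkov_flux k (w z) - ?c * \<bar>w z - k\<bar>)" for z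
    have i1: "integrable halfplane (\<lambda>z. \<bar>w z - (k + h)\<bar> * F1 z)" "integrable halfplane (\<lambda>z. \<bar>w z - k\<bar> * F1 z)"
      by (rule F_w(3)[OF cs1 fluxes(1,3)]; use kh in simp)+
    have i2: "integrable halfplane (\<lambda>z. (kruzhkov_flux (k + h) (w z) - ?c * \<bar>w z - (k + h)\<bar>) * F2 z)"
      "integrable halfplane (\<lambda>z. (kruzhkov_flux k (w z) - ?c * \<bar>w z - k\<bar>) * F2 z)"
      by (rule F_w(3)[OF cs2 fluxes(2,4)]; use kh in simp)+
    have i3: "integrable lebesgue (\<lambda>x. \<bar>u0 x - (k + h)\<bar> * \<rho> x)" "integrable lebesgue (\<lambda>x. \<bar>u0 x - k\<bar> * \<rho> x)"
      by (rule F_0(3)[OF \<rho>i fluxes(1,3)]; use kh in simp)+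
    have "D (k + h) \<psi> \<rho> ?c = 0" "D k \<psi> \<rho> ?c = 0"
      by (rule D_eq_0[OF ab(1) t(3,4) E \<psi> \<rho>(1) \<psi>b \<rho>(2) \<psi>s]; use kh k in simp)+
    then have "0 = (LINT z|halfplane. \<bar>w z - (k + h)\<bar> * F1 z) - (LINT z|halfplane. \<bar>w z - k\<bar> * F1 z)
       + ((LINT z|halfplane. (kruzhkov_flux (k + h) (w z) - ?c * \<bar>w z - (k + h)\<bar>) * F2 z) - (LINT z|halfplane. (kruzhkov_flux k (w z) - ?c * \<bar>w z - k\<bar>) * F2 z))
       + ((LINT x|lebesgue. \<bar>u0 x - (k + h)\<bar> * \<rho> x) - (LINT x|lebesgue. \<bar>u0 x - k\<bar> * \<rho> x))"
      by (simp add: D_def \<psi>0 F1_def F2_def)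
    also have "(LINT z|halfplane. \<bar>w z - (k + h)\<bar> * F1 z) - (LINT z|halfplane. \<bar>w z - k\<bar> * F1 z) = (LINT z|halfplane. Y z * F1 z)"
      unfolding Y_def left_diff_distrib by (rule Bochner_Integration.integral_diff[OF i1, symmetric])
    also have "(LINT z|halfplane. (kruzhkov_flux (k + h) (w z) - ?c * \<bar>w z - (k + h)\<bar>) * F2 z) - (LINT z|halfplane. (kruzhkov_flux k (w z) - ?c * \<bar>w z - k\<bar>) * F2 z)
       = (LINT z|halfplane. X z * F2 z)"
      unfolding X_def left_diff_distrib[of "kruzhkov_flux (k + h) (w _) - _"]
      by (rule Bochner_Integration.integral_diff[OF i2, symmetric])
    also have "(LINT x|lebesgue. \<bar>u0 x - (k + h)\<bar> * \<rho> x) - (LINT x|lebesgue. \<bar>u0 x - k\<bar> * \<rho> x) = (LINT x|lebesgue. (- s * h) * \<rho> x)"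
    proof -
      have "(LINT x|lebesgue. \<bar>u0 x - (k + h)\<bar> * \<rho> x) - (LINT x|lebesgue. \<bar>u0 x - k\<bar> * \<rho> x) = (LINT x|lebesgue. \<bar>u0 x - (k + h)\<bar> * \<rho> x - \<bar>u0 x - k\<bar> * \<rho> x)"
        by (rule Bochner_Integration.integral_diff[OF i3, symmetric])
      also have "\<dots> = (LINT x|lebesgue. (- s * h) * \<rho> x)"
      proof (intro Bochner_Integration.integral_cong refl)
        fix x
        show "\<bar>u0 x - (k + h)\<bar> * \<rho> x - \<bar>u0 x - k\<bar> * \<rho> x = (- s * h) * \<rho> x"
        proof (cases "\<rho> x = 0")
          case False
          have "s * (s * (\<bar>u0 x - (k + h)\<bar> - \<bar>u0 x - k\<bar>)) = s * (- h)" using init[OF h False] by simp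
          moreover have "s * s = 1" using s by (metis abs_mult_self_eq mult_1)
          ultimately have "\<bar>u0 x - (k + h)\<bar> - \<bar>u0 x - k\<bar> = - s * h" by (simp flip: mult.assoc)
          then show ?thesis by (simp flip: left_diff_distrib)
        qed simp
      qed
      finally show ?thesis .
    qed
    also have "\<dots> = - s * h * (LINT x|lborel. \<rho> x)"
      using Cc_continuous_measurable[OF \<rho>(1)] by (simp add: integral_completion)
    \<comment> \<open>As \<open>\<psi>\<close> equals 1 at time 0, the mass of \<open>\<rho>\<close>
      is minus the integral of \<open>F1\<close>. The initial term thus becomes an interior one, to
      be combined with the entropy difference pointwise.\<close>
    also have "\<dots> = s * h * (LINT z|halfplane. F1 z)"
      using wave_integrals(1)[OF \<psi> \<rho>(1), of ?c] by (simp add: F1_def \<psi>0)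
    finally have "(LINT z|halfplane. Y z * F1 z) + s * h * (LINT z|halfplane. F1 z) = - (LINT z|halfplane. X z * F2 z)" by simp
    then have "s * ((LINT z|halfplane. Y z * F1 z) + s * h * (LINT z|halfplane. F1 z)) = s * - (LINT z|halfplane. X z * F2 z)" by simp
    moreover have "s * s = 1" using s by (metis abs_mult_self_eq mult_1)
    ultimately have eq: "s * (LINT z|halfplane. Y z * F1 z) + h * (LINT z|halfplane. F1 z) = - s * (LINT z|halfplane. X z * F2 z)"
      by (simp add: distrib_left flip: mult.assoc)
    have Yi: "integrable halfplane (\<lambda>z. Y z * F1 z)"
      unfolding Y_def left_diff_distrib by (rule Bochner_Integration.integrable_diff[OF i1])
    have Xi: "integrable halfplane (\<lambda>z. X z * F2 z)"
      using Bochner_Integration.integrable_diff[OF i2] by (simp add: X_def left_diff_distrib)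
    have "2 * h * I = (LINT z|halfplane. 2 * h * (indicator A (w z) * - F1 z))" by (simp add: I_def)
    also have "\<dots> \<le> (LINT z|halfplane. - (s * (Y z * F1 z) + h * F1 z))"
    proof (rule integral_mono)
      show "integrable halfplane (\<lambda>z. 2 * h * (indicator A (w z) * - F1 z))" by (rule integrable_mult_right[OF Ii])
      show "integrable halfplane (\<lambda>z. - (s * (Y z * F1 z) + h * F1 z))"
        by (intro integrable_minus Bochner_Integration.integrable_add integrable_mult_right Yi F1i)
      fix z assume z: "z \<in> space halfplane"
      \<comment> \<open>The entropy difference \<open>s * Y\<close> lies between \<open>- h\<close>
        and \<open>h\<close> and reaches \<open>h\<close> on \<open>A\<close>, so adding
        \<open>h\<close> gives a non-negative function that detects \<open>A\<close>.\<close>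
      have "2 * h * indicator A (w z) \<le> s * Y z + h"
      proof (cases "w z \<in> A")
        case True
        then show ?thesis using S[OF h True] by (simp add: Y_def)
      next
        case False
        have "\<bar>s * Y z\<bar> \<le> h" using s h by (simp add: abs_mult Y_def)
        then show ?thesis using False by simp
      qed
      then have "2 * h * indicator A (w z) * (- F1 z) \<le> (s * Y z + h) * (- F1 z)"
        using F1[OF z] by (intro mult_right_mono) auto
      then show "2 * h * (indicator A (w z) * - F1 z) \<le> - (s * (Y z * F1 z) + h * F1 z)"
        by (simp add: algebra_simps)
    qed
    also have "\<dots> = - (s * (LINT z|halfplane. Y z * F1 z) + h * (LINT z|halfplane. F1 z))"
      using Yi F1i by simp
    also have "\<dots> = s * (LINT z|halfplane. X z * F2 z)" unfolding eq by simp
    also have "\<dots> \<le> \<bar>s * (LINT z|halfplane. X z * F2 z)\<bar>" by simp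
    also have "\<dots> = \<bar>LINT z|halfplane. X z * F2 z\<bar>" using s by (simp add: abs_mult)
    also have "\<dots> \<le> (LINT z|halfplane. 3/2 * h\<^sup>2 * \<bar>F2 z\<bar>)"
      unfolding real_norm_def[symmetric]
    proof (rule Bochner_Integration.integral_norm_bound_integral[OF Xi])
      show "integrable halfplane (\<lambda>z. 3/2 * h\<^sup>2 * norm (F2 z))" using F2i by simp
      show "norm (X z * F2 z) \<le> 3/2 * h\<^sup>2 * norm (F2 z)" for z
        using galilean_flux_difference[OF h(1), of k "w z"]
        unfolding real_norm_def abs_mult by (intro mult_right_mono) (auto simp: X_def)
    qed
    also have "\<dots> = 3/2 * h\<^sup>2 * G" by (simp add: G_def)
    finally show ?thesis .
  qed
  have In: "I \<ge> 0"
  proof -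
    have "0 \<le> (LINT z|halfplane. indicator A (w z) * - F1 z)"
      using F1 by (intro integral_nonneg_AE AE_I2) (auto simp: indicator_def)
    then show ?thesis unfolding I_def .
  qed
  have "I \<le> 0"
  proof (rule ccontr)
    assume "\<not> I \<le> 0"
    then have I: "I > 0" by simp
    \<comment> \<open>After division by \<open>h\<close> the estimate reads
      \<open>2 I \<le> 3/2 h G\<close>; this \<open>h\<close> makes \<open>h G \<le> I\<close>,
      which is impossible for positive \<open>I\<close>.\<close>
    define h where "h = min h0 (I / (G + 1))"
    have h: "0 < h" "h \<le> h0" "h \<le> I / (G + 1)" using k(2) I G0 by (auto simp: h_def)
    have "h * (2 * I) \<le> h * (3/2 * h * G)" using key[OF h(1,2)] by (simp add: power2_eq_square algebra_simps)
    then have "2 * I \<le> 3/2 * h * G" using h(1) by simp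
    moreover have "h * G \<le> I / (G + 1) * G" using h(3) G0 by (rule mult_right_mono)
    moreover have "I / (G + 1) * G \<le> I" using I G0 by (simp add: field_simps)
    ultimately show False using I by linarith
  qed
  with In have "I = 0" by (rule antisym[rotated])
  have "AE z in halfplane. indicator A (w z) * - F1 z = 0"
  proof -
    have "AE z in halfplane. 0 \<le> indicator A (w z) * - F1 z"
      using F1 by (intro AE_I2) (auto simp: indicator_def)
    from integral_nonneg_eq_0_iff_AE[OF Ii this] \<open>I = 0\<close> show ?thesis unfolding I_def by blast
  qed
  moreover have "AE z in halfplane. z \<in> space halfplane" by simp
  ultimately show ?thesis
  proof eventually_elim
    case (elim z)
    show ?case
    proof (intro impI notI)
      assume *: "a1 < fst z" "fst z < b1" "\<rho> (snd z - 3 * k * fst z) > 0" "w z \<in> A"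
      then have "deriv \<psi> (fst z) < 0" unfolding \<psi>_def using t by (intro step_down_deriv_sign(2)) auto
      then have "F1 z < 0" using *(3) by (simp add: F1_def wave_def mult_neg_pos)
      then show False using elim *(4) by simp
    qed
  qed
qed

text \<open>Where the initial datum compresses strongly enough, a faster state and a slower one are
  transported to the same point before time \<open>b\<close>.\<close>

lemma no_conservation_after_breaking:
  assumes ab: "0 \<le> a" "a < b"
    and E: "(LINT x|lebesgue. (u0 x)\<^sup>2) \<le> - (LINT z|halfplane. (w z)\<^sup>2 * deriv (step_down a b) (fst z))"
    and d: "(u0 has_real_derivative d) (at y)" and ts: "a < ts" "ts < b" "1 + 3 * ts * d < 0"
    and M: "\<bar>u0 y\<bar> < M"
  shows False
proof -
  define k0 where "k0 = u0 y"
  \<comment> \<open>For every \<open>h\<close> the line starting at \<open>y - 3 * ts * h\<close>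
    with speed \<open>3 * (k0 + h)\<close> passes through \<open>y + 3 * ts * k0\<close> at time
    \<open>ts\<close>. The sign of \<open>g\<close> tells whether the datum at the foot of the line
    lies above or below the level carried along it; after breaking \<open>g\<close> increases
    through 0.\<close>
  define g where "g h = u0 (y - 3 * ts * h) - (k0 + h)" for h
  have t0: "ts > 0" using ab ts by simp
  have gd: "(g has_real_derivative (d * (- (3 * ts)) - 1)) (at 0)"
  proof -
    have "((\<lambda>h. u0 (y - 3 * ts * h)) has_real_derivative d * (- (3 * ts))) (at 0)"
      by (rule DERIV_chain2[of u0]) (use d in \<open>auto intro!: derivative_eq_intros\<close>)
    then show ?thesis unfolding g_def[abs_def] by (auto intro!: derivative_eq_intros)
  qed
  have g0: "g 0 = 0" by (simp add: g_def k0_def)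
  have pos: "d * (- (3 * ts)) - 1 > 0" using ts(3) by (simp add: algebra_simps)
  obtain e1 where e1: "e1 > 0" "\<And>h. 0 < h \<Longrightarrow> h < e1 \<Longrightarrow> g h > 0"
    using DERIV_pos_inc_right[OF gd pos] g0 by auto
  obtain e2 where e2: "e2 > 0" "\<And>h. 0 < h \<Longrightarrow> h < e2 \<Longrightarrow> g (- h) < 0"
    using DERIV_pos_inc_left[OF gd pos] g0 by auto
  define \<tau> where "\<tau> = min (min e1 e2) (M - \<bar>k0\<bar>) / 2"
  have \<tau>: "0 < \<tau>" "\<tau> < e1" "\<tau> < e2" "\<tau> < M - \<bar>k0\<bar>" using e1(1) e2(1) M by (auto simp: \<tau>_def k0_def)
  define k1 k2 where "k1 = k0 + \<tau>" and "k2 = k0 - \<tau>"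
  have up: "u0 (y - 3 * ts * \<tau>) > k1" using e1(2)[OF \<tau>(1,2)] by (simp add: g_def k1_def)
  have lo: "u0 (y + 3 * ts * \<tau>) < k2" using e2(2)[OF \<tau>(1,3)] by (simp add: g_def k2_def)
  have kM: "\<bar>k1\<bar> < M" "\<bar>k2\<bar> < M" using \<tau> by (auto simp: k1_def k2_def)
  \<comment> \<open>Half of the available gap, so that the datum stays above \<open>k1 + h1\<close>
    near the foot point and the levels stay below \<open>M\<close>.\<close>
  define h1 where "h1 = min (u0 (y - 3 * ts * \<tau>) - k1) (M - k1) / 2"
  have h1: "h1 > 0" "k1 + h1 < M" "k1 + h1 < u0 (y - 3 * ts * \<tau>)"
    using up kM by (auto simp: h1_def abs_less_iff min_def field_simps split: if_splits)
  have h2: "2 * \<tau> > 0" "k2 + 2 * \<tau> < M" using \<tau> by (auto simp: k2_def abs_less_iff)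
  have ic: "isCont u0 x" for x using u0(1) by (simp add: continuous_on_eq_continuous_at)
  have "\<forall>\<^sub>F x in at (y - 3 * ts * \<tau>). u0 x > k1 + h1"
    using ic h1(3) by (intro order_tendstoD) (auto simp: isCont_def)
  then obtain \<delta>1 where \<delta>1: "\<delta>1 > 0" "\<And>x. \<bar>x - (y - 3 * ts * \<tau>)\<bar> < \<delta>1 \<Longrightarrow> u0 x > k1 + h1"
    using h1(3) unfolding eventually_at dist_real_def by (metis abs_0 diff_self UNIV_I)
  have "\<forall>\<^sub>F x in at (y + 3 * ts * \<tau>). u0 x < k2"
    using ic lo by (intro order_tendstoD) (auto simp: isCont_def)
  then obtain \<delta>2 where \<delta>2: "\<delta>2 > 0" "\<And>x. \<bar>x - (y + 3 * ts * \<tau>)\<bar> < \<delta>2 \<Longrightarrow> u0 x < k2"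
    using lo unfolding eventually_at dist_real_def by (metis abs_0 diff_self UNIV_I)
  define \<delta> where "\<delta> = min \<delta>1 \<delta>2 / 3"
  have \<delta>: "\<delta> > 0" "2 * \<delta> < \<delta>1" "2 * \<delta> < \<delta>2" using \<delta>1(1) \<delta>2(1) by (auto simp: \<delta>_def)
  define bump_at where "bump_at c x = cutoff \<delta> (1 * x + (- c))" for c x
  have bCc: "bump_at c \<in> Cc_infinity" for c
  proof (rule Cc_infinityI[of _ "{c - 2 * \<delta>..c + 2 * \<delta>}"])
    show "Ck n (bump_at c)" for n unfolding bump_at_def[abs_def] by (rule Ck_compose_affine[OF Ck_cutoff])
    show "x \<in> {c - 2 * \<delta>..c + 2 * \<delta>}" if "bump_at c x \<noteq> 0" for x
      using that cutoff_eq_0[OF \<delta>(1), of "x - c"] by (force simp: bump_at_def abs_le_iff not_le)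
  qed auto
  have bs: "\<bar>x - c\<bar> < 2 * \<delta>" if "bump_at c x \<noteq> 0" for c x
    using that cutoff_eq_0[OF \<delta>(1), of "x - c"] by (force simp: bump_at_def not_le)
  have bp: "bump_at c x > 0" if "\<bar>x - c\<bar> \<le> \<delta>" for c x
    using that cutoff_eq_1[OF \<delta>(1), of "x - c"] by (simp add: bump_at_def)
  have bn: "bump_at c x \<ge> 0" for c x using cutoff_bounds(1) by (simp add: bump_at_def)
  define b1 where "b1 = (ts + b) / 2"
  have t: "0 \<le> a" "a < b1" "a < b1" "b1 < b" "ts < b1" using ab ts by (auto simp: b1_def)
  have AE1: "AE z in halfplane. a < fst z \<longrightarrow> fst z < b1 \<longrightarrow> bump_at (y - 3 * ts * \<tau>) (snd z - 3 * k1 * fst z) > 0 \<longrightarrow> w z \<notin> {..k1}"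
  proof (rule transport_excludes_states[OF ab E bCc bn t(1-4) kM(1) h1(1,2), of 1])
    fix h x assume h: "0 < h" "h \<le> h1" and "bump_at (y - 3 * ts * \<tau>) x \<noteq> 0"
    then have "u0 x > k1 + h1" using bs \<delta> by (intro \<delta>1(2)) (meson less_trans)
    then show "1 * (\<bar>u0 x - (k1 + h)\<bar> - \<bar>u0 x - k1\<bar>) = - h" using h by auto
  qed auto
  \<comment> \<open>The increment \<open>2 * \<tau>\<close> is chosen so that
    \<open>k2 + 2 * \<tau> = k1\<close>: the half-line excluded here and the one excluded in
    \<open>AE1\<close> together cover all real values.\<close>
  have AE2: "AE z in halfplane. a < fst z \<longrightarrow> fst z < b1 \<longrightarrow> bump_at (y + 3 * ts * \<tau>) (snd z - 3 * k2 * fst z) > 0 \<longrightarrow> w z \<notin> {k2 + 2 * \<tau>..}"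
  proof (rule transport_excludes_states[OF ab E bCc bn t(1-4) kM(2) h2, of "-1"])
    fix h x assume h: "0 < h" "h \<le> 2 * \<tau>" and "bump_at (y + 3 * ts * \<tau>) x \<noteq> 0"
    then have "u0 x < k2" using bs \<delta> by (intro \<delta>2(2)) (meson less_trans)
    then show "- 1 * (\<bar>u0 x - (k2 + h)\<bar> - \<bar>u0 x - k2\<bar>) = - h" using h by auto
  qed auto
  \<comment> \<open>The overlap of the two tubes around the colliding lines: open, and containing
    their meeting point.\<close>
  define V where "V = {z::real \<times> real. a < fst z \<and> fst z < b1 \<and> \<bar>(snd z - 3 * k1 * fst z) - (y - 3 * ts * \<tau>)\<bar> < \<delta>
     \<and> \<bar>(snd z - 3 * k2 * fst z) - (y + 3 * ts * \<tau>)\<bar> < \<delta>}"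
  have "open V" unfolding V_def by (intro open_Collect_conj open_Collect_less continuous_intros)
  moreover have "(ts, y + 3 * ts * k0) \<in> V"
    using t ts \<delta> by (simp add: V_def k1_def k2_def algebra_simps)
  moreover have "V \<subseteq> {0<..} \<times> UNIV" using ab by (auto simp: V_def)
  moreover have "AE z in halfplane. z \<notin> V"
    using AE1 AE2
  proof eventually_elim
    case (elim z)
    show ?case
    proof
      assume z: "z \<in> V"
      then have "w z \<notin> {..k1}" "w z \<notin> {k2 + 2 * \<tau>..}"
        using elim bp[of "snd z - 3 * k1 * fst z"] bp[of "snd z - 3 * k2 * fst z"] by (auto simp: V_def less_imp_le)
      then show False by (auto simp: k1_def k2_def)
    qed
  qed
  \<comment> \<open>No value of \<open>w\<close> is possible in \<open>V\<close>, so the open set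
    \<open>V\<close> is null and hence empty, although the meeting point belongs to it.\<close>
  ultimately have "AE z in lebesgue. z \<notin> V"
    unfolding halfplane_def by (subst (asm) AE_restrict_space_iff) (auto elim!: eventually_mono)
  then have "AE z in lebesgue. z \<in> UNIV \<longrightarrow> z \<in> - V" by auto
  then have "(ts, y + 3 * ts * k0) \<in> - V"
    using \<open>open V\<close> by (intro mem_closed_if_AE_lebesgue) auto
  with \<open>(ts, y + 3 * ts * k0) \<in> V\<close> show False by simp
qed

end

section \<open>The limit of vanishing length scale\<close>

text \<open>The weights confine the integrand to a compact box at positive times, where it is
  continuous; Fubini's theorem for continuous functions on a box then applies.\<close>

lemma space_time_integral:
  fixes A :: "real \<times> real \<Rightarrow> real"
  assumes t: "0 < t1" "t1 \<le> t2" and A: "continuous_on ({0..} \<times> UNIV) A"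
    and \<eta>: "continuous_on UNIV \<eta>" "\<forall>t>0. t \<notin> {t1..t2} \<longrightarrow> \<eta> t = 0"
    and g: "continuous_on UNIV g" "\<forall>x. g x \<noteq> 0 \<longrightarrow> \<bar>x\<bar> \<le> r"
  shows "integrable halfplane (\<lambda>z. \<eta> (fst z) * (A z * g (snd z)))"
    and "(LINT z|halfplane. \<eta> (fst z) * (A z * g (snd z))) = integral {t1..t2} (\<lambda>t. \<eta> t * (LINT x|lebesgue. A (t, x) * g x))"
    and "(\<lambda>t. \<eta> t * (LINT x|lebesgue. A (t, x) * g x)) integrable_on {t1..t2}"
proof -
  define f where "f z = \<eta> (fst z) * (A z * g (snd z))" for z
  let ?B = "cbox (t1, - r) (t2, r)"
  have B: "?B = {t1..t2} \<times> {-r..r}" by (simp add: cbox_Pair_eq)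
  have cA: "continuous_on ?B A" using A t by (rule_tac continuous_on_subset) (auto simp: B)
  have cf: "continuous_on ?B f"
    unfolding f_def
    by (intro continuous_on_mult cA continuous_on_compose2[OF \<eta>(1)] continuous_on_compose2[OF g(1)] continuous_intros) auto
  have f0: "f z = 0" if "fst z > 0" "z \<notin> ?B" for z
    using that \<eta>(2)[rule_format, of "fst z"] g(2)[rule_format, of "snd z"] by (cases z) (auto simp: f_def B abs_le_iff)
  have ai: "f absolutely_integrable_on ?B" by (rule absolutely_integrable_continuous[OF cf])
  have ind: "indicator ({0<..} \<times> UNIV) z *\<^sub>R f z = indicator ?B z *\<^sub>R f z" for z
  proof (cases "z \<in> ?B")
    case True
    then have "z \<in> {0<..} \<times> UNIV" using t by (auto simp: B)
    then show ?thesis using True by simp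
  next
    case False
    then show ?thesis using f0[of z] by (cases z) (auto simp: indicator_def)
  qed
  have "integrable lebesgue (\<lambda>z. indicator ({0<..} \<times> UNIV) z *\<^sub>R f z)"
    using ai unfolding set_integrable_def ind .
  then have "integrable halfplane f"
    unfolding halfplane_def by (subst integrable_restrict_space) simp_all
  then show "integrable halfplane (\<lambda>z. \<eta> (fst z) * (A z * g (snd z)))" by (simp add: f_def[abs_def])
  have inner: "integral {-r..r} (\<lambda>x. f (t, x)) = \<eta> t * (LINT x|lebesgue. A (t, x) * g x)" if t': "t \<in> {t1..t2}" for t
  proof -
    have c: "continuous_on {-r..r} (\<lambda>x. f (t, x))"
      using cf t' by (intro continuous_on_compose2[OF cf] continuous_intros) (auto simp: B)
    have "integral {-r..r} (\<lambda>x. f (t, x)) = (LINT x:{-r..r}|lebesgue. f (t, x))"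
      using absolutely_integrable_continuous_real[OF c] by (rule set_lebesgue_integral_eq_integral(2)[symmetric])
    also have "\<dots> = (LINT x|lebesgue. \<eta> t * (A (t, x) * g x))"
      unfolding set_lebesgue_integral_def
    proof (intro Bochner_Integration.integral_cong refl)
      fix x show "indicator {-r..r} x *\<^sub>R f (t, x) = \<eta> t * (A (t, x) * g x)"
        using g(2)[rule_format, of x] by (auto simp: f_def indicator_def abs_le_iff)
    qed
    finally show ?thesis by simp
  qed
  have "(LINT z|halfplane. f z) = (LINT z|lebesgue. indicator ({0<..} \<times> UNIV) z *\<^sub>R f z)"
    unfolding halfplane_def by (subst integral_restrict_space) auto
  also have "\<dots> = (LINT z:?B|lebesgue. f z)" by (simp only: ind set_lebesgue_integral_def)
  also have "\<dots> = integral ?B f" by (rule set_lebesgue_integral_eq_integral(2)[OF ai])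
  also have "\<dots> = integral (cbox t1 t2) (\<lambda>t. integral (cbox (-r) r) (\<lambda>x. f (t, x)))"
    by (rule integral_prod_continuous[OF cf])
  also have "\<dots> = integral {t1..t2} (\<lambda>t. \<eta> t * (LINT x|lebesgue. A (t, x) * g x))"
    unfolding cbox_interval by (rule integral_cong) (rule inner)
  finally show "(LINT z|halfplane. \<eta> (fst z) * (A z * g (snd z))) = integral {t1..t2} (\<lambda>t. \<eta> t * (LINT x|lebesgue. A (t, x) * g x))"
    by (simp add: f_def[abs_def])
  have "continuous_on (cbox t1 t2) (\<lambda>t. integral (cbox (-r) r) (\<lambda>x. f (t, x)))"
    using integral_continuous_on_param[where f = "\<lambda>t x. f (t, x)" and a = "- r" and b = r and U = "cbox t1 t2"] cf by (simp add: cbox_Pair_eq case_prod_beta')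
  then have "(\<lambda>t. integral (cbox (-r) r) (\<lambda>x. f (t, x))) integrable_on cbox t1 t2" by (rule integrable_continuous)
  then show "(\<lambda>t. \<eta> t * (LINT x|lebesgue. A (t, x) * g x)) integrable_on {t1..t2}"
    unfolding cbox_interval by (rule integrable_eq) (use inner in auto)
qed

text \<open>The shift has two uses: \<open>c = 0\<close> gives the truncated moment itself, and
  \<open>c = 2 * R\<close> a version that is non-negative on the support of the cutoff.\<close>

lemma moment_cutoff:
  assumes R: "R > 0"
  shows "(\<lambda>x. (x + c) * cutoff R x) \<in> Cc_infinity"
    and "deriv (\<lambda>x. (x + c) * cutoff R x) x = cutoff R x + (x + c) * deriv (cutoff R) x"
proof -
  have "Ck n (\<lambda>x. (1 * x + c) * cutoff R x)" for n by (intro Ck_mult Ck_affine Ck_cutoff)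
  then show "(\<lambda>x. (x + c) * cutoff R x) \<in> Cc_infinity"
    using cutoff_eq_0[OF R] by (intro Cc_infinityI[of _ "{-2*R..2*R}"]) (auto simp: abs_le_iff not_le intro: ccontr)
  show "deriv (\<lambda>x. (x + c) * cutoff R x) x = cutoff R x + (x + c) * deriv (cutoff R) x"
    by (rule DERIV_imp_deriv) (auto intro!: derivative_eq_intros cutoff_deriv)
qed

section \<open>Burgers' equation in weak form\<close>

context entropy_burgers
begin

text \<open>At the levels \<open>k = M\<close> and \<open>k = - M\<close>, which bound the range of
  \<open>w\<close>, the Kruzhkov entropies are affine in \<open>w\<close> with opposite slopes; the
  two entropy inequalities combine to an equality.\<close>

lemma weak_solution_nonneg:
  assumes Cc: "\<theta> \<in> Cc_infinity" "\<beta> \<in> Cc_infinity" and nn: "\<And>t. t \<ge> 0 \<Longrightarrow> \<theta> t \<ge> 0" "\<And>x. \<beta> x \<ge> 0" and \<theta>0: "\<theta> 0 = 0"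
  shows "(LINT z|halfplane. w z * wave (deriv \<theta>) \<beta> 0 z) + (LINT z|halfplane. 3/2 * (w z)\<^sup>2 * wave \<theta> (deriv \<beta>) 0 z) = 0"
proof -
  note cs1 = Cc_facts(1)[OF Cc, of 0] and cs2 = Cc_facts(2)[OF Cc, of 0]
  note i = cont_cs_halfplane_integrable[OF cs1] cont_cs_halfplane_integrable[OF cs2]
    and z = wave_integrals[OF Cc, of 0]
  have wi: "integrable halfplane (\<lambda>z. w z * wave (deriv \<theta>) \<beta> 0 z)" "integrable halfplane (\<lambda>z. (w z)\<^sup>2 * wave \<theta> (deriv \<beta>) 0 z)"
    using w_power_integrable[OF cs1, of 1] w_power_integrable[OF cs2, of 2] by simp_all
  have "D M \<theta> \<beta> 0 = (LINT z|halfplane. M * wave (deriv \<theta>) \<beta> 0 z - w z * wave (deriv \<theta>) \<beta> 0 z)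
      + (LINT z|halfplane. 3/2 * M\<^sup>2 * wave \<theta> (deriv \<beta>) 0 z - 3/2 * ((w z)\<^sup>2 * wave \<theta> (deriv \<beta>) 0 z))"
  proof -
    have a: "\<bar>w z - M\<bar> = M - w z" for z using wb[of z] by auto
    have "\<bar>w z - M\<bar> * wave (deriv \<theta>) \<beta> 0 z = M * wave (deriv \<theta>) \<beta> 0 z - w z * wave (deriv \<theta>) \<beta> 0 z"
      "(kruzhkov_flux M (w z) - 0 * \<bar>w z - M\<bar>) * wave \<theta> (deriv \<beta>) 0 z = 3/2 * M\<^sup>2 * wave \<theta> (deriv \<beta>) 0 z - 3/2 * ((w z)\<^sup>2 * wave \<theta> (deriv \<beta>) 0 z)" for z
      unfolding kruzhkov_flux_def a by (simp_all add: power2_eq_square algebra_simps)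
    then show ?thesis by (simp add: D_def \<theta>0)
  qed
  also have "\<dots> = - (LINT z|halfplane. w z * wave (deriv \<theta>) \<beta> 0 z) - 3/2 * (LINT z|halfplane. (w z)\<^sup>2 * wave \<theta> (deriv \<beta>) 0 z)"
    using i wi z \<theta>0 by simp
  finally have 1: "0 \<le> - (LINT z|halfplane. w z * wave (deriv \<theta>) \<beta> 0 z) - 3/2 * (LINT z|halfplane. (w z)\<^sup>2 * wave \<theta> (deriv \<beta>) 0 z)"
    using D_nonneg[OF Cc nn, of M 0] by simp
  have "D (- M) \<theta> \<beta> 0 = (LINT z|halfplane. M * wave (deriv \<theta>) \<beta> 0 z + w z * wave (deriv \<theta>) \<beta> 0 z)
      + (LINT z|halfplane. 3/2 * ((w z)\<^sup>2 * wave \<theta> (deriv \<beta>) 0 z) - 3/2 * M\<^sup>2 * wave \<theta> (deriv \<beta>) 0 z)"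
  proof -
    have a: "\<bar>w z - (- M)\<bar> = M + w z" for z using wb[of z] by auto
    have "\<bar>w z - (- M)\<bar> * wave (deriv \<theta>) \<beta> 0 z = M * wave (deriv \<theta>) \<beta> 0 z + w z * wave (deriv \<theta>) \<beta> 0 z"
      "(kruzhkov_flux (- M) (w z) - 0 * \<bar>w z - (- M)\<bar>) * wave \<theta> (deriv \<beta>) 0 z = 3/2 * ((w z)\<^sup>2 * wave \<theta> (deriv \<beta>) 0 z) - 3/2 * M\<^sup>2 * wave \<theta> (deriv \<beta>) 0 z" for z
      unfolding kruzhkov_flux_def a by (simp_all add: power2_eq_square algebra_simps)
    then show ?thesis unfolding D_def \<theta>0 by simp
  qed
  also have "\<dots> = (LINT z|halfplane. w z * wave (deriv \<theta>) \<beta> 0 z) + 3/2 * (LINT z|halfplane. (w z)\<^sup>2 * wave \<theta> (deriv \<beta>) 0 z)"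
    using i wi z \<theta>0 by simp
  finally have 2: "0 \<le> (LINT z|halfplane. w z * wave (deriv \<theta>) \<beta> 0 z) + 3/2 * (LINT z|halfplane. (w z)\<^sup>2 * wave \<theta> (deriv \<beta>) 0 z)"
    using D_nonneg[OF Cc nn, of "- M" 0] by simp
  have "(LINT z|halfplane. 3/2 * (w z)\<^sup>2 * wave \<theta> (deriv \<beta>) 0 z) = 3/2 * (LINT z|halfplane. (w z)\<^sup>2 * wave \<theta> (deriv \<beta>) 0 z)"
    by (simp add: mult.assoc)
  then show ?thesis using 1 2 by linarith
qed

text \<open>The truncated moment changes sign and cannot be tested directly, but it is the
  difference of the non-negative test functions \<open>(x + 2 * R) * cutoff R x\<close> and
  \<open>2 * R * cutoff R x\<close>.\<close>

lemma weak_solution_moment: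
  assumes \<theta>: "\<theta> \<in> Cc_infinity" "\<And>t. t \<ge> 0 \<Longrightarrow> \<theta> t \<ge> 0" "\<theta> 0 = 0" and R: "R > 0"
  shows "(LINT z|halfplane. w z * wave (deriv \<theta>) (\<lambda>x. x * cutoff R x) 0 z)
     + (LINT z|halfplane. 3/2 * (w z)\<^sup>2 * wave \<theta> (\<lambda>x. cutoff R x + x * deriv (cutoff R) x) 0 z) = 0"
proof -
  let ?\<beta>1 = "\<lambda>x. (x + 2 * R) * cutoff R x" and ?\<beta>2 = "cutoff R"
  have nn1: "?\<beta>1 x \<ge> 0" for x
    using cutoff_bounds(1)[of R x] cutoff_eq_0[OF R, of x] by (cases "\<bar>x\<bar> \<ge> 2 * R") auto
  note M1 = moment_cutoff[OF R, of "2 * R"]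
  note C2 = cutoff_Cc[OF R]
  note w1 = weak_solution_nonneg[OF \<theta>(1) M1(1) \<theta>(2) nn1 \<theta>(3)]
    and w2 = weak_solution_nonneg[OF \<theta>(1) C2 \<theta>(2) cutoff_bounds(1) \<theta>(3)]
  have i: "integrable halfplane (\<lambda>z. w z * wave (deriv \<theta>) \<beta> 0 z)" "integrable halfplane (\<lambda>z. 3/2 * (w z)\<^sup>2 * wave \<theta> (deriv \<beta>) 0 z)"
    if "\<beta> \<in> Cc_infinity" for \<beta>
    using w_power_integrable[OF Cc_facts(1)[OF \<theta>(1) that, of 0], of 1]
      integrable_mult_right[OF w_power_integrable[OF Cc_facts(2)[OF \<theta>(1) that, of 0], of 2], of "3/2"]
    by (simp_all add: mult.assoc)
  note i1 = i[OF M1(1)] and i2 = i[OF C2]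
  have lin: "(LINT z|halfplane. f z - 2 * R * g z) = (LINT z|halfplane. f z) - 2 * R * (LINT z|halfplane. g z)"
    if "integrable halfplane f" "integrable halfplane g" for f g
    using that by simp
  have "(LINT z|halfplane. w z * wave (deriv \<theta>) (\<lambda>x. x * cutoff R x) 0 z)
      = (LINT z|halfplane. w z * wave (deriv \<theta>) ?\<beta>1 0 z - 2 * R * (w z * wave (deriv \<theta>) ?\<beta>2 0 z))"
    by (intro Bochner_Integration.integral_cong refl) (simp add: wave_def algebra_simps)
  also have "\<dots> = (LINT z|halfplane. w z * wave (deriv \<theta>) ?\<beta>1 0 z) - 2 * R * (LINT z|halfplane. w z * wave (deriv \<theta>) ?\<beta>2 0 z)"
    using i1(1) i2(1) by simp
  finally have 1: "(LINT z|halfplane. w z * wave (deriv \<theta>) (\<lambda>x. x * cutoff R x) 0 z) = \<dots>" .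
  have "(LINT z|halfplane. 3/2 * (w z)\<^sup>2 * wave \<theta> (\<lambda>x. cutoff R x + x * deriv (cutoff R) x) 0 z)
      = (LINT z|halfplane. 3/2 * (w z)\<^sup>2 * wave \<theta> (deriv ?\<beta>1) 0 z - 2 * R * (3/2 * (w z)\<^sup>2 * wave \<theta> (deriv ?\<beta>2) 0 z))"
    by (intro Bochner_Integration.integral_cong refl) (simp only: wave_def M1(2), simp add: algebra_simps)
  also have "\<dots> = (LINT z|halfplane. 3/2 * (w z)\<^sup>2 * wave \<theta> (deriv ?\<beta>1) 0 z) - 2 * R * (LINT z|halfplane. 3/2 * (w z)\<^sup>2 * wave \<theta> (deriv ?\<beta>2) 0 z)"
    using i1(2) i2(2) by (rule lin)
  finally have 2: "(LINT z|halfplane. 3/2 * (w z)\<^sup>2 * wave \<theta> (\<lambda>x. cutoff R x + x * deriv (cutoff R) x) 0 z) = \<dots>" .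
  have alg: "a1 - c * a2 + (b1 - c * b2) = 0" if "a1 + b1 = 0" "a2 + b2 = 0" for a1 a2 b1 b2 c :: real
    using that by algebra
  show ?thesis unfolding 1 2 by (rule alg[OF w1 w2])
qed

end

text \<open>The energy density lost to the dispersive scale is non-negative, and by the weak form tested
  with \<open>x \<mapsto> x cutoff(x)\<close> it vanishes in the limit; tightness then gives the full initial energy.\<close>

lemma (in CH_flow) energy_in_window:
  fixes \<sigma> :: real
  assumes t: "0 < t1" "t1 < t2" and l1: "l \<le> 1"
    and \<sigma>: "\<bar>\<sigma>\<bar> = 1" and init: "\<And>x. \<sigma> * (u 0 x - l\<^sup>2 * u2 0 x) \<ge> 0"
    and C: "C > 0" "\<And>R x. R > 0 \<Longrightarrow> \<bar>deriv (cutoff R) x\<bar> \<le> C / R"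
    and \<delta>: "\<And>R. \<delta> R = (LINT x|lebesgue. (1 - cutoff R x) * ((u 0 x)\<^sup>2 + (u1 0 x)\<^sup>2))
        + C / R * (3 * (LINT x|lebesgue. \<bar>u 0 x\<bar> * ((u 0 x)\<^sup>2 + (u1 0 x)\<^sup>2))) * t2"
    and \<eta>: "\<And>t. (\<eta> has_real_derivative \<eta>' t) (at t)" "continuous_on UNIV \<eta>'" "\<And>t. t > 0 \<Longrightarrow> t \<notin> {t1<..<t2} \<Longrightarrow> \<eta> t = 0"
      "\<And>t. t > 0 \<Longrightarrow> t \<notin> {t1..t2} \<Longrightarrow> \<eta>' t = 0"
      "\<And>t. t > 0 \<Longrightarrow> 0 \<le> \<eta> t" "\<And>t. \<bar>\<eta> t\<bar> \<le> K" "integral {t1..t2} \<eta> = 1"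
    and R: "R > 0"
  shows "(LINT x|lebesgue. (u 0 x)\<^sup>2) \<le> \<delta> R + 6 * C * \<delta> (R / 2)
      + 2 * (LINT z|halfplane. \<eta> (fst z) * ((3/2 * (u (fst z) (snd z))\<^sup>2 + l\<^sup>2 / 2 * (u1 (fst z) (snd z))\<^sup>2) * (cutoff R (snd z) + snd z * deriv (cutoff R) (snd z))))
      - 2 * (LINT z|halfplane. \<eta> (fst z) * ((u (fst z) (snd z))\<^sup>2 * cutoff R (snd z)))"
    and "\<bar>(LINT z|halfplane. \<eta>' (fst z) * (u (fst z) (snd z) * (snd z * cutoff R (snd z))))
      + (LINT z|halfplane. \<eta> (fst z) * ((3/2 * (u (fst z) (snd z))\<^sup>2 + l\<^sup>2 / 2 * (u1 (fst z) (snd z))\<^sup>2) * (cutoff R (snd z) + snd z * deriv (cutoff R) (snd z))))\<bar>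
      \<le> l * (K * (((LINT x|lebesgue. (u 0 x)\<^sup>2 + (u1 0 x)\<^sup>2)) / 2) * (LINT x|lebesgue. \<bar>deriv (deriv (deriv (\<lambda>x. x * cutoff R x))) x\<bar>) * (t2 - t1))"
proof -
  let ?U = "\<lambda>z. u (fst z) (snd z)" and ?V = "\<lambda>z. u1 (fst z) (snd z)"
  have cU: "continuous_on ({0..} \<times> UNIV) ?U" "continuous_on ({0..} \<times> UNIV) ?V"
    using joint_continuity by (simp_all add: case_prod_beta')
  have c\<eta>: "continuous_on UNIV \<eta>" using \<eta>(1) by (intro continuous_at_imp_continuous_on) (auto intro: DERIV_isCont)
  have \<eta>0: "\<forall>t>0. t \<notin> {t1..t2} \<longrightarrow> \<eta> t = 0" "\<forall>t>0. t \<notin> {t1..t2} \<longrightarrow> \<eta>' t = 0" using \<eta>(3,4) by auto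
  have t': "t1 \<le> t2" using t by simp
  have sup: "\<bar>x\<bar> \<le> 2 * R" if "cutoff R x \<noteq> 0 \<or> deriv (cutoff R) x \<noteq> 0" for x
    using that cutoff_eq_0[OF R, of x] deriv_cutoff_eq_0[OF R, of x] by force
  define e where "e z = (?U z)\<^sup>2 + l\<^sup>2 * (?V z)\<^sup>2" for z
  define A where "A z = 3/2 * (?U z)\<^sup>2 + l\<^sup>2 / 2 * (?V z)\<^sup>2" for z
  define \<zeta>' where "\<zeta>' x = cutoff R x + x * deriv (cutoff R) x" for x
  have ce: "continuous_on ({0..} \<times> UNIV) e" "continuous_on ({0..} \<times> UNIV) A" "continuous_on ({0..} \<times> UNIV) (\<lambda>z. (?U z)\<^sup>2)"
    unfolding e_def A_def by (intro continuous_intros cU)+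
  have cg: "continuous_on UNIV (cutoff R)" "continuous_on UNIV \<zeta>'" "continuous_on UNIV (\<lambda>x. \<bar>x * deriv (cutoff R) x\<bar>)" "continuous_on UNIV (\<lambda>x. x * deriv (cutoff R) x)"
    "continuous_on UNIV (\<lambda>x. x * cutoff R x)"
    unfolding \<zeta>'_def by (intro continuous_intros continuous_cutoff continuous_deriv_cutoff)+
  note ST = space_time_integral[OF t(1) t' _ c\<eta> \<eta>0(1)]
  have sg: "\<forall>x. cutoff R x \<noteq> 0 \<longrightarrow> \<bar>x\<bar> \<le> 2 * R" "\<forall>x. \<zeta>' x \<noteq> 0 \<longrightarrow> \<bar>x\<bar> \<le> 2 * R" "\<forall>x. \<bar>x * deriv (cutoff R) x\<bar> \<noteq> 0 \<longrightarrow> \<bar>x\<bar> \<le> 2 * R"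
    "\<forall>x. x * deriv (cutoff R) x \<noteq> 0 \<longrightarrow> \<bar>x\<bar> \<le> 2 * R" "\<forall>x. x * cutoff R x \<noteq> 0 \<longrightarrow> \<bar>x\<bar> \<le> 2 * R"
    using sup unfolding \<zeta>'_def by (metis abs_zero add.right_neutral mult_zero_right)+
  have ei: "integrable lebesgue (\<lambda>x. e (t, x))" if "t \<ge> 0" for t
    using energy_density_integrable[OF that] by (simp add: e_def)
  \<comment> \<open>Since \<open>l \<le> 1\<close>, replacing \<open>l\<close> by 1 in the initial
    quantities and \<open>s\<close> by \<open>t2\<close> gives a bound that depends only on the
    datum, \<open>C\<close>, \<open>r\<close> and \<open>t2\<close>.\<close>
  have tail: "energy (\<lambda>x. 1 - cutoff r x) s \<le> \<delta> r" if r: "r > 0" and s: "s \<in> {t1..t2}" for r s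
  proof -
    have s0: "s \<ge> 0" using s t by auto
    have F0: "(LINT x|lebesgue. \<bar>u 0 x\<bar> * ((u 0 x)\<^sup>2 + (u1 0 x)\<^sup>2)) \<ge> 0" by (intro Bochner_Integration.integral_nonneg) auto
    have "energy (\<lambda>x. 1 - cutoff r x) s \<le> energy (\<lambda>x. 1 - cutoff r x) 0 + C / r * (3 * (\<sigma> * cubic 0)) * s"
      by (rule energy_tail[OF \<sigma> init r s0 C(2)[OF r]]) (use C in simp)
    also have "C / r * (3 * (\<sigma> * cubic 0)) * s \<le> C / r * (3 * (LINT x|lebesgue. \<bar>u 0 x\<bar> * ((u 0 x)\<^sup>2 + (u1 0 x)\<^sup>2))) * t2"
    proof -
      have "C / r * (3 * (\<sigma> * cubic 0)) * s \<le> C / r * (3 * (LINT x|lebesgue. \<bar>u 0 x\<bar> * ((u 0 x)\<^sup>2 + (u1 0 x)\<^sup>2))) * s"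
        using cubic_bound_0[OF \<sigma> l1] C r s0 by (intro mult_right_mono mult_left_mono) auto
      also have "\<dots> \<le> C / r * (3 * (LINT x|lebesgue. \<bar>u 0 x\<bar> * ((u 0 x)\<^sup>2 + (u1 0 x)\<^sup>2))) * t2"
        using F0 C r s by (intro mult_left_mono) auto
      finally show ?thesis .
    qed
    also have "energy (\<lambda>x. 1 - cutoff r x) 0 \<le> (LINT x|lebesgue. (1 - cutoff r x) * ((u 0 x)\<^sup>2 + (u1 0 x)\<^sup>2))"
      unfolding energy_def
    proof (rule integral_mono)
      have b: "\<bar>1 - cutoff r x\<bar> \<le> 1" for x using cutoff_bounds[of r x] by (simp add: abs_le_iff)
      have c: "continuous_on UNIV (\<lambda>x. 1 - cutoff r x)" by (intro continuous_intros continuous_cutoff)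
      show "integrable lebesgue (\<lambda>x. (1 - cutoff r x) * ((u 0 x)\<^sup>2 + l\<^sup>2 * (u1 0 x)\<^sup>2))"
        by (rule integrable_bounded_continuous_mult[OF energy_density_integrable c b]) simp
      show "integrable lebesgue (\<lambda>x. (1 - cutoff r x) * ((u 0 x)\<^sup>2 + (u1 0 x)\<^sup>2))"
        by (rule integrable_bounded_continuous_mult[OF _ c b]) (use L2_D(2) uD(3,4)[of 0] in auto)
      fix x
      have "l\<^sup>2 * (u1 0 x)\<^sup>2 \<le> 1 * (u1 0 x)\<^sup>2" using l l1 by (intro mult_right_mono) (auto simp: power_le_one)
      then show "(1 - cutoff r x) * ((u 0 x)\<^sup>2 + l\<^sup>2 * (u1 0 x)\<^sup>2) \<le> (1 - cutoff r x) * ((u 0 x)\<^sup>2 + (u1 0 x)\<^sup>2)"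
        using cutoff_bounds(2)[of r x] by (intro mult_left_mono) auto
    qed
    finally show ?thesis by (simp add: \<delta>)
  qed
  have \<eta>i: "\<eta> integrable_on {t1..t2}" by (intro integrable_continuous_real continuous_on_subset[OF c\<eta>]) auto
  have avg: "integral {t1..t2} (\<lambda>t. \<eta> t * c) = c" for c using \<eta>(7) by simp
  have \<eta>nn: "\<eta> s \<ge> 0" if "s \<in> {t1..t2}" for s using \<eta>(5)[of s] that t by auto
  note S1 = ST[OF ce(1) cg(1) sg(1)] and S2 = ST[OF ce(1) cg(3) sg(3)] and S3 = ST[OF ce(2) cg(2) sg(2)]
    and S4 = ST[OF ce(3) cg(1) sg(1)] and S5 = ST[OF ce(2) cg(4) sg(4)] and S6 = ST[OF ce(2) cg(1) sg(1)]
  have E0: "(LINT x|lebesgue. (u 0 x)\<^sup>2) \<le> energy (\<lambda>_. 1) 0"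
    unfolding energy_def using energy_density_integrable[of 0] L2_D(2)[OF uD(3)[of 0]] by (intro integral_mono) auto
  \<comment> \<open>The total energy is conserved and its tail is at most \<open>\<delta> R\<close>,
    so the part under the cutoff is bounded below at every time of the window; averaging with the
    unit mass \<open>\<eta>\<close> preserves the bound.\<close>
  have low: "(LINT x|lebesgue. (u 0 x)\<^sup>2) - \<delta> R \<le> (LINT z|halfplane. \<eta> (fst z) * (e z * cutoff R (snd z)))"
  proof -
    have "(LINT x|lebesgue. (u 0 x)\<^sup>2) - \<delta> R \<le> (LINT x|lebesgue. e (s, x) * cutoff R x)" if s: "s \<in> {t1..t2}" for s
    proof -
      have s0: "s \<ge> 0" using s t by auto
      have i: "integrable lebesgue (\<lambda>x. cutoff R x * e (s, x))"
        by (rule integrable_bounded_continuous_mult[OF ei[OF s0] cg(1), of 1]) (use cutoff_bounds in \<open>simp add: abs_le_iff\<close>)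
      have "energy (\<lambda>x. 1 - cutoff R x) s = (LINT x|lebesgue. e (s, x) - cutoff R x * e (s, x))"
        unfolding energy_def e_def by (intro Bochner_Integration.integral_cong refl) (simp add: algebra_simps)
      also have "\<dots> = (LINT x|lebesgue. e (s, x)) - (LINT x|lebesgue. cutoff R x * e (s, x))" using i ei[OF s0] by simp
      also have "(LINT x|lebesgue. e (s, x)) = energy (\<lambda>_. 1) s" by (simp add: energy_def e_def)
      also have "\<dots> = energy (\<lambda>_. 1) 0" by (rule energy_const[OF s0])
      finally show ?thesis using tail[OF R s] E0 by (simp add: mult.commute)
    qed
    then have "integral {t1..t2} (\<lambda>t. \<eta> t * ((LINT x|lebesgue. (u 0 x)\<^sup>2) - \<delta> R)) \<le> integral {t1..t2} (\<lambda>t. \<eta> t * (LINT x|lebesgue. e (t, x) * cutoff R x))"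
      using \<eta>nn \<eta>i by (intro integral_le S1(3) mult_left_mono) (auto intro: integrable_on_mult_left)
    then show ?thesis unfolding avg S1(2) .
  qed
  have mid: "(LINT z|halfplane. \<eta> (fst z) * (e z * \<bar>snd z * deriv (cutoff R) (snd z)\<bar>)) \<le> 2 * C * \<delta> (R / 2)"
  proof -
    have "(LINT x|lebesgue. e (s, x) * \<bar>x * deriv (cutoff R) x\<bar>) \<le> 2 * C * \<delta> (R / 2)" if s: "s \<in> {t1..t2}" for s
    proof -
      have s0: "s \<ge> 0" using s t by auto
      have R2: "R / 2 > 0" using R by simp
      \<comment> \<open>The left side lives on \<open>R \<le> \<bar>x\<bar> \<le> 2 * R\<close>,
        where the cutoff at scale \<open>R / 2\<close> is already 0. The growth of \<open>x\<close>
        is compensated by the decay \<open>C / R\<close>, so the error is a tail of the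
        energy.\<close>
      have b: "\<bar>x * deriv (cutoff R) x\<bar> \<le> 2 * C * (1 - cutoff (R / 2) x)" for x
      proof (cases "\<bar>x\<bar> < R \<or> 2 * R < \<bar>x\<bar>")
        case True
        then show ?thesis using deriv_cutoff_eq_0[OF R True] C(1) cutoff_bounds(2)[of "R / 2" x] by simp
      next
        case False
        then have "cutoff (R / 2) x = 0" using cutoff_eq_0[OF R2, of x] by simp
        moreover have "\<bar>x\<bar> * \<bar>deriv (cutoff R) x\<bar> \<le> (2 * R) * (C / R)" using False C(2)[OF R] R by (intro mult_mono) auto
        ultimately show ?thesis using R by (simp add: abs_mult)
      qed
      have c: "continuous_on UNIV (\<lambda>x. 1 - cutoff (R / 2) x)" by (intro continuous_intros continuous_cutoff)
      have i: "integrable lebesgue (\<lambda>x. (1 - cutoff (R / 2) x) * e (s, x))"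
        by (rule integrable_bounded_continuous_mult[OF ei[OF s0] c, of 1]) (use cutoff_bounds in \<open>simp add: abs_le_iff\<close>)
      have "\<bar>\<bar>x * deriv (cutoff R) x\<bar>\<bar> \<le> 2 * C" for x
        using b[of x] cutoff_bounds(1)[of "R / 2" x] C(1) mult_left_mono[of "1 - cutoff (R / 2) x" 1 "2 * C"]
        by (simp only: abs_abs) linarith
      then have i': "integrable lebesgue (\<lambda>x. \<bar>x * deriv (cutoff R) x\<bar> * e (s, x))"
        by (rule integrable_bounded_continuous_mult[OF ei[OF s0] cg(3)])
      have "(LINT x|lebesgue. e (s, x) * \<bar>x * deriv (cutoff R) x\<bar>) \<le> (LINT x|lebesgue. 2 * C * ((1 - cutoff (R / 2) x) * e (s, x)))"
      proof (rule integral_mono)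
        show "integrable lebesgue (\<lambda>x. e (s, x) * \<bar>x * deriv (cutoff R) x\<bar>)" using i' by (simp add: mult.commute)
        show "integrable lebesgue (\<lambda>x. 2 * C * ((1 - cutoff (R / 2) x) * e (s, x)))" using i by simp
        fix x
        have "e (s, x) \<ge> 0" by (simp add: e_def)
        from mult_right_mono[OF b[of x] this]
        show "e (s, x) * \<bar>x * deriv (cutoff R) x\<bar> \<le> 2 * C * ((1 - cutoff (R / 2) x) * e (s, x))" by (simp add: mult_ac)
      qed
      also have "\<dots> = 2 * C * energy (\<lambda>x. 1 - cutoff (R / 2) x) s" by (simp add: energy_def e_def)
      also have "\<dots> \<le> 2 * C * \<delta> (R / 2)" using tail[OF R2 s] C by (intro mult_left_mono) auto
      finally show ?thesis .
    qed
    then have "integral {t1..t2} (\<lambda>t. \<eta> t * (LINT x|lebesgue. e (t, x) * \<bar>x * deriv (cutoff R) x\<bar>)) \<le> integral {t1..t2} (\<lambda>t. \<eta> t * (2 * C * \<delta> (R / 2)))"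
      using \<eta>nn \<eta>i by (intro integral_le S2(3) mult_left_mono) (auto intro: integrable_on_mult_left)
    then show ?thesis unfolding avg S2(2) .
  qed
  have A_eq: "(LINT z|halfplane. \<eta> (fst z) * (A z * \<zeta>' (snd z))) = (LINT z|halfplane. \<eta> (fst z) * (A z * cutoff R (snd z))) + (LINT z|halfplane. \<eta> (fst z) * (A z * (snd z * deriv (cutoff R) (snd z))))"
    using S5(1) S6(1) by (simp add: \<zeta>'_def distrib_left flip: Bochner_Integration.integral_add)
  \<comment> \<open>The momentum flux density is at most \<open>3/2\<close> of the energy density.
    With the factor \<open>2 * C\<close> of the tail bound \<open>mid\<close> and the factor 2 of
    \<open>split\<close> this yields the constant \<open>6 * C\<close>.\<close>
  have up: "- (LINT z|halfplane. \<eta> (fst z) * (A z * (snd z * deriv (cutoff R) (snd z)))) \<le> 3/2 * (LINT z|halfplane. \<eta> (fst z) * (e z * \<bar>snd z * deriv (cutoff R) (snd z)\<bar>))"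
  proof -
    have "- (LINT z|halfplane. \<eta> (fst z) * (A z * (snd z * deriv (cutoff R) (snd z)))) = (LINT z|halfplane. - (\<eta> (fst z) * (A z * (snd z * deriv (cutoff R) (snd z)))))"
      by simp
    also have "\<dots> \<le> (LINT z|halfplane. 3/2 * (\<eta> (fst z) * (e z * \<bar>snd z * deriv (cutoff R) (snd z)\<bar>)))"
    proof (rule integral_mono)
      show "integrable halfplane (\<lambda>z. - (\<eta> (fst z) * (A z * (snd z * deriv (cutoff R) (snd z)))))" using S5(1) by (rule integrable_minus)
      show "integrable halfplane (\<lambda>z. 3/2 * (\<eta> (fst z) * (e z * \<bar>snd z * deriv (cutoff R) (snd z)\<bar>)))" using S2(1) by (rule integrable_mult_right)
      fix z assume "z \<in> space halfplane"
      then have \<eta>z: "\<eta> (fst z) \<ge> 0" using \<eta>(5) by (cases z) (auto simp: space_halfplane)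
      have "A z * - (snd z * deriv (cutoff R) (snd z)) \<le> (3/2 * e z) * \<bar>snd z * deriv (cutoff R) (snd z)\<bar>"
      proof -
        have "A z * - (snd z * deriv (cutoff R) (snd z)) \<le> A z * \<bar>snd z * deriv (cutoff R) (snd z)\<bar>"
          by (intro mult_left_mono abs_ge_minus_self) (simp add: A_def)
        also have "\<dots> \<le> (3/2 * e z) * \<bar>snd z * deriv (cutoff R) (snd z)\<bar>"
          by (intro mult_right_mono) (auto simp: A_def e_def)
        finally show ?thesis .
      qed
      from mult_left_mono[OF this \<eta>z]
      show "- (\<eta> (fst z) * (A z * (snd z * deriv (cutoff R) (snd z)))) \<le> 3/2 * (\<eta> (fst z) * (e z * \<bar>snd z * deriv (cutoff R) (snd z)\<bar>))"
        by (simp add: mult_ac)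
    qed
    finally show ?thesis by simp
  qed
  \<comment> \<open>The identity \<open>e = 2 A - 2 u\<^sup>2\<close>: it trades the dispersive part
    of the energy for the momentum flux, whose limit the moment determines.\<close>
  have split: "(LINT z|halfplane. \<eta> (fst z) * (e z * cutoff R (snd z))) \<le> 2 * (LINT z|halfplane. \<eta> (fst z) * (A z * cutoff R (snd z))) - 2 * (LINT z|halfplane. \<eta> (fst z) * ((?U z)\<^sup>2 * cutoff R (snd z)))"
  proof -
    have "(LINT z|halfplane. \<eta> (fst z) * (e z * cutoff R (snd z))) = (LINT z|halfplane. 2 * (\<eta> (fst z) * (A z * cutoff R (snd z))) - 2 * (\<eta> (fst z) * ((?U z)\<^sup>2 * cutoff R (snd z))))"
      by (intro Bochner_Integration.integral_cong refl) (simp add: e_def A_def algebra_simps)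
    then show ?thesis using S6(1) S4(1) by simp
  qed
  show "(LINT x|lebesgue. (u 0 x)\<^sup>2) \<le> \<delta> R + 6 * C * \<delta> (R / 2)
      + 2 * (LINT z|halfplane. \<eta> (fst z) * ((3/2 * (u (fst z) (snd z))\<^sup>2 + l\<^sup>2 / 2 * (u1 (fst z) (snd z))\<^sup>2) * (cutoff R (snd z) + snd z * deriv (cutoff R) (snd z))))
      - 2 * (LINT z|halfplane. \<eta> (fst z) * ((u (fst z) (snd z))\<^sup>2 * cutoff R (snd z)))"
    using low mid A_eq up split unfolding A_def \<zeta>'_def by linarith
  have m0: "(\<lambda>x. x * cutoff R x) \<in> Cc_infinity" "deriv (\<lambda>x. x * cutoff R x) x = \<zeta>' x" for x
    using moment_cutoff[OF R, of 0] by (simp_all add: \<zeta>'_def)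
  have \<eta>e: "\<eta> t1 = 0" "\<eta> t2 = 0" using \<eta>(3)[of t1] \<eta>(3)[of t2] t by auto
  note S7 = space_time_integral[OF t(1) t' cU(1) \<eta>(2) \<eta>0(2) cg(5) sg(5)]
  have "(LINT z|halfplane. \<eta>' (fst z) * (?U z * (snd z * cutoff R (snd z)))) + (LINT z|halfplane. \<eta> (fst z) * (A z * \<zeta>' (snd z)))
     = integral {t1..t2} (\<lambda>t. \<eta>' t * (LINT x|lebesgue. u t x * (x * cutoff R x)) + \<eta> t * (LINT x|lebesgue. (3/2 * (u t x)\<^sup>2 + l\<^sup>2 / 2 * (u1 t x)\<^sup>2) * deriv (\<lambda>x. x * cutoff R x) x))"
    using S7(3) S3(3) unfolding S7(2) S3(2) m0(2)
    by (subst Henstock_Kurzweil_Integration.integral_add) (auto simp: A_def)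
  then have "\<bar>(LINT z|halfplane. \<eta>' (fst z) * (?U z * (snd z * cutoff R (snd z)))) + (LINT z|halfplane. \<eta> (fst z) * (A z * \<zeta>' (snd z)))\<bar>
     \<le> l * (K * (energy (\<lambda>_. 1) 0 / 2) * (LINT x|lebesgue. \<bar>deriv (deriv (deriv (\<lambda>x. x * cutoff R x))) x\<bar>) * (t2 - t1))"
    using weak_form[OF m0(1) less_imp_le[OF t(1)] t' \<eta>(1,2) \<eta>e \<eta>(6)] by simp
  also have "\<dots> \<le> l * (K * (((LINT x|lebesgue. (u 0 x)\<^sup>2 + (u1 0 x)\<^sup>2)) / 2) * (LINT x|lebesgue. \<bar>deriv (deriv (deriv (\<lambda>x. x * cutoff R x))) x\<bar>) * (t2 - t1))"
  proof -
    have "energy (\<lambda>_. 1) 0 \<le> (LINT x|lebesgue. (u 0 x)\<^sup>2 + (u1 0 x)\<^sup>2)"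
      unfolding energy_def
    proof (rule integral_mono)
      show "integrable lebesgue (\<lambda>x. 1 * ((u 0 x)\<^sup>2 + l\<^sup>2 * (u1 0 x)\<^sup>2))" using energy_density_integrable[of 0] by simp
      show "integrable lebesgue (\<lambda>x. (u 0 x)\<^sup>2 + (u1 0 x)\<^sup>2)" using L2_D(2) uD(3,4)[of 0] by auto
      show "1 * ((u 0 x)\<^sup>2 + l\<^sup>2 * (u1 0 x)\<^sup>2) \<le> (u 0 x)\<^sup>2 + (u1 0 x)\<^sup>2" for x
        using l l1 mult_right_mono[of "l\<^sup>2" 1 "(u1 0 x)\<^sup>2"] by (simp add: power_le_one)
    qed
    moreover have "K \<ge> 0" using \<eta>(6)[of 0] by linarith
    ultimately show ?thesis using l t by (intro mult_left_mono mult_right_mono divide_right_mono) auto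
  qed
  finally show "\<bar>(LINT z|halfplane. \<eta>' (fst z) * (u (fst z) (snd z) * (snd z * cutoff R (snd z))))
      + (LINT z|halfplane. \<eta> (fst z) * ((3/2 * (u (fst z) (snd z))\<^sup>2 + l\<^sup>2 / 2 * (u1 (fst z) (snd z))\<^sup>2) * (cutoff R (snd z) + snd z * deriv (cutoff R) (snd z))))\<bar>
      \<le> l * (K * (((LINT x|lebesgue. (u 0 x)\<^sup>2 + (u1 0 x)\<^sup>2)) / 2) * (LINT x|lebesgue. \<bar>deriv (deriv (deriv (\<lambda>x. x * cutoff R x))) x\<bar>) * (t2 - t1))"
    by (simp add: A_def \<zeta>'_def)
qed

text \<open>A bounded weight supported in \<open>S\<close> defines a functional that is continuous
  for the \<open>L\<^sup>1\<close> distance on \<open>S\<close>. The comparison is made between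
  non-negative integrals, which need no finiteness of that distance for individual
  \<open>n\<close>.\<close>

lemma halfplane_integral_tendsto:
  fixes V :: "nat \<Rightarrow> real \<times> real \<Rightarrow> real"
  assumes i: "\<And>n. integrable halfplane (\<lambda>z. V n z * h z)" "integrable halfplane (\<lambda>z. w z * h z)"
    and S: "S \<in> sets lebesgue" "S \<subseteq> {0<..} \<times> UNIV"
    and h: "\<And>z. z \<in> space halfplane \<Longrightarrow> \<bar>h z\<bar> \<le> B * indicator S z" and B: "B > 0"
    and lim: "(\<lambda>n. \<integral>\<^sup>+ z. ennreal \<bar>V n z - w z\<bar> \<partial>lebesgue_on S) \<longlonglongrightarrow> 0"
  shows "(\<lambda>n. LINT z|halfplane. V n z * h z) \<longlonglongrightarrow> (LINT z|halfplane. w z * h z)"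
proof -
  define g where "g z = h z / B" for z
  have g: "\<bar>g z\<bar> \<le> indicator S z" if "z \<in> space halfplane" for z
    using h[OF that] B by (simp add: g_def field_simps)
  have ig: "integrable halfplane (\<lambda>z. V n z * g z)" "integrable halfplane (\<lambda>z. w z * g z)" for n
    using integrable_divide[OF i(1)[of n], of B] integrable_divide[OF i(2), of B] by (simp_all add: g_def)
  have "ennreal \<bar>(LINT z|halfplane. V n z * g z) - (LINT z|halfplane. w z * g z)\<bar> \<le> (\<integral>\<^sup>+ z. ennreal \<bar>V n z - w z\<bar> \<partial>lebesgue_on S)" for n
  proof -
    have "(LINT z|halfplane. V n z * g z) - (LINT z|halfplane. w z * g z) = (LINT z|halfplane. V n z * g z - w z * g z)"
      by (rule Bochner_Integration.integral_diff[OF ig, symmetric])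
    also have "ennreal \<bar>\<dots>\<bar> \<le> (\<integral>\<^sup>+ z. ennreal \<bar>V n z * g z - w z * g z\<bar> \<partial>halfplane)"
      using integral_norm_bound_ennreal[OF Bochner_Integration.integrable_diff[OF ig(1)[of n] ig(2)]] by simp
    also have "\<dots> = (\<integral>\<^sup>+ z. ennreal \<bar>V n z * g z - w z * g z\<bar> * indicator ({0<..} \<times> UNIV) z \<partial>lebesgue)"
      unfolding halfplane_def by (rule nn_integral_restrict_space) simp
    also have "\<dots> \<le> (\<integral>\<^sup>+ z. ennreal \<bar>V n z - w z\<bar> * indicator S z \<partial>lebesgue)"
    proof (rule nn_integral_mono)
      fix z
      have *: "\<bar>V n z * g z - w z * g z\<bar> = \<bar>V n z - w z\<bar> * \<bar>g z\<bar>" by (simp add: abs_mult flip: left_diff_distrib)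
      show "ennreal \<bar>V n z * g z - w z * g z\<bar> * indicator ({0<..} \<times> UNIV) z \<le> ennreal \<bar>V n z - w z\<bar> * indicator S z"
      proof (cases "z \<in> {0<..} \<times> UNIV")
        case True
        have "\<bar>V n z - w z\<bar> * \<bar>g z\<bar> \<le> \<bar>V n z - w z\<bar> * indicator S z"
          using g[of z] True by (intro mult_left_mono) (simp_all add: space_halfplane)
        then have "ennreal (\<bar>V n z - w z\<bar> * \<bar>g z\<bar>) \<le> ennreal (\<bar>V n z - w z\<bar> * indicator S z)" by (rule ennreal_leI)
        also have "\<dots> = ennreal \<bar>V n z - w z\<bar> * indicator S z" by (simp add: indicator_def)
        finally show ?thesis unfolding * using True by simp
      qed simp
    qed
    also have "\<dots> = (\<integral>\<^sup>+ z. ennreal \<bar>V n z - w z\<bar> \<partial>lebesgue_on S)"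
      by (rule nn_integral_restrict_space[symmetric]) (use S in simp)
    finally show ?thesis .
  qed
  then have "(\<lambda>n. ennreal \<bar>(LINT z|halfplane. V n z * g z) - (LINT z|halfplane. w z * g z)\<bar>) \<longlonglongrightarrow> 0"
    by (intro tendsto_sandwich[OF _ _ tendsto_const lim]) (auto intro: always_eventually)
  then have "(\<lambda>n. ennreal \<bar>(LINT z|halfplane. V n z * g z) - (LINT z|halfplane. w z * g z)\<bar>) \<longlonglongrightarrow> ennreal 0" by simp
  then have "(\<lambda>n. \<bar>(LINT z|halfplane. V n z * g z) - (LINT z|halfplane. w z * g z)\<bar>) \<longlonglongrightarrow> 0"
    by (rule tendsto_ennrealD) (auto intro: always_eventually)
  then have "(\<lambda>n. (LINT z|halfplane. V n z * g z) - (LINT z|halfplane. w z * g z)) \<longlonglongrightarrow> 0" by (rule tendsto_rabs_zero_cancel)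
  then have "(\<lambda>n. LINT z|halfplane. V n z * g z) \<longlonglongrightarrow> (LINT z|halfplane. w z * g z)" by (simp only: LIM_zero_iff)
  then have "(\<lambda>n. B * (LINT z|halfplane. V n z * g z)) \<longlonglongrightarrow> B * (LINT z|halfplane. w z * g z)" by (intro tendsto_intros)
  then show ?thesis using B unfolding g_def by simp
qed

lemma cutoff_tendsto:
  assumes r: "filterlim r at_top sequentially"
  shows "(\<lambda>n. cutoff (r n) x) \<longlonglongrightarrow> 1" and "(\<lambda>n. x * deriv (cutoff (r n)) x) \<longlonglongrightarrow> 0"
proof -
  have ev: "\<forall>\<^sub>F n in sequentially. \<bar>x\<bar> + 1 \<le> r n" using r by (simp add: filterlim_at_top)
  show "(\<lambda>n. cutoff (r n) x) \<longlonglongrightarrow> 1"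
    by (rule tendsto_eventually, rule eventually_mono[OF ev]) (rule cutoff_eq_1, auto)
  show "(\<lambda>n. x * deriv (cutoff (r n)) x) \<longlonglongrightarrow> 0"
    by (rule tendsto_eventually, rule eventually_mono[OF ev]) (simp add: deriv_cutoff_eq_0)
qed

lemma cutoff_tail_tendsto:
  assumes f: "integrable lebesgue f" and r: "filterlim r at_top sequentially"
  shows "(\<lambda>n. LINT x|lebesgue. (1 - cutoff (r n) x) * f x) \<longlonglongrightarrow> 0"
proof -
  have "(\<lambda>n. LINT x|lebesgue. (1 - cutoff (r n) x) * f x) \<longlonglongrightarrow> (LINT x|(lebesgue :: real measure). 0)"
  proof (rule integral_dominated_convergence[where w = "\<lambda>x. \<bar>f x\<bar>"])
    have fm: "f \<in> borel_measurable lebesgue" using f by simp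
    show "(\<lambda>x. (1 - cutoff (r n) x) * f x) \<in> borel_measurable lebesgue" for n
      by (intro borel_measurable_times fm continuous_lebesgue_measurable continuous_intros continuous_cutoff)
    show "AE x in lebesgue. (\<lambda>n. (1 - cutoff (r n) x) * f x) \<longlonglongrightarrow> 0"
    proof (rule AE_I2)
      fix x
      have "(\<lambda>n. (1 - cutoff (r n) x) * f x) \<longlonglongrightarrow> (1 - 1) * f x" by (intro tendsto_intros cutoff_tendsto(1)[OF r])
      then show "(\<lambda>n. (1 - cutoff (r n) x) * f x) \<longlonglongrightarrow> 0" by simp
    qed
    show "AE x in lebesgue. norm ((1 - cutoff (r n) x) * f x) \<le> \<bar>f x\<bar>" for n
    proof (rule AE_I2)
      fix x
      have "\<bar>1 - cutoff (r n) x\<bar> \<le> 1" using cutoff_bounds[of "r n" x] by (simp add: abs_le_iff)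
      then show "norm ((1 - cutoff (r n) x) * f x) \<le> \<bar>f x\<bar>" using mult_right_mono[of "\<bar>1 - cutoff (r n) x\<bar>" 1 "\<bar>f x\<bar>"] by (simp add: abs_mult)
    qed
  qed (use f in auto)
  then show ?thesis by simp
qed

section \<open>Energy of the entropy solution in the window\<close>

context entropy_burgers
begin

text \<open>At fixed \<open>R\<close> only \<open>Z\<close>, which is linear in \<open>U\<close>,
  has to converge; \<open>X\<close> is then forced to the negative of its limit by the weak form,
  whose error is of order \<open>l\<close>, and \<open>Y\<close> is merely bounded below.\<close>

lemma energy_kept_cutoff:
  fixes \<sigma> :: real
  assumes t: "0 < t1" "t1 < t2"
    and flow: "\<And>n. CH_flow (l n) (U n) (U1 n) (U2 n) (U3 n) (v n) (v1 n) (v2 n)"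
    and U0: "\<And>n. U n 0 = u0" "\<And>n. U1 n 0 = u01" "\<And>n. U2 n 0 = u02"
    and l: "\<And>n. l n \<le> 1" "l \<longlonglongrightarrow> 0"
    and \<sigma>: "\<bar>\<sigma>\<bar> = 1" "\<And>n x. \<sigma> * (u0 x - (l n)\<^sup>2 * u02 x) \<ge> 0"
    and lim: "\<And>r. r > 0 \<Longrightarrow> (\<lambda>n. \<integral>\<^sup>+ z. ennreal \<bar>U n (fst z) (snd z) - w z\<bar> \<partial>lebesgue_on ({t1..t2} \<times> {-r..r})) \<longlonglongrightarrow> 0"
    and C: "C > 0" "\<And>R x. R > 0 \<Longrightarrow> \<bar>deriv (cutoff R) x\<bar> \<le> C / R"
    and \<delta>: "\<And>R. \<delta> R = (LINT x|lebesgue. (1 - cutoff R x) * ((u0 x)\<^sup>2 + (u01 x)\<^sup>2))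
        + C / R * (3 * (LINT x|lebesgue. \<bar>u0 x\<bar> * ((u0 x)\<^sup>2 + (u01 x)\<^sup>2))) * t2"
    and \<eta>_def: "\<eta> = (\<lambda>t. - deriv (step_down t1 t2) t)"
    and R: "R > 0"
  shows "(LINT x|lebesgue. (u0 x)\<^sup>2) \<le> \<delta> R + 6 * C * \<delta> (R / 2)
     + 3 * (LINT z|halfplane. (w z)\<^sup>2 * (\<eta> (fst z) * (cutoff R (snd z) + snd z * deriv (cutoff R) (snd z))))
     - 2 * (LINT z|halfplane. (w z)\<^sup>2 * (\<eta> (fst z) * cutoff R (snd z)))"
proof -
  have s: "step_down t1 t2 \<in> Cc_infinity" by (rule step_down_Cc[OF t(2)])
  have ds: "deriv (step_down t1 t2) \<in> Cc_infinity" by (rule Cc_infinity_deriv[OF s])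
  define \<eta>' where "\<eta>' = deriv \<eta>"
  have \<eta>C: "\<eta> \<in> Cc_infinity"
  proof -
    obtain A where A: "\<And>x. deriv (step_down t1 t2) x \<noteq> 0 \<Longrightarrow> norm x \<le> A" by (rule Cc_infinityE[OF ds]) blast
    have "Ck n (deriv (step_down t1 t2))" for n using ds by (simp add: Cc_infinity_def)
    then show ?thesis unfolding \<eta>_def
      by (intro Cc_infinityI[of _ "cball 0 A"] Ck_uminus) (use A in auto)
  qed
  have \<eta>'C: "\<eta>' \<in> Cc_infinity" unfolding \<eta>'_def by (rule Cc_infinity_deriv[OF \<eta>C])
  have \<eta>d: "(\<eta> has_real_derivative \<eta>' x) (at x)" for x unfolding \<eta>'_def by (rule Cc_infinity_D(2)[OF \<eta>C])
  have c': "continuous_on UNIV \<eta>'" by (rule Cc_infinity_D(1)[OF \<eta>'C])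
  have \<eta>0: "\<eta> x = 0" if "x > 0" "x \<notin> {t1<..<t2}" for x unfolding \<eta>_def using step_down_deriv_sign(3)[OF t(2) _ that(2)] that(1) by simp
  have \<eta>nn: "\<eta> x \<ge> 0" if "x \<ge> 0" for x unfolding \<eta>_def using step_down_deriv_sign(1)[OF t(2), of x] that by simp
  have \<eta>'0: "\<eta>' x = 0" if "x > 0" "x \<notin> {t1..t2}" for x
  proof -
    have "open ({0<..<t1} \<union> {t2<..})" by (intro open_Un open_greaterThanLessThan open_greaterThan)
    moreover have "x \<in> {0<..<t1} \<union> {t2<..}" using that by auto
    ultimately have "\<forall>\<^sub>F y in nhds x. y \<in> {0<..<t1} \<union> {t2<..}" by (rule eventually_nhds_in_open)
    then have "\<forall>\<^sub>F y in nhds x. \<eta> y = 0" by (rule eventually_mono) (rule \<eta>0, use t in auto)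
    then have "deriv \<eta> x = deriv (\<lambda>_. 0) x" by (rule deriv_cong_ev) simp
    then show ?thesis by (simp add: \<eta>'_def)
  qed
  obtain K where K: "K > 0" "\<And>x. \<bar>\<eta> x\<bar> \<le> K" by (rule Cc_infinity_L2_bounded[OF \<eta>C]) blast
  obtain K' where K': "K' > 0" "\<And>x. \<bar>\<eta>' x\<bar> \<le> K'" by (rule Cc_infinity_L2_bounded[OF \<eta>'C]) blast
  have \<eta>1: "integral {t1..t2} \<eta> = 1"
  proof -
    have "(\<eta> has_integral ((\<lambda>t. - step_down t1 t2 t) t2 - (\<lambda>t. - step_down t1 t2 t) t1)) {t1..t2}"
    proof (rule fundamental_theorem_of_calculus)
      fix x
      have "((\<lambda>t. - step_down t1 t2 t) has_real_derivative \<eta> x) (at x)"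
        unfolding \<eta>_def by (rule DERIV_minus[OF Cc_infinity_D(2)[OF s]])
      then show "((\<lambda>t. - step_down t1 t2 t) has_vector_derivative \<eta> x) (at x within {t1..t2})"
        by (simp add: has_real_derivative_iff_has_vector_derivative has_vector_derivative_at_within)
    qed (use t in simp)
    then show ?thesis using t step_down_eq_0[of t1 t2 t2] step_down_eq_1[of t1 t2 t1] by (simp add: integral_unique)
  qed
  define E where "E = (LINT x|lebesgue. (u0 x)\<^sup>2)"
  define \<zeta>' where "\<zeta>' x = cutoff R x + x * deriv (cutoff R) x" for x
  define X where "X n = (LINT z|halfplane. \<eta> (fst z) * ((3/2 * (U n (fst z) (snd z))\<^sup>2 + (l n)\<^sup>2 / 2 * (U1 n (fst z) (snd z))\<^sup>2) * \<zeta>' (snd z)))" for n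
  define Y where "Y n = (LINT z|halfplane. \<eta> (fst z) * ((U n (fst z) (snd z))\<^sup>2 * cutoff R (snd z)))" for n
  define Z where "Z n = (LINT z|halfplane. \<eta>' (fst z) * (U n (fst z) (snd z) * (snd z * cutoff R (snd z))))" for n
  define H where "H = K * ((LINT x|lebesgue. (u0 x)\<^sup>2 + (u01 x)\<^sup>2) / 2) * (LINT x|lebesgue. \<bar>deriv (deriv (deriv (\<lambda>x. x * cutoff R x))) x\<bar>) * (t2 - t1)"
  have \<sigma>n: "\<And>x. \<sigma> * (U n 0 x - (l n)\<^sup>2 * U2 n 0 x) \<ge> 0" for n using \<sigma>(2) by (simp add: U0)
  have \<delta>n: "\<And>R. \<delta> R = (LINT x|lebesgue. (1 - cutoff R x) * ((U n 0 x)\<^sup>2 + (U1 n 0 x)\<^sup>2))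
        + C / R * (3 * (LINT x|lebesgue. \<bar>U n 0 x\<bar> * ((U n 0 x)\<^sup>2 + (U1 n 0 x)\<^sup>2))) * t2" for n by (simp only: \<delta> U0)
  have 1: "E \<le> \<delta> R + 6 * C * \<delta> (R / 2) + 2 * X n - 2 * Y n" and 2: "\<bar>Z n + X n\<bar> \<le> l n * H" for n
    using CH_flow.energy_in_window[OF flow[of n] t l(1)[of n] \<sigma>(1) \<sigma>n[of n] C \<delta>n[of _ n] \<eta>d c' \<eta>0 \<eta>'0 \<eta>nn[OF less_imp_le] K(2) \<eta>1 R]
    unfolding E_def X_def Y_def Z_def H_def \<zeta>'_def U0 by blast+
  let ?S = "{t1..t2} \<times> {-(2*R)..2*R}"
  have S: "?S \<in> sets lebesgue" "?S \<subseteq> {0<..} \<times> UNIV"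
  proof -
    have "closed ?S" by (intro closed_Times closed_atLeastAtMost)
    then show "?S \<in> sets lebesgue" by (simp add: borel_closed sets_completionI_sets)
    show "?S \<subseteq> {0<..} \<times> UNIV" using t by auto
  qed
  have R2: "2 * R > 0" using R by simp
  have cs0: "cutoff R x = 0" if "x \<notin> {-(2*R)..2*R}" for x
    using cutoff_eq_0[OF R, of x] that by (auto simp: not_le)

  have cU: "continuous_on ({0..} \<times> UNIV) (\<lambda>z. U n (fst z) (snd z))" for n
    using CH_flow.joint_continuity(1)[OF flow[of n]] by (simp add: case_prod_beta')
  have \<eta>f: "\<forall>x>0. x \<notin> {t1..t2} \<longrightarrow> \<eta> x = 0" "\<forall>x>0. x \<notin> {t1..t2} \<longrightarrow> \<eta>' x = 0" using \<eta>0 \<eta>'0 by auto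
  have \<eta>c: "continuous_on UNIV \<eta>" by (rule Cc_infinity_D(1)[OF \<eta>C])
  have gc: "continuous_on UNIV (\<lambda>x. x * cutoff R x)" by (intro continuous_intros continuous_cutoff)
  have gs: "\<forall>x. x * cutoff R x \<noteq> 0 \<longrightarrow> \<bar>x\<bar> \<le> 2 * R" "\<forall>x. cutoff R x \<noteq> 0 \<longrightarrow> \<bar>x\<bar> \<le> 2 * R"
    using cutoff_eq_0[OF R] by (auto simp: not_le intro: ccontr)
  have t': "t1 \<le> t2" using t by simp
  have xc: "(\<lambda>x. x * cutoff R x) \<in> Cc_infinity" using moment_cutoff(1)[OF R, of 0] by simp
  have limS: "(\<lambda>n. \<integral>\<^sup>+ z. ennreal \<bar>U n (fst z) (snd z) - w z\<bar> \<partial>lebesgue_on ?S) \<longlonglongrightarrow> 0" by (rule lim[OF R2])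
  define Zl where "Zl = (LINT z|halfplane. w z * (\<eta>' (fst z) * (snd z * cutoff R (snd z))))"
  have Zlim: "Z \<longlonglongrightarrow> Zl"
  proof -
    have "(\<lambda>n. LINT z|halfplane. U n (fst z) (snd z) * (\<eta>' (fst z) * (snd z * cutoff R (snd z)))) \<longlonglongrightarrow> Zl"
      unfolding Zl_def
    proof (rule halfplane_integral_tendsto[OF _ _ S _ _ limS])
      show "integrable halfplane (\<lambda>z. U n (fst z) (snd z) * (\<eta>' (fst z) * (snd z * cutoff R (snd z))))" for n
        using space_time_integral(1)[OF t(1) t' cU[of n] c' \<eta>f(2) gc gs(1)] by (simp add: mult.left_commute)
      show "integrable halfplane (\<lambda>z. w z * (\<eta>' (fst z) * (snd z * cutoff R (snd z))))"
        using w_power_integrable[OF cont_cs_wave[OF Cc_infinity_cont_cs[OF \<eta>'C] Cc_infinity_cont_cs[OF xc]], of 1 0]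
        by (simp add: wave_def)
      show "K' * (2 * R) > 0" using K'(1) R by simp
      fix z :: "real \<times> real" assume z: "z \<in> space halfplane"
      show "\<bar>\<eta>' (fst z) * (snd z * cutoff R (snd z))\<bar> \<le> K' * (2 * R) * indicator ?S z"
      proof (cases "z \<in> ?S")
        case True
        then have x: "\<bar>snd z\<bar> \<le> 2 * R" by (auto simp: abs_le_iff)
        have "\<bar>snd z\<bar> * \<bar>cutoff R (snd z)\<bar> \<le> (2 * R) * 1"
          using x cutoff_bounds[of R "snd z"] R by (intro mult_mono) auto
        then have "\<bar>snd z\<bar> * \<bar>cutoff R (snd z)\<bar> \<le> 2 * R" by simp
        from mult_mono[OF K'(2)[of "fst z"] this] have "\<bar>\<eta>' (fst z)\<bar> * (\<bar>snd z\<bar> * \<bar>cutoff R (snd z)\<bar>) \<le> K' * (2 * R)"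
          using K'(1) by simp
        then show ?thesis using True by (simp add: abs_mult)
      next
        case False
        then have "\<eta>' (fst z) = 0 \<or> cutoff R (snd z) = 0"
          using z \<eta>'0[of "fst z"] cs0[of "snd z"] by (cases z) (auto simp: space_halfplane)
        then show ?thesis using False by auto
      qed
    qed
    then show ?thesis by (simp add: Z_def[abs_def] mult.left_commute)
  qed
  \<comment> \<open>The equation for \<open>w\<close>, tested with the same truncated moment,
    identifies the limit of the linear term with the quadratic flux of \<open>w\<close>.\<close>
  have wz: "(LINT z|halfplane. (w z)\<^sup>2 * (\<eta> (fst z) * \<zeta>' (snd z))) * (3/2) = - Zl"
  proof -
    have "Zl + (LINT z|halfplane. 3/2 * (w z)\<^sup>2 * (\<eta> (fst z) * \<zeta>' (snd z))) = 0"
      using weak_solution_moment[OF \<eta>C \<eta>nn _ R] \<eta>0[of "0"] step_down_deriv_sign(3)[OF t(2), of 0] t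
      by (simp add: Zl_def wave_def \<eta>'_def \<zeta>'_def \<eta>_def)
    moreover have "(LINT z|halfplane. 3/2 * (w z)\<^sup>2 * (\<eta> (fst z) * \<zeta>' (snd z))) = 3/2 * (LINT z|halfplane. (w z)\<^sup>2 * (\<eta> (fst z) * \<zeta>' (snd z)))"
      by (simp add: mult.assoc)
    ultimately show ?thesis by linarith
  qed
  define Yl where "Yl = (LINT z|halfplane. (w z)\<^sup>2 * (\<eta> (fst z) * cutoff R (snd z)))"
  define Y' where "Y' n = (LINT z|halfplane. U n (fst z) (snd z) * (w z * (\<eta> (fst z) * cutoff R (snd z))))" for n
  have ci: "integrable halfplane (\<lambda>z. (w z)\<^sup>2 * (\<eta> (fst z) * cutoff R (snd z)))"
    using w_power_integrable[OF cont_cs_wave[OF Cc_infinity_cont_cs[OF \<eta>C] Cc_infinity_cont_cs[OF cutoff_Cc[OF R]]], of 2 0]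
    by (simp add: wave_def)
  have Ui: "integrable halfplane (\<lambda>z. w z * (\<eta> (fst z) * (U n (fst z) (snd z) * cutoff R (snd z))))" for n
    using wb by (intro integrable_bounded_mult[OF space_time_integral(1)[OF t(1) t' cU \<eta>c \<eta>f(1) continuous_cutoff gs(2)] wm]) auto
  then have Ui': "integrable halfplane (\<lambda>z. U n (fst z) (snd z) * (w z * (\<eta> (fst z) * cutoff R (snd z))))" for n
    by (simp add: mult.left_commute)
  have U2i: "integrable halfplane (\<lambda>z. \<eta> (fst z) * ((U n (fst z) (snd z))\<^sup>2 * cutoff R (snd z)))" for n
    by (rule space_time_integral(1)[OF t(1) t' _ \<eta>c \<eta>f(1) continuous_cutoff gs(2)]) (intro continuous_intros cU)
  have Ylim: "Y' \<longlonglongrightarrow> Yl"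
  proof -
    have "Y' \<longlonglongrightarrow> (LINT z|halfplane. w z * (w z * (\<eta> (fst z) * cutoff R (snd z))))"
      unfolding Y'_def[abs_def]
    proof (rule halfplane_integral_tendsto[OF Ui' _ S _ _ limS])
      show "integrable halfplane (\<lambda>z. w z * (w z * (\<eta> (fst z) * cutoff R (snd z))))"
        using ci by (simp add: power2_eq_square mult.assoc)
      show "(M + 1) * K > 0" using M_nonneg K(1) by simp
      fix z :: "real \<times> real" assume z: "z \<in> space halfplane"
      show "\<bar>w z * (\<eta> (fst z) * cutoff R (snd z))\<bar> \<le> (M + 1) * K * indicator ?S z"
      proof (cases "z \<in> ?S")
        case True
        have "\<bar>\<eta> (fst z)\<bar> * \<bar>cutoff R (snd z)\<bar> \<le> K * 1"
          using K cutoff_bounds[of R "snd z"] by (intro mult_mono) auto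
        then have b: "\<bar>\<eta> (fst z)\<bar> * \<bar>cutoff R (snd z)\<bar> \<le> K" by simp
        have "\<bar>w z\<bar> \<le> M + 1" using wb[of z] by simp
        from mult_mono[OF this b] have "\<bar>w z\<bar> * (\<bar>\<eta> (fst z)\<bar> * \<bar>cutoff R (snd z)\<bar>) \<le> (M + 1) * K"
          using M_nonneg by simp
        then show ?thesis using True by (simp add: abs_mult)
      next
        case False
        then have "\<eta> (fst z) = 0 \<or> cutoff R (snd z) = 0"
          using z \<eta>f(1) cs0[of "snd z"] by (cases z) (auto simp: space_halfplane)
        then show ?thesis using False by auto
      qed
    qed
    then show ?thesis by (simp add: Yl_def power2_eq_square mult.assoc)
  qed
  \<comment> \<open>Lower semicontinuity made explicit: \<open>(U - w)\<^sup>2 \<ge> 0\<close>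
    bounds \<open>U\<^sup>2\<close> below by \<open>2 U w - w\<^sup>2\<close>, whose dependence on
    \<open>U\<close> is linear.\<close>
  have Yn: "2 * Y' n - Yl \<le> Y n" for n
  proof -
    have "2 * Y' n - Yl = (LINT z|halfplane. 2 * (U n (fst z) (snd z) * (w z * (\<eta> (fst z) * cutoff R (snd z)))) - (w z)\<^sup>2 * (\<eta> (fst z) * cutoff R (snd z)))"
      using Ui'[of n] ci by (simp add: Y'_def Yl_def)
    also have "\<dots> \<le> Y n"
      unfolding Y_def
    proof (rule integral_mono)
      show "integrable halfplane (\<lambda>z. 2 * (U n (fst z) (snd z) * (w z * (\<eta> (fst z) * cutoff R (snd z)))) - (w z)\<^sup>2 * (\<eta> (fst z) * cutoff R (snd z)))"
        using Ui'[of n] ci by (intro Bochner_Integration.integrable_diff integrable_mult_right)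
      show "integrable halfplane (\<lambda>z. \<eta> (fst z) * ((U n (fst z) (snd z))\<^sup>2 * cutoff R (snd z)))" by (rule U2i)
      fix z :: "real \<times> real" assume z: "z \<in> space halfplane"
      have nn: "0 \<le> \<eta> (fst z) * cutoff R (snd z)"
        using \<eta>nn[of "fst z"] cutoff_bounds(1)[of R "snd z"] z by (cases z) (auto simp: space_halfplane)
      have "0 \<le> (U n (fst z) (snd z) - w z)\<^sup>2 * (\<eta> (fst z) * cutoff R (snd z))" using nn by simp
      then show "2 * (U n (fst z) (snd z) * (w z * (\<eta> (fst z) * cutoff R (snd z)))) - (w z)\<^sup>2 * (\<eta> (fst z) * cutoff R (snd z)) \<le> \<eta> (fst z) * ((U n (fst z) (snd z))\<^sup>2 * cutoff R (snd z))"
        by (simp add: power2_eq_square algebra_simps)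
    qed
    finally show ?thesis .
  qed
  have XZ: "(\<lambda>n. Z n + X n) \<longlonglongrightarrow> 0"
  proof (rule Lim_null_comparison)
    show "\<forall>\<^sub>F n in sequentially. norm (Z n + X n) \<le> l n * H" using 2 by (intro always_eventually) simp
    show "(\<lambda>n. l n * H) \<longlonglongrightarrow> 0" using tendsto_mult_left_zero[OF l(2)] .
  qed
  have "(\<lambda>n. \<delta> R + 6 * C * \<delta> (R / 2) + 2 * ((Z n + X n) - Z n) - 2 * (2 * Y' n - Yl)) \<longlonglongrightarrow> \<delta> R + 6 * C * \<delta> (R / 2) + 2 * (0 - Zl) - 2 * (2 * Yl - Yl)"
    by (intro tendsto_intros XZ Zlim Ylim)
  moreover have "E \<le> \<delta> R + 6 * C * \<delta> (R / 2) + 2 * ((Z n + X n) - Z n) - 2 * (2 * Y' n - Yl)" for n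
    using 1[of n] Yn[of n] by simp
  ultimately have "E \<le> \<delta> R + 6 * C * \<delta> (R / 2) + 2 * (0 - Zl) - 2 * (2 * Yl - Yl)"
    by (intro LIMSEQ_le_const) auto
  moreover have "2 * (0 - b) = 3 * a" if "a * (3/2) = - b" for a b :: real using that by (simp add: field_simps)
  note this[OF wz]
  moreover have "2 * (2 * Yl - Yl) = 2 * Yl" by simp
  ultimately show ?thesis unfolding E_def Yl_def \<zeta>'_def by simp
qed

text \<open>As \<open>R\<close> grows the tails vanish, and both spatial weights tend boundedly to
  1. The coefficients 3 and 2 of the two integrals then leave exactly one copy of the averaged
  energy.\<close>

lemma energy_kept:
  fixes \<sigma> :: real
  assumes t: "0 < t1" "t1 < t2"
    and flow: "\<And>n. CH_flow (l n) (U n) (U1 n) (U2 n) (U3 n) (v n) (v1 n) (v2 n)"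
    and U0: "\<And>n. U n 0 = u0" "\<And>n. U1 n 0 = u01" "\<And>n. U2 n 0 = u02" and H2: "H2_fun u0 u01 u02"
    and l: "\<And>n. l n \<le> 1" "l \<longlonglongrightarrow> 0"
    and \<sigma>: "\<bar>\<sigma>\<bar> = 1" "\<And>n x. \<sigma> * (u0 x - (l n)\<^sup>2 * u02 x) \<ge> 0"
    and lim: "\<And>r. r > 0 \<Longrightarrow> (\<lambda>n. \<integral>\<^sup>+ z. ennreal \<bar>U n (fst z) (snd z) - w z\<bar> \<partial>lebesgue_on ({t1..t2} \<times> {-r..r})) \<longlonglongrightarrow> 0"
  shows "(LINT x|lebesgue. (u0 x)\<^sup>2) \<le> - (LINT z|halfplane. (w z)\<^sup>2 * deriv (step_down t1 t2) (fst z))"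
proof -
  obtain C where C: "C > 0" "\<And>R x. R > 0 \<Longrightarrow> \<bar>deriv (cutoff R) x\<bar> \<le> C / R" using deriv_cutoff_bound by blast
  define F where "F = 3 * (LINT x|lebesgue. \<bar>u0 x\<bar> * ((u0 x)\<^sup>2 + (u01 x)\<^sup>2))"
  define \<delta> where "\<delta> R = (LINT x|lebesgue. (1 - cutoff R x) * ((u0 x)\<^sup>2 + (u01 x)\<^sup>2)) + C / R * F * t2" for R
  define \<eta> where "\<eta> = (\<lambda>t. - deriv (step_down t1 t2) t)"
  have \<delta>lim: "(\<lambda>n. \<delta> (r n)) \<longlonglongrightarrow> 0" if r: "filterlim r at_top sequentially" for r
  proof -
    have "integrable lebesgue (\<lambda>x. (u0 x)\<^sup>2 + (u01 x)\<^sup>2)" using L2_D(2) H2_funD(3,4)[OF H2] by auto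
    from cutoff_tail_tendsto[OF this r]
    have 1: "(\<lambda>n. LINT x|lebesgue. (1 - cutoff (r n) x) * ((u0 x)\<^sup>2 + (u01 x)\<^sup>2)) \<longlonglongrightarrow> 0" .
    have "(\<lambda>n. C / r n) \<longlonglongrightarrow> 0"
      by (rule tendsto_divide_0[OF tendsto_const filterlim_at_top_imp_at_infinity[OF r]])
    then have "(\<lambda>n. \<delta> (r n)) \<longlonglongrightarrow> 0 + 0 * F * t2" unfolding \<delta>_def by (intro tendsto_intros 1)
    then show ?thesis by simp
  qed
  define I where "I = (LINT z|halfplane. (w z)\<^sup>2 * \<eta> (fst z))"
  obtain K where K: "K > 0" "\<And>x. \<bar>deriv (step_down t1 t2) x\<bar> \<le> K" by (rule step_down_deriv_bounded[OF t(2)]) blast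
  have \<eta>m: "\<eta> \<in> borel_measurable borel"
    unfolding \<eta>_def by (intro borel_measurable_uminus Cc_continuous_measurable Cc_infinity_deriv step_down_Cc t)
  define f where "f z = (w z)\<^sup>2 * \<eta> (fst z)" for z
  have fi: "integrable halfplane f"
  proof -
    have T: "t2 > 0" using t by simp
    have "integrable halfplane (\<lambda>z. \<eta> (fst z) * (indicator {..t2} (fst z) * (w z)\<^sup>2))"
      by (rule integrable_bounded_mult[OF w_square_integrable[OF T] halfplane_measurable_fst[OF \<eta>m], of K]) (use K in \<open>simp add: \<eta>_def\<close>)
    moreover have "(\<eta> (fst z) * (indicator {..t2} (fst z) * (w z)\<^sup>2)) = f z" if "z \<in> space halfplane" for z
      using step_down_deriv_sign(3)[OF t(2), of "fst z"] that by (cases z) (auto simp: f_def \<eta>_def indicator_def space_halfplane)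
    ultimately show ?thesis by (simp cong: Bochner_Integration.integrable_cong)
  qed
  have lim_I: "(\<lambda>n. LINT z|halfplane. f z * g n (snd z)) \<longlonglongrightarrow> I"
    if g: "\<And>n. continuous_on UNIV (g n)" "\<And>n x. \<bar>g n x\<bar> \<le> B" "\<And>x. (\<lambda>n. g n x) \<longlonglongrightarrow> 1" for g B
    unfolding I_def f_def[symmetric]
  proof (rule integral_dominated_convergence[where w = "\<lambda>z. B * \<bar>f z\<bar>"])
    show fm: "f \<in> borel_measurable halfplane" using fi by simp
    show "(\<lambda>z. f z * g n (snd z)) \<in> borel_measurable halfplane" for n
      by (intro borel_measurable_times fm halfplane_measurable_snd borel_measurable_continuous_onI g(1))
    show "AE z in halfplane. (\<lambda>n. f z * g n (snd z)) \<longlonglongrightarrow> f z"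
    proof (rule AE_I2)
      fix z
      have "(\<lambda>n. f z * g n (snd z)) \<longlonglongrightarrow> f z * 1" by (intro tendsto_intros g(3))
      then show "(\<lambda>n. f z * g n (snd z)) \<longlonglongrightarrow> f z" by simp
    qed
    show "AE z in halfplane. norm (f z * g n (snd z)) \<le> B * \<bar>f z\<bar>" for n
    proof (rule AE_I2)
      fix z show "norm (f z * g n (snd z)) \<le> B * \<bar>f z\<bar>"
        using mult_right_mono[OF g(2)[of n "snd z"], of "\<bar>f z\<bar>"] by (simp add: abs_mult mult.commute)
    qed
  qed (use fi in auto)
  define r where "r n = 2 * real (Suc n)" for n
  have r0: "r n > 0" for n by (simp add: r_def)
  have rl: "filterlim r at_top sequentially" "filterlim (\<lambda>n. r n / 2) at_top sequentially"
  proof -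
    have 1: "filterlim (\<lambda>n. real (Suc n)) at_top sequentially"
      by (rule filterlim_compose[OF filterlim_real_sequentially filterlim_Suc])
    then show "filterlim (\<lambda>n. r n / 2) at_top sequentially" by (simp add: r_def del: of_nat_Suc)
    show "filterlim r at_top sequentially" unfolding r_def[abs_def]
      by (rule filterlim_tendsto_pos_mult_at_top[OF tendsto_const _ 1]) simp
  qed
  have b1: "\<bar>cutoff R x\<bar> \<le> 1" for R x using cutoff_bounds[of R x] by simp
  \<comment> \<open>This bound, uniform in \<open>R\<close>, is what permits dominated convergence
    for the derivative of the truncated moment.\<close>
  have b2: "\<bar>x * deriv (cutoff R) x\<bar> \<le> 2 * C" if R: "R > 0" for R x
  proof (cases "\<bar>x\<bar> \<le> 2 * R")
    case True
    have "\<bar>x\<bar> * \<bar>deriv (cutoff R) x\<bar> \<le> (2 * R) * (C / R)" using True C(2)[OF R] R by (intro mult_mono) auto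
    then show ?thesis using R by (simp add: abs_mult)
  qed (use deriv_cutoff_eq_0[OF R, of x] C in simp)
  have L1: "(\<lambda>n. LINT z|halfplane. f z * cutoff (r n) (snd z)) \<longlonglongrightarrow> I"
    by (rule lim_I[OF continuous_cutoff b1 cutoff_tendsto(1)[OF rl(1)]])
  have L2: "(\<lambda>n. LINT z|halfplane. f z * (cutoff (r n) (snd z) + snd z * deriv (cutoff (r n)) (snd z))) \<longlonglongrightarrow> I"
  proof (rule lim_I)
    show "continuous_on UNIV (\<lambda>x. cutoff (r n) x + x * deriv (cutoff (r n)) x)" for n
      by (intro continuous_intros continuous_cutoff continuous_deriv_cutoff)
    show "\<bar>cutoff (r n) x + x * deriv (cutoff (r n)) x\<bar> \<le> 1 + 2 * C" for n x
      using b1[of "r n" x] b2[OF r0, of x n] by linarith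
    show "(\<lambda>n. cutoff (r n) x + x * deriv (cutoff (r n)) x) \<longlonglongrightarrow> 1" for x
      using tendsto_add[OF cutoff_tendsto[OF rl(1)]] by simp
  qed
  have "(\<lambda>n. \<delta> (r n) + 6 * C * \<delta> (r n / 2)
     + 3 * (LINT z|halfplane. f z * (cutoff (r n) (snd z) + snd z * deriv (cutoff (r n)) (snd z)))
     - 2 * (LINT z|halfplane. f z * cutoff (r n) (snd z))) \<longlonglongrightarrow> 0 + 6 * C * 0 + 3 * I - 2 * I"
    by (intro tendsto_intros L1 L2 \<delta>lim rl)
  moreover have "(LINT x|lebesgue. (u0 x)\<^sup>2) \<le> \<delta> (r n) + 6 * C * \<delta> (r n / 2)
     + 3 * (LINT z|halfplane. f z * (cutoff (r n) (snd z) + snd z * deriv (cutoff (r n)) (snd z)))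
     - 2 * (LINT z|halfplane. f z * cutoff (r n) (snd z))" for n
    using energy_kept_cutoff[OF t flow U0 l \<sigma> lim C \<delta>_def[unfolded F_def] \<eta>_def r0[of n]] by (simp add: f_def mult.assoc)
  ultimately have "(LINT x|lebesgue. (u0 x)\<^sup>2) \<le> 0 + 6 * C * 0 + 3 * I - 2 * I"
    by (intro LIMSEQ_le_const) auto
  also have "\<dots> = I" by simp
  also have "I = - (LINT z|halfplane. (w z)\<^sup>2 * deriv (step_down t1 t2) (fst z))" by (simp add: I_def \<eta>_def)
  finally show ?thesis .
qed

end

section \<open>From Kruzhkov's definition to travelling test functions\<close>

lemma sgn_burgers_flux: "sgn (s - k) * (burgers_flux s - burgers_flux k) = kruzhkov_flux k s"
  by (auto simp: burgers_flux_def kruzhkov_flux_def power2_eq_square algebra_simps sgn_if abs_if)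

text \<open>The bound on \<open>u\<close> holds only almost everywhere; clipping at height
  \<open>M\<close> gives a representative \<open>w\<close> bounded everywhere, and the entropy
  integrals do not see the change.\<close>

lemma entropy_solution_imp_entropy_burgers:
  assumes ent: "entropy_solution burgers_flux u0 u"
    and u0: "continuous_on UNIV u0" "u0 \<in> L2" "\<And>x. \<bar>u0 x\<bar> \<le> C"
  obtains w M D where "entropy_burgers w u0 M D" "AE z in halfplane. w z = u (fst z) (snd z)" "C < M"
proof -
  let ?u = "\<lambda>z. u (fst z) (snd z)"
  from ent obtain M1 where um: "?u \<in> borel_measurable halfplane" and M1: "AE z in halfplane. \<bar>?u z\<bar> \<le> M1"
    and K: "\<And>k \<phi>. \<phi> \<in> Cc_infinity \<Longrightarrow> (\<And>t x. t \<ge> 0 \<Longrightarrow> \<phi> (t, x) \<ge> 0) \<Longrightarrow>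
        (LINT z|halfplane. \<bar>?u z - k\<bar> * frechet_derivative \<phi> (at z) (1, 0)
            + sgn (?u z - k) * (burgers_flux (?u z) - burgers_flux k) * frechet_derivative \<phi> (at z) (0, 1))
        + (LINT x|lebesgue. \<bar>u0 x - k\<bar> * \<phi> (0, x)) \<ge> 0"
    unfolding entropy_solution_def halfplane_def by (auto simp: case_prod_beta')
  \<comment> \<open>The extra 1 makes \<open>M\<close> strictly larger than every value of the
    datum, which leaves room for levels \<open>k\<close> on both sides of such a value.\<close>
  define M where "M = max C M1 + 1"
  define w where "w z = max (- M) (min M (?u z))" for z
  have M: "C < M" "M1 \<le> M" by (auto simp: M_def)
  have M0: "0 \<le> M" using u0(3)[of 0] M by linarith
  have wb: "\<bar>w z\<bar> \<le> M" for z unfolding w_def using M0 by auto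
  have wm: "w \<in> borel_measurable halfplane" unfolding w_def[abs_def] using um by simp
  have wu: "AE z in halfplane. w z = ?u z"
    using M1 by (rule eventually_mono) (use M in \<open>auto simp: w_def\<close>)
  define D where "D k \<theta> \<beta> c = (LINT z|halfplane. \<bar>w z - k\<bar> * wave (deriv \<theta>) \<beta> c z)
       + (LINT z|halfplane. (kruzhkov_flux k (w z) - c * \<bar>w z - k\<bar>) * wave \<theta> (deriv \<beta>) c z)
       + \<theta> 0 * (LINT x|lebesgue. \<bar>u0 x - k\<bar> * \<beta> x)" for k \<theta> \<beta> and c :: real
  have entD: "N * D k \<theta> \<beta> b - D k \<psi> \<rho> c \<ge> 0"
    if Cc: "\<theta> \<in> Cc_infinity" "\<beta> \<in> Cc_infinity" "\<psi> \<in> Cc_infinity" "\<rho> \<in> Cc_infinity"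
      and nn: "\<And>t x. t \<ge> 0 \<Longrightarrow> N * wave \<theta> \<beta> b (t, x) - wave \<psi> \<rho> c (t, x) \<ge> 0"
    for k N \<theta> \<beta> b \<psi> \<rho> c
  proof -
    define \<phi> where "\<phi> z = N * wave \<theta> \<beta> b z - wave \<psi> \<rho> c z" for z
    note W1 = Cc_infinity_wave[OF Cc(1,2), of b] and W2 = Cc_infinity_wave[OF Cc(3,4), of c]
    have \<phi>: "\<phi> \<in> Cc_infinity"
    proof -
      obtain A where A: "\<And>z. wave \<theta> \<beta> b z \<noteq> 0 \<Longrightarrow> norm z \<le> A" by (rule Cc_infinityE[OF W1]) blast
      obtain B where B: "\<And>z. wave \<psi> \<rho> c z \<noteq> 0 \<Longrightarrow> norm z \<le> B" by (rule Cc_infinityE[OF W2]) blast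
      show ?thesis
      proof (rule Cc_infinityI[of _ "cball 0 (max A B)"])
        show "Ck n \<phi>" for n unfolding \<phi>_def[abs_def] using W1 W2 by (intro Ck_diff Ck_cmult) (auto simp: Cc_infinity_def)
        show "z \<in> cball 0 (max A B)" if "\<phi> z \<noteq> 0" for z
        proof -
          have "wave \<theta> \<beta> b z \<noteq> 0 \<or> wave \<psi> \<rho> c z \<noteq> 0" using that by (auto simp: \<phi>_def)
          then show ?thesis using A[of z] B[of z] by auto
        qed
      qed simp
    qed
    \<comment> \<open>\<open>p\<close> and \<open>q\<close> are the time and space derivatives of
      the combined test function; the drift terms in \<open>p\<close> are absorbed into the fluxes
      of \<open>D\<close>.\<close>
    define p where "p z = N * (wave (deriv \<theta>) \<beta> b z - b * wave \<theta> (deriv \<beta>) b z) - (wave (deriv \<psi>) \<rho> c z - c * wave \<psi> (deriv \<rho>) c z)" for z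
    define q where "q z = N * wave \<theta> (deriv \<beta>) b z - wave \<psi> (deriv \<rho>) c z" for z
    have "(\<phi> has_derivative (\<lambda>h. fst h * p z + snd h * q z)) (at z)" for z
      unfolding \<phi>_def[abs_def]
      by (rule has_derivative_eq_rhs[OF has_derivative_diff[OF has_derivative_mult_right[OF wave_derivative[OF Cc(1,2)]] wave_derivative[OF Cc(3,4)]]])
         (simp add: p_def q_def fun_eq_iff algebra_simps)
    then have fd: "frechet_derivative \<phi> (at z) = (\<lambda>h. fst h * p z + snd h * q z)" for z by (rule frechet_derivative_at[symmetric])
    have cs: "cont_cs (wave (deriv \<theta>) \<beta> b)" "cont_cs (wave \<theta> (deriv \<beta>) b)" "cont_cs (wave (deriv \<psi>) \<rho> c)" "cont_cs (wave \<psi> (deriv \<rho>) c)"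
      using Cc by (auto intro!: cont_cs_wave Cc_infinity_cont_cs Cc_infinity_deriv)
    have ms: "F \<in> borel_measurable halfplane" if "cont_cs F" for F
      using that by (simp add: cont_cs_def continuous_halfplane_measurable)
    have pq: "p \<in> borel_measurable halfplane" "q \<in> borel_measurable halfplane"
      unfolding p_def[abs_def] q_def[abs_def]
      by (intro borel_measurable_diff borel_measurable_times borel_measurable_const ms cs)+
    have km: "(\<lambda>z. kruzhkov_flux k (v z)) \<in> borel_measurable halfplane" "(\<lambda>z. \<bar>v z - k\<bar>) \<in> borel_measurable halfplane"
      if "v \<in> borel_measurable halfplane" for v :: "real \<times> real \<Rightarrow> real"
      using that unfolding kruzhkov_flux_def by measurable
    have vb: "\<bar>\<bar>w z - k\<bar>\<bar> \<le> M + \<bar>k\<bar>" "\<bar>kruzhkov_flux k (w z) - d * \<bar>w z - k\<bar>\<bar> \<le> 3/2 * ((M + \<bar>k\<bar>) * (M + \<bar>k\<bar>)) + \<bar>d\<bar> * (M + \<bar>k\<bar>)" for z d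
    proof -
      show 1: "\<bar>\<bar>w z - k\<bar>\<bar> \<le> M + \<bar>k\<bar>" using wb[of z] by linarith
      have "\<bar>w z - k\<bar> * \<bar>w z + k\<bar> \<le> (M + \<bar>k\<bar>) * (M + \<bar>k\<bar>)" using wb[of z] by (intro mult_mono) linarith+
      then have 2: "\<bar>kruzhkov_flux k (w z)\<bar> \<le> 3/2 * ((M + \<bar>k\<bar>) * (M + \<bar>k\<bar>))" by (simp add: kruzhkov_flux_def abs_mult)
      have "\<bar>d * \<bar>w z - k\<bar>\<bar> \<le> \<bar>d\<bar> * (M + \<bar>k\<bar>)" using 1 by (simp add: abs_mult mult_left_mono)
      then show "\<bar>kruzhkov_flux k (w z) - d * \<bar>w z - k\<bar>\<bar> \<le> 3/2 * ((M + \<bar>k\<bar>) * (M + \<bar>k\<bar>)) + \<bar>d\<bar> * (M + \<bar>k\<bar>)" using 2 by linarith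
    qed
    have i1: "integrable halfplane (\<lambda>z. \<bar>w z - k\<bar> * F z)" if "cont_cs F" for F
      by (rule halfplane_integrable_mult[OF that km(2)[OF wm] vb(1)])
    have i2: "integrable halfplane (\<lambda>z. (kruzhkov_flux k (w z) - d * \<bar>w z - k\<bar>) * F z)" if "cont_cs F" for F d
      by (rule halfplane_integrable_mult[OF that _ vb(2)]) (intro borel_measurable_diff borel_measurable_times borel_measurable_const km wm)
    have i0: "integrable lebesgue (\<lambda>x. \<bar>u0 x - k\<bar> * \<gamma> x)" if "\<gamma> \<in> Cc_infinity" for \<gamma>
      by (rule loc_integrable_mult_test[OF loc_integrable_continuous that]) (intro continuous_intros u0(1))
    have "(LINT z|halfplane. \<bar>?u z - k\<bar> * frechet_derivative \<phi> (at z) (1, 0)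
            + sgn (?u z - k) * (burgers_flux (?u z) - burgers_flux k) * frechet_derivative \<phi> (at z) (0, 1))
       = (LINT z|halfplane. \<bar>?u z - k\<bar> * p z + kruzhkov_flux k (?u z) * q z)"
      by (intro Bochner_Integration.integral_cong refl) (simp add: sgn_burgers_flux fd)
    also have "\<dots> = (LINT z|halfplane. \<bar>w z - k\<bar> * p z + kruzhkov_flux k (w z) * q z)"
    proof (rule integral_cong_AE)
      show "(\<lambda>z. \<bar>?u z - k\<bar> * p z + kruzhkov_flux k (?u z) * q z) \<in> borel_measurable halfplane"
        "(\<lambda>z. \<bar>w z - k\<bar> * p z + kruzhkov_flux k (w z) * q z) \<in> borel_measurable halfplane"
        by (intro borel_measurable_add borel_measurable_times km um wm pq)+
      show "AE z in halfplane. \<bar>?u z - k\<bar> * p z + kruzhkov_flux k (?u z) * q z = \<bar>w z - k\<bar> * p z + kruzhkov_flux k (w z) * q z"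
        using wu by (rule eventually_mono) simp
    qed
    also have "\<dots> = (LINT z|halfplane. N * (\<bar>w z - k\<bar> * wave (deriv \<theta>) \<beta> b z + (kruzhkov_flux k (w z) - b * \<bar>w z - k\<bar>) * wave \<theta> (deriv \<beta>) b z)
        - (\<bar>w z - k\<bar> * wave (deriv \<psi>) \<rho> c z + (kruzhkov_flux k (w z) - c * \<bar>w z - k\<bar>) * wave \<psi> (deriv \<rho>) c z))"
      by (intro Bochner_Integration.integral_cong refl) (simp only: p_def q_def, simp only: algebra_simps)
    also have "\<dots> = N * ((LINT z|halfplane. \<bar>w z - k\<bar> * wave (deriv \<theta>) \<beta> b z) + (LINT z|halfplane. (kruzhkov_flux k (w z) - b * \<bar>w z - k\<bar>) * wave \<theta> (deriv \<beta>) b z))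
        - ((LINT z|halfplane. \<bar>w z - k\<bar> * wave (deriv \<psi>) \<rho> c z) + (LINT z|halfplane. (kruzhkov_flux k (w z) - c * \<bar>w z - k\<bar>) * wave \<psi> (deriv \<rho>) c z))"
      using i1[OF cs(1)] i1[OF cs(3)] i2[OF cs(2)] i2[OF cs(4)]
      by (simp only: Bochner_Integration.integral_diff Bochner_Integration.integral_add integral_mult_right_zero
          Bochner_Integration.integrable_add integrable_mult_right)
    finally have h: "(LINT z|halfplane. \<bar>?u z - k\<bar> * frechet_derivative \<phi> (at z) (1, 0)
            + sgn (?u z - k) * (burgers_flux (?u z) - burgers_flux k) * frechet_derivative \<phi> (at z) (0, 1)) = \<dots>" .
    have "(LINT x|lebesgue. \<bar>u0 x - k\<bar> * \<phi> (0, x)) = (LINT x|lebesgue. N * \<theta> 0 * (\<bar>u0 x - k\<bar> * \<beta> x) - \<psi> 0 * (\<bar>u0 x - k\<bar> * \<rho> x))"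
      by (intro Bochner_Integration.integral_cong refl) (simp add: \<phi>_def wave_def algebra_simps)
    also have "\<dots> = N * \<theta> 0 * (LINT x|lebesgue. \<bar>u0 x - k\<bar> * \<beta> x) - \<psi> 0 * (LINT x|lebesgue. \<bar>u0 x - k\<bar> * \<rho> x)"
      using i0[OF Cc(2)] i0[OF Cc(4)] by simp
    finally have h0: "(LINT x|lebesgue. \<bar>u0 x - k\<bar> * \<phi> (0, x)) = \<dots>" .
    have "\<phi> (t, x) \<ge> 0" if "t \<ge> 0" for t x using nn[OF that, of x] by (simp add: \<phi>_def)
    from K[OF \<phi> this, of k] have "0 \<le> N * (A1 + B1) - (A2 + B2) + (N * \<theta> 0 * C1 - \<psi> 0 * C2)"
      if "A1 = (LINT z|halfplane. \<bar>w z - k\<bar> * wave (deriv \<theta>) \<beta> b z)" "B1 = (LINT z|halfplane. (kruzhkov_flux k (w z) - b * \<bar>w z - k\<bar>) * wave \<theta> (deriv \<beta>) b z)"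
        "A2 = (LINT z|halfplane. \<bar>w z - k\<bar> * wave (deriv \<psi>) \<rho> c z)" "B2 = (LINT z|halfplane. (kruzhkov_flux k (w z) - c * \<bar>w z - k\<bar>) * wave \<psi> (deriv \<rho>) c z)"
        "C1 = (LINT x|lebesgue. \<bar>u0 x - k\<bar> * \<beta> x)" "C2 = (LINT x|lebesgue. \<bar>u0 x - k\<bar> * \<rho> x)" for A1 B1 A2 B2 C1 C2
      unfolding h h0 that .
    from this[OF refl refl refl refl refl refl] show ?thesis unfolding D_def distrib_left mult.assoc by linarith
  qed
  have u0M: "\<bar>u0 x\<bar> \<le> M" for x using u0(3)[of x] M(1) by simp
  have "entropy_burgers w u0 M D"
    by (rule entropy_burgers.intro[OF wm wb u0(1,2) u0M D_def entD])
  then show thesis using that wu M(1) by blast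
qed

section \<open>Nonzero square integrable data have a negative slope\<close>

lemma square_integrable_ge_0:
  fixes f :: "real \<Rightarrow> real"
  assumes "f \<in> L2" and c: "\<And>n. \<exists>a. \<forall>x\<in>{a..a + real n}. c \<le> (f x)\<^sup>2" shows "c \<le> 0"
proof (rule ccontr)
  assume "\<not> c \<le> 0"
  then have c0: "c > 0" by simp
  let ?I = "LINT x|lebesgue. (f x)\<^sup>2"
  have "real n * c \<le> ?I" for n
  proof -
    obtain a where a: "\<And>x. x \<in> {a..a + real n} \<Longrightarrow> c \<le> (f x)\<^sup>2" using c by blast
    have "(LINT x|lebesgue. indicator {a..a + real n} x * c) \<le> ?I"
    proof (rule integral_mono)
      show "integrable lebesgue (\<lambda>x. indicator {a..a + real n} x * c)"
        by (intro integrable_mult_left integrable_real_indicator) (auto simp: emeasure_lborel_Icc_eq)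
      show "integrable lebesgue (\<lambda>x. (f x)\<^sup>2)" using assms(1) by (rule L2_D(2))
      show "indicator {a..a + real n} x * c \<le> (f x)\<^sup>2" for x using a[of x] by (auto simp: indicator_def)
    qed
    then show ?thesis by simp
  qed
  moreover obtain n where "?I / c < real n" using reals_Archimedean2 by blast
  ultimately show False using c0 by (meson mult.commute not_le pos_divide_less_eq)
qed

text \<open>A monotone function keeps at least the modulus of \<open>f a\<close> to the right of
  \<open>a\<close> if \<open>f a \<ge> 0\<close>, and to the left otherwise; a nonzero value would
  make the square non-integrable on that half-line.\<close>

lemma mono_L2_eq_0:
  fixes f :: "real \<Rightarrow> real"
  assumes m: "mono f" and f: "f \<in> L2" shows "f a = 0"
proof -
  have "\<exists>b. \<forall>x\<in>{b..b + real n}. (f a)\<^sup>2 \<le> (f x)\<^sup>2" for n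
  proof (cases "f a \<ge> 0")
    case True
    have "(f a)\<^sup>2 \<le> (f x)\<^sup>2" if "x \<in> {a..a + real n}" for x
      using monoD[OF m, of a x] that True by (intro power_mono) auto
    then show ?thesis by blast
  next
    case False
    have "(f a)\<^sup>2 \<le> (f x)\<^sup>2" if "x \<in> {a - real n..a - real n + real n}" for x
      using monoD[OF m, of x a] that False power_mono[of "- f a" "- f x" 2] by auto
    then show ?thesis by blast
  qed
  from square_integrable_ge_0[OF f this] show ?thesis by simp
qed

theorem theorem1p1:
  fixes u0 :: "real \<Rightarrow> real"
    and l0 :: real
    and U :: "real \<Rightarrow> real \<Rightarrow> real \<Rightarrow> real"
    and u :: "real \<Rightarrow> real \<Rightarrow> real"
  assumes "u0 \<in> sobolev_H 3"
    and "continuous_on UNIV u0"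
    and "integrable lebesgue u0"
    and "\<exists>x. u0 x \<noteq> 0"
    and "0 < l0" "l0 < 1"
    and "(\<forall>l. 0 < l \<and> l < l0 \<longrightarrow> (\<forall>x. u0 x - l\<^sup>2 * deriv (deriv u0) x \<ge> 0)) \<or>
         (\<forall>l. 0 < l \<and> l < l0 \<longrightarrow> (\<forall>x. u0 x - l\<^sup>2 * deriv (deriv u0) x \<le> 0))"
    and "\<forall>l. 0 < l \<and> l < l0 \<longrightarrow> CH_solution l u0 (U l)"
    and "entropy_solution burgers_flux u0 u"
  shows "bdd_below (range (deriv u0)) \<and> 0 < burgers_time u0 \<and>
    (\<forall>t1 t2. burgers_time u0 \<le> t1 \<and> t1 < t2 \<longrightarrow>
       \<not> (\<exists>l :: nat \<Rightarrow> real. (\<forall>n. 0 < l n \<and> l n < l0) \<and> decseq l \<and> l \<longlonglongrightarrow> 0 \<and>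
            converges_L1_loc t1 t2 (\<lambda>n. U (l n)) u))"
proof -
  obtain u01 u02 u03 where u123: "H2_fun u0 u01 u02" "H2_fun u01 u02 u03"
    using sobolev_H3_H2_fun[OF assms(1,2)] by blast
  have H: "H2_fun u0 (deriv u0) (deriv (deriv u0))"
    using u123(1) by (simp only: H2_fun_deriv[OF u123(1)] H2_fun_deriv[OF u123(2)])
  note HD = H2_funD[OF H]
  obtain C where C: "C > 0" "\<And>x. \<bar>u0 x\<bar> \<le> C" "\<And>x. \<bar>deriv u0 x\<bar> \<le> C" by (rule H2_fun_bounded[OF H]) blast
  have bdd: "bdd_below (range (deriv u0))"
    by (rule bdd_belowI[of _ "- C"]) (use C(3) in \<open>auto simp: abs_le_iff minus_le_iff\<close>)
  define I where "I = (INF x. deriv u0 x)"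
  \<comment> \<open>Otherwise the datum would be non-decreasing and square integrable, hence zero.
    This makes the infimum of the slope negative and the breaking time positive.\<close>
  have "\<exists>x. deriv u0 x < 0"
  proof (rule ccontr)
    assume "\<not> (\<exists>x. deriv u0 x < 0)"
    then have nn: "deriv u0 x \<ge> 0" for x by (simp add: not_less)
    have "mono u0"
    proof (rule monoI)
      fix x y :: real assume "x \<le> y"
      then show "u0 x \<le> u0 y" by (rule DERIV_nonneg_imp_nondecreasing) (use nn HD(1) in blast)
    qed
    then show False using mono_L2_eq_0[OF _ HD(3)] assms(4) by blast
  qed
  then have I: "I < 0" unfolding I_def using bdd by (simp add: cINF_less_iff)
  have T: "burgers_time u0 = - 1 / (3 * I)" by (simp add: burgers_time_def I_def)
  have T0: "burgers_time u0 > 0" unfolding T using I by (simp add: divide_neg_neg)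
  have False if t: "burgers_time u0 \<le> t1" "t1 < t2" and l: "\<And>n. 0 < l n" "\<And>n. l n < l0" "l \<longlonglongrightarrow> 0"
    and conv: "converges_L1_loc t1 t2 (\<lambda>n. U (l n)) u" for t1 t2 :: real and l :: "nat \<Rightarrow> real"
  proof -
    have t1: "0 < t1" using T0 t by simp
    obtain w M D where eb: "entropy_burgers w u0 M D" and wu: "AE z in halfplane. w z = u (fst z) (snd z)" and CM: "C < M"
      by (rule entropy_solution_imp_entropy_burgers[OF assms(9,2) HD(3) C(2)])
    interpret entropy_burgers w u0 M D by (rule eb)
    \<comment> \<open>An interior time of the window is strictly later than the breaking time even
      if \<open>t1\<close> equals it, so some slope lies strictly below
      \<open>- 1 / (3 * ts)\<close>, whether or not the infimum is attained.\<close>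
    define ts where "ts = (t1 + t2) / 2"
    have ts: "t1 < ts" "ts < t2" using t by (simp_all add: ts_def)
    have ts0: "ts > 0" using ts t1 by simp
    have "- 1 / (3 * I) < ts" using t ts T by simp
    then have "I < - 1 / (3 * ts)" using I ts0 by (simp add: field_simps)
    then obtain y where "deriv u0 y < - 1 / (3 * ts)" unfolding I_def using bdd by (auto simp: cINF_less_iff)
    then have y: "1 + 3 * ts * deriv u0 y < 0" using ts0 by (simp add: field_simps)
    have CH: "CH_solution (l n) u0 (U (l n))" for n using assms(8) l by blast
    have "\<exists>u3 v v1 v2. CH_flow (l n) (U (l n)) (\<lambda>t. deriv (U (l n) t)) (\<lambda>t. deriv (deriv (U (l n) t))) u3 v v1 v2" for n
      by (rule CH_solution_flow[OF CH l(1)])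
    then obtain u3 v v1 v2 where flow: "\<And>n. CH_flow (l n) (U (l n)) (\<lambda>t. deriv (U (l n) t)) (\<lambda>t. deriv (deriv (U (l n) t))) (u3 n) (v n) (v1 n) (v2 n)"
      by metis
    have U0: "U (l n) 0 = u0" for n using CH[of n] by (simp add: CH_solution_def)
    have l1: "l n \<le> 1" for n using l(2)[of n] assms(6) by simp
    \<comment> \<open>The sign alternative becomes a factor \<open>\<sigma>\<close> that is the same
      for all members of the sequence.\<close>
    obtain \<sigma> :: real where \<sigma>: "\<bar>\<sigma>\<bar> = 1" "\<And>n x. \<sigma> * (u0 x - (l n)\<^sup>2 * deriv (deriv u0) x) \<ge> 0"
    proof -
      from assms(7) show thesis
      proof
        assume "\<forall>l. 0 < l \<and> l < l0 \<longrightarrow> (\<forall>x. u0 x - l\<^sup>2 * deriv (deriv u0) x \<ge> 0)"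
        then show thesis using l by (intro that[of 1]) simp_all
      next
        assume "\<forall>l. 0 < l \<and> l < l0 \<longrightarrow> (\<forall>x. u0 x - l\<^sup>2 * deriv (deriv u0) x \<le> 0)"
        then show thesis using l by (intro that[of "-1"]) simp_all
      qed
    qed
    \<comment> \<open>The window lies at positive times, where the clipped \<open>w\<close> agrees
      with \<open>u\<close> almost everywhere, so the assumed convergence carries over to
      \<open>w\<close>.\<close>
    have lim: "(\<lambda>n. \<integral>\<^sup>+ z. ennreal \<bar>U (l n) (fst z) (snd z) - w z\<bar> \<partial>lebesgue_on ({t1..t2} \<times> {-r..r})) \<longlonglongrightarrow> 0" if r: "r > 0" for r
    proof -
      let ?S = "{t1..t2} \<times> {-r..r}"
      have "closed ?S" by (intro closed_Times closed_atLeastAtMost)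
      then have S: "?S \<in> sets lebesgue" by (simp add: borel_closed sets_completionI_sets)
      have "AE z in lebesgue. z \<in> {0<..} \<times> UNIV \<longrightarrow> w z = u (fst z) (snd z)"
        using wu unfolding halfplane_def by (subst (asm) AE_restrict_space_iff) auto
      then have "AE z in lebesgue. z \<in> ?S \<longrightarrow> w z = u (fst z) (snd z)"
        by (rule eventually_mono) (use t1 in auto)
      then have AE: "AE z in lebesgue_on ?S. w z = u (fst z) (snd z)"
        by (subst AE_restrict_space_iff) (use S in auto)
      have "(\<integral>\<^sup>+ z. ennreal \<bar>U (l n) (fst z) (snd z) - w z\<bar> \<partial>lebesgue_on ?S) = (\<integral>\<^sup>+ (t, x). ennreal \<bar>U (l n) t x - u t x\<bar> \<partial>lebesgue_on ?S)" for n
        by (rule nn_integral_cong_AE, rule eventually_mono[OF AE]) (simp add: case_prod_beta')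
      then show ?thesis using conv r by (simp add: converges_L1_loc_def)
    qed
    have "(LINT x|lebesgue. (u0 x)\<^sup>2) \<le> - (LINT z|halfplane. (w z)\<^sup>2 * deriv (step_down t1 t2) (fst z))"
      by (rule energy_kept[OF t1 t(2) flow U0 _ _ H l1 l(3) \<sigma> lim]) (simp_all add: U0)
    from no_conservation_after_breaking[OF less_imp_le[OF t1] t(2) this HD(1) ts y] show False
      using C(2)[of y] CM by simp
  qed
  then show ?thesis using bdd T0 by blast
qed

end
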